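(* Let $E$ be an ordered basis of $\mathbf R^d$, $\Phi\in\Sigma_1(\mathbf R^{2d})\setminus0$ and $p\in(0,\infty]$. Then $$\|f\|_{M^p}\asymp\|V_\Phi(Z_Ef)\|_{L^p(Q_{E\times E'}\times\mathbf R^{2d})},\qquad f\in\Sigma_1'(\mathbf R^d),$$ where the implied constants are independent of $f$.
   Context: For an ordered basis $E=\{e_1,\dots,e_d\}$ of $\mathbf R^d$, the dual basis $E'$ is defined by $\langle e_j,e_k'\rangle=2\pi\delta_{jk}$; $\Lambda_E$ is the lattice of integer combinations of $E$; $Q_E=\{\sum t_je_j:0\le t_j\le1\}$; $Q_{E\times E'}=Q_E\times Q_{E'}\subseteq\mathbf R^{2d}$. $\Sigma_1(\mathbf R^n)$ is the Fréchet space of all $f\in C^\infty(\mathbf R^n)$ with $\sup_{\alpha,\beta,x}|x^\alpha\partial^\beta f(x)|/(h^{|\alpha+\beta|}\alpha!\beta!)<\infty$ for every $h>0$; $\Sigma_1'(\mathbf R^n)$ is its dual. Short-time Fourier transform on $\mathbf R^n$: $V_\phi f(x,\xi)=\mathscr F(f\,\overline{\phi(\cdot-x)})(\xi)$ with $\mathscr Ff(\xi)=(2\pi)^{-n/2}\int f(x)e^{-i\langle x,\xi\rangle}dx$. On $\mathbf R^{2d}$, $V_\Phi F(x,\xi,\eta,y)$ has position variables $(x,\xi)\in\mathbf R^{2d}$ and frequency variables $(\eta,y)\in\mathbf R^{2d}$; in $L^p(Q_{E\times E'}\times\mathbf R^{2d})$ one has $(x,\xi)\in Q_{E\times E'}$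 and $(\eta,y)\in\mathbf R^{2d}$. Modulation (quasi-)norm: $\|f\|_{M^p}=\|V_\phi f\|_{L^p(\mathbf R^{2d})}$ for a fixed $\phi\in\Sigma_1(\mathbf R^d)\setminus0$ (different $\phi$ give equivalent quasi-norms). Zak transform: $(Z_Ef)(x,\xi)=\sum_{j\in\Lambda_E}f(x-j)e^{i\langle j,\xi\rangle}$; for $f\in\Sigma_1'(\mathbf R^d)$ the series converges in $\Sigma_1'(\mathbf R^{2d})$. *)

theory Defs
  imports "HOL-Analysis.Analysis" "HOL-Probability.Essential_Supremum"
begin

section \<open>Multi-indices and smooth functions\<close>

text \<open>
  A multi-index is a function on the type; only its values on \<^const>\<open>Basis\<close> (the coordinates)
  are ever used.
\<close>

definition mi_abs :: "('a::euclidean_space \<Rightarrow> nat) \<Rightarrow> nat" where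
  "mi_abs \<alpha> = (\<Sum>b\<in>Basis. \<alpha> b)"

definition mi_fact :: "('a::euclidean_space \<Rightarrow> nat) \<Rightarrow> real" where
  "mi_fact \<alpha> = (\<Prod>b\<in>Basis. fact (\<alpha> b))"

definition mi_power :: "'a::euclidean_space \<Rightarrow> ('a \<Rightarrow> nat) \<Rightarrow> real" where
  "mi_power x \<alpha> = (\<Prod>b\<in>Basis. (x \<bullet> b) ^ \<alpha> b)"

definition partial1 :: "'a::euclidean_space \<Rightarrow> ('a \<Rightarrow> complex) \<Rightarrow> 'a \<Rightarrow> complex" where
  "partial1 b f x = vector_derivative (\<lambda>t. f (x + t *\<^sub>R b)) (at 0)"

text \<open>All iterated partial derivatives, in any order, exist and are differentiable.\<close>

definition smooth :: "('a::euclidean_space \<Rightarrow> complex) \<Rightarrow> bool" where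
  "smooth f \<longleftrightarrow> (\<forall>bs. set bs \<subseteq> Basis \<longrightarrow> (\<forall>x. foldr partial1 bs f differentiable (at x)))"

text \<open>
  The enumeration of the coordinates only fixes the order of differentiation, which is irrelevant
  for smooth functions.
\<close>

definition basis_enum :: "'a::euclidean_space list" where
  "basis_enum = (SOME bs. distinct bs \<and> set bs = Basis)"

definition partial :: "('a::euclidean_space \<Rightarrow> nat) \<Rightarrow> ('a \<Rightarrow> complex) \<Rightarrow> 'a \<Rightarrow> complex" where
  "partial \<beta> f = foldr (\<lambda>b. partial1 b ^^ \<beta> b) basis_enum f"


section \<open>The Gelfand--Shilov space of Beurling type and its dual\<close>

definition Sigma1_seminorm :: "real \<Rightarrow> ('a::euclidean_space \<Rightarrow> complex) \<Rightarrow> ennreal" where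
  "Sigma1_seminorm h f =
     (SUP (\<alpha>, \<beta>, x) \<in> UNIV. ennreal (cmod (mi_power x \<alpha> * partial \<beta> f x) /
        (h ^ (mi_abs \<alpha> + mi_abs \<beta>) * mi_fact \<alpha> * mi_fact \<beta>)))"

definition Sigma1 :: "('a::euclidean_space \<Rightarrow> complex) set" where
  "Sigma1 = {f. smooth f \<and> (\<forall>h>0. Sigma1_seminorm h f < \<infinity>)}"

text \<open>
  Continuous complex-linear functionals for the Frechet topology given by the above seminorms.
  They are directed (decreasing in \<open>h\<close>), so continuity means boundedness by a multiple of one of
  them.  A functional is a function on all of \<^typ>\<open>'a \<Rightarrow> complex\<close>, but only its values on
  \<^const>\<open>Sigma1\<close> matter.  The pairing is bilinear: a function \<open>v\<close> acts as
  \<open>g \<mapsto> \<integral> v g\<close>, without conjugation.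
\<close>

definition Sigma1_dual :: "(('a::euclidean_space \<Rightarrow> complex) \<Rightarrow> complex) set" where
  "Sigma1_dual = {u.
     (\<forall>f\<in>Sigma1. \<forall>g\<in>Sigma1. u (\<lambda>x. f x + g x) = u f + u g) \<and>
     (\<forall>c. \<forall>f\<in>Sigma1. u (\<lambda>x. c * f x) = c * u f) \<and>
     (\<exists>h>0. \<exists>C\<ge>0. \<forall>f\<in>Sigma1. ennreal (cmod (u f)) \<le> ennreal C * Sigma1_seminorm h f)}"


section \<open>Short-time Fourier transform and quasi-norms\<close>

text \<open>
  The Fourier transform of the ultradistribution \<open>u \<cdot> cnj (\<phi>(\<sqdot> - x))\<close> at \<open>\<xi>\<close>, the integral
  in the Fourier transform being the action of \<open>u\<close>.
\<close>

definition stft ::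
  "('a::euclidean_space \<Rightarrow> complex) \<Rightarrow> (('a \<Rightarrow> complex) \<Rightarrow> complex) \<Rightarrow> 'a \<times> 'a \<Rightarrow> complex" where
  "stft \<phi> u = (\<lambda>(x, \<xi>).
     of_real ((2 * pi) powr (- real DIM('a) / 2)) *
       u (\<lambda>y. cnj (\<phi> (y - x)) * exp (- \<i> * of_real (y \<bullet> \<xi>))))"

definition Lp_qnorm :: "ennreal \<Rightarrow> 'b measure \<Rightarrow> ('b \<Rightarrow> complex) \<Rightarrow> ennreal" where
  "Lp_qnorm p M F =
     (if p = \<infinity> then esssup M (\<lambda>z. ennreal (cmod (F z)))
      else let I = (\<integral>\<^sup>+ z. ennreal (cmod (F z) powr enn2real p) \<partial>M)
           in if I = \<infinity> then \<infinity> else ennreal (enn2real I powr (1 / enn2real p)))"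

definition modulation_qnorm ::
  "('a::euclidean_space \<Rightarrow> complex) \<Rightarrow> ennreal \<Rightarrow> (('a \<Rightarrow> complex) \<Rightarrow> complex) \<Rightarrow> ennreal" where
  "modulation_qnorm \<phi> p u = Lp_qnorm p lborel (stft \<phi> u)"


section \<open>Bases, lattices and the Zak transform\<close>

definition is_basis :: "('n::finite \<Rightarrow> real ^ 'n) \<Rightarrow> bool" where
  "is_basis E \<longleftrightarrow> inj E \<and> independent (range E) \<and> span (range E) = UNIV"

definition dual_basis :: "('n::finite \<Rightarrow> real ^ 'n) \<Rightarrow> 'n \<Rightarrow> real ^ 'n" where
  "dual_basis E = (THE E'. \<forall>j k. E j \<bullet> E' k = (if j = k then 2 * pi else 0))"

lemma dual_basis_ex1:
  fixes E :: "'n::finite \<Rightarrow> real ^ 'n"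
  assumes "is_basis E"
  shows "\<exists>!E'. \<forall>j k. E j \<bullet> E' k = (if j = k then 2 * pi else 0)"
proof -
  define A :: "real^'n^'n" where "A = (\<chi> j. E j)"
  have "rows A = range E"
    by (auto simp: rows_def row_def A_def)
  then have "span (rows A) = UNIV"
    using assms by (simp add: is_basis_def)
  then obtain B where B: "B ** A = mat 1"
    using matrix_left_invertible_span_rows by blast
  then have AB: "A ** B = mat 1"
    using matrix_left_right_inverse by blast
  show ?thesis
  proof (rule ex1I)
    show "\<forall>j k. E j \<bullet> (2 * pi) *\<^sub>R column k B = (if j = k then 2 * pi else 0)"
    proof (intro allI)
      fix j k
      have "E j \<bullet> column k B = (A ** B) $ j $ k"
        by (simp add: A_def matrix_matrix_mult_def inner_vec_def column_def)
      then show "E j \<bullet> (2 * pi) *\<^sub>R column k B = (if j = k then 2 * pi else 0)"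
        by (simp add: AB mat_def)
    qed
  next
    fix E' assume E': "\<forall>j k. E j \<bullet> E' k = (if j = k then 2 * pi else 0)"
    show "E' = (\<lambda>k. (2 * pi) *\<^sub>R column k B)"
    proof
      fix k
      have "A *v E' k = (2 * pi) *\<^sub>R axis k 1"
        using E' by (auto simp: vec_eq_iff matrix_vector_mult_def A_def inner_vec_def axis_def)
      then have "B *v (A *v E' k) = (2 * pi) *\<^sub>R (B *v axis k 1)"
        by (simp add: matrix_vector_mult_scaleR)
      then show "E' k = (2 * pi) *\<^sub>R column k B"
        by (simp add: matrix_vector_mul_assoc B matrix_vector_mult_basis)
    qed
  qed
qed

lemma inner_dual_basis:
  fixes E :: "'n::finite \<Rightarrow> real ^ 'n"
  assumes "is_basis E"
  shows "E j \<bullet> dual_basis E k = (if j = k then 2 * pi else 0)"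
  using theI'[OF dual_basis_ex1[OF assms]] unfolding dual_basis_def by blast

definition lattice_of :: "('n::finite \<Rightarrow> real ^ 'n) \<Rightarrow> (real ^ 'n) set" where
  "lattice_of E = {\<Sum>j\<in>UNIV. of_int (k j) *\<^sub>R E j | k :: 'n \<Rightarrow> int. True}"

definition parallelepiped :: "('n::finite \<Rightarrow> real ^ 'n) \<Rightarrow> (real ^ 'n) set" where
  "parallelepiped E = {\<Sum>j\<in>UNIV. t j *\<^sub>R E j | t :: 'n \<Rightarrow> real. \<forall>j. 0 \<le> t j \<and> t j \<le> 1}"

text \<open>
  The ultradistribution \<open>f(x - j) exp(i\<langle>j, \<xi>\<rangle>)\<close> on the product space, i.e. the tensor product of
  a translate of \<open>f\<close> with a character: integrate the test function against the character in \<open>\<xi>\<close>,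
  then apply the translate of \<open>f\<close> in \<open>x\<close>.
\<close>

definition zak_term ::
  "'a::euclidean_space \<Rightarrow> (('a \<Rightarrow> complex) \<Rightarrow> complex) \<Rightarrow> ('a \<times> 'a \<Rightarrow> complex) \<Rightarrow> complex" where
  "zak_term j f \<Psi> =
     f (\<lambda>y. integral\<^sup>L lborel (\<lambda>\<xi>. \<Psi> (y + j, \<xi>) * exp (\<i> * of_real (j \<bullet> \<xi>))))"

definition zak ::
  "('n::finite \<Rightarrow> real ^ 'n) \<Rightarrow> ((real ^ 'n \<Rightarrow> complex) \<Rightarrow> complex)
     \<Rightarrow> ((real ^ 'n) \<times> (real ^ 'n) \<Rightarrow> complex) \<Rightarrow> complex" where
  "zak E f \<Psi> = infsum (\<lambda>j. zak_term j f \<Psi>) (lattice_of E)"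

end

theory Submission
  imports Defs "HOL-Probability.Probability" "HOL-Complex_Analysis.Cauchy_Integral_Formula"
begin

text \<open>
  Everything is reduced to Gaussian windows.  Elements of the Gelfand--Shilov space are rapidly
  convergent superpositions of Gaussian time-frequency shifts with which functionals commute, so
  short-time Fourier transforms with two windows dominate each other up to convolution with
  arbitrarily fast exponential decay.  Raising such an inequality to the power \<open>p\<close> is Jensen's
  inequality for \<open>p \<ge> 1\<close> and Peetre's maximal function argument for \<open>p < 1\<close>.

  For Gaussian windows the transform of the Zak transform of \<open>f\<close> at \<open>((x, \<xi>), (\<eta>, y))\<close> is, up to
  phases, a Fourier series in \<open>\<xi>\<close> over the lattice whose coefficient at \<open>j\<close> is the transform of
  \<open>f\<close> at \<open>(x - j, \<eta>)\<close> times a Gaussian in \<open>j - y\<close>.  Summing the series gives the upper bound,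
  and integrating over a period in \<open>\<xi>\<close> recovers the coefficient \<open>j = 0\<close>, which gives the lower
  bound after phase space has been cut into translates of the fundamental domain, on which the
  modulus is the same by quasi-periodicity.  Both estimates end with Schur's test.
\<close>


subsection \<open>Lebesgue integration over a Euclidean space\<close>

text \<open>Two obstacles shape the argument. A functional is linear and bounded only on
  \<open>Sigma1\<close>, so it cannot be moved past an integral before that integral is known to be
  a member; this is settled once, in \<open>synthesis\<close>. Gaussians serve there because their
  atoms are entire, so that Cauchy's inequality gives all seminorms at once, because they factor
  over products, and because they are their own Fourier transforms: the fibre maps of the Zak
  transform send Gaussian atoms to multiples of Gaussian atoms. Membership of other functions is
  then read off from their Gaussian coefficients.

  The second obstacle is uniformity in \<open>f\<close>. Each \<open>f\<close> has its own
  exponential growth rate, which must not enter the constants. Hence kernels are kept with an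
  arbitrary rate \<open>N\<close>, and powers are taken of pointwise inequalities before any norm
  appears, since convolution with an integrable kernel need not be bounded on \<open>L^p\<close> for
  \<open>p < 1\<close>.

  The domain on the Zak side is bounded in \<open>(x, \<xi>)\<close> only. A lattice translation of
  \<open>x\<close> also moves \<open>y\<close>, so the unbounded variable \<open>y\<close> records
  \<open>f\<close> over all translates of the cell.\<close>

lemma lborel_integral_affine_euclidean:
  fixes f :: "'a::euclidean_space \<Rightarrow> complex" and t :: 'a
  assumes c: "c \<noteq> 0" and f[measurable]: "f \<in> borel_measurable borel"
  shows "integrable lborel (\<lambda>x. f (t + c *\<^sub>R x)) \<longleftrightarrow> integrable lborel f"
    and "integral\<^sup>L lborel f = \<bar>c\<bar> ^ DIM('a) *\<^sub>R (\<integral>x. f (t + c *\<^sub>R x) \<partial>lborel)"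
proof -
  have *: "integrable lborel f \<longleftrightarrow>
      integrable (density (distr lborel borel (\<lambda>x. t + c *\<^sub>R x)) (\<lambda>_. ennreal (\<bar>c\<bar>^DIM('a)))) f"
    using lborel_affine[OF c, of t] by simp
  show "integrable lborel (\<lambda>x. f (t + c *\<^sub>R x)) \<longleftrightarrow> integrable lborel f"
  proof -
    let ?k = "\<bar>c\<bar> ^ DIM('a)" and ?g = "\<lambda>x. f (t + c *\<^sub>R x)"
    have "integrable lborel ?g \<longleftrightarrow> integrable lborel (\<lambda>x. ?k *\<^sub>R ?g x)"
      using c integrable_scaleR_right[of ?k lborel ?g]
        integrable_scaleR_right[of "1 / ?k" lborel "\<lambda>x. ?k *\<^sub>R ?g x"] by auto
    then show ?thesis
      unfolding * by (simp add: integrable_density integrable_distr_eq)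
  qed
  have "integral\<^sup>L lborel f =
      integral\<^sup>L (density (distr lborel borel (\<lambda>x. t + c *\<^sub>R x)) (\<lambda>_. ennreal (\<bar>c\<bar>^DIM('a)))) f"
    using lborel_affine[OF c, of t] by simp
  also have "\<dots> = \<bar>c\<bar> ^ DIM('a) *\<^sub>R (\<integral>x. f (t + c *\<^sub>R x) \<partial>lborel)"
    by (simp add: integral_density integral_distr)
  finally show "integral\<^sup>L lborel f = \<bar>c\<bar> ^ DIM('a) *\<^sub>R (\<integral>x. f (t + c *\<^sub>R x) \<partial>lborel)" .
qed

lemma lborel_integral_translate:
  fixes f :: "'a::euclidean_space \<Rightarrow> complex" and t :: 'a
  assumes [measurable]: "f \<in> borel_measurable borel"
  shows "(\<integral>x. f (x + t) \<partial>lborel) = integral\<^sup>L lborel f"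
    and "(\<integral>x. f (x - t) \<partial>lborel) = integral\<^sup>L lborel f"
    and "(\<integral>x. f (t - x) \<partial>lborel) = integral\<^sup>L lborel f"
  using lborel_integral_affine_euclidean(2)[of 1 f t] lborel_integral_affine_euclidean(2)[of 1 f "-t"]
    lborel_integral_affine_euclidean(2)[of "-1" f t]
  by (simp_all add: add.commute)

lemma nn_integral_lborel_translate:
  fixes f :: "'a::euclidean_space \<Rightarrow> ennreal" and t :: 'a
  assumes [measurable]: "f \<in> borel_measurable borel"
  shows "(\<integral>\<^sup>+x. f (x + t) \<partial>lborel) = (\<integral>\<^sup>+x. f x \<partial>lborel)"
    and "(\<integral>\<^sup>+x. f (x - t) \<partial>lborel) = (\<integral>\<^sup>+x. f x \<partial>lborel)"
    and "(\<integral>\<^sup>+x. f (t - x) \<partial>lborel) = (\<integral>\<^sup>+x. f x \<partial>lborel)"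
proof -
  have *: "(\<integral>\<^sup>+x. f x \<partial>lborel) = (\<integral>\<^sup>+x. f (t + c *\<^sub>R x) \<partial>lborel)" if "\<bar>c\<bar> = 1" for c and t :: 'a
    using that by (subst lborel_affine[of c t]) (auto simp: density_1 nn_integral_distr)
  from *[of 1 t] *[of 1 "-t"] *[of "-1" t] show
    "(\<integral>\<^sup>+x. f (x + t) \<partial>lborel) = (\<integral>\<^sup>+x. f x \<partial>lborel)"
    "(\<integral>\<^sup>+x. f (x - t) \<partial>lborel) = (\<integral>\<^sup>+x. f x \<partial>lborel)"
    "(\<integral>\<^sup>+x. f (t - x) \<partial>lborel) = (\<integral>\<^sup>+x. f x \<partial>lborel)"
    by (simp_all add: add.commute)
qed

lemma integrable_tensor:
  fixes f :: "'a::euclidean_space \<Rightarrow> complex" and g :: "'b::euclidean_space \<Rightarrow> complex"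
  assumes f: "integrable lborel f" and g: "integrable lborel g"
  shows "integrable (lborel \<Otimes>\<^sub>M lborel) (\<lambda>(x, y). f x * g y)"
proof (rule lborel_pair.Fubini_integrable)
  have [measurable]: "f \<in> borel_measurable borel" "g \<in> borel_measurable borel"
    using f g by auto
  show "(\<lambda>(x, y). f x * g y) \<in> borel_measurable (lborel \<Otimes>\<^sub>M lborel)"
    by measurable
  show "integrable lborel (\<lambda>x. \<integral>y. norm (case (x, y) of (x, y) \<Rightarrow> f x * g y) \<partial>lborel)"
    using f by (simp add: norm_mult)
  show "AE x in lborel. integrable lborel (\<lambda>y. case (x, y) of (x, y) \<Rightarrow> f x * g y)"
    using g by simp
qed

text \<open>Domination by a tensor product of integrable functions supplies the joint integrability;
  the kernels met in \<open>dual_inversion\<close> and \<open>zak_fibre_expansion\<close> are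
  bounded in this form.\<close>

lemma lborel_Fubini:
  fixes f :: "'a::euclidean_space \<Rightarrow> complex" and g :: "'b::euclidean_space \<Rightarrow> complex"
  assumes f: "integrable lborel f" and g: "integrable lborel g"
    and k: "case_prod k \<in> borel_measurable (borel \<Otimes>\<^sub>M borel)"
    and le: "\<And>x y. cmod (k x y) \<le> cmod (f x) * cmod (g y)"
  shows "(\<integral>x. (\<integral>y. k x y \<partial>lborel) \<partial>lborel) = (\<integral>y. (\<integral>x. k x y \<partial>lborel) \<partial>lborel)"
proof -
  have 1: "integrable (lborel \<Otimes>\<^sub>M lborel) (case_prod k)"
    by (rule Bochner_Integration.integrable_bound[OF integrable_tensor[OF f g]])
      (use k le in \<open>auto simp: norm_mult\<close>)
  then show ?thesis
    using lborel_pair.Fubini_integral[OF 1] by simp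
qed

text \<open>Lebesgue measure is the image of the product measure over \<open>Basis\<close> under
  summation of coordinates. This reduces the Gaussian Fourier transform and the orthogonality of
  lattice characters to one real variable.\<close>

lemma lborel_integral_prod_Basis:
  fixes f :: "'a::euclidean_space \<Rightarrow> real \<Rightarrow> complex"
  assumes f: "\<And>b. b \<in> Basis \<Longrightarrow> integrable lborel (f b)"
  shows "integrable lborel (\<lambda>x. \<Prod>b\<in>Basis. f b (x \<bullet> b))"
    and "(\<integral>x. (\<Prod>b\<in>Basis. f b (x \<bullet> b)) \<partial>lborel) = (\<Prod>b\<in>Basis. integral\<^sup>L lborel (f b))"
proof -
  interpret product_sigma_finite "\<lambda>_::'a. lborel :: real measure"
    by standard
  have [measurable]: "f b \<in> borel_measurable borel" if "b \<in> Basis" for b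
    using f[OF that] by auto
  let ?P = "\<Pi>\<^sub>M b\<in>(Basis::'a set). (lborel :: real measure)"
  let ?g = "\<lambda>f. \<Sum>b\<in>Basis. f b *\<^sub>R (b::'a)"
  have m: "?g \<in> ?P \<rightarrow>\<^sub>M borel"
    by measurable
  have *: "(\<Prod>b\<in>Basis. f b (?g x \<bullet> b)) = (\<Prod>b\<in>Basis. f b (x b))" for x
    by (intro prod.cong) (auto simp: inner_sum_left inner_Basis if_distrib sum.delta cong: if_cong)
  have m2: "(\<lambda>x::'a. \<Prod>b\<in>Basis. f b (x \<bullet> b)) \<in> borel_measurable borel"
    by measurable
  show "integrable lborel (\<lambda>x. \<Prod>b\<in>Basis. f b (x \<bullet> b))"
    by (subst lborel_eq, subst integrable_distr_eq[OF m m2])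
      (simp add: * product_integrable_prod f)
  show "(\<integral>x. (\<Prod>b\<in>Basis. f b (x \<bullet> b)) \<partial>lborel) = (\<Prod>b\<in>Basis. integral\<^sup>L lborel (f b))"
    by (subst lborel_eq, subst integral_distr[OF m m2])
      (simp add: * product_integral_prod f)
qed

section \<open>Exponentials of the norm and functions of rapid decay\<close>

lemma integrable_exp_neg_abs:
  assumes a: "0 < (a::real)"
  shows "integrable lborel (\<lambda>x::real. exp (- (a * \<bar>x\<bar>)))"
proof -
  \<comment> \<open>The exponential density has mass 1; added to its reflection and divided by
    \<open>a\<close>, it dominates the two-sided exponential.\<close>
  interpret prob_space "density lborel (exponential_density a)"
    using a by (rule prob_space_exponential_density)
  have 1: "integrable lborel (exponential_density a)"
    using emeasure_space_1 a
    by (intro integrableI_nonneg) (auto simp: emeasure_density exponential_density_def)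
  have 2: "integrable lborel (\<lambda>x. exponential_density a (0 + (-1) * x))"
    by (rule lborel_integrable_real_affine[OF 1]) simp
  have 3: "integrable lborel (\<lambda>x. (exponential_density a x + exponential_density a (0 + (-1) * x)) / a)"
    using 1 2 by simp
  show ?thesis
    by (rule Bochner_Integration.integrable_bound[OF 3])
      (use a in \<open>auto simp: exponential_density_def field_simps\<close>)
qed

lemma integrable_exp_neg_norm:
  assumes r: "0 < (r::real)"
  shows "integrable lborel (\<lambda>x::'a::euclidean_space. exp (- (r * norm x)))"
proof -
  \<comment> \<open>Each of the \<open>DIM('a)\<close> coordinates is at most the norm, so with this
    rate the product of one-dimensional exponentials dominates.\<close>
  let ?a = "r / DIM('a)"
  have "integrable lborel (\<lambda>x::'a. \<Prod>b\<in>Basis. complex_of_real (exp (- (?a * \<bar>x \<bullet> b\<bar>))))"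
    using r by (intro lborel_integral_prod_Basis(1)[where f="\<lambda>b y. complex_of_real (exp (- (?a * \<bar>y\<bar>)))"]
        integrable_of_real integrable_exp_neg_abs) simp
  then show ?thesis
  proof (rule Bochner_Integration.integrable_bound)
    show "AE x::'a in lborel. norm (exp (- (r * norm x)))
        \<le> norm (\<Prod>b\<in>Basis. complex_of_real (exp (- (?a * \<bar>x \<bullet> b\<bar>))))"
    proof (rule AE_I2)
      fix x :: 'a
      have "(\<Sum>b\<in>Basis. ?a * \<bar>x \<bullet> b\<bar>) \<le> (\<Sum>b\<in>(Basis::'a set). ?a * norm x)"
        using r by (intro sum_mono mult_left_mono Basis_le_norm) auto
      then have "(\<Sum>b\<in>Basis. ?a * \<bar>x \<bullet> b\<bar>) \<le> r * norm x"
        by simp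
      then show "norm (exp (- (r * norm x))) \<le> norm (\<Prod>b\<in>Basis. complex_of_real (exp (- (?a * \<bar>x \<bullet> b\<bar>))))"
        by (simp add: prod_norm[symmetric] exp_sum[symmetric] sum_negf)
    qed
  qed simp
qed

text \<open>Decay beyond every exponential, which both the elements of \<open>Sigma1\<close> and
  their Gabor coefficients have. Values of a functional on Gabor atoms grow at most exponentially,
  so a rapid weight pairs integrably with them.\<close>

definition rapid :: "('a::real_normed_vector \<Rightarrow> complex) \<Rightarrow> bool" where
  "rapid g \<longleftrightarrow> (\<forall>N. \<exists>C\<ge>0. \<forall>x. cmod (g x) \<le> C * exp (- (N * norm x)))"

lemma rapidE:
  assumes "rapid g"
  obtains C where "0 \<le> C" "\<And>x. cmod (g x) \<le> C * exp (- (N * norm x))"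
  using assms unfolding rapid_def by blast

lemma rapidI:
  assumes "\<And>N. 0 < N \<Longrightarrow> \<exists>C. \<forall>x. cmod (g x) \<le> C * exp (- (N * norm x))"
  shows "rapid g"
  unfolding rapid_def
proof
  fix N :: real
  obtain C where C: "cmod (g x) \<le> C * exp (- (max N 1 * norm x))" for x
    using assms[of "max N 1"] by (auto simp: less_max_iff_disj)
  have "0 \<le> C"
    using order_trans[OF norm_ge_zero C[of 0]] by simp
  moreover have "C * exp (- (max N 1 * norm x)) \<le> C * exp (- (N * norm x))" for x :: 'a
    using \<open>0 \<le> C\<close> by (intro mult_left_mono) (auto intro: mult_right_mono)
  ultimately show "\<exists>C\<ge>0. \<forall>x. cmod (g x) \<le> C * exp (- (N * norm x))"
    using C order_trans by blast
qed

lemma rapid_integrable_exp: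
  fixes g :: "'a::euclidean_space \<Rightarrow> complex"
  assumes "rapid g" and [measurable]: "g \<in> borel_measurable borel"
  shows "integrable lborel (\<lambda>x. cmod (g x) * exp (c * norm x))"
proof -
  obtain C where C: "0 \<le> C" "\<And>x. cmod (g x) \<le> C * exp (- ((c + 1) * norm x))"
    using rapidE[OF assms(1)] by blast
  have "integrable lborel (\<lambda>x::'a. C * exp (- (1 * norm x)))"
    using integrable_mult_right[OF integrable_exp_neg_norm[of 1]] by simp
  then show ?thesis
  proof (rule Bochner_Integration.integrable_bound)
    show "AE x in lborel. norm (cmod (g x) * exp (c * norm x)) \<le> norm (C * exp (- (1 * norm x)))"
    proof (rule AE_I2)
      fix x
      have "cmod (g x) * exp (c * norm x) \<le> C * exp (- ((c + 1) * norm x)) * exp (c * norm x)"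
        using C(2)[of x] by simp
      also have "\<dots> = C * exp (- (1 * norm x))"
        by (simp add: mult.assoc exp_add[symmetric] algebra_simps)
      finally show "norm (cmod (g x) * exp (c * norm x)) \<le> norm (C * exp (- (1 * norm x)))"
        using C(1) by simp
    qed
  qed simp
qed

lemma rapid_integrable:
  fixes g :: "'a::euclidean_space \<Rightarrow> complex"
  assumes "rapid g" and "g \<in> borel_measurable borel"
  shows "integrable lborel g"
  using rapid_integrable_exp[OF assms, of 0] assms(2) by (simp add: integrable_norm_iff)

lemma rapid_integrable_mult:
  fixes g :: "'a::euclidean_space \<Rightarrow> complex"
  assumes g: "rapid g" and [measurable]: "g \<in> borel_measurable borel" "h \<in> borel_measurable borel"
    and h: "\<And>x. cmod (h x) \<le> A * exp (c * norm x)"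
  shows "integrable lborel (\<lambda>x. g x * h x)"
proof -
  have "integrable lborel (\<lambda>x. A * (cmod (g x) * exp (c * norm x)))"
    using rapid_integrable_exp[OF g] by simp
  then show ?thesis
  proof (rule Bochner_Integration.integrable_bound)
    show "AE x in lborel. norm (g x * h x) \<le> norm (A * (cmod (g x) * exp (c * norm x)))"
    proof (rule AE_I2)
      fix x
      have "cmod (g x) * cmod (h x) \<le> cmod (g x) * (A * exp (c * norm x))"
        by (intro mult_left_mono h) simp
      also have "\<dots> = A * (cmod (g x) * exp (c * norm x))"
        by simp
      also have "\<dots> \<le> norm (A * (cmod (g x) * exp (c * norm x)))"
        unfolding real_norm_def by (rule abs_ge_self)
      finally show "norm (g x * h x) \<le> norm (A * (cmod (g x) * exp (c * norm x)))"
        by (simp add: norm_mult)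
    qed
  qed simp
qed

lemma rapid_bounded:
  assumes "rapid g"
  obtains B where "0 \<le> B" "\<And>x. cmod (g x) \<le> B"
  using rapidE[OF assms, of 0] by auto

subsection \<open>The Fourier transform of a Gaussian and Fourier inversion\<close>

text \<open>This scaling makes the function its own Fourier transform up to the factor
  \<open>sqrt (2 * pi) ^ DIM('a)\<close>.\<close>

definition gauss :: "'a::real_normed_vector \<Rightarrow> complex" where
  "gauss s = of_real (exp (- (norm s)\<^sup>2 / 2))"

lemma continuous_on_gauss: "continuous_on UNIV gauss"
  unfolding gauss_def by (intro continuous_intros) auto

lemma borel_measurable_gauss [measurable]: "gauss \<in> borel_measurable (borel :: 'a::euclidean_space measure)"
  by (rule borel_measurable_continuous_onI[OF continuous_on_gauss])

lemma rapid_gauss: "rapid (gauss :: 'a::real_normed_vector \<Rightarrow> complex)"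
proof (rule rapidI)
  fix N :: real
  have "- (norm x)\<^sup>2 / 2 \<le> N\<^sup>2 / 2 - N * norm x" for x :: 'a
    using sum_squares_ge_zero[of "norm x - N" 0] by (simp add: power2_eq_square algebra_simps)
  then have "cmod (gauss x) \<le> exp (N\<^sup>2 / 2 - N * norm x)" for x :: 'a
    unfolding gauss_def by simp
  then show "\<exists>C. \<forall>x::'a. cmod (gauss x) \<le> C * exp (- (N * norm x))"
    by (intro exI[of _ "exp (N\<^sup>2 / 2)"]) (auto simp: exp_add[symmetric])
qed

lemma integrable_gauss: "integrable lborel (gauss :: 'a::euclidean_space \<Rightarrow> complex)"
  by (rule rapid_integrable[OF rapid_gauss]) simp

lemma borel_measurable_cis [measurable (raw)]:
  "f \<in> borel_measurable M \<Longrightarrow> (\<lambda>x. cis (f x)) \<in> borel_measurable M"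
  unfolding cis_conv_exp by measurable

lemma gauss_prod:
  "gauss (x::'a::euclidean_space) = (\<Prod>b\<in>Basis. gauss (x \<bullet> b))"
proof -
  have "(norm x)\<^sup>2 = (\<Sum>b\<in>Basis. (x \<bullet> b)\<^sup>2)"
    by (simp add: norm_eq_sqrt_inner euclidean_inner[of x x] power2_eq_square sum_nonneg)
  then show ?thesis
    unfolding gauss_def of_real_prod[symmetric]
    by (simp add: exp_sum[symmetric] sum_negf sum_divide_distrib)
qed

lemma cis_inner_prod: "cis (x \<bullet> y) = (\<Prod>b\<in>Basis. cis ((x \<bullet> b) * (y \<bullet> b)))"
  by (subst euclidean_inner) (simp add: cis_conv_exp exp_sum sum_distrib_left)

lemma gauss_fourier_real:
  "(\<integral>x. gauss x * cis (x * t) \<partial>lborel) = of_real (sqrt (2 * pi)) * gauss (t::real)"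
proof -
  \<comment> \<open>The characteristic function of the standard normal law is the wanted transform,
    up to the normalisation of the density.\<close>
  have "char std_normal_distribution t = complex_of_real (exp (- t\<^sup>2 / 2))"
    using char_std_normal_distribution by (metis (no_types))
  moreover have "char std_normal_distribution t = (\<integral>x. of_real (normal_density 0 1 x) * cis (t * x) \<partial>lborel)"
    unfolding char_def
    by (subst integral_density) (auto simp: scaleR_conv_of_real cis_conv_exp normal_density_nonneg)
  moreover have "(\<integral>x. of_real (normal_density 0 1 x) * cis (t * x) \<partial>lborel)
      = (\<integral>x. of_real (1 / sqrt (2 * pi)) * (gauss x * cis (x * t)) \<partial>lborel)"
    by (intro Bochner_Integration.integral_cong) (auto simp: normal_density_def gauss_def mult.commute)
  ultimately show ?thesis
    unfolding gauss_def by (simp add: field_simps)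
qed

lemma integrable_gauss_cis:
  "integrable lborel (\<lambda>x::'a::euclidean_space. gauss x * cis (x \<bullet> t))"
  by (rule Bochner_Integration.integrable_bound[OF integrable_gauss]) (auto simp: norm_mult)

lemma gauss_fourier:
  "(\<integral>x. gauss x * cis (x \<bullet> t) \<partial>lborel) = of_real (sqrt (2 * pi)) ^ DIM('a) * gauss (t::'a::euclidean_space)"
proof -
  have "(\<integral>x. gauss x * cis (x \<bullet> t) \<partial>lborel)
      = (\<integral>x. (\<Prod>b\<in>Basis. gauss (x \<bullet> b) * cis ((x \<bullet> b) * (t \<bullet> b))) \<partial>lborel)"
    by (intro Bochner_Integration.integral_cong refl)
      (simp only: gauss_prod[where 'a='a] cis_inner_prod prod.distrib)
  also have "\<dots> = (\<Prod>b\<in>Basis. (\<integral>y. gauss y * cis (y * (t \<bullet> b)) \<partial>lborel))"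
    using integrable_gauss_cis[where 'a=real]
    by (intro lborel_integral_prod_Basis(2)[where f="\<lambda>b y. gauss y * cis (y * (t \<bullet> b))"])
      (simp add: inner_real_def)
  also have "\<dots> = of_real (sqrt (2 * pi)) ^ DIM('a) * gauss t"
    by (simp add: gauss_fourier_real gauss_prod[of t] prod.distrib)
  finally show ?thesis .
qed

lemma integral_gauss:
  "integral\<^sup>L lborel (gauss :: 'a::euclidean_space \<Rightarrow> complex) = of_real (sqrt (2 * pi)) ^ DIM('a)"
proof -
  have "gauss (0::'a) = 1"
    by (simp add: gauss_def)
  then show ?thesis
    using gauss_fourier[of "0::'a"] by simp
qed

text \<open>Gaussian summability. Damping the outer integral by
  \<open>gauss (e n *\<^sub>R \<xi>)\<close> makes the double integral absolutely convergent.
  Integrating in \<open>\<xi>\<close> first then produces a Gaussian of width \<open>e n\<close>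
  around \<open>s\<close>, an approximate identity, while the damping is removed by domination with
  the integrable transform.\<close>

lemma fourier_inversion:
  fixes h :: "'a::euclidean_space \<Rightarrow> complex"
  assumes h: "integrable lborel h" and cont: "continuous_on UNIV h" and B: "\<And>x. cmod (h x) \<le> B"
    and hh: "integrable lborel (\<lambda>\<xi>. \<integral>t. h t * cis (t \<bullet> \<xi>) \<partial>lborel)"
  shows "(\<integral>\<xi>. (\<integral>t. h t * cis (t \<bullet> \<xi>) \<partial>lborel) * cis (- (s \<bullet> \<xi>)) \<partial>lborel)
     = of_real ((2 * pi) ^ DIM('a)) * h s"
proof -
  define H where "H \<xi> = (\<integral>t. h t * cis (t \<bullet> \<xi>) \<partial>lborel)" for \<xi>
  define e where "e n = 1 / real (Suc n)" for n
  have e: "e n > 0" "e n \<noteq> 0" for n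
    by (auto simp: e_def)
  define J where "J n = (\<integral>\<xi>. H \<xi> * cis (- (s \<bullet> \<xi>)) * gauss (e n *\<^sub>R \<xi>) \<partial>lborel)" for n
  have [measurable]: "h \<in> borel_measurable borel"
    using h by auto
  have HI: "integrable lborel H"
    using hh unfolding H_def .
  then have [measurable]: "H \<in> borel_measurable borel"
    by auto
  have e0: "e \<longlonglongrightarrow> 0"
    unfolding e_def by (rule LIMSEQ_Suc[OF lim_1_over_n])
  have gauss_le: "cmod (gauss (x::'a)) \<le> 1" for x
    unfolding gauss_def by simp
  have gauss_lim: "(\<lambda>n. gauss (e n *\<^sub>R x)) \<longlonglongrightarrow> 1" for x :: 'a
  proof -
    have "isCont gauss (0 *\<^sub>R x)"
      using continuous_on_gauss[where 'a='a] by (simp add: continuous_on_eq_continuous_at)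
    moreover have "(\<lambda>n. e n *\<^sub>R x) \<longlonglongrightarrow> 0 *\<^sub>R x"
      by (intro tendsto_intros e0)
    ultimately show ?thesis
      using isCont_tendsto_compose[of "0 *\<^sub>R x" gauss "\<lambda>n. e n *\<^sub>R x"] by (simp add: gauss_def)
  qed
  have mc [measurable]: "(\<lambda>\<xi>. cis (- (s \<bullet> \<xi>))) \<in> borel_measurable borel"
    by measurable
  have 1: "J \<longlonglongrightarrow> (\<integral>\<xi>. H \<xi> * cis (- (s \<bullet> \<xi>)) \<partial>lborel)"
    unfolding J_def
  proof (rule integral_dominated_convergence[where w="\<lambda>\<xi>. cmod (H \<xi>)"])
    show "AE \<xi> in lborel. (\<lambda>n. H \<xi> * cis (- (s \<bullet> \<xi>)) * gauss (e n *\<^sub>R \<xi>)) \<longlonglongrightarrow> H \<xi> * cis (- (s \<bullet> \<xi>))"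
      using tendsto_mult[OF tendsto_const gauss_lim] by auto
    show "AE \<xi> in lborel. norm (H \<xi> * cis (- (s \<bullet> \<xi>)) * gauss (e n *\<^sub>R \<xi>)) \<le> cmod (H \<xi>)" for n
      using gauss_le by (auto simp: norm_mult intro!: mult_left_le)
  qed (use HI in \<open>auto\<close>)
  have 2: "J n = of_real (sqrt (2 * pi)) ^ DIM('a) * (\<integral>v. h (s + e n *\<^sub>R v) * gauss v \<partial>lborel)" for n
  proof -
    let ?G = "\<lambda>\<xi>::'a. gauss (e n *\<^sub>R \<xi>)"
    have gI: "integrable lborel ?G"
      using lborel_integral_affine_euclidean(1)[of "e n" gauss "0::'a"] e integrable_gauss by auto
    have "integrable (lborel \<Otimes>\<^sub>M lborel) (\<lambda>(\<xi>, t). h t * cis ((t - s) \<bullet> \<xi>) * ?G \<xi>)"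
    proof (rule Bochner_Integration.integrable_bound)
      show "integrable (lborel \<Otimes>\<^sub>M lborel) (\<lambda>(\<xi>::'a, t::'a). ?G \<xi> * h t)"
        by (rule integrable_tensor) (use gI h in auto)
    qed (auto simp: norm_mult)
    from lborel_pair.Fubini_integral[OF this]
    have sw: "(\<integral>\<xi>. (\<integral>t. h t * cis ((t - s) \<bullet> \<xi>) * ?G \<xi> \<partial>lborel) \<partial>lborel)
      = (\<integral>t. (\<integral>\<xi>. h t * cis ((t - s) \<bullet> \<xi>) * ?G \<xi> \<partial>lborel) \<partial>lborel)"
      by simp
    have "J n = (\<integral>\<xi>. (\<integral>t. h t * cis ((t - s) \<bullet> \<xi>) * ?G \<xi> \<partial>lborel) \<partial>lborel)"
    proof -
      have "H \<xi> * cis (- (s \<bullet> \<xi>)) * ?G \<xi> = (\<integral>t. h t * cis ((t - s) \<bullet> \<xi>) * ?G \<xi> \<partial>lborel)" for \<xi>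
        unfolding H_def
        by (simp flip: integral_mult_left_zero add: inner_diff_left mult.assoc cis_mult)
      then show ?thesis
        by (simp only: J_def)
    qed
    also have "\<dots> = (\<integral>t. h t * (\<integral>\<xi>. cis ((t - s) \<bullet> \<xi>) * ?G \<xi> \<partial>lborel) \<partial>lborel)"
      unfolding sw by (simp add: mult.assoc)
    \<comment> \<open>Rescaling \<open>t = s + e n *\<^sub>R v\<close> fixes the width of the
      Gaussian and moves the dependence on \<open>n\<close> into the argument of \<open>h\<close>,
      where continuity and boundedness of \<open>h\<close> give the limit.\<close>
    also have "\<dots> = e n ^ DIM('a) *\<^sub>R (\<integral>v. h (s + e n *\<^sub>R v) * (\<integral>\<xi>. cis ((e n *\<^sub>R v) \<bullet> \<xi>) * ?G \<xi> \<partial>lborel) \<partial>lborel)"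
    proof -
      have "(\<lambda>t. h t * (\<integral>\<xi>. cis ((t - s) \<bullet> \<xi>) * ?G \<xi> \<partial>lborel)) \<in> borel_measurable borel"
        by measurable
      from lborel_integral_affine_euclidean(2)[OF e(2)[of n] this, of s] e(1)[of n] show ?thesis
        by simp
    qed
    also have "\<dots> = (\<integral>v. h (s + e n *\<^sub>R v) * (e n ^ DIM('a) *\<^sub>R (\<integral>\<xi>. cis ((e n *\<^sub>R v) \<bullet> \<xi>) * ?G \<xi> \<partial>lborel)) \<partial>lborel)"
      by (simp flip: integral_scaleR_right add: scaleR_conv_of_real mult_ac)
    also have "\<dots> = (\<integral>v. h (s + e n *\<^sub>R v) * (of_real (sqrt (2 * pi)) ^ DIM('a) * gauss v) \<partial>lborel)"
    proof -
      have "e n ^ DIM('a) *\<^sub>R (\<integral>\<xi>. cis ((e n *\<^sub>R v) \<bullet> \<xi>) * ?G \<xi> \<partial>lborel)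
         = of_real (sqrt (2 * pi)) ^ DIM('a) * gauss v" for v :: 'a
      proof -
        have "integral\<^sup>L lborel (\<lambda>x. gauss x * cis (x \<bullet> v))
          = \<bar>e n\<bar> ^ DIM('a) *\<^sub>R (\<integral>x. gauss (0 + e n *\<^sub>R x) * cis ((0 + e n *\<^sub>R x) \<bullet> v) \<partial>lborel)"
          by (rule lborel_integral_affine_euclidean(2)) (use e in auto)
        then show ?thesis
          using e(1)[of n] by (simp add: gauss_fourier inner_commute mult.commute)
      qed
      then show ?thesis by (simp only:)
    qed
    also have "\<dots> = of_real (sqrt (2 * pi)) ^ DIM('a) * (\<integral>v. h (s + e n *\<^sub>R v) * gauss v \<partial>lborel)"
      by (simp flip: integral_mult_right_zero add: mult_ac)
    finally show ?thesis .
  qed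
  have 3: "(\<lambda>n. \<integral>v. h (s + e n *\<^sub>R v) * gauss v \<partial>lborel) \<longlonglongrightarrow> (\<integral>v. h s * gauss (v::'a) \<partial>lborel)"
  proof (rule integral_dominated_convergence[where w="\<lambda>v. B * cmod (gauss v)"])
    show "AE v::'a in lborel. (\<lambda>n. h (s + e n *\<^sub>R v) * gauss v) \<longlonglongrightarrow> h s * gauss v"
    proof (rule AE_I2)
      fix v :: 'a
      have "(\<lambda>n. s + e n *\<^sub>R v) \<longlonglongrightarrow> s + 0 *\<^sub>R v"
        by (intro tendsto_intros e0)
      moreover have "isCont h (s + 0 *\<^sub>R v)"
        using cont by (simp add: continuous_on_eq_continuous_at)
      ultimately have "(\<lambda>n. h (s + e n *\<^sub>R v)) \<longlonglongrightarrow> h (s + 0 *\<^sub>R v)"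
        by (rule isCont_tendsto_compose[rotated])
      then show "(\<lambda>n. h (s + e n *\<^sub>R v) * gauss v) \<longlonglongrightarrow> h s * gauss v"
        using tendsto_mult_right by fastforce
    qed
    show "AE v::'a in lborel. norm (h (s + e n *\<^sub>R v) * gauss v) \<le> B * cmod (gauss v)" for n
      using B by (auto simp: norm_mult mult_right_mono)
    show "integrable lborel (\<lambda>v::'a. B * cmod (gauss v))"
      using integrable_gauss by auto
  qed auto
  have "J \<longlonglongrightarrow> of_real (sqrt (2 * pi)) ^ DIM('a) * (\<integral>v. h s * gauss (v::'a) \<partial>lborel)"
    unfolding 2 by (intro tendsto_intros 3)
  moreover have "of_real (sqrt (2 * pi)) ^ DIM('a) * (\<integral>v. h s * gauss (v::'a) \<partial>lborel)
     = of_real ((2 * pi) ^ DIM('a)) * h s"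
  proof -
    have "complex_of_real (sqrt (2 * pi)) * of_real (sqrt (2 * pi)) = of_real (2 * pi)"
      by (simp flip: of_real_mult)
    then have *: "complex_of_real (sqrt (2 * pi)) ^ DIM('a) * of_real (sqrt (2 * pi)) ^ DIM('a)
        = of_real ((2 * pi) ^ DIM('a))"
      by (simp only: power_mult_distrib[symmetric] of_real_power)
    have "of_real (sqrt (2 * pi)) ^ DIM('a) * (\<integral>v. h s * gauss (v::'a) \<partial>lborel)
      = (complex_of_real (sqrt (2 * pi)) ^ DIM('a) * of_real (sqrt (2 * pi)) ^ DIM('a)) * h s"
      by (subst integral_mult_right_zero, subst integral_gauss) (simp only: mult_ac)
    then show ?thesis
      unfolding * .
  qed
  ultimately have "J \<longlonglongrightarrow> of_real ((2 * pi) ^ DIM('a)) * h s"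
    by (simp only:)
  from LIMSEQ_unique[OF 1 this] show ?thesis
    unfolding H_def .
qed

subsection \<open>Time-frequency shifts and the inversion formula\<close>

text \<open>The test function at which \<open>stft\<close> evaluates the functional, without the
  normalising power of \<open>2 * pi\<close>; hence the conjugate on the window. The centre is
  \<open>fst X\<close> in position and \<open>snd X\<close> in frequency.\<close>

definition gabor :: "('a::euclidean_space \<Rightarrow> complex) \<Rightarrow> 'a \<times> 'a \<Rightarrow> 'a \<Rightarrow> complex" where
  "gabor \<phi> X = (\<lambda>s. cnj (\<phi> (s - fst X)) * cis (- (s \<bullet> snd X)))"

text \<open>The \<open>L^2\<close> inner product of \<open>g\<close> with
  \<open>gabor \<psi> X\<close>, whose conjugate is
  \<open>\<psi> (t - fst X) * cis (t \<bullet> snd X)\<close>.\<close>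

definition coef :: "('a::euclidean_space \<Rightarrow> complex) \<Rightarrow> ('a \<Rightarrow> complex) \<Rightarrow> 'a \<times> 'a \<Rightarrow> complex" where
  "coef \<psi> g X = (\<integral>t. g t * \<psi> (t - fst X) * cis (t \<bullet> snd X) \<partial>lborel)"

lemma borel_measurable_coef [measurable]:
  fixes g \<psi> :: "'a::euclidean_space \<Rightarrow> complex"
  assumes [measurable]: "g \<in> borel_measurable borel" "\<psi> \<in> borel_measurable borel"
  shows "coef \<psi> g \<in> borel_measurable borel"
proof -
  have [measurable]: "fst \<in> borel_measurable (borel :: ('a \<times> 'a) measure)"
    "snd \<in> borel_measurable (borel :: ('a \<times> 'a) measure)"
    by (intro borel_measurable_continuous_onI continuous_intros)+
  show ?thesis
    unfolding coef_def by measurable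
qed

lemma borel_measurable_cnj [measurable (raw)]:
  "f \<in> borel_measurable M \<Longrightarrow> (\<lambda>x. cnj (f x)) \<in> borel_measurable M"
  by (rule measurable_compose[OF _ borel_measurable_continuous_onI[of cnj]]) (auto intro: continuous_intros)

lemma borel_measurable_gabor [measurable]:
  fixes \<phi> :: "'a::euclidean_space \<Rightarrow> complex"
  assumes [measurable]: "\<phi> \<in> borel_measurable borel"
  shows "gabor \<phi> X \<in> borel_measurable borel"
  unfolding gabor_def by measurable

lemma borel_measurable_gabor_index [measurable]:
  fixes \<phi> :: "'a::euclidean_space \<Rightarrow> complex"
  assumes [measurable]: "\<phi> \<in> borel_measurable borel"
  shows "(\<lambda>X. gabor \<phi> X s) \<in> borel_measurable borel"
proof -
  have [measurable]: "fst \<in> borel_measurable (borel :: ('a \<times> 'a) measure)"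
    "snd \<in> borel_measurable (borel :: ('a \<times> 'a) measure)"
    by (intro borel_measurable_continuous_onI continuous_intros)+
  show ?thesis
    unfolding gabor_def by measurable
qed

lemma continuous_on_gabor:
  fixes \<phi> :: "'a::euclidean_space \<Rightarrow> complex"
  assumes "continuous_on UNIV \<phi>"
  shows "continuous_on UNIV (gabor \<phi> X)"
  unfolding gabor_def cis_conv_exp
  by (intro continuous_intros continuous_on_compose2[OF assms]) auto

lemma cmod_gabor: "cmod (gabor \<phi> X s) = cmod (\<phi> (s - fst X))"
  by (simp add: gabor_def norm_mult)

text \<open>For fixed \<open>x\<close> the frequency integral inverts the Fourier transform of the
  product of \<open>g\<close> with the window translated by \<open>x\<close>, and leaves
  \<open>(2 pi)^d g(s) |\<phi>(s - x)|^2\<close>. The integral over \<open>x\<close> then gives the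
  squared norm of the window. Rapid decay of the coefficients justifies the inversion and the
  splitting of the integral over pairs.\<close>

lemma coef_inversion:
  fixes g \<phi> :: "'a::euclidean_space \<Rightarrow> complex"
  assumes g: "continuous_on UNIV g" "rapid g" and \<phi>: "continuous_on UNIV \<phi>" "rapid \<phi>"
    and c: "rapid (coef \<phi> g)"
  shows "(\<integral>Y. coef \<phi> g Y * gabor \<phi> Y s \<partial>lborel)
      = of_real ((2 * pi) ^ DIM('a)) * (\<integral>v. \<phi> v * cnj (\<phi> v) \<partial>lborel) * g s"
proof -
  have [measurable]: "g \<in> borel_measurable borel" "\<phi> \<in> borel_measurable borel"
    using g(1) \<phi>(1) by (auto intro: borel_measurable_continuous_onI)
  obtain B where B: "0 \<le> B" "\<And>x. cmod (\<phi> x) \<le> B"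
    using rapid_bounded[OF \<phi>(2)] by blast
  obtain B' where B': "0 \<le> B'" "\<And>x. cmod (g x) \<le> B'"
    using rapid_bounded[OF g(2)] by blast
  have I: "integrable lborel (\<lambda>Y. coef \<phi> g Y * gabor \<phi> Y s)"
    by (rule rapid_integrable_mult[OF c, where A=B and c=0]) (use B in \<open>auto simp: cmod_gabor\<close>)
  have inner: "(\<integral>\<xi>. coef \<phi> g (x, \<xi>) * gabor \<phi> (x, \<xi>) s \<partial>lborel)
     = of_real ((2 * pi) ^ DIM('a)) * g s * (\<phi> (s - x) * cnj (\<phi> (s - x)))" for x
  proof -
    define h where "h t = g t * \<phi> (t - x)" for t
    have hI: "integrable lborel h"
      unfolding h_def
      by (rule rapid_integrable_mult[OF g(2), where A=B and c=0]) (use B in auto)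
    have hc: "continuous_on UNIV h"
      unfolding h_def by (intro continuous_intros g continuous_on_compose2[OF \<phi>(1)]) auto
    have hb: "cmod (h t) \<le> B' * B" for t
      unfolding h_def norm_mult by (intro mult_mono B B') auto
    have eq: "coef \<phi> g (x, \<xi>) = (\<integral>t. h t * cis (t \<bullet> \<xi>) \<partial>lborel)" for \<xi>
      unfolding coef_def h_def by simp
    have "rapid (\<lambda>\<xi>. coef \<phi> g (x, \<xi>))"
    proof (rule rapidI)
      fix N :: real assume "0 < N"
      obtain C where C: "0 \<le> C" "\<And>Y. cmod (coef \<phi> g Y) \<le> C * exp (- (N * norm Y))"
        using rapidE[OF c] by blast
      have "exp (- (N * norm (x, \<xi>))) \<le> exp (- (N * norm \<xi>))" for \<xi>
        using \<open>0 < N\<close> norm_snd_le[of \<xi> x] by simp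
      then show "\<exists>C. \<forall>\<xi>. cmod (coef \<phi> g (x, \<xi>)) \<le> C * exp (- (N * norm \<xi>))"
        using C by (meson mult_left_mono order_trans)
    qed
    then have fI: "integrable lborel (\<lambda>\<xi>. \<integral>t. h t * cis (t \<bullet> \<xi>) \<partial>lborel)"
      using rapid_integrable[of "\<lambda>\<xi>. coef \<phi> g (x, \<xi>)"] unfolding eq by (simp add: h_def)
    have "(\<integral>\<xi>. coef \<phi> g (x, \<xi>) * gabor \<phi> (x, \<xi>) s \<partial>lborel)
      = (\<integral>\<xi>. cnj (\<phi> (s - x)) * ((\<integral>t. h t * cis (t \<bullet> \<xi>) \<partial>lborel) * cis (- (s \<bullet> \<xi>))) \<partial>lborel)"
      unfolding eq gabor_def by (simp add: mult_ac)
    also have "\<dots> = cnj (\<phi> (s - x)) * (of_real ((2 * pi) ^ DIM('a)) * h s)"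
      by (subst integral_mult_right_zero, subst fourier_inversion[OF hI hc hb fI]) simp
    finally show ?thesis
      by (simp add: h_def mult_ac)
  qed
  have "(\<integral>Y. coef \<phi> g Y * gabor \<phi> Y s \<partial>lborel)
     = (\<integral>x. (\<integral>\<xi>. coef \<phi> g (x, \<xi>) * gabor \<phi> (x, \<xi>) s \<partial>lborel) \<partial>lborel)"
    using lborel_pair.integral_fst'[of "\<lambda>Y. coef \<phi> g Y * gabor \<phi> Y s"] I
    by (simp add: lborel_prod)
  also have "\<dots> = of_real ((2 * pi) ^ DIM('a)) * g s * (\<integral>x. \<phi> (s - x) * cnj (\<phi> (s - x)) \<partial>lborel)"
    unfolding inner by (rule integral_mult_right_zero)
  also have "(\<integral>x. \<phi> (s - x) * cnj (\<phi> (s - x)) \<partial>lborel) = (\<integral>v. \<phi> v * cnj (\<phi> v) \<partial>lborel)"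
    by (rule lborel_integral_translate(3)[where f="\<lambda>v. \<phi> v * cnj (\<phi> v)"]) measurable
  finally show "(\<integral>Y. coef \<phi> g Y * gabor \<phi> Y s \<partial>lborel)
      = of_real ((2 * pi) ^ DIM('a)) * (\<integral>v. \<phi> v * cnj (\<phi> v) \<partial>lborel) * g s"
    by (simp add: mult_ac)
qed

subsection \<open>Decay of functions in the Gelfand--Shilov space\<close>

text \<open>Summation of the exponential series. Halving the rate \<open>1 / k\<close> turns the
  moment bounds into the geometric series with ratio 1/2, which explains the factor 2.\<close>

lemma exp_bound_from_moments:
  fixes a y B k :: real
  assumes "0 \<le> a" "0 \<le> y" "0 < k" and m: "\<And>m. y ^ m * a \<le> B * k ^ m * fact m"
  shows "a * exp (y / (2 * k)) \<le> 2 * B"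
proof -
  have 1: "(\<lambda>m. a * ((y / (2 * k)) ^ m /\<^sub>R fact m)) sums (a * exp (y / (2 * k)))"
    by (intro sums_mult exp_converges)
  have 2: "(\<lambda>m. B * (1 / 2) ^ m) sums (B * 2)"
    using sums_mult[OF geometric_sums[of "1/2::real"], of B] by simp
  have "a * ((y / (2 * k)) ^ m /\<^sub>R fact m) \<le> B * (1 / 2) ^ m" for m
  proof -
    have "a * ((y / (2 * k)) ^ m /\<^sub>R fact m) = (y ^ m * a) / (k ^ m * fact m) * (1 / 2) ^ m"
      by (simp add: power_divide power_mult_distrib field_simps)
    also have "\<dots> \<le> B * (1 / 2) ^ m"
      using m[of m] \<open>0 < k\<close> by (intro mult_right_mono) (auto simp: field_simps)
    finally show ?thesis .
  qed
  from sums_le[OF this 1 2] show ?thesis by simp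
qed

lemma norm_le_DIM_coordinate:
  fixes x :: "'a::euclidean_space"
  obtains b where "b \<in> Basis" "norm x \<le> real DIM('a) * \<bar>x \<bullet> b\<bar>"
proof (rule ccontr)
  assume "\<not> thesis"
  with that have "\<And>b. b \<in> Basis \<Longrightarrow> \<bar>x \<bullet> b\<bar> < norm x / real DIM('a)"
    by (force simp: field_simps not_le)
  then have "(\<Sum>b\<in>Basis. \<bar>x \<bullet> b\<bar>) < (\<Sum>b\<in>(Basis::'a set). norm x / real DIM('a))"
    by (intro sum_strict_mono) auto
  then show False
    using norm_le_l1[of x] by simp
qed

lemma exp_norm_bound_from_coordinates:
  fixes x :: "'a::euclidean_space"
  assumes "0 \<le> a" "0 \<le> r" and "\<And>b. b \<in> Basis \<Longrightarrow> a * exp (\<bar>x \<bullet> b\<bar> * r) \<le> B"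
  shows "a * exp (norm x * (r / real DIM('a))) \<le> B"
proof -
  obtain b where b: "b \<in> Basis" "norm x \<le> real DIM('a) * \<bar>x \<bullet> b\<bar>"
    by (rule norm_le_DIM_coordinate)
  have "norm x * (r / real DIM('a)) \<le> real DIM('a) * \<bar>x \<bullet> b\<bar> * (r / real DIM('a))"
    using assms(2) by (intro mult_right_mono b) simp
  also have "\<dots> = \<bar>x \<bullet> b\<bar> * r"
    by simp
  finally have "a * exp (norm x * (r / real DIM('a))) \<le> a * exp (\<bar>x \<bullet> b\<bar> * r)"
    using assms(1) by (intro mult_left_mono) auto
  with assms(3)[OF b(1)] show ?thesis by linarith
qed

section \<open>One-coordinate multi-indices and the decay of derivatives\<close>

lemma basis_enum: "distinct (basis_enum :: 'a::euclidean_space list)" "set (basis_enum :: 'a list) = Basis"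
proof -
  have "\<exists>bs :: 'a list. distinct bs \<and> set bs = Basis"
    using finite_distinct_list[OF finite_Basis] by auto
  from someI_ex[OF this] show "distinct (basis_enum :: 'a list)" "set (basis_enum :: 'a list) = Basis"
    unfolding basis_enum_def by auto
qed

text \<open>The decay estimate \<open>Sigma1_derivative_decay\<close> uses the seminorms only for
  powers of one coordinate and derivatives in one direction; the two may belong to different basis
  vectors.\<close>

lemma partial_single:
  fixes f :: "'a::euclidean_space \<Rightarrow> complex"
  assumes "b \<in> Basis"
  shows "partial (\<lambda>c. if c = b then n else 0) f = (partial1 b ^^ n) f"
proof -
  have "foldr (\<lambda>c. partial1 c ^^ (if c = b then n else 0)) xs f = (if b \<in> set xs then (partial1 b ^^ n) f else f)"
    if "distinct xs" for xs :: "'a list"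
    using that by (induction xs) auto
  from this[OF basis_enum(1)] assms show ?thesis
    unfolding partial_def basis_enum(2) by simp
qed

lemma mi_single:
  fixes b x :: "'a::euclidean_space"
  assumes "b \<in> Basis"
  shows "mi_abs (\<lambda>c::'a. if c = b then n else 0) = n"
    and "mi_fact (\<lambda>c::'a. if c = b then n else 0) = fact n"
    and "mi_power x (\<lambda>c::'a. if c = b then n else 0) = (x \<bullet> b) ^ n"
proof -
  show "mi_abs (\<lambda>c::'a. if c = b then n else 0) = n"
    using assms by (simp add: mi_abs_def)
  have "(\<Prod>c\<in>Basis. if c = b then k else 1) = k" for k :: real
    using assms by (simp add: prod.delta)
  moreover have "fact (if c = b then n else 0) = (if c = b then fact n else (1::real))"
    "(x \<bullet> c) ^ (if c = b then n else 0) = (if c = b then (x \<bullet> b) ^ n else 1)" for c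
    by auto
  ultimately show "mi_fact (\<lambda>c::'a. if c = b then n else 0) = fact n"
    "mi_power x (\<lambda>c::'a. if c = b then n else 0) = (x \<bullet> b) ^ n"
    unfolding mi_fact_def mi_power_def by simp_all
qed

text \<open>A real-valued version, faithful on \<open>Sigma1\<close> for positive \<open>h\<close>.
  For other functions \<open>enn2real\<close> would send an infinite seminorm to 0, so it serves as
  an upper bound only for members.\<close>

abbreviation sem :: "real \<Rightarrow> ('a::euclidean_space \<Rightarrow> complex) \<Rightarrow> real" where
  "sem h g \<equiv> enn2real (Sigma1_seminorm h g)"

lemma mi_fact_pos: "0 < mi_fact \<alpha>"
  unfolding mi_fact_def by (intro prod_pos) simp

lemma Sigma1_seminorm_eq_sem: "g \<in> Sigma1 \<Longrightarrow> 0 < h \<Longrightarrow> Sigma1_seminorm h g = ennreal (sem h g)"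
  unfolding Sigma1_def by auto

lemma sem_bound:
  assumes "g \<in> Sigma1" "0 < h"
  shows "cmod (mi_power x \<alpha> * partial \<beta> g x)
    \<le> sem h g * (h ^ (mi_abs \<alpha> + mi_abs \<beta>) * mi_fact \<alpha> * mi_fact \<beta>)"
proof -
  let ?d = "h ^ (mi_abs \<alpha> + mi_abs \<beta>) * mi_fact \<alpha> * mi_fact \<beta>"
  have "ennreal (cmod (mi_power x \<alpha> * partial \<beta> g x) / ?d) \<le> Sigma1_seminorm h g"
    unfolding Sigma1_seminorm_def by (rule SUP_upper2[of "(\<alpha>, \<beta>, x)"]) auto
  then have "ennreal (cmod (mi_power x \<alpha> * partial \<beta> g x) / ?d) \<le> ennreal (sem h g)"
    using Sigma1_seminorm_eq_sem[OF assms] by simp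
  then have "cmod (mi_power x \<alpha> * partial \<beta> g x) / ?d \<le> sem h g"
    by (simp add: ennreal_le_iff)
  moreover have "0 < ?d"
    using assms(2) mi_fact_pos[of \<alpha>] mi_fact_pos[of \<beta>] by simp
  ultimately show ?thesis
    by (simp add: pos_divide_le_eq mult_ac)
qed

text \<open>The moments of order \<open>m\<close> in one coordinate grow like
  \<open>h ^ m * fact m\<close>, which gives the exponential rate \<open>1 / (2 * h)\<close> there;
  the largest coordinate carries at least the \<open>DIM('a)\<close>-th part of the norm. Small
  \<open>h\<close> means fast decay.\<close>

lemma Sigma1_derivative_decay:
  fixes g :: "'a::euclidean_space \<Rightarrow> complex"
  assumes g: "g \<in> Sigma1" and h: "0 < h" and b: "b \<in> Basis"
  shows "cmod ((partial1 b ^^ n) g x)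
    \<le> 2 * sem h g * h ^ n * fact n * exp (- (1 / (2 * h * DIM('a)) * norm x))"
proof -
  let ?a = "cmod ((partial1 b ^^ n) g x)" and ?B = "sem h g * h ^ n * fact n"
  have "?a * exp (\<bar>x \<bullet> c\<bar> * (1 / (2 * h))) \<le> 2 * ?B" if c: "c \<in> Basis" for c
  proof -
    have "\<bar>x \<bullet> c\<bar> ^ m * ?a \<le> ?B * h ^ m * fact m" for m
      using sem_bound[OF g h, of x "\<lambda>d. if d = c then m else 0" "\<lambda>d. if d = b then n else 0"]
      unfolding mi_single[OF b] mi_single[OF c] partial_single[OF b]
      by (simp add: norm_mult norm_power power_add mult_ac)
    from exp_bound_from_moments[OF _ _ h this] show ?thesis by simp
  qed
  from exp_norm_bound_from_coordinates[OF _ _ this]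
  have "?a * exp (norm x * (1 / (2 * h) / DIM('a))) \<le> 2 * ?B"
    using h by simp
  then have "?a * exp (1 / (2 * h * DIM('a)) * norm x) * exp (- (1 / (2 * h * DIM('a)) * norm x))
      \<le> 2 * ?B * exp (- (1 / (2 * h * DIM('a)) * norm x))"
    by (intro mult_right_mono) (auto simp: mult_ac)
  then show ?thesis
    by (simp add: mult.assoc exp_add[symmetric])
qed

lemma Sigma1_rapid:
  fixes g :: "'a::euclidean_space \<Rightarrow> complex"
  assumes g: "g \<in> Sigma1"
  shows "rapid g"
proof (rule rapidI)
  fix N :: real assume "0 < N"
  obtain b :: 'a where b: "b \<in> Basis"
    using nonempty_Basis by blast
  let ?h = "1 / (2 * N * DIM('a))"
  have "0 < ?h" using \<open>0 < N\<close> by simp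
  from Sigma1_derivative_decay[OF g this b, of 0]
  have "cmod (g x) \<le> 2 * sem ?h g * exp (- (N * norm x))" for x
    using \<open>0 < N\<close> by simp
  then show "\<exists>C. \<forall>x. cmod (g x) \<le> C * exp (- (N * norm x))"
    by blast
qed

lemma smooth_differentiable:
  "smooth f \<Longrightarrow> set bs \<subseteq> Basis \<Longrightarrow> foldr partial1 bs f differentiable (at x)"
  unfolding smooth_def by blast

lemma smooth_continuous: "smooth f \<Longrightarrow> set bs \<subseteq> Basis \<Longrightarrow> continuous_on UNIV (foldr partial1 bs f)"
  by (intro continuous_at_imp_continuous_on ballI differentiable_imp_continuous_within
      smooth_differentiable)

lemma foldr_replicate_funpow: "foldr F (replicate n b) x = (F b ^^ n) x"
  by (induction n) auto

lemma Sigma1_continuous: "g \<in> Sigma1 \<Longrightarrow> continuous_on UNIV g"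
  using smooth_continuous[of g "[]"] by (simp add: Sigma1_def)

lemma Sigma1_measurable: "g \<in> Sigma1 \<Longrightarrow> g \<in> borel_measurable borel"
  by (intro borel_measurable_continuous_onI Sigma1_continuous)

section \<open>Differentiation along lines, integration by parts, and decay of Gabor
  coefficients\<close>

lemma has_vector_derivative_line:
  fixes f :: "'a::euclidean_space \<Rightarrow> complex"
  assumes "(f has_derivative D) (at (x + t *\<^sub>R b))"
  shows "((\<lambda>\<tau>. f (x + \<tau> *\<^sub>R b)) has_vector_derivative D b) (at t)"
proof -
  have "((\<lambda>\<tau>. x + \<tau> *\<^sub>R b) has_derivative (\<lambda>\<tau>. \<tau> *\<^sub>R b)) (at t)"
    by (auto intro!: derivative_eq_intros)
  from has_derivative_compose[OF this assms]
  have "((\<lambda>\<tau>. f (x + \<tau> *\<^sub>R b)) has_derivative (\<lambda>\<tau>. D (\<tau> *\<^sub>R b))) (at t)" .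
  moreover have "linear D"
    using assms has_derivative_linear by blast
  ultimately show ?thesis
    unfolding has_vector_derivative_def by (simp add: linear_scale)
qed

lemma partial1_eq_derivative:
  fixes f :: "'a::euclidean_space \<Rightarrow> complex"
  assumes "(f has_derivative D) (at x)"
  shows "partial1 b f x = D b"
  unfolding partial1_def
  by (rule vector_derivative_at[OF has_vector_derivative_line]) (use assms in simp)

lemma smooth_line_derivative:
  fixes f :: "'a::euclidean_space \<Rightarrow> complex"
  assumes "smooth f" and "b \<in> Basis"
  shows "((\<lambda>\<tau>. (partial1 b ^^ n) f (x + \<tau> *\<^sub>R b)) has_vector_derivative
    (partial1 b ^^ Suc n) f (x + t *\<^sub>R b)) (at t)"
proof -
  have "(partial1 b ^^ n) f differentiable (at (x + t *\<^sub>R b))"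
    using smooth_differentiable[OF assms(1), of "replicate n b"] assms(2)
    by (simp add: foldr_replicate_funpow set_replicate_conv_if)
  then obtain D where D: "((partial1 b ^^ n) f has_derivative D) (at (x + t *\<^sub>R b))"
    unfolding differentiable_def by blast
  from has_vector_derivative_line[OF this] partial1_eq_derivative[OF D] show ?thesis
    by simp
qed

text \<open>The increment \<open>H (x + b) - H x\<close> is the integral of \<open>H'\<close> over a
  segment. Integrated over all \<open>x\<close> it vanishes by translation invariance, while Fubini
  turns the other side into the integral of \<open>H'\<close>. No boundary terms at infinity arise
  in this way.\<close>

lemma integral_directional_derivative:
  fixes H H' :: "'a::euclidean_space \<Rightarrow> complex"
  assumes H: "integrable lborel H" and H': "integrable lborel H'" "continuous_on UNIV H'"
    and d: "\<And>x t. ((\<lambda>\<tau>. H (x + \<tau> *\<^sub>R b)) has_vector_derivative H' (x + t *\<^sub>R b)) (at t)"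
  shows "integral\<^sup>L lborel H' = 0"
proof -
  let ?k = "\<lambda>t x. indicator {0..1::real} t *\<^sub>R H' (x + t *\<^sub>R b)"
  have [measurable]: "H \<in> borel_measurable borel" "H' \<in> borel_measurable borel"
    using H H' by auto
  have k: "integrable (lborel \<Otimes>\<^sub>M lborel) (case_prod ?k)"
  proof (rule lborel_pair.Fubini_integrable)
    show "case_prod ?k \<in> borel_measurable (lborel \<Otimes>\<^sub>M lborel)"
      by measurable
    have *: "(\<integral>x. norm (?k t x) \<partial>lborel) = indicator {0..1} t *\<^sub>R (\<integral>x. cmod (H' x) \<partial>lborel)" for t
    proof -
      have "(\<integral>x. complex_of_real (cmod (H' (x + t *\<^sub>R b))) \<partial>lborel) = (\<integral>x. complex_of_real (cmod (H' x)) \<partial>lborel)"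
        by (rule lborel_integral_translate(1)[where f="\<lambda>x. complex_of_real (cmod (H' x))"]) measurable
      then have "(\<integral>x. cmod (H' (x + t *\<^sub>R b)) \<partial>lborel) = (\<integral>x. cmod (H' x) \<partial>lborel)"
        by (simp only: integral_complex_of_real of_real_eq_iff)
      then show ?thesis
        by (simp split: split_indicator)
    qed
    show "integrable lborel (\<lambda>t. \<integral>x. norm (case (t, x) of (t, x) \<Rightarrow> ?k t x) \<partial>lborel)"
      unfolding prod.case * by (intro integrable_scaleR_left integrable_real_indicator) auto
    have "integrable lborel (\<lambda>x. H' (x + t *\<^sub>R b))" for t
      using lborel_integral_affine_euclidean(1)[of 1 H' "t *\<^sub>R b"] H' by (simp add: add.commute)
    then show "AE t in lborel. integrable lborel (\<lambda>x. case (t, x) of (t, x) \<Rightarrow> ?k t x)"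
      by simp
  qed
  have "(\<integral>t. ?k t x \<partial>lborel) = H (x + b) - H x" for x
  proof -
    have "(\<integral>t. indicator {0..1} t *\<^sub>R H' (x + t *\<^sub>R b) \<partial>lborel) = H (x + 1 *\<^sub>R b) - H (x + 0 *\<^sub>R b)"
    proof (rule integral_FTC_Icc)
      show "continuous_on {0..1} (\<lambda>t. H' (x + t *\<^sub>R b))"
        by (intro continuous_on_compose2[OF H'(2)] continuous_intros) auto
      show "((\<lambda>\<tau>. H (x + \<tau> *\<^sub>R b)) has_vector_derivative H' (x + t *\<^sub>R b)) (at t within {0..1})" for t
        by (rule has_vector_derivative_at_within[OF d])
    qed simp
    then show ?thesis by simp
  qed
  then have "(\<integral>x. (\<integral>t. ?k t x \<partial>lborel) \<partial>lborel) = (\<integral>x. H (x + b) - H x \<partial>lborel)"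
    by simp
  also have "\<dots> = (\<integral>x. H (x + b) \<partial>lborel) - (\<integral>x. H x \<partial>lborel)"
  proof (rule Bochner_Integration.integral_diff)
    show "integrable lborel (\<lambda>x. H (x + b))"
      using lborel_integral_affine_euclidean(1)[of 1 H b] H by (simp add: add.commute)
  qed (rule H)
  also have "\<dots> = 0"
    by (simp add: lborel_integral_translate(1))
  finally have "0 = (\<integral>t. (\<integral>x. ?k t x \<partial>lborel) \<partial>lborel)"
    using lborel_pair.Fubini_integral[OF k] by simp
  also have "\<dots> = (\<integral>t. indicator {0..1::real} t *\<^sub>R integral\<^sup>L lborel H' \<partial>lborel)"
    by (simp add: lborel_integral_translate(1))
  also have "\<dots> = (\<integral>t. indicator {0..1::real} t \<partial>lborel) *\<^sub>R integral\<^sup>L lborel H'"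
    by (intro integral_scaleR_left integrable_real_indicator) auto
  finally show ?thesis by simp
qed

text \<open>Pascal's rule: the derivative of the Leibniz sum of order \<open>n\<close> is the one of
  order \<open>n + 1\<close>, with \<open>a\<close> and \<open>c\<close> standing for the successive
  derivatives of the two factors.\<close>

lemma leibniz_sum:
  fixes a c :: "nat \<Rightarrow> complex"
  shows "(\<Sum>k\<le>n. of_nat (n choose k) * (a (Suc k) * c (n - k) + a k * c (Suc (n - k))))
    = (\<Sum>k\<le>Suc n. of_nat (Suc n choose k) * (a k * c (Suc n - k)))"
proof -
  have 1: "(\<Sum>k\<le>Suc n. of_nat (Suc n choose k) * (a k * c (Suc n - k)))
    = a 0 * c (Suc n) + (\<Sum>k\<le>n. of_nat (Suc n choose Suc k) * (a (Suc k) * c (n - k)))"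
    by (subst sum.atMost_Suc_shift) simp
  have 2: "(\<Sum>k\<le>n. of_nat (Suc n choose Suc k) * (a (Suc k) * c (n - k)))
    = (\<Sum>k\<le>n. of_nat (n choose k) * (a (Suc k) * c (n - k)))
      + (\<Sum>k\<le>n. of_nat (n choose Suc k) * (a (Suc k) * c (n - k)))"
    by (simp add: sum.distrib[symmetric] algebra_simps)
  have "(\<Sum>k\<le>n. of_nat (n choose k) * (a k * c (Suc (n - k))))
     = (\<Sum>k\<le>n. of_nat (n choose k) * (a k * c (Suc n - k)))"
    by (intro sum.cong) (auto simp: Suc_diff_le)
  also have "\<dots> = (\<Sum>k\<le>Suc n. of_nat (n choose k) * (a k * c (Suc n - k)))"
    by simp
  also have "\<dots> = a 0 * c (Suc n) + (\<Sum>k\<le>n. of_nat (n choose Suc k) * (a (Suc k) * c (n - k)))"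
    by (subst sum.atMost_Suc_shift) simp
  finally have 3: "(\<Sum>k\<le>n. of_nat (n choose k) * (a k * c (Suc (n - k))))
     = a 0 * c (Suc n) + (\<Sum>k\<le>n. of_nat (n choose Suc k) * (a (Suc k) * c (n - k)))" .
  show ?thesis
    unfolding 1 2 by (simp add: distrib_left sum.distrib 3)
qed

text \<open>Decay in position comes from the overlap of \<open>g\<close> with the translated window,
  decay in frequency from integration by parts: each power of a frequency coordinate is a derivative
  of the product, with bounds of factorial type. As \<open>K\<close> is chosen before
  \<open>g\<close> and \<open>\<psi>\<close>, this is a continuity estimate for a sesquilinear or
  bilinear pairing and not only a decay statement.\<close>

lemma coef_decay:
  fixes \<psi> g :: "'a::euclidean_space \<Rightarrow> complex"
  assumes h: "0 < h"
  shows "\<exists>K\<ge>0. \<forall>g\<in>Sigma1. \<forall>\<psi>\<in>Sigma1. \<forall>X :: 'a \<times> 'a.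
    cmod (coef \<psi> g X) \<le> K * sem h g * sem h \<psi> * exp (- (1 / (4 * h * DIM('a)) * norm X))"
proof -
  let ?d = "real DIM('a)"
  define \<rho> where "\<rho> = 1 / (2 * h * ?d)"
  have \<rho>: "0 < \<rho>"
    using h by (simp add: \<rho>_def)
  define J where "J = (\<integral>t. exp (- (\<rho> / 2 * norm (t::'a))) \<partial>lborel)"
  have JI: "integrable lborel (\<lambda>t::'a. exp (- (\<rho> / 2 * norm t)))"
    using \<rho> by (intro integrable_exp_neg_norm) simp
  have J: "0 \<le> J"
    unfolding J_def by (rule Bochner_Integration.integral_nonneg) simp
  have main: "cmod (coef \<psi> g (x, \<xi>)) \<le> 8 * J * sem h g * sem h \<psi> * exp (- (1 / (4 * h * ?d) * norm (x, \<xi>)))"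
    if g: "g \<in> Sigma1" and \<psi>: "\<psi> \<in> Sigma1" for g \<psi> :: "'a \<Rightarrow> complex" and x \<xi>
  proof -
    let ?A = "cmod (coef \<psi> g (x, \<xi>))"
    define D where "D = 4 * sem h g * sem h \<psi> * exp (- (\<rho> / 2 * norm x)) * J"
    have D0: "0 \<le> D"
      using J unfolding D_def by simp
    have sg: "smooth g" and s\<psi>: "smooth \<psi>"
      using g \<psi> by (auto simp: Sigma1_def)
    have "\<bar>\<xi> \<bullet> b\<bar> ^ n * ?A \<le> D * (2 * h) ^ n * fact n" if b: "b \<in> Basis" for b n
    proof -
      define dg where "dg k = (partial1 b ^^ k) g" for k
      define d\<psi> where "d\<psi> k t = (partial1 b ^^ k) \<psi> (t - x)" for k t
      \<comment> \<open>By Leibniz, the derivative of order \<open>n\<close> in direction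
        \<open>b\<close> of \<open>g\<close> times the translated window.\<close>
      define F where "F n t = (\<Sum>k\<le>n. of_nat (n choose k) * (dg k t * d\<psi> (n - k) t))" for n t
      have cg: "continuous_on UNIV (dg k)" for k
        using smooth_continuous[OF sg, of "replicate k b"] b
        by (simp add: dg_def foldr_replicate_funpow set_replicate_conv_if)
      have "continuous_on UNIV ((partial1 b ^^ k) \<psi>)" for k
        using smooth_continuous[OF s\<psi>, of "replicate k b"] b
        by (simp add: foldr_replicate_funpow set_replicate_conv_if)
      then have c\<psi>: "continuous_on UNIV (d\<psi> k)" for k
        unfolding d\<psi>_def by (rule continuous_on_compose2) (auto intro!: continuous_intros)
      have cF: "continuous_on UNIV (F n)" for n
        unfolding F_def by (intro continuous_intros cg c\<psi>)
      have [measurable]: "F n \<in> borel_measurable borel" for n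
        by (rule borel_measurable_continuous_onI[OF cF])
      have F_bound: "cmod (F n t) \<le> 4 * sem h g * sem h \<psi> * exp (- (\<rho> / 2 * norm x)) * (h ^ n * fact (Suc n))
          * exp (- (\<rho> / 2 * norm t))" for n t
      proof -
        \<comment> \<open>Half of the rate \<open>\<rho>\<close> pays for decay in \<open>x\<close>
          by the triangle inequality, the other half keeps integrability in
          \<open>t\<close>.\<close>
        have e: "exp (- (\<rho> * norm t)) * exp (- (\<rho> * norm (t - x)))
            \<le> exp (- (\<rho> / 2 * norm x)) * exp (- (\<rho> / 2 * norm t))"
        proof -
          have "norm x \<le> norm t + norm (t - x)"
            using norm_triangle_ineq4[of t "t - x"] by simp
          then have "\<rho> / 2 * norm x \<le> \<rho> / 2 * (norm t + norm (t - x))"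
            using \<rho> by (intro mult_left_mono) auto
          moreover have "0 \<le> \<rho> / 2 * norm (t - x)"
            using \<rho> by simp
          ultimately show ?thesis
            by (simp add: exp_add[symmetric] algebra_simps)
        qed
        have "cmod (of_nat (n choose k) * (dg k t * d\<psi> (n - k) t))
          \<le> 4 * sem h g * sem h \<psi> * exp (- (\<rho> / 2 * norm x)) * exp (- (\<rho> / 2 * norm t)) * (h ^ n * fact n)"
          if k: "k \<le> n" for k
        proof -
          have 1: "cmod (dg k t) \<le> 2 * sem h g * h ^ k * fact k * exp (- (\<rho> * norm t))"
            unfolding dg_def \<rho>_def by (rule Sigma1_derivative_decay[OF g h b])
          have 2: "cmod (d\<psi> (n - k) t) \<le> 2 * sem h \<psi> * h ^ (n - k) * fact (n - k) * exp (- (\<rho> * norm (t - x)))"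
            unfolding d\<psi>_def \<rho>_def by (rule Sigma1_derivative_decay[OF \<psi> h b])
          have "cmod (dg k t) * cmod (d\<psi> (n - k) t)
            \<le> (2 * sem h g * h ^ k * fact k * exp (- (\<rho> * norm t)))
              * (2 * sem h \<psi> * h ^ (n - k) * fact (n - k) * exp (- (\<rho> * norm (t - x))))"
            using h by (intro mult_mono 1 2) auto
          also have "\<dots> = 4 * sem h g * sem h \<psi> * (h ^ k * h ^ (n - k)) * (fact k * fact (n - k))
              * (exp (- (\<rho> * norm t)) * exp (- (\<rho> * norm (t - x))))"
            by simp
          also have "h ^ k * h ^ (n - k) = h ^ n"
            using k by (simp flip: power_add)
          finally have "real (n choose k) * (cmod (dg k t) * cmod (d\<psi> (n - k) t))
            \<le> real (n choose k) * (4 * sem h g * sem h \<psi> * h ^ n * (fact k * fact (n - k))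
              * (exp (- (\<rho> * norm t)) * exp (- (\<rho> * norm (t - x)))))"
            by (intro mult_left_mono) auto
          also have "\<dots> = 4 * sem h g * sem h \<psi> * h ^ n * (fact k * fact (n - k) * real (n choose k))
              * (exp (- (\<rho> * norm t)) * exp (- (\<rho> * norm (t - x))))"
            by simp
          \<comment> \<open>The binomial coefficient cancels the two factorials, so all
            \<open>n + 1\<close> summands have the same bound; this is the origin of
            \<open>fact (Suc n)\<close>.\<close>
          also have "fact k * fact (n - k) * real (n choose k) = fact n"
            using binomial_fact_lemma[OF k] by (metis of_nat_fact of_nat_mult)
          also have "4 * sem h g * sem h \<psi> * h ^ n * fact n * (exp (- (\<rho> * norm t)) * exp (- (\<rho> * norm (t - x))))
            \<le> 4 * sem h g * sem h \<psi> * h ^ n * fact n * (exp (- (\<rho> / 2 * norm x)) * exp (- (\<rho> / 2 * norm t)))"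
            using h by (intro mult_left_mono e) auto
          finally show ?thesis
            by (simp add: norm_mult mult_ac)
        qed
        then have "cmod (F n t) \<le> (\<Sum>k\<le>n. 4 * sem h g * sem h \<psi> * exp (- (\<rho> / 2 * norm x))
            * exp (- (\<rho> / 2 * norm t)) * (h ^ n * fact n))"
          unfolding F_def by (intro sum_norm_le) auto
        then show ?thesis
          by (simp add: algebra_simps)
      qed
      have FI: "integrable lborel (F n)" for n
      proof (rule Bochner_Integration.integrable_bound)
        let ?c = "4 * sem h g * sem h \<psi> * exp (- (\<rho> / 2 * norm x)) * (h ^ n * fact (Suc n))"
        show "integrable lborel (\<lambda>t::'a. ?c * exp (- (\<rho> / 2 * norm t)))"
          by (rule integrable_mult_right[OF JI])
        show "AE t in lborel. cmod (F n t) \<le> norm (?c * exp (- (\<rho> / 2 * norm t)))"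
          using F_bound[of n] by (auto intro!: AE_I2 order_trans[OF _ abs_ge_self] simp del: fact_Suc)
      qed simp
      define I where "I n = (\<integral>t. F n t * cis (t \<bullet> \<xi>) \<partial>lborel)" for n
      have FcI: "integrable lborel (\<lambda>t. F n t * cis (t \<bullet> \<xi>))" for n
        by (rule Bochner_Integration.integrable_bound[OF FI[of n]]) (auto simp: norm_mult)
      \<comment> \<open>The integral of the directional derivative of
        \<open>F n t * cis (t \<bullet> \<xi>)\<close> is zero; differentiating the character
        produces the factor \<open>\<xi> \<bullet> b\<close>.\<close>
      have step: "I (Suc n) = - (\<i> * of_real (\<xi> \<bullet> b)) * I n" for n
      proof -
        let ?H' = "\<lambda>t. F (Suc n) t * cis (t \<bullet> \<xi>) + F n t * (\<i> * of_real (\<xi> \<bullet> b) * cis (t \<bullet> \<xi>))"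
        have dF: "((\<lambda>\<tau>. F n (y + \<tau> *\<^sub>R b)) has_vector_derivative F (Suc n) (y + t *\<^sub>R b)) (at t)" for y t
        proof -
          have a: "((\<lambda>\<tau>. dg k (y + \<tau> *\<^sub>R b)) has_vector_derivative dg (Suc k) (y + t *\<^sub>R b)) (at t)" for k
            unfolding dg_def by (rule smooth_line_derivative[OF sg b])
          have a': "((\<lambda>\<tau>. d\<psi> k (y + \<tau> *\<^sub>R b)) has_vector_derivative d\<psi> (Suc k) (y + t *\<^sub>R b)) (at t)" for k
            using smooth_line_derivative[OF s\<psi> b, of k "y - x" t]
            unfolding d\<psi>_def by (simp add: algebra_simps)
          show ?thesis
            unfolding F_def leibniz_sum[symmetric, where a="\<lambda>k. dg k (y + t *\<^sub>R b)" and c="\<lambda>k. d\<psi> k (y + t *\<^sub>R b)"]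
            by (intro has_vector_derivative_sum has_vector_derivative_mult_right)
              (auto intro!: derivative_eq_intros a a')
        qed
        have dc: "((\<lambda>\<tau>. cis ((y + \<tau> *\<^sub>R b) \<bullet> \<xi>)) has_vector_derivative
            \<i> * of_real (\<xi> \<bullet> b) * cis ((y + t *\<^sub>R b) \<bullet> \<xi>)) (at t)" for y t
        proof -
          have "((\<lambda>z. exp (\<i> * of_real (y \<bullet> \<xi>) + \<i> * of_real (b \<bullet> \<xi>) * z)) has_field_derivative
              \<i> * of_real (\<xi> \<bullet> b) * exp (\<i> * of_real (y \<bullet> \<xi>) + \<i> * of_real (b \<bullet> \<xi>) * of_real t)) (at (of_real t))"
            by (auto intro!: derivative_eq_intros simp: inner_commute)
          from has_vector_derivative_real_field[OF this] show ?thesis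
            by (simp add: cis_conv_exp inner_add_left distrib_left mult_ac)
        qed
        have "integral\<^sup>L lborel ?H' = 0"
        proof (rule integral_directional_derivative[OF FcI[of n], where b=b])
          show "integrable lborel ?H'"
            using FcI[of "Suc n"] integrable_mult_right[OF FcI[of n], of "\<i> * of_real (\<xi> \<bullet> b)"]
            by (simp add: mult_ac)
          show "continuous_on UNIV ?H'"
            unfolding cis_conv_exp by (intro continuous_intros cF)
          show "((\<lambda>\<tau>. F n (y + \<tau> *\<^sub>R b) * cis ((y + \<tau> *\<^sub>R b) \<bullet> \<xi>)) has_vector_derivative ?H' (y + t *\<^sub>R b)) (at t)" for y t
            using has_vector_derivative_mult[OF dF[of y t] dc[of y t]] by (simp add: add.commute)
        qed
        moreover have "integral\<^sup>L lborel ?H' = I (Suc n) + \<i> * of_real (\<xi> \<bullet> b) * I n"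
        proof -
          have "integral\<^sup>L lborel ?H' = I (Suc n) + (\<integral>t. F n t * (\<i> * of_real (\<xi> \<bullet> b) * cis (t \<bullet> \<xi>)) \<partial>lborel)"
            unfolding I_def using FcI[of "Suc n"] integrable_mult_right[OF FcI[of n], of "\<i> * of_real (\<xi> \<bullet> b)"]
            by (intro Bochner_Integration.integral_add) (simp_all add: mult_ac)
          also have "(\<integral>t. F n t * (\<i> * of_real (\<xi> \<bullet> b) * cis (t \<bullet> \<xi>)) \<partial>lborel)
            = (\<integral>t. \<i> * of_real (\<xi> \<bullet> b) * (F n t * cis (t \<bullet> \<xi>)) \<partial>lborel)"
            by (simp add: mult_ac)
          also have "\<dots> = \<i> * of_real (\<xi> \<bullet> b) * I n"
            unfolding I_def by (rule integral_mult_right_zero)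
          finally show ?thesis .
        qed
        ultimately show ?thesis
          by (simp add: add_eq_0_iff2)
      qed
      have "cmod (I n) = \<bar>\<xi> \<bullet> b\<bar> ^ n * ?A" for n
      proof (induction n)
        case 0
        show ?case by (simp add: I_def F_def dg_def d\<psi>_def coef_def)
      next
        case (Suc n)
        then show ?case by (simp add: step norm_mult)
      qed
      then have "\<bar>\<xi> \<bullet> b\<bar> ^ n * ?A = cmod (I n)" by simp
      also have "\<dots> \<le> (\<integral>t. cmod (F n t * cis (t \<bullet> \<xi>)) \<partial>lborel)"
        unfolding I_def by (rule Bochner_Integration.integral_norm_bound)
      also have "\<dots> \<le> (\<integral>t. 4 * sem h g * sem h \<psi> * exp (- (\<rho> / 2 * norm x)) * (h ^ n * fact (Suc n))
          * exp (- (\<rho> / 2 * norm (t::'a))) \<partial>lborel)"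
      proof (rule Bochner_Integration.integral_mono)
        show "integrable lborel (\<lambda>t. cmod (F n t * cis (t \<bullet> \<xi>)))"
          using FcI by (rule integrable_norm)
        show "integrable lborel (\<lambda>t::'a. 4 * sem h g * sem h \<psi> * exp (- (\<rho> / 2 * norm x)) * (h ^ n * fact (Suc n))
          * exp (- (\<rho> / 2 * norm t)))"
          by (rule integrable_mult_right[OF JI])
      qed (use F_bound in \<open>simp add: norm_mult del: fact_Suc\<close>)
      also have "\<dots> = D * (h ^ n * fact (Suc n))"
        unfolding D_def J_def by (subst integral_mult_right_zero) (simp del: fact_Suc)
      also have "\<dots> = D * h ^ n * fact n * real (Suc n)"
        by simp
      \<comment> \<open>The surplus factor \<open>n + 1\<close> is absorbed by doubling
        \<open>h\<close>. This is why the rate in frequency has 4 where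
        \<open>Sigma1_derivative_decay\<close> has 2; in position the halving of
        \<open>\<rho>\<close> has the same effect.\<close>
      also have "\<dots> \<le> D * h ^ n * fact n * 2 ^ n"
      proof (rule mult_left_mono)
        have "real (Suc n) \<le> real (2 ^ n)"
          using Suc_leI[OF less_exp[of n]] by (simp only: of_nat_le_iff)
        then show "real (Suc n) \<le> 2 ^ n"
          by simp
      qed (use D0 h in simp)
      also have "\<dots> = D * (2 * h) ^ n * fact n"
        by (simp only: power_mult_distrib mult_ac)
      finally show ?thesis .
    qed
    then have "?A * exp (\<bar>\<xi> \<bullet> b\<bar> / (2 * (2 * h))) \<le> 2 * D" if "b \<in> Basis" for b
      using h that by (intro exp_bound_from_moments) auto
    then have "?A * exp (norm \<xi> * (1 / (2 * (2 * h)) / ?d)) \<le> 2 * D"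
      using h by (intro exp_norm_bound_from_coordinates) auto
    then have "?A * exp (norm \<xi> * (1 / (2 * (2 * h)) / ?d)) * exp (- (\<rho> / 2 * norm \<xi>)) \<le> 2 * D * exp (- (\<rho> / 2 * norm \<xi>))"
      by (intro mult_right_mono) auto
    then have "?A \<le> 2 * D * exp (- (\<rho> / 2 * norm \<xi>))"
      by (simp add: mult.assoc exp_add[symmetric] \<rho>_def)
    also have "\<dots> = 8 * J * sem h g * sem h \<psi> * exp (- (\<rho> / 2 * (norm x + norm \<xi>)))"
      by (simp add: D_def exp_add[symmetric] algebra_simps)
    also have "\<dots> \<le> 8 * J * sem h g * sem h \<psi> * exp (- (\<rho> / 2 * norm (x, \<xi>)))"
      using J \<rho> norm_Pair_le[of x \<xi>] by (intro mult_left_mono) auto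
    finally show ?thesis
      by (simp add: \<rho>_def mult.assoc)
  qed
  show ?thesis
    using main J by (intro exI[of _ "8 * J"]) auto
qed

lemma rapid_coef:
  fixes \<psi> g :: "'a::euclidean_space \<Rightarrow> complex"
  assumes "g \<in> Sigma1" "\<psi> \<in> Sigma1"
  shows "rapid (coef \<psi> g)"
proof (rule rapidI)
  fix N :: real assume "0 < N"
  let ?h = "1 / (4 * N * DIM('a))"
  have "0 < ?h" using \<open>0 < N\<close> by simp
  from coef_decay[OF this, where 'a='a] assms obtain K where
    "\<And>X. cmod (coef \<psi> g X) \<le> K * sem ?h g * sem ?h \<psi> * exp (- (1 / (4 * ?h * DIM('a)) * norm X))"
    by blast
  then show "\<exists>C. \<forall>X. cmod (coef \<psi> g X) \<le> C * exp (- (N * norm X))"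
    using \<open>0 < N\<close> by (intro exI[of _ "K * sem ?h g * sem ?h \<psi>"]) simp
qed

subsection \<open>Gaussian atoms\<close>

text \<open>One coordinate of a Gaussian atom, extended to an entire function of \<open>z\<close> so
  that its derivatives can be bounded by Cauchy's inequality.\<close>

definition atom1 :: "real \<Rightarrow> real \<Rightarrow> complex \<Rightarrow> complex" where
  "atom1 x \<xi> z = exp (- (z - of_real x)\<^sup>2 / 2 - \<i> * z * of_real \<xi>)"

lemma atom1_holomorphic: "atom1 x \<xi> holomorphic_on S"
  unfolding atom1_def by (intro holomorphic_intros) auto

lemma cmod_atom1: "cmod (atom1 x \<xi> z) = exp (((Im z)\<^sup>2 - (Re z - x)\<^sup>2) / 2 + \<xi> * Im z)"
  unfolding atom1_def norm_exp_eq_Re by (simp add: power2_eq_square algebra_simps)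

text \<open>On a square of half-width \<open>r\<close> around a real point \<open>s\<close> the
  Gaussian decay is traded for the exponential rate \<open>R\<close>, by
  \<open>R |a| <= a^2 / 2 + R^2 / 2\<close>. The price is exponential growth in the parameters
  \<open>x\<close> and \<open>\<xi>\<close>.\<close>

lemma atom1_bound:
  assumes "\<bar>Re z - s\<bar> \<le> r" "\<bar>Im z\<bar> \<le> r" "0 \<le> R"
  shows "cmod (atom1 x \<xi> z) \<le> exp (r\<^sup>2 / 2 + r * \<bar>\<xi>\<bar> + R\<^sup>2 / 2 + R * \<bar>x\<bar> + R * r - R * \<bar>s\<bar>)"
proof -
  define a where "a = Re z - x"
  have r: "0 \<le> r" using assms by linarith
  have 1: "(Im z)\<^sup>2 \<le> r\<^sup>2"
    using assms(2) r by (metis abs_le_square_iff abs_of_nonneg)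
  have 2: "\<xi> * Im z \<le> r * \<bar>\<xi>\<bar>"
    using abs_ge_self[of "\<xi> * Im z"] mult_right_mono[OF assms(2), of "\<bar>\<xi>\<bar>"] by (simp add: abs_mult mult.commute)
  have "\<bar>s\<bar> \<le> \<bar>a\<bar> + \<bar>x\<bar> + r"
    using assms(1) unfolding a_def by linarith
  then have 3: "R * \<bar>s\<bar> \<le> R * (\<bar>a\<bar> + \<bar>x\<bar> + r)"
    using assms(3) by (intro mult_left_mono) auto
  have 4: "R * \<bar>a\<bar> \<le> a\<^sup>2 / 2 + R\<^sup>2 / 2"
    using sum_squares_ge_zero[of "R - \<bar>a\<bar>" 0] by (simp add: power2_eq_square algebra_simps)
  show ?thesis
    unfolding cmod_atom1 exp_le_cancel_iff a_def[symmetric]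
    using 1 2 3 4 by (simp add: field_simps)
qed

text \<open>Mean value inequality on the half-plane bounded by the larger real part, which is convex
  and on which the derivative is at most the larger of the two moduli.\<close>

lemma cmod_exp_diff_le: "cmod (exp u - exp v) \<le> (cmod (exp u) + cmod (exp v)) * cmod (u - v)"
proof -
  let ?S = "{z. Re z \<le> max (Re u) (Re v)}"
  have "cmod (exp u - exp v) \<le> exp (max (Re u) (Re v)) * cmod (u - v)"
  proof (rule field_differentiable_bound[where S="?S" and f'=exp])
    show "(exp has_field_derivative exp z) (at z within ?S)" for z :: complex
      by (auto intro!: derivative_eq_intros)
    show "cmod (exp z) \<le> exp (max (Re u) (Re v))" if "z \<in> ?S" for z
      using that by (simp add: norm_exp_eq_Re)
  qed (auto simp: convex_halfspace_Re_le)
  also have "\<dots> \<le> (cmod (exp u) + cmod (exp v)) * cmod (u - v)"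
    by (intro mult_right_mono) (auto simp: norm_exp_eq_Re max_def)
  finally show ?thesis .
qed

lemma exp_mult_le: "0 \<le> (x::real) \<Longrightarrow> x * exp y \<le> exp (x + y)"
  using order_trans[OF _ exp_ge_add_one_self[of x], of x] by (simp add: exp_add)

text \<open>The exponents differ by the parameter differences times a factor growing linearly in
  \<open>s\<close> and the parameters. Each atom is bounded with rate \<open>R + 1\<close>, and the
  extra unit of rate absorbs that linear factor through \<open>exp_mult_le\<close>.\<close>

lemma atom1_diff:
  assumes z: "\<bar>Re z - s\<bar> \<le> r" "\<bar>Im z\<bar> \<le> r" and R: "0 \<le> R"
  shows "cmod (atom1 x \<xi> z - atom1 x' \<xi>' z) \<le>
    2 * exp (r\<^sup>2 / 2 + (R + 1)\<^sup>2 / 2 + (R + 1) * r + 2 * r) *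
      exp ((r + R + 2) * (\<bar>x\<bar> + \<bar>\<xi>\<bar> + \<bar>x'\<bar> + \<bar>\<xi>'\<bar>)) * exp (- (R * \<bar>s\<bar>)) * (\<bar>x - x'\<bar> + \<bar>\<xi> - \<xi>'\<bar>)"
proof -
  define d where "d = \<bar>x - x'\<bar> + \<bar>\<xi> - \<xi>'\<bar>"
  define T where "T = \<bar>x\<bar> + \<bar>\<xi>\<bar> + \<bar>x'\<bar> + \<bar>\<xi>'\<bar>"
  define E where "E = exp (r\<^sup>2 / 2 + (R + 1)\<^sup>2 / 2 + (R + 1) * r + (r + R + 1) * T - (R + 1) * \<bar>s\<bar>)"
  let ?u = "- (z - of_real x)\<^sup>2 / 2 - \<i> * z * of_real \<xi>" and ?v = "- (z - of_real x')\<^sup>2 / 2 - \<i> * z * of_real \<xi>'"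
  have r: "0 \<le> r" using z by linarith
  have T: "0 \<le> T" "\<bar>x\<bar> \<le> T" "\<bar>\<xi>\<bar> \<le> T" "\<bar>x'\<bar> \<le> T" "\<bar>\<xi>'\<bar> \<le> T" "\<bar>x\<bar> + \<bar>x'\<bar> \<le> T"
    unfolding T_def by auto
  have b: "cmod (atom1 y \<eta> z) \<le> E" if "\<bar>y\<bar> \<le> T" "\<bar>\<eta>\<bar> \<le> T" for y \<eta>
  proof -
    have "r * \<bar>\<eta>\<bar> \<le> r * T" "(R + 1) * \<bar>y\<bar> \<le> (R + 1) * T"
      using that r R by (intro mult_left_mono; simp)+
    then have "exp (r\<^sup>2 / 2 + r * \<bar>\<eta>\<bar> + (R + 1)\<^sup>2 / 2 + (R + 1) * \<bar>y\<bar> + (R + 1) * r - (R + 1) * \<bar>s\<bar>) \<le> E"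
      unfolding E_def by (simp add: algebra_simps)
    moreover have "0 \<le> R + 1" using R by simp
    ultimately show ?thesis
      using atom1_bound[OF z, of "R + 1" y \<eta>] by linarith
  qed
  have zb: "cmod z \<le> \<bar>s\<bar> + 2 * r"
    using cmod_le[of z] z by linarith
  have "?u - ?v = of_real (x - x') * (z - of_real ((x + x') / 2)) - \<i> * z * of_real (\<xi> - \<xi>')"
    by (simp add: power2_eq_square field_simps)
  then have "cmod (?u - ?v) \<le> cmod (of_real (x - x') * (z - of_real ((x + x') / 2))) + cmod (\<i> * z * of_real (\<xi> - \<xi>'))"
    by (simp only: norm_triangle_ineq4)
  also have "\<dots> = \<bar>x - x'\<bar> * cmod (z - of_real ((x + x') / 2)) + cmod z * \<bar>\<xi> - \<xi>'\<bar>"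
    by (simp only: norm_mult norm_of_real norm_ii mult_1)
  also have "\<dots> \<le> \<bar>x - x'\<bar> * (\<bar>s\<bar> + 2 * r + T) + (\<bar>s\<bar> + 2 * r + T) * \<bar>\<xi> - \<xi>'\<bar>"
  proof (intro add_mono mult_left_mono mult_right_mono)
    have "cmod (z - of_real ((x + x') / 2)) \<le> cmod z + \<bar>(x + x') / 2\<bar>"
      using norm_triangle_ineq4[of z "of_real ((x + x') / 2)"] by (simp only: norm_of_real)
    moreover have "\<bar>(x + x') / 2\<bar> \<le> T"
      using T(1,6) abs_triangle_ineq[of x x'] by simp
    ultimately show "cmod (z - of_real ((x + x') / 2)) \<le> \<bar>s\<bar> + 2 * r + T"
      using zb by linarith
    show "cmod z \<le> \<bar>s\<bar> + 2 * r + T"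
      using zb T by linarith
  qed auto
  also have "\<dots> = (\<bar>s\<bar> + 2 * r + T) * d"
    by (simp add: d_def algebra_simps)
  finally have uv: "cmod (?u - ?v) \<le> (\<bar>s\<bar> + 2 * r + T) * d" .
  have d: "0 \<le> d" by (simp add: d_def)
  have "cmod (atom1 x \<xi> z - atom1 x' \<xi>' z) \<le> (cmod (atom1 x \<xi> z) + cmod (atom1 x' \<xi>' z)) * cmod (?u - ?v)"
    unfolding atom1_def by (rule cmod_exp_diff_le)
  also have "\<dots> \<le> (E + E) * ((\<bar>s\<bar> + 2 * r + T) * d)"
    by (intro mult_mono add_mono b T uv) (auto simp: E_def)
  also have "\<dots> = 2 * ((\<bar>s\<bar> + 2 * r + T) * E) * d"
    by simp
  also have "\<dots> \<le> 2 * exp (\<bar>s\<bar> + 2 * r + T + (r\<^sup>2 / 2 + (R + 1)\<^sup>2 / 2 + (R + 1) * r + (r + R + 1) * T - (R + 1) * \<bar>s\<bar>)) * d"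
    unfolding E_def using d r T by (intro mult_right_mono mult_left_mono exp_mult_le) auto
  also have "\<bar>s\<bar> + 2 * r + T + (r\<^sup>2 / 2 + (R + 1)\<^sup>2 / 2 + (R + 1) * r + (r + R + 1) * T - (R + 1) * \<bar>s\<bar>)
     = (r\<^sup>2 / 2 + (R + 1)\<^sup>2 / 2 + (R + 1) * r + 2 * r) + (r + R + 2) * T + (- (R * \<bar>s\<bar>))"
    by (simp add: algebra_simps)
  finally show ?thesis
    unfolding exp_add d_def[symmetric] T_def[symmetric] by (simp add: mult.assoc)
qed

text \<open>A single term of the exponential series of \<open>\<bar>s\<bar> / h\<close> is at most
  the whole series.\<close>

lemma power_mult_exp_neg_le:
  fixes h s :: real
  assumes "0 < h"
  shows "\<bar>s\<bar> ^ m * exp (- (1 / h * \<bar>s\<bar>)) \<le> h ^ m * fact m"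
proof -
  have "(\<bar>s\<bar> / h) ^ m / fact m \<le> exp (\<bar>s\<bar> / h)"
  proof -
    have "(\<Sum>n\<in>{m}. (\<bar>s\<bar> / h) ^ n /\<^sub>R fact n) \<le> (\<Sum>n. (\<bar>s\<bar> / h) ^ n /\<^sub>R fact n)"
      using assms by (intro sum_le_suminf summable_exp_generic) auto
    then show ?thesis
      by (simp add: exp_def divide_inverse mult.commute)
  qed
  then have "(\<bar>s\<bar> / h) ^ m / fact m * exp (- (\<bar>s\<bar> / h)) \<le> exp (\<bar>s\<bar> / h) * exp (- (\<bar>s\<bar> / h))"
    by (intro mult_right_mono) auto
  then show ?thesis
    using assms by (simp add: exp_add[symmetric] power_divide field_simps)
qed

text \<open>Cauchy's estimates on a disc of radius \<open>1 / h\<close> control all derivatives of a Gaussian atom.\<close>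

lemma atom1_deriv_bounds:
  assumes h: "0 < h"
  shows "\<exists>C\<ge>1. \<exists>c\<ge>0. \<forall>x \<xi> s m n. \<bar>s\<bar> ^ m * cmod ((deriv ^^ n) (atom1 x \<xi>) (of_real s))
      \<le> h ^ m * h ^ n * fact m * fact n * (C * exp (c * (\<bar>x\<bar> + \<bar>\<xi>\<bar>)))
    \<and> (\<forall>x' \<xi>'. \<bar>s\<bar> ^ m * cmod ((deriv ^^ n) (atom1 x \<xi>) (of_real s) - (deriv ^^ n) (atom1 x' \<xi>') (of_real s))
      \<le> h ^ m * h ^ n * fact m * fact n * (C * exp (c * (\<bar>x\<bar> + \<bar>\<xi>\<bar> + \<bar>x'\<bar> + \<bar>\<xi>'\<bar>)) * (\<bar>x - x'\<bar> + \<bar>\<xi> - \<xi>'\<bar>)))"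
proof -
  \<comment> \<open>The radius turns \<open>1 / r ^ n\<close> of Cauchy's inequality into
    \<open>h ^ n\<close>. The same number serves as decay rate in \<open>s\<close>, so that the
    power \<open>m\<close> of \<open>s\<close> costs \<open>h ^ m * fact m\<close>.\<close>
  define r where "r = 1 / h"
  have r: "0 < r" using h by (simp add: r_def)
  define C where "C = 2 * exp (r\<^sup>2 / 2 + (r + 1)\<^sup>2 / 2 + (r + 1) * r + 2 * r)"
  define c where "c = r + r + 2"
  have C: "1 \<le> C"
  proof -
    have "1 \<le> exp (r\<^sup>2 / 2 + (r + 1)\<^sup>2 / 2 + (r + 1) * r + 2 * r)"
      using r by simp
    then show ?thesis unfolding C_def by linarith
  qed
  have c: "0 \<le> c" using r by (simp add: c_def)
  have circle: "\<bar>Re z - s\<bar> \<le> r" "\<bar>Im z\<bar> \<le> r" if "norm (of_real s - z) = r" for z s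
    using that abs_Re_le_cmod[of "of_real s - z"] abs_Im_le_cmod[of "of_real s - z"] by auto
  have cauchy: "\<bar>s\<bar> ^ m * cmod ((deriv ^^ n) f (of_real s)) \<le> h ^ m * h ^ n * fact m * fact n * A"
    if f: "f holomorphic_on UNIV" and A: "0 \<le> A"
      and b: "\<And>z. \<bar>Re z - s\<bar> \<le> r \<Longrightarrow> \<bar>Im z\<bar> \<le> r \<Longrightarrow> cmod (f z) \<le> A * exp (- (r * \<bar>s\<bar>))" for f s m n A
  proof -
    have "cmod ((deriv ^^ n) f (of_real s)) \<le> fact n * (A * exp (- (r * \<bar>s\<bar>))) / r ^ n"
    proof (rule Cauchy_inequality)
      show "f holomorphic_on ball (of_real s) r"
        by (rule holomorphic_on_subset[OF f]) simp
      show "continuous_on (cball (of_real s) r) f"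
        using holomorphic_on_imp_continuous_on[OF f] continuous_on_subset by blast
    qed (use r b circle in auto)
    also have "\<dots> = h ^ n * fact n * A * exp (- (r * \<bar>s\<bar>))"
      using h by (simp add: r_def power_divide)
    finally have "\<bar>s\<bar> ^ m * cmod ((deriv ^^ n) f (of_real s)) \<le> \<bar>s\<bar> ^ m * (h ^ n * fact n * A * exp (- (r * \<bar>s\<bar>)))"
      by (intro mult_left_mono) auto
    also have "\<dots> = (\<bar>s\<bar> ^ m * exp (- (1 / h * \<bar>s\<bar>))) * (h ^ n * fact n * A)"
      by (simp add: r_def)
    also have "\<dots> \<le> (h ^ m * fact m) * (h ^ n * fact n * A)"
      using A h by (intro mult_right_mono power_mult_exp_neg_le) auto
    finally show ?thesis
      by (simp add: mult_ac)
  qed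
  have 1: "\<bar>s\<bar> ^ m * cmod ((deriv ^^ n) (atom1 x \<xi>) (of_real s))
      \<le> h ^ m * h ^ n * fact m * fact n * (C * exp (c * (\<bar>x\<bar> + \<bar>\<xi>\<bar>)))" for x \<xi> s m n
  proof (rule cauchy[OF atom1_holomorphic])
    fix z assume z: "\<bar>Re z - s\<bar> \<le> r" "\<bar>Im z\<bar> \<le> r"
    have "cmod (atom1 x \<xi> z) \<le> exp (r\<^sup>2 / 2 + r * \<bar>\<xi>\<bar> + r\<^sup>2 / 2 + r * \<bar>x\<bar> + r * r - r * \<bar>s\<bar>)"
      using atom1_bound[OF z, of r x \<xi>] r by simp
    also have "\<dots> \<le> exp ((r\<^sup>2 / 2 + (r + 1)\<^sup>2 / 2 + (r + 1) * r + 2 * r) + c * (\<bar>x\<bar> + \<bar>\<xi>\<bar>) + (- (r * \<bar>s\<bar>)))"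
    proof -
      have "r * (\<bar>x\<bar> + \<bar>\<xi>\<bar>) \<le> c * (\<bar>x\<bar> + \<bar>\<xi>\<bar>)"
        using r by (intro mult_right_mono) (auto simp: c_def)
      moreover have e: "r * (\<bar>x\<bar> + \<bar>\<xi>\<bar>) = r * \<bar>x\<bar> + r * \<bar>\<xi>\<bar>" "(r + 1)\<^sup>2 = r\<^sup>2 + 2 * r + 1"
        "(r + 1) * r = r\<^sup>2 + r" "r * r = r\<^sup>2"
        by (simp_all add: power2_eq_square algebra_simps)
      ultimately have "r * \<bar>x\<bar> + r * \<bar>\<xi>\<bar> \<le> c * (\<bar>x\<bar> + \<bar>\<xi>\<bar>)"
        by simp
      moreover have "q / 2 + u + q / 2 + v + q - w \<le> q / 2 + (q + 2 * r + 1) / 2 + (q + r) + 2 * r + y + - w"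
        if "v + u \<le> y" for q u v w y :: real
        using that r by (simp add: field_simps)
      ultimately show ?thesis
        unfolding exp_le_cancel_iff e by blast
    qed
    also have "\<dots> \<le> C * exp (c * (\<bar>x\<bar> + \<bar>\<xi>\<bar>)) * exp (- (r * \<bar>s\<bar>))"
      unfolding exp_add C_def by (intro mult_right_mono) auto
    finally show "cmod (atom1 x \<xi> z) \<le> C * exp (c * (\<bar>x\<bar> + \<bar>\<xi>\<bar>)) * exp (- (r * \<bar>s\<bar>))" .
  qed (use C in simp)
  have 2: "\<bar>s\<bar> ^ m * cmod ((deriv ^^ n) (atom1 x \<xi>) (of_real s) - (deriv ^^ n) (atom1 x' \<xi>') (of_real s))
      \<le> h ^ m * h ^ n * fact m * fact n * (C * exp (c * (\<bar>x\<bar> + \<bar>\<xi>\<bar> + \<bar>x'\<bar> + \<bar>\<xi>'\<bar>)) * (\<bar>x - x'\<bar> + \<bar>\<xi> - \<xi>'\<bar>))" for x \<xi> s m n x' \<xi>'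
  proof -
    have "(deriv ^^ n) (\<lambda>z. atom1 x \<xi> z - atom1 x' \<xi>' z) (of_real s)
      = (deriv ^^ n) (atom1 x \<xi>) (of_real s) - (deriv ^^ n) (atom1 x' \<xi>') (of_real s)"
      by (rule higher_deriv_diff[of _ UNIV]) (auto simp: atom1_holomorphic)
    moreover have "\<bar>s\<bar> ^ m * cmod ((deriv ^^ n) (\<lambda>z. atom1 x \<xi> z - atom1 x' \<xi>' z) (of_real s))
      \<le> h ^ m * h ^ n * fact m * fact n * (C * exp (c * (\<bar>x\<bar> + \<bar>\<xi>\<bar> + \<bar>x'\<bar> + \<bar>\<xi>'\<bar>)) * (\<bar>x - x'\<bar> + \<bar>\<xi> - \<xi>'\<bar>))"
    proof (rule cauchy)
      show "(\<lambda>z. atom1 x \<xi> z - atom1 x' \<xi>' z) holomorphic_on UNIV"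
        by (intro holomorphic_intros atom1_holomorphic)
      fix z assume z: "\<bar>Re z - s\<bar> \<le> r" "\<bar>Im z\<bar> \<le> r"
      show "cmod (atom1 x \<xi> z - atom1 x' \<xi>' z)
        \<le> C * exp (c * (\<bar>x\<bar> + \<bar>\<xi>\<bar> + \<bar>x'\<bar> + \<bar>\<xi>'\<bar>)) * (\<bar>x - x'\<bar> + \<bar>\<xi> - \<xi>'\<bar>) * exp (- (r * \<bar>s\<bar>))"
        using atom1_diff[OF z, of r x \<xi> x' \<xi>'] r unfolding C_def c_def by (simp add: mult_ac)
    qed (use C in simp)
    ultimately show ?thesis by simp
  qed
  show ?thesis
    using C c 1 2 by blast
qed

lemma atom1_deriv_step:
  "((\<lambda>t. (deriv ^^ n) (atom1 x \<xi>) (of_real t)) has_vector_derivative (deriv ^^ Suc n) (atom1 x \<xi>) (of_real t)) (at t)"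
proof -
  have "(deriv ^^ n) (atom1 x \<xi>) holomorphic_on UNIV"
    by (rule holomorphic_higher_deriv) (auto simp: atom1_holomorphic)
  then have "((deriv ^^ n) (atom1 x \<xi>) has_field_derivative deriv ((deriv ^^ n) (atom1 x \<xi>)) (of_real t)) (at (of_real t))"
    by (rule holomorphic_derivI) auto
  from has_vector_derivative_real_field[OF this] show ?thesis by simp
qed

text \<open>The partial derivative of order \<open>k\<close> of the Gaussian atom at
  \<open>Y\<close>, written as a product of one-variable complex derivatives; as a family in
  \<open>k\<close> it is a \<open>tower\<close>.\<close>

definition gatom :: "('a::euclidean_space \<Rightarrow> nat) \<Rightarrow> 'a \<times> 'a \<Rightarrow> 'a \<Rightarrow> complex" where
  "gatom k Y s = (\<Prod>b\<in>Basis. (deriv ^^ k b) (atom1 (fst Y \<bullet> b) (snd Y \<bullet> b)) (of_real (s \<bullet> b)))"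

lemma cnj_gauss [simp]: "cnj (gauss s) = gauss s"
  by (simp add: gauss_def)

lemma gabor_gauss_eq_gatom: "gabor gauss Y = gatom (\<lambda>_. 0) Y"
proof
  fix s
  have "cis (- (s \<bullet> snd Y)) = (\<Prod>b\<in>Basis. cis (- ((s \<bullet> b) * (snd Y \<bullet> b))))"
    using cis_inner_prod[of "- s" "snd Y"] by simp
  then have "gabor gauss Y s = (\<Prod>b\<in>Basis. gauss ((s - fst Y) \<bullet> b) * cis (- ((s \<bullet> b) * (snd Y \<bullet> b))))"
    unfolding gabor_def cnj_gauss gauss_prod[of "s - fst Y"] by (simp add: prod.distrib)
  also have "\<dots> = gatom (\<lambda>_. 0) Y s"
    unfolding gatom_def
  proof (intro prod.cong refl)
    fix b
    let ?a = "s \<bullet> b" and ?x = "fst Y \<bullet> b" and ?y = "snd Y \<bullet> b"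
    have "gauss (?a - ?x) = exp (- (complex_of_real ?a - of_real ?x)\<^sup>2 / 2)"
      unfolding gauss_def exp_of_real[symmetric] by simp
    then show "gauss ((s - fst Y) \<bullet> b) * cis (- (?a * ?y)) = (deriv ^^ 0) (atom1 ?x ?y) (of_real ?a)"
      by (simp add: inner_diff_left atom1_def cis_conv_exp exp_add[symmetric] mult.assoc)
  qed
  finally show "gabor gauss Y s = gatom (\<lambda>_. 0) Y s" .
qed

lemma gatom_has_derivative:
  fixes s :: "'a::euclidean_space"
  shows "(gatom k Y has_derivative (\<lambda>v. \<Sum>b\<in>Basis. (v \<bullet> b) *\<^sub>R gatom (k(b := Suc (k b))) Y s)) (at s)"
proof -
  let ?D = "\<lambda>n b t. (deriv ^^ n) (atom1 (fst Y \<bullet> b) (snd Y \<bullet> b)) (of_real t)"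
  have d: "((\<lambda>s. ?D (k b) b (s \<bullet> b)) has_derivative (\<lambda>v. (v \<bullet> b) *\<^sub>R ?D (Suc (k b)) b (s \<bullet> b))) (at s)" for b
  proof -
    have "((\<lambda>s. s \<bullet> b) has_derivative (\<lambda>v. v \<bullet> b)) (at s)"
      by (auto intro!: derivative_eq_intros)
    from has_derivative_compose[OF this atom1_deriv_step[unfolded has_vector_derivative_def]]
    show ?thesis .
  qed
  have "(gatom k Y has_derivative
      (\<lambda>v. \<Sum>b\<in>Basis. (v \<bullet> b) *\<^sub>R ?D (Suc (k b)) b (s \<bullet> b) * (\<Prod>c\<in>Basis - {b}. ?D (k c) c (s \<bullet> c)))) (at s)"
    unfolding gatom_def by (rule has_derivative_prod) (use d in auto)
  moreover have "?D (Suc (k b)) b (s \<bullet> b) * (\<Prod>c\<in>Basis - {b}. ?D (k c) c (s \<bullet> c))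
      = gatom (k(b := Suc (k b))) Y s" if b: "b \<in> Basis" for b
  proof -
    have "gatom (k(b := Suc (k b))) Y s
      = ?D (Suc (k b)) b (s \<bullet> b) * (\<Prod>c\<in>Basis - {b}. ?D ((k(b := Suc (k b))) c) c (s \<bullet> c))"
      unfolding gatom_def by (subst prod.remove[OF finite_Basis b]) simp
    also have "(\<Prod>c\<in>Basis - {b}. ?D ((k(b := Suc (k b))) c) c (s \<bullet> c)) = (\<Prod>c\<in>Basis - {b}. ?D (k c) c (s \<bullet> c))"
      by (intro prod.cong) auto
    finally show ?thesis by (rule sym)
  qed
  ultimately show ?thesis
    by (simp only: mult_scaleR_left cong: sum.cong)
qed

text \<open>The one-coordinate estimates multiply. After division by the weights of the seminorm
  both bounds are uniform in all moments and derivatives and depend on the centres only; the second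
  one makes the atoms Lipschitz in their centre, in every seminorm.\<close>

lemma gatom_bounds:
  assumes h: "0 < h"
  shows "\<exists>C\<ge>0. \<exists>c\<ge>0. \<forall>Y \<alpha> k s. cmod (mi_power s \<alpha> * gatom k Y s)
        \<le> h ^ (mi_abs \<alpha> + mi_abs k) * mi_fact \<alpha> * mi_fact k * (C * exp (c * norm Y))
    \<and> (\<forall>Y'. cmod (mi_power s \<alpha> * (gatom k Y s - gatom k (Y'::'a::euclidean_space \<times> 'a) s))
        \<le> h ^ (mi_abs \<alpha> + mi_abs k) * mi_fact \<alpha> * mi_fact k * (C * norm (Y - Y') * exp (c * (norm Y + norm Y'))))"
proof -
  let ?d = "DIM('a)"
  obtain C c where C: "1 \<le> C" and c: "0 \<le> c"
    and b1: "\<And>x \<xi> s m n. \<bar>s\<bar> ^ m * cmod ((deriv ^^ n) (atom1 x \<xi>) (of_real s))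
      \<le> h ^ m * h ^ n * fact m * fact n * (C * exp (c * (\<bar>x\<bar> + \<bar>\<xi>\<bar>)))"
    and b2: "\<And>x \<xi> s m n x' \<xi>'. \<bar>s\<bar> ^ m * cmod ((deriv ^^ n) (atom1 x \<xi>) (of_real s) - (deriv ^^ n) (atom1 x' \<xi>') (of_real s))
      \<le> h ^ m * h ^ n * fact m * fact n * (C * exp (c * (\<bar>x\<bar> + \<bar>\<xi>\<bar> + \<bar>x'\<bar> + \<bar>\<xi>'\<bar>)) * (\<bar>x - x'\<bar> + \<bar>\<xi> - \<xi>'\<bar>))"
    using atom1_deriv_bounds[OF h] by metis
  define w where "w m n = h ^ m * h ^ n * fact m * fact n" for m n :: nat
  have w: "0 < w m n" for m n
    using h by (simp add: w_def)
  \<comment> \<open>Each factor is divided by its seminorm weight, so that only the dependence on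
    the centre remains to be bounded.\<close>
  define q where "q \<alpha> k Y s b = (complex_of_real (s \<bullet> b) ^ \<alpha> b
      * (deriv ^^ k b) (atom1 (fst Y \<bullet> b) (snd Y \<bullet> b)) (of_real (s \<bullet> b))) / of_real (w (\<alpha> b) (k b))"
    for \<alpha> k :: "'a \<Rightarrow> nat" and Y s and b :: 'a
  have W: "h ^ (mi_abs \<alpha> + mi_abs k) * mi_fact \<alpha> * mi_fact k = (\<Prod>b\<in>Basis. w (\<alpha> b) (k b))" for \<alpha> k :: "'a \<Rightarrow> nat"
    by (simp add: w_def mi_abs_def mi_fact_def prod.distrib power_sum power_add)
  have Wpos: "0 < (\<Prod>b\<in>Basis. w (\<alpha> b) (k b))" for \<alpha> k :: "'a \<Rightarrow> nat"
    by (intro prod_pos w)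
  have Q: "mi_power s \<alpha> * gatom k Y s = of_real (\<Prod>b\<in>Basis. w (\<alpha> b) (k b)) * (\<Prod>b\<in>Basis. q \<alpha> k Y s b)" for \<alpha> k Y and s :: 'a
  proof -
    have "mi_power s \<alpha> * gatom k Y s = (\<Prod>b\<in>Basis. complex_of_real (s \<bullet> b) ^ \<alpha> b
      * (deriv ^^ k b) (atom1 (fst Y \<bullet> b) (snd Y \<bullet> b)) (of_real (s \<bullet> b)))"
      by (simp add: mi_power_def gatom_def prod.distrib)
    also have "\<dots> = (\<Prod>b\<in>Basis. of_real (w (\<alpha> b) (k b)) * q \<alpha> k Y s b)"
      using w by (intro prod.cong) (auto simp: q_def less_imp_neq[symmetric])
    finally show ?thesis
      by (simp add: prod.distrib)
  qed
  have coord: "\<bar>fst Y \<bullet> b\<bar> \<le> norm Y" "\<bar>snd Y \<bullet> b\<bar> \<le> norm Y" if "b \<in> Basis" for Y :: "'a \<times> 'a" and b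
    using Basis_le_norm[OF that, of "fst Y"] Basis_le_norm[OF that, of "snd Y"] norm_fst_le[of "fst Y" "snd Y"] norm_snd_le[of "snd Y" "fst Y"]
    by auto
  define B where "B t = C * exp (2 * c * t)" for t
  have B: "1 \<le> B t" if "0 \<le> t" for t
    using C c that mult_mono[of 1 C 1 "exp (2 * c * t)"] by (simp add: B_def)
  have q1: "cmod (q \<alpha> k Y s b) \<le> B (norm Y)" if b: "b \<in> Basis" for \<alpha> k Y s b
  proof -
    have "c * (\<bar>fst Y \<bullet> b\<bar> + \<bar>snd Y \<bullet> b\<bar>) \<le> 2 * c * norm Y"
      using mult_left_mono[OF coord(1)[OF b, of Y] c] mult_left_mono[OF coord(2)[OF b, of Y] c] by (simp add: algebra_simps)
    then have "C * exp (c * (\<bar>fst Y \<bullet> b\<bar> + \<bar>snd Y \<bullet> b\<bar>)) \<le> B (norm Y)"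
      using C by (simp add: B_def)
    moreover have "cmod (q \<alpha> k Y s b) \<le> C * exp (c * (\<bar>fst Y \<bullet> b\<bar> + \<bar>snd Y \<bullet> b\<bar>))"
      using b1[of "s \<bullet> b" "\<alpha> b" "k b" "fst Y \<bullet> b" "snd Y \<bullet> b"] w[of "\<alpha> b" "k b"]
      unfolding q_def w_def[symmetric] by (simp add: norm_mult norm_divide norm_power pos_divide_le_eq mult_ac)
    ultimately show ?thesis by linarith
  qed
  have q2: "cmod (q \<alpha> k Y s b - q \<alpha> k Y' s b) \<le> B (norm Y + norm Y') * (2 * norm (Y - Y'))" if b: "b \<in> Basis" for \<alpha> k Y Y' s b
  proof -
    have "c * (\<bar>fst Y \<bullet> b\<bar> + \<bar>snd Y \<bullet> b\<bar> + \<bar>fst Y' \<bullet> b\<bar> + \<bar>snd Y' \<bullet> b\<bar>) \<le> c * (2 * (norm Y + norm Y'))"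
      using coord[OF b, of Y] coord[OF b, of Y'] c by (intro mult_left_mono) auto
    also have "\<dots> = 2 * c * (norm Y + norm Y')"
      by simp
    finally have "C * exp (c * (\<bar>fst Y \<bullet> b\<bar> + \<bar>snd Y \<bullet> b\<bar> + \<bar>fst Y' \<bullet> b\<bar> + \<bar>snd Y' \<bullet> b\<bar>)) \<le> B (norm Y + norm Y')"
      using C by (simp add: B_def)
    moreover have "\<bar>fst Y \<bullet> b - fst Y' \<bullet> b\<bar> + \<bar>snd Y \<bullet> b - snd Y' \<bullet> b\<bar> \<le> 2 * norm (Y - Y')"
      using coord[OF b, of "Y - Y'"] by (simp add: inner_diff_left)
    ultimately have "C * exp (c * (\<bar>fst Y \<bullet> b\<bar> + \<bar>snd Y \<bullet> b\<bar> + \<bar>fst Y' \<bullet> b\<bar> + \<bar>snd Y' \<bullet> b\<bar>))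
        * (\<bar>fst Y \<bullet> b - fst Y' \<bullet> b\<bar> + \<bar>snd Y \<bullet> b - snd Y' \<bullet> b\<bar>) \<le> B (norm Y + norm Y') * (2 * norm (Y - Y'))"
      using B[of "norm Y + norm Y'"] by (intro mult_mono) auto
    moreover have "cmod (q \<alpha> k Y s b - q \<alpha> k Y' s b)
      = \<bar>s \<bullet> b\<bar> ^ \<alpha> b * cmod ((deriv ^^ k b) (atom1 (fst Y \<bullet> b) (snd Y \<bullet> b)) (of_real (s \<bullet> b))
          - (deriv ^^ k b) (atom1 (fst Y' \<bullet> b) (snd Y' \<bullet> b)) (of_real (s \<bullet> b))) / w (\<alpha> b) (k b)" (is "_ = ?X / _")
      unfolding q_def diff_divide_distrib[symmetric] right_diff_distrib[symmetric]
      using w[of "\<alpha> b" "k b"] by (simp add: norm_mult norm_divide norm_power)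
    moreover have "?X \<le> w (\<alpha> b) (k b) * (C * exp (c * (\<bar>fst Y \<bullet> b\<bar> + \<bar>snd Y \<bullet> b\<bar> + \<bar>fst Y' \<bullet> b\<bar> + \<bar>snd Y' \<bullet> b\<bar>))
        * (\<bar>fst Y \<bullet> b - fst Y' \<bullet> b\<bar> + \<bar>snd Y \<bullet> b - snd Y' \<bullet> b\<bar>))" (is "_ \<le> _ * ?A")
      using b2[of "s \<bullet> b" "\<alpha> b" "k b" "fst Y \<bullet> b" "snd Y \<bullet> b" "fst Y' \<bullet> b" "snd Y' \<bullet> b"]
      unfolding w_def .
    then have "?X / w (\<alpha> b) (k b) \<le> ?A"
      using w[of "\<alpha> b" "k b"] by (simp only: pos_divide_le_eq mult.commute)
    ultimately show ?thesis
      by linarith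
  qed
  \<comment> \<open>The factor \<open>2 * ?d\<close> comes from the Lipschitz bound: one
    contribution \<open>2 * norm (Y - Y')\<close> for each coordinate.\<close>
  let ?C = "C ^ ?d * (2 * ?d)" and ?c = "2 * c * ?d"
  have d1: "1 \<le> 2 * real ?d"
    using DIM_positive[where 'a='a] by linarith
  have Bpow: "B t ^ ?d = C ^ ?d * exp (?c * t)" for t
    by (simp add: B_def power_mult_distrib exp_of_nat_mult[symmetric] mult_ac)
  have 1: "cmod (mi_power s \<alpha> * gatom k Y s)
        \<le> h ^ (mi_abs \<alpha> + mi_abs k) * mi_fact \<alpha> * mi_fact k * (?C * exp (?c * norm Y))" for Y \<alpha> k and s :: 'a
  proof -
    have "(\<Prod>b\<in>Basis. cmod (q \<alpha> k Y s b)) \<le> (\<Prod>b\<in>(Basis::'a set). B (norm Y))"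
      using q1 by (intro prod_mono) auto
    then have "cmod (\<Prod>b\<in>Basis. q \<alpha> k Y s b) \<le> C ^ ?d * exp (?c * norm Y)"
      by (simp add: prod_norm Bpow)
    also have "\<dots> \<le> (C ^ ?d * exp (?c * norm Y)) * (2 * ?d)"
      using C d1 mult_left_mono[of 1 "2 * real ?d" "C ^ ?d * exp (?c * norm Y)"] by simp
    finally have "cmod (\<Prod>b\<in>Basis. q \<alpha> k Y s b) \<le> ?C * exp (?c * norm Y)"
      by (simp add: mult_ac)
    then show ?thesis
      unfolding Q W norm_mult norm_of_real using Wpos[of \<alpha> k]
      by (simp only: abs_of_pos) (rule mult_left_mono, auto)
  qed
  have 2: "cmod (mi_power s \<alpha> * (gatom k Y s - gatom k Y' s))
        \<le> h ^ (mi_abs \<alpha> + mi_abs k) * mi_fact \<alpha> * mi_fact k * (?C * norm (Y - Y') * exp (?c * (norm Y + norm Y')))"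
    for Y Y' \<alpha> k and s :: 'a
  proof -
    let ?B = "B (norm Y + norm Y')"
    have B1: "1 \<le> ?B" by (rule B) simp
    have Bm: "B (norm Y) \<le> ?B" "B (norm Y') \<le> ?B"
      using C c by (auto simp: B_def intro!: mult_left_mono)
    \<comment> \<open>\<open>norm_prod_diff\<close> telescopes the difference of two products whose
      factors have modulus at most 1; division by the common bound \<open>?B\<close> brings the
      factors there.\<close>
    have "norm ((\<Prod>b\<in>(Basis::'a set). q \<alpha> k Y s b / of_real ?B) - (\<Prod>b\<in>Basis. q \<alpha> k Y' s b / of_real ?B))
       \<le> (\<Sum>b\<in>(Basis::'a set). norm (q \<alpha> k Y s b / of_real ?B - q \<alpha> k Y' s b / of_real ?B))"
      using B1 order_trans[OF q1 Bm(1)] order_trans[OF q1 Bm(2)]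
      by (intro norm_prod_diff) (simp_all add: norm_divide pos_divide_le_eq)
    also have "\<dots> \<le> (\<Sum>b\<in>(Basis::'a set). 2 * norm (Y - Y'))"
    proof (rule sum_mono)
      fix b :: 'a assume b: "b \<in> Basis"
      have "norm (q \<alpha> k Y s b / of_real ?B - q \<alpha> k Y' s b / of_real ?B) = cmod (q \<alpha> k Y s b - q \<alpha> k Y' s b) / ?B"
        unfolding diff_divide_distrib[symmetric] norm_divide norm_of_real using B1 by simp
      also have "\<dots> \<le> 2 * norm (Y - Y')"
        using q2[OF b, of \<alpha> k Y s Y'] B1 by (simp add: pos_divide_le_eq mult_ac)
      finally show "norm (q \<alpha> k Y s b / of_real ?B - q \<alpha> k Y' s b / of_real ?B) \<le> 2 * norm (Y - Y')" .
    qed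
    finally have *: "norm ((\<Prod>b\<in>(Basis::'a set). q \<alpha> k Y s b / of_real ?B) - (\<Prod>b\<in>Basis. q \<alpha> k Y' s b / of_real ?B))
      \<le> 2 * ?d * norm (Y - Y')"
      by simp
    have "(\<Prod>b\<in>(Basis::'a set). q \<alpha> k Y s b) - (\<Prod>b\<in>Basis. q \<alpha> k Y' s b)
      = of_real ?B ^ ?d * ((\<Prod>b\<in>(Basis::'a set). q \<alpha> k Y s b / of_real ?B) - (\<Prod>b\<in>Basis. q \<alpha> k Y' s b / of_real ?B))"
      using B1 by (simp add: prod_dividef right_diff_distrib)
    then have "cmod ((\<Prod>b\<in>(Basis::'a set). q \<alpha> k Y s b) - (\<Prod>b\<in>Basis. q \<alpha> k Y' s b)) \<le> ?B ^ ?d * (2 * ?d * norm (Y - Y'))"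
      using * B1 by (simp add: norm_mult norm_power mult_left_mono)
    also have "\<dots> = ?C * norm (Y - Y') * exp (?c * (norm Y + norm Y'))"
      unfolding Bpow by simp
    finally have **: "cmod ((\<Prod>b\<in>(Basis::'a set). q \<alpha> k Y s b) - (\<Prod>b\<in>Basis. q \<alpha> k Y' s b))
      \<le> ?C * norm (Y - Y') * exp (?c * (norm Y + norm Y'))" .
    have "mi_power s \<alpha> * (gatom k Y s - gatom k Y' s)
       = of_real (\<Prod>b\<in>Basis. w (\<alpha> b) (k b)) * ((\<Prod>b\<in>(Basis::'a set). q \<alpha> k Y s b) - (\<Prod>b\<in>Basis. q \<alpha> k Y' s b))"
      unfolding right_diff_distrib Q ..
    then show ?thesis
      unfolding W using ** Wpos[of \<alpha> k]
      by (simp only: norm_mult norm_of_real abs_of_pos) (rule mult_left_mono, auto)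
  qed
  show ?thesis
  proof (intro exI conjI allI)
    show "0 \<le> ?C" using C by simp
    show "0 \<le> ?c" using c by simp
  qed (use 1 2 in auto)
qed

subsection \<open>Superpositions of Gaussian atoms\<close>

text \<open>A function together with candidates for all its partial derivatives, indexed by multi-indices.\<close>

definition tower :: "(('a::euclidean_space \<Rightarrow> nat) \<Rightarrow> 'a \<Rightarrow> complex) \<Rightarrow> bool" where
  "tower G \<longleftrightarrow> (\<forall>k s. (G k has_derivative (\<lambda>v. \<Sum>b\<in>Basis. (v \<bullet> b) *\<^sub>R G (k(b := Suc (k b))) s)) (at s))"

lemma tower_partial1:
  assumes "tower G" "b \<in> Basis"
  shows "partial1 b (G k) = G (k(b := Suc (k b)))"
proof
  fix s
  have "(G k has_derivative (\<lambda>v. \<Sum>c\<in>Basis. (v \<bullet> c) *\<^sub>R G (k(c := Suc (k c))) s)) (at s)"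
    using assms(1) unfolding tower_def by blast
  from partial1_eq_derivative[OF this, of b]
  have "partial1 b (G k) s = (\<Sum>c\<in>Basis. (if c = b then G (k(c := Suc (k c))) s else 0))"
    using assms(2) by (simp only:) (intro sum.cong refl, auto simp: inner_Basis)
  then show "partial1 b (G k) s = G (k(b := Suc (k b))) s"
    using assms(2) by (simp add: sum.delta del: fun_upd_apply)
qed

text \<open>Only the number of occurrences of each direction matters, so one family indexed by
  multi-indices covers the derivatives in every order that \<open>smooth\<close> asks for.\<close>

lemma tower_foldr:
  assumes "tower G" "set bs \<subseteq> Basis"
  shows "foldr partial1 bs (G k) = G (\<lambda>b. k b + count_list bs b)"
  using assms(2)
proof (induction bs)
  case (Cons a bs)
  have "(\<lambda>b. k b + count_list bs b)(a := Suc (k a + count_list bs a)) = (\<lambda>b. k b + count_list (a # bs) b)"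
    by auto
  then show ?case
    using Cons tower_partial1[OF assms(1), of a] by simp
qed simp

lemma tower_smooth:
  assumes "tower G"
  shows "smooth (G k)"
  unfolding smooth_def
proof (intro allI impI)
  fix bs :: "'a list" and x assume "set bs \<subseteq> Basis"
  then show "foldr partial1 bs (G k) differentiable at x"
    unfolding tower_foldr[OF assms \<open>set bs \<subseteq> Basis\<close>] using assms
    unfolding tower_def differentiable_def by blast
qed

lemma tower_partial:
  assumes "tower G"
  shows "partial \<beta> (G (\<lambda>_. 0)) = G (\<lambda>b. if b \<in> Basis then \<beta> b else 0)"
proof -
  have pow: "(partial1 b ^^ n) (G k) = G (k(b := k b + n))" if "b \<in> Basis" for b n k
  proof (induction n)
    case (Suc n)
    have "(partial1 b ^^ Suc n) (G k) = partial1 b (G (k(b := k b + n)))"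
      by (simp only: funpow.simps comp_apply Suc)
    also have "\<dots> = G ((k(b := k b + n))(b := Suc ((k(b := k b + n)) b)))"
      by (rule tower_partial1[OF assms that])
    also have "(k(b := k b + n))(b := Suc ((k(b := k b + n)) b)) = k(b := k b + Suc n)"
      by (rule ext) simp
    finally show ?case .
  qed simp
  have "foldr (\<lambda>b. partial1 b ^^ \<beta> b) xs (G (\<lambda>_. 0)) = G (\<lambda>b. if b \<in> set xs then \<beta> b else 0)"
    if "distinct xs" "set xs \<subseteq> Basis" for xs
    using that
  proof (induction xs)
    case (Cons a xs)
    have "(\<lambda>b. if b \<in> set xs then \<beta> b else 0)(a := \<beta> a) = (\<lambda>b. if b \<in> set (a # xs) then \<beta> b else 0)"
      by auto
    then show ?case
      using Cons pow[of a "\<beta> a" "\<lambda>b. if b \<in> set xs then \<beta> b else 0"] by simp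
  qed simp
  from this[OF basis_enum(1)] show ?thesis
    unfolding partial_def basis_enum(2) by simp
qed

lemma tower_Sigma1_seminorm:
  fixes G :: "('a::euclidean_space \<Rightarrow> nat) \<Rightarrow> 'a \<Rightarrow> complex"
  assumes "tower G" and h: "0 < h"
    and b: "\<And>\<alpha> k s. cmod (mi_power s \<alpha> * G k s) \<le> h ^ (mi_abs \<alpha> + mi_abs k) * mi_fact \<alpha> * mi_fact k * C"
  shows "Sigma1_seminorm h (G (\<lambda>_. 0)) \<le> ennreal C"
  unfolding Sigma1_seminorm_def
proof (rule SUP_least, clarify)
  fix \<alpha> \<beta> :: "'a \<Rightarrow> nat" and x :: 'a
  \<comment> \<open>\<open>tower_partial\<close> cuts the index off outside \<open>Basis\<close>;
    length and factorial are computed on \<open>Basis\<close> and do not change.\<close>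
  let ?\<beta> = "\<lambda>b. if b \<in> Basis then \<beta> b else 0"
  have "mi_abs ?\<beta> = mi_abs \<beta>" "mi_fact ?\<beta> = mi_fact \<beta>"
    unfolding mi_abs_def mi_fact_def by auto
  then have "cmod (mi_power x \<alpha> * partial \<beta> (G (\<lambda>_. 0)) x)
      \<le> (h ^ (mi_abs \<alpha> + mi_abs \<beta>) * mi_fact \<alpha> * mi_fact \<beta>) * C"
    using b[of x \<alpha> ?\<beta>] unfolding tower_partial[OF assms(1)] by simp
  moreover have "0 < h ^ (mi_abs \<alpha> + mi_abs \<beta>) * mi_fact \<alpha> * mi_fact \<beta>"
    using h mi_fact_pos[of \<alpha>] mi_fact_pos[of \<beta>] by simp
  ultimately show "ennreal (cmod (mi_power x \<alpha> * partial \<beta> (G (\<lambda>_. 0)) x) /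
      (h ^ (mi_abs \<alpha> + mi_abs \<beta>) * mi_fact \<alpha> * mi_fact \<beta>)) \<le> ennreal C"
    by (intro ennreal_leI) (simp only: pos_divide_le_eq mult.commute)
qed

lemma tower_Sigma1:
  fixes G :: "('a::euclidean_space \<Rightarrow> nat) \<Rightarrow> 'a \<Rightarrow> complex"
  assumes "tower G"
    and b: "\<And>h. 0 < h \<Longrightarrow> \<exists>C. \<forall>\<alpha> k s. cmod (mi_power s \<alpha> * G k s) \<le> h ^ (mi_abs \<alpha> + mi_abs k) * mi_fact \<alpha> * mi_fact k * C"
  shows "G (\<lambda>_. 0) \<in> Sigma1"
proof -
  have "Sigma1_seminorm h (G (\<lambda>_. 0)) < \<infinity>" if h: "0 < h" for h
  proof -
    obtain C where "\<And>\<alpha> k s. cmod (mi_power s \<alpha> * G k s) \<le> h ^ (mi_abs \<alpha> + mi_abs k) * mi_fact \<alpha> * mi_fact k * C"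
      using b[OF h] by blast
    from tower_Sigma1_seminorm[OF assms(1) h this] show ?thesis
      using ennreal_less_top le_less_trans by (metis infinity_ennreal_def)
  qed
  then show ?thesis
    unfolding Sigma1_def using tower_smooth[OF assms(1)] by blast
qed

lemma tower_gatom: "tower (\<lambda>k. gatom k Y)"
  unfolding tower_def using gatom_has_derivative by blast

lemma tower_diff: "tower G \<Longrightarrow> tower H \<Longrightarrow> tower (\<lambda>k s. G k s - H k s)"
  unfolding tower_def
  by (auto intro!: derivative_eq_intros simp: scaleR_diff_right sum_subtractf)

lemma tower_sum:
  assumes "\<And>v. v \<in> S \<Longrightarrow> tower (G v)"
  shows "tower (\<lambda>k s. \<Sum>v\<in>S. a v * G v k s)"
  unfolding tower_def
proof (intro allI)
  fix k s
  have "((\<lambda>s. \<Sum>v\<in>S. a v * G v k s) has_derivative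
     (\<lambda>w. \<Sum>v\<in>S. a v * (\<Sum>b\<in>Basis. (w \<bullet> b) *\<^sub>R G v (k(b := Suc (k b))) s))) (at s)"
    using assms unfolding tower_def by (intro has_derivative_sum has_derivative_mult_right) blast
  moreover have "(\<Sum>v\<in>S. a v * (\<Sum>b\<in>Basis. (w \<bullet> b) *\<^sub>R G v (k(b := Suc (k b))) s))
     = (\<Sum>b\<in>Basis. (w \<bullet> b) *\<^sub>R (\<Sum>v\<in>S. a v * G v (k(b := Suc (k b))) s))" for w
  proof -
    have "(\<Sum>v\<in>S. a v * (\<Sum>b\<in>Basis. (w \<bullet> b) *\<^sub>R G v (k(b := Suc (k b))) s))
       = (\<Sum>v\<in>S. \<Sum>b\<in>Basis. (w \<bullet> b) *\<^sub>R (a v * G v (k(b := Suc (k b))) s))"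
      by (simp add: sum_distrib_left del: fun_upd_apply)
    also have "\<dots> = (\<Sum>b\<in>Basis. \<Sum>v\<in>S. (w \<bullet> b) *\<^sub>R (a v * G v (k(b := Suc (k b))) s))"
      by (rule sum.swap)
    finally show ?thesis
      by (simp only: scaleR_sum_right)
  qed
  ultimately show "((\<lambda>s. \<Sum>v\<in>S. a v * G v k s) has_derivative
     (\<lambda>w. \<Sum>b\<in>Basis. (w \<bullet> b) *\<^sub>R (\<Sum>v\<in>S. a v * G v (k(b := Suc (k b))) s))) (at s)"
    by (simp only:)
qed

text \<open>The form in which the Lipschitz bounds of \<open>gatom_bounds\<close> arrive: the
  Lipschitz constant is bounded near each point, though not globally.\<close>

lemma continuous_on_if_exp_lipschitz:
  fixes F :: "'b::real_normed_vector \<Rightarrow> complex"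
  assumes "\<And>Y Y'. cmod (F Y - F Y') \<le> C * norm (Y - Y') * exp (c * (norm Y + norm Y'))"
  shows "continuous_on UNIV F"
proof -
  have "isCont F Y" for Y
    unfolding isCont_def
  proof (rule Lim_null[THEN iffD2], rule Lim_null_comparison)
    show "\<forall>\<^sub>F Y' in at Y. norm (F Y' - F Y) \<le> C * norm (Y' - Y) * exp (c * (norm Y' + norm Y))"
      using assms by simp
    have "((\<lambda>Y'. C * norm (Y' - Y) * exp (c * (norm Y' + norm Y))) \<longlongrightarrow> C * norm (Y - Y) * exp (c * (norm Y + norm Y))) (at Y)"
      by (intro tendsto_intros)
    then show "((\<lambda>Y'. C * norm (Y' - Y) * exp (c * (norm Y' + norm Y))) \<longlongrightarrow> 0) (at Y)"
      by simp
  qed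
  then show ?thesis
    by (simp add: continuous_at_imp_continuous_on)
qed

lemma mi_zero [simp]: "mi_abs (\<lambda>_. 0) = 0" "mi_fact (\<lambda>_. 0) = 1" "mi_power s (\<lambda>_. 0) = 1"
  by (simp_all add: mi_abs_def mi_fact_def mi_power_def)

lemma gatom_pointwise:
  "\<exists>C\<ge>0. \<exists>c\<ge>0. \<forall>k s. \<forall>Y :: 'a::euclidean_space \<times> 'a. cmod (gatom k Y s) \<le> mi_fact k * (C * exp (c * norm Y))"
proof -
  obtain C c where "0 \<le> C" "0 \<le> c" and b: "\<And>(Y::'a \<times> 'a) \<alpha> k s. cmod (mi_power s \<alpha> * gatom k Y s)
      \<le> 1 ^ (mi_abs \<alpha> + mi_abs k) * mi_fact \<alpha> * mi_fact k * (C * exp (c * norm Y))"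
    using gatom_bounds[of 1, where 'a='a] by auto
  then show ?thesis
    using b[of _ "\<lambda>_. 0"] by (intro exI[of _ C] exI[of _ c] conjI) simp_all
qed

lemma borel_measurable_gatom [measurable]:
  "(\<lambda>Y::'a::euclidean_space \<times> 'a. gatom k Y s) \<in> borel_measurable borel"
proof -
  obtain C c where "0 \<le> C" "0 \<le> c" and b: "\<And>(Y::'a \<times> 'a) Y' \<alpha> k s. cmod (mi_power s \<alpha> * (gatom k Y s - gatom k Y' s))
      \<le> 1 ^ (mi_abs \<alpha> + mi_abs k) * mi_fact \<alpha> * mi_fact k * (C * norm (Y - Y') * exp (c * (norm Y + norm Y')))"
    using gatom_bounds[of 1, where 'a='a] by auto
  have "cmod (gatom k Y s - gatom k Y' s) \<le> (mi_fact k * C) * norm (Y - Y') * exp (c * (norm Y + norm Y'))" for Y Y'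
    using b[of s "\<lambda>_. 0" k Y Y'] by (simp add: mult_ac)
  from continuous_on_if_exp_lipschitz[OF this] show ?thesis
    by (rule borel_measurable_continuous_onI)
qed

text \<open>Rapid decay of the weight beats the exponential growth of the atoms in their centres.
  The factor 2 leaves room for the simple functions by which \<open>synthesis\<close> approximates
  the map of centres.\<close>

lemma synthesis_integrable:
  fixes W :: "'c::euclidean_space \<Rightarrow> complex" and r :: "'c \<Rightarrow> 'a::euclidean_space \<times> 'a"
  assumes W: "rapid W" and [measurable]: "W \<in> borel_measurable borel" "r \<in> borel_measurable borel"
    and r: "\<And>Y. norm (r Y) \<le> 2 * norm Y"
  shows "integrable lborel (\<lambda>Y. W Y * gatom k (r Y) s)"
proof -
  obtain C c where C: "0 \<le> C" "0 \<le> c" and b: "\<And>k s. \<And>Y :: 'a \<times> 'a. cmod (gatom k Y s) \<le> mi_fact k * (C * exp (c * norm Y))"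
    using gatom_pointwise by metis
  show ?thesis
  proof (rule rapid_integrable_mult[OF W, where A="mi_fact k * C" and c="c * 2"])
    fix Y
    have "c * norm (r Y) \<le> c * (2 * norm Y)"
      using r C by (intro mult_left_mono) auto
    then have "mi_fact k * (C * exp (c * norm (r Y))) \<le> mi_fact k * (C * exp (c * 2 * norm Y))"
      using C mi_fact_pos[of k] by (intro mult_left_mono) auto
    then show "cmod (gatom k (r Y) s) \<le> mi_fact k * C * exp (c * 2 * norm Y)"
      using b[of k "r Y" s] by (simp add: mult.assoc)
  qed measurable
qed

text \<open>Differentiation under the integral sign, for all orders at once. The error of the
  first-order expansion of an atom is at most linear in the increment, with a constant that grows
  exponentially in the centre and that \<open>W\<close> makes integrable.\<close>

lemma tower_synthesis:
  fixes W :: "'c::euclidean_space \<Rightarrow> complex" and r :: "'c \<Rightarrow> 'a::euclidean_space \<times> 'a"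
  assumes W: "rapid W" and [measurable]: "W \<in> borel_measurable borel" "r \<in> borel_measurable borel"
    and r: "\<And>Y. norm (r Y) \<le> 2 * norm Y"
  shows "tower (\<lambda>k s. \<integral>Y. W Y * gatom k (r Y) s \<partial>lborel)"
  unfolding tower_def
proof (intro allI)
  fix k :: "'a \<Rightarrow> nat" and s :: 'a
  let ?up = "\<lambda>b::'a. k(b := Suc (k b))"
  let ?T = "\<lambda>k s. \<integral>Y. W Y * gatom k (r Y) s \<partial>lborel"
  let ?D = "\<lambda>v. \<Sum>b\<in>Basis. (v \<bullet> b) *\<^sub>R ?T (?up b) s"
  note I = synthesis_integrable[OF assms]
  obtain C c where C: "0 \<le> C" "0 \<le> c" and gb: "\<And>k s. \<And>Y :: 'a \<times> 'a. cmod (gatom k Y s) \<le> mi_fact k * (C * exp (c * norm Y))"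
    using gatom_pointwise by metis
  define A where "A = (\<Sum>b\<in>Basis. mi_fact (?up b)) * C"
  have A: "0 \<le> A"
    unfolding A_def using C by (intro mult_nonneg_nonneg sum_nonneg less_imp_le[OF mi_fact_pos]) auto
  have bd: "cmod (\<Sum>b\<in>Basis. (v \<bullet> b) *\<^sub>R gatom (?up b) Y x) \<le> A * exp (c * norm Y) * norm v" for Y v and x :: 'a
  proof -
    have "cmod (\<Sum>b\<in>Basis. (v \<bullet> b) *\<^sub>R gatom (?up b) Y x)
      \<le> (\<Sum>b\<in>Basis. norm v * (mi_fact (?up b) * (C * exp (c * norm Y))))"
    proof (rule sum_norm_le)
      fix b :: 'a assume "b \<in> Basis"
      then show "cmod ((v \<bullet> b) *\<^sub>R gatom (?up b) Y x) \<le> norm v * (mi_fact (?up b) * (C * exp (c * norm Y)))"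
        unfolding norm_scaleR by (intro mult_mono Basis_le_norm gb) auto
    qed
    also have "\<dots> = A * exp (c * norm Y) * norm v"
      by (simp add: A_def sum_distrib_left sum_distrib_right mult_ac)
    finally show ?thesis .
  qed
  define E where "E v Y = gatom k (r Y) (s + v) - gatom k (r Y) s - (\<Sum>b\<in>Basis. (v \<bullet> b) *\<^sub>R gatom (?up b) (r Y) s)" for v Y
  have [measurable]: "(\<lambda>Y. E v Y) \<in> borel_measurable borel" for v
    unfolding E_def by measurable
  \<comment> \<open>The mean value inequality bounds the increment by the gradient, and the linear
    part obeys the same bound; hence the factor 2, and a majorant of the difference quotient that
    does not depend on \<open>v\<close>.\<close>
  have Eb: "cmod (E v Y) \<le> 2 * A * exp (2 * c * norm Y) * norm v" for v Y
  proof -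
    have "norm (gatom k (r Y) (s + v) - gatom k (r Y) s) \<le> (A * exp (c * norm (r Y))) * norm (s + v - s)"
    proof (rule differentiable_bound[where S=UNIV])
      show "(gatom k (r Y) has_derivative (\<lambda>v. \<Sum>b\<in>Basis. (v \<bullet> b) *\<^sub>R gatom (?up b) (r Y) x)) (at x within UNIV)" for x
        using gatom_has_derivative[of k "r Y" x] by simp
      show "onorm (\<lambda>v. \<Sum>b\<in>Basis. (v \<bullet> b) *\<^sub>R gatom (?up b) (r Y) x) \<le> A * exp (c * norm (r Y))" for x
        using A bd by (intro onorm_bound) auto
    qed auto
    with bd[of v "r Y" s] have "cmod (E v Y) \<le> 2 * (A * exp (c * norm (r Y)) * norm v)"
      unfolding E_def
      using norm_triangle_ineq4[of "gatom k (r Y) (s + v) - gatom k (r Y) s" "\<Sum>b\<in>Basis. (v \<bullet> b) *\<^sub>R gatom (?up b) (r Y) s"]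
      by simp
    also have "\<dots> \<le> 2 * (A * exp (2 * c * norm Y) * norm v)"
    proof -
      have "c * norm (r Y) \<le> 2 * c * norm Y"
        using mult_left_mono[OF r[of Y] C(2)] by simp
      then show ?thesis
        using A by (intro mult_left_mono mult_right_mono) auto
    qed
    finally show ?thesis by simp
  qed
  have key: "?T k (s + v) - ?T k s - ?D v = (\<integral>Y. W Y * E v Y \<partial>lborel)" for v
  proof -
    have "?D v = (\<integral>Y. (\<Sum>b\<in>Basis. (v \<bullet> b) *\<^sub>R (W Y * gatom (?up b) (r Y) s)) \<partial>lborel)"
      by (subst Bochner_Integration.integral_sum) (auto intro!: I simp del: fun_upd_apply)
    then have "?T k (s + v) - ?T k s - ?D v
      = (\<integral>Y. W Y * gatom k (r Y) (s + v) - W Y * gatom k (r Y) s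
          - (\<Sum>b\<in>Basis. (v \<bullet> b) *\<^sub>R (W Y * gatom (?up b) (r Y) s)) \<partial>lborel)"
      by (simp only: Bochner_Integration.integral_diff Bochner_Integration.integrable_diff
          Bochner_Integration.integrable_sum integrable_scaleR_right I)
    also have "\<dots> = (\<integral>Y. W Y * E v Y \<partial>lborel)"
      unfolding E_def
      by (intro Bochner_Integration.integral_cong refl)
        (simp add: right_diff_distrib sum_distrib_left scaleR_conv_of_real mult_ac del: fun_upd_apply)
    finally show ?thesis .
  qed
  show "(?T k has_derivative ?D) (at s)"
    unfolding has_derivative_at
  proof
    have "linear ?D"
      by (rule linearI)
        (simp_all add: inner_add_left scaleR_add_left sum.distrib scaleR_sum_right del: fun_upd_apply)
    then show "bounded_linear ?D"
      by (simp only: linear_conv_bounded_linear)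
    show "(\<lambda>v. norm (?T k (s + v) - ?T k s - ?D v) / norm v) \<midarrow>0\<rightarrow> 0"
      unfolding key tendsto_at_iff_sequentially
    proof (intro allI impI)
      fix X :: "nat \<Rightarrow> 'a" assume X: "\<forall>i. X i \<in> UNIV - {0}" "X \<longlonglongrightarrow> 0"
      have lim: "(\<lambda>i. \<integral>Y. cmod (W Y) * (cmod (E (X i) Y) / norm (X i)) \<partial>lborel) \<longlonglongrightarrow> (\<integral>Y. 0 \<partial>(lborel::'c measure))"
      proof (rule integral_dominated_convergence[where w="\<lambda>Y. 2 * A * (cmod (W Y) * exp (2 * c * norm Y))"])
        show "integrable lborel (\<lambda>Y. 2 * A * (cmod (W Y) * exp (2 * c * norm Y)))"
          by (rule integrable_mult_right[OF rapid_integrable_exp[OF W]]) simp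
        show "AE Y in lborel. (\<lambda>i. cmod (W Y) * (cmod (E (X i) Y) / norm (X i))) \<longlonglongrightarrow> 0"
        proof (rule AE_I2)
          fix Y
          have "(\<lambda>v. cmod (E v Y) / norm v) \<midarrow>0\<rightarrow> 0"
            using gatom_has_derivative[of k "r Y" s] unfolding has_derivative_at E_def by blast
          then have "(\<lambda>i. cmod (E (X i) Y) / norm (X i)) \<longlonglongrightarrow> 0"
            using X unfolding tendsto_at_iff_sequentially comp_def by blast
          then show "(\<lambda>i. cmod (W Y) * (cmod (E (X i) Y) / norm (X i))) \<longlonglongrightarrow> 0"
            by (rule tendsto_mult_right_zero)
        qed
        show "AE Y in lborel. norm (cmod (W Y) * (cmod (E (X i) Y) / norm (X i))) \<le> 2 * A * (cmod (W Y) * exp (2 * c * norm Y))" for i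
        proof (rule AE_I2)
          fix Y
          have "X i \<noteq> 0" using X(1) by auto
          then have "cmod (E (X i) Y) / norm (X i) \<le> 2 * A * exp (2 * c * norm Y)"
            using Eb[of "X i" Y] by (simp add: pos_divide_le_eq)
          then have "cmod (W Y) * (cmod (E (X i) Y) / norm (X i)) \<le> cmod (W Y) * (2 * A * exp (2 * c * norm Y))"
            by (intro mult_left_mono) auto
          then show "norm (cmod (W Y) * (cmod (E (X i) Y) / norm (X i))) \<le> 2 * A * (cmod (W Y) * exp (2 * c * norm Y))"
            by (simp add: mult_ac)
        qed
      qed measurable
      have "(\<lambda>i. norm (\<integral>Y. W Y * E (X i) Y \<partial>lborel) / norm (X i)) \<longlonglongrightarrow> 0"
      proof (rule tendsto_sandwich[OF _ _ tendsto_const])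
        show "\<forall>\<^sub>F i in sequentially. 0 \<le> norm (\<integral>Y. W Y * E (X i) Y \<partial>lborel) / norm (X i)"
          by simp
        show "\<forall>\<^sub>F i in sequentially. norm (\<integral>Y. W Y * E (X i) Y \<partial>lborel) / norm (X i)
          \<le> (\<integral>Y. cmod (W Y) * (cmod (E (X i) Y) / norm (X i)) \<partial>lborel)"
        proof (rule always_eventually, rule allI)
          fix i
          have "norm (\<integral>Y. W Y * E (X i) Y \<partial>lborel) / norm (X i) \<le> (\<integral>Y. cmod (W Y * E (X i) Y) \<partial>lborel) / norm (X i)"
            by (intro divide_right_mono Bochner_Integration.integral_norm_bound) auto
          also have "\<dots> = (\<integral>Y. cmod (W Y * E (X i) Y) / norm (X i) \<partial>lborel)"
            by simp
          also have "\<dots> = (\<integral>Y. cmod (W Y) * (cmod (E (X i) Y) / norm (X i)) \<partial>lborel)"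
            by (simp add: norm_mult)
          finally show "norm (\<integral>Y. W Y * E (X i) Y \<partial>lborel) / norm (X i)
            \<le> (\<integral>Y. cmod (W Y) * (cmod (E (X i) Y) / norm (X i)) \<partial>lborel)" .
        qed
        show "(\<lambda>i. \<integral>Y. cmod (W Y) * (cmod (E (X i) Y) / norm (X i)) \<partial>lborel) \<longlonglongrightarrow> 0"
          using lim by simp
      qed
      then show "((\<lambda>v. norm (\<integral>Y. W Y * E v Y \<partial>lborel) / norm v) \<circ> X) \<longlonglongrightarrow> 0"
        by (simp add: comp_def)
    qed
  qed
qed

section \<open>Functionals on Gaussian atoms and on their superpositions\<close>

lemma Sigma1_dualD:
  assumes "u \<in> Sigma1_dual"
  shows "f \<in> Sigma1 \<Longrightarrow> g \<in> Sigma1 \<Longrightarrow> u (\<lambda>x. f x + g x) = u f + u g"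
    and "f \<in> Sigma1 \<Longrightarrow> u (\<lambda>x. c * f x) = c * u f"
    and "\<exists>h>0. \<exists>C\<ge>0. \<forall>f\<in>Sigma1. cmod (u f) \<le> C * sem h f"
proof -
  show "f \<in> Sigma1 \<Longrightarrow> g \<in> Sigma1 \<Longrightarrow> u (\<lambda>x. f x + g x) = u f + u g"
    "f \<in> Sigma1 \<Longrightarrow> u (\<lambda>x. c * f x) = c * u f"
    using assms unfolding Sigma1_dual_def by auto
  obtain h C where hC: "h > 0" "C \<ge> 0" "\<And>f. f \<in> Sigma1 \<Longrightarrow> ennreal (cmod (u f)) \<le> ennreal C * Sigma1_seminorm h f"
    using assms unfolding Sigma1_dual_def by auto
  have "cmod (u f) \<le> C * sem h f" if "f \<in> Sigma1" for f
  proof -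
    have "ennreal (cmod (u f)) \<le> ennreal (C * sem h f)"
      using hC(3)[OF that]
      by (simp only: ennreal_mult'[OF hC(2)] Sigma1_seminorm_eq_sem[OF that hC(1), symmetric])
    then show ?thesis
      using hC(2) by (subst (asm) ennreal_le_iff) auto
  qed
  with hC show "\<exists>h>0. \<exists>C\<ge>0. \<forall>f\<in>Sigma1. cmod (u f) \<le> C * sem h f"
    by blast
qed

lemma Sigma1_dual_diff:
  assumes "u \<in> Sigma1_dual" "f \<in> Sigma1" "(\<lambda>x. f x - g x) \<in> Sigma1" "g \<in> Sigma1"
  shows "u (\<lambda>x. f x - g x) = u f - u g"
  using Sigma1_dualD(1)[OF assms(1,3,4)] by simp

lemma gabor_gauss_Sigma1: "gabor gauss Y \<in> Sigma1"
  unfolding gabor_gauss_eq_gatom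
proof (rule tower_Sigma1[OF tower_gatom])
  fix h :: real assume "0 < h"
  obtain C c where "\<And>Y \<alpha> k s. cmod (mi_power s \<alpha> * gatom k (Y::'a \<times> 'a) s)
      \<le> h ^ (mi_abs \<alpha> + mi_abs k) * mi_fact \<alpha> * mi_fact k * (C * exp (c * norm Y))"
    using gatom_bounds[OF \<open>0 < h\<close>, where 'a='a] by metis
  then show "\<exists>C. \<forall>\<alpha> k s. cmod (mi_power s \<alpha> * gatom k Y s) \<le> h ^ (mi_abs \<alpha> + mi_abs k) * mi_fact \<alpha> * mi_fact k * C"
    by blast
qed

lemma gauss_Sigma1: "gauss \<in> Sigma1"
proof -
  have "gabor gauss (0, 0) = (gauss :: 'a \<Rightarrow> complex)"
    by (simp add: gabor_def)
  then show ?thesis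
    using gabor_gauss_Sigma1[of "(0, 0) :: 'a \<times> 'a"] by simp
qed

text \<open>A functional is controlled by one seminorm, and in every seminorm the atoms grow
  exponentially with the centre and are locally Lipschitz in it.\<close>

lemma dual_gabor_gauss:
  assumes u: "u \<in> Sigma1_dual"
  shows "\<exists>C\<ge>0. \<exists>c\<ge>0. \<forall>Y. cmod (u (gabor gauss Y)) \<le> C * exp (c * norm Y)"
    and "continuous_on UNIV (\<lambda>Y. u (gabor gauss Y))"
proof -
  obtain h D where h: "0 < h" "0 \<le> D" and D: "\<And>f. f \<in> Sigma1 \<Longrightarrow> cmod (u f) \<le> D * sem h f"
    using Sigma1_dualD(3)[OF u] by blast
  obtain C c where C: "0 \<le> C" "0 \<le> c" and b1: "\<And>Y \<alpha> k s. cmod (mi_power s \<alpha> * gatom k (Y::'a \<times> 'a) s)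
      \<le> h ^ (mi_abs \<alpha> + mi_abs k) * mi_fact \<alpha> * mi_fact k * (C * exp (c * norm Y))"
    and b2: "\<And>Y Y' \<alpha> k s. cmod (mi_power s \<alpha> * (gatom k Y s - gatom k (Y'::'a \<times> 'a) s))
        \<le> h ^ (mi_abs \<alpha> + mi_abs k) * mi_fact \<alpha> * mi_fact k * (C * norm (Y - Y') * exp (c * (norm Y + norm Y')))"
    using gatom_bounds[OF h(1), where 'a='a] by metis
  have sem_le: "sem h f \<le> B" if "Sigma1_seminorm h f \<le> ennreal B" "0 \<le> B" for f :: "'a \<Rightarrow> complex" and B
    using enn2real_mono[OF that(1)] that(2) by simp
  have "cmod (u (gabor gauss Y)) \<le> D * C * exp (c * norm Y)" for Y
  proof -
    have "sem h (gabor gauss Y) \<le> C * exp (c * norm Y)"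
      unfolding gabor_gauss_eq_gatom
      by (rule sem_le[OF tower_Sigma1_seminorm[OF tower_gatom h(1) b1]]) (use C in simp)
    then have "D * sem h (gabor gauss Y) \<le> D * (C * exp (c * norm Y))"
      using h by (intro mult_left_mono)
    then show ?thesis
      using D[OF gabor_gauss_Sigma1[of Y]] by (simp add: mult.assoc)
  qed
  then show "\<exists>C\<ge>0. \<exists>c\<ge>0. \<forall>Y. cmod (u (gabor gauss Y)) \<le> C * exp (c * norm Y)"
    using C h by (intro exI[of _ "D * C"] conjI exI[of _ c]) auto
  have "cmod (u (gabor gauss Y) - u (gabor gauss Y')) \<le> (D * C) * norm (Y - Y') * exp (c * (norm Y + norm Y'))" for Y Y'
  proof -
    let ?G = "\<lambda>k s. gatom k Y s - gatom k Y' s"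
    have tw: "tower ?G"
      by (rule tower_diff[OF tower_gatom tower_gatom])
    have S: "?G (\<lambda>_. 0) \<in> Sigma1"
    proof (rule tower_Sigma1[OF tw])
      fix h' :: real assume "0 < h'"
      obtain C c where "\<And>Y Y' \<alpha> k s. cmod (mi_power s \<alpha> * (gatom k Y s - gatom k (Y'::'a \<times> 'a) s))
        \<le> h' ^ (mi_abs \<alpha> + mi_abs k) * mi_fact \<alpha> * mi_fact k * (C * norm (Y - Y') * exp (c * (norm Y + norm Y')))"
        using gatom_bounds[OF \<open>0 < h'\<close>, where 'a='a] by metis
      then show "\<exists>C. \<forall>\<alpha> k s. cmod (mi_power s \<alpha> * ?G k s) \<le> h' ^ (mi_abs \<alpha> + mi_abs k) * mi_fact \<alpha> * mi_fact k * C"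
        by blast
    qed
    have "sem h (?G (\<lambda>_. 0)) \<le> C * norm (Y - Y') * exp (c * (norm Y + norm Y'))"
      by (rule sem_le[OF tower_Sigma1_seminorm[OF tw h(1) b2]]) (use C in simp)
    then have "D * sem h (?G (\<lambda>_. 0)) \<le> D * (C * norm (Y - Y') * exp (c * (norm Y + norm Y')))"
      using h by (intro mult_left_mono)
    moreover have "u (gabor gauss Y) - u (gabor gauss Y') = u (?G (\<lambda>_. 0))"
      using Sigma1_dual_diff[OF u gabor_gauss_Sigma1[of Y] _ gabor_gauss_Sigma1[of Y']] S
      unfolding gabor_gauss_eq_gatom by simp
    ultimately show ?thesis
      using D[OF S] by (simp add: mult.assoc)
  qed
  from continuous_on_if_exp_lipschitz[OF this] show "continuous_on UNIV (\<lambda>Y. u (gabor gauss Y))" .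
qed

text \<open>The algebraic case of the superposition principle, to which simple functions reduce the
  general one.\<close>

lemma finite_synthesis:
  fixes a :: "'a::euclidean_space \<times> 'a \<Rightarrow> complex"
  assumes "finite S"
  shows "(\<lambda>s. \<Sum>v\<in>S. a v * gatom (\<lambda>_. 0) v s) \<in> Sigma1"
    and "u \<in> Sigma1_dual \<Longrightarrow> u (\<lambda>s. \<Sum>v\<in>S. a v * gatom (\<lambda>_. 0) v s) = (\<Sum>v\<in>S. a v * u (gabor gauss v))"
proof -
  have mem: "(\<lambda>s. \<Sum>v\<in>S. a v * gatom (\<lambda>_. 0) v s) \<in> Sigma1" if "finite S" for S
  proof -
    have tw: "tower (\<lambda>k s. \<Sum>v\<in>S. a v * gatom k v s)"
      by (rule tower_sum[OF tower_gatom])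
    show ?thesis
    proof (rule tower_Sigma1[OF tw])
      fix h :: real assume "0 < h"
      obtain C c where b: "\<And>Y \<alpha> k s. cmod (mi_power s \<alpha> * gatom k (Y::'a \<times> 'a) s)
          \<le> h ^ (mi_abs \<alpha> + mi_abs k) * mi_fact \<alpha> * mi_fact k * (C * exp (c * norm Y))"
        using gatom_bounds[OF \<open>0 < h\<close>, where 'a='a] by metis
      have "cmod (mi_power s \<alpha> * (\<Sum>v\<in>S. a v * gatom k v s))
          \<le> h ^ (mi_abs \<alpha> + mi_abs k) * mi_fact \<alpha> * mi_fact k * (\<Sum>v\<in>S. cmod (a v) * (C * exp (c * norm v)))" for \<alpha> k s
      proof -
        have "mi_power s \<alpha> * (\<Sum>v\<in>S. a v * gatom k v s) = (\<Sum>v\<in>S. a v * (mi_power s \<alpha> * gatom k v s))"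
          by (simp add: sum_distrib_left mult_ac)
        then have "cmod (mi_power s \<alpha> * (\<Sum>v\<in>S. a v * gatom k v s)) \<le> (\<Sum>v\<in>S. cmod (a v) * cmod (mi_power s \<alpha> * gatom k v s))"
          by (simp only:) (intro sum_norm_le, simp add: norm_mult)
        also have "\<dots> \<le> (\<Sum>v\<in>S. cmod (a v) * (h ^ (mi_abs \<alpha> + mi_abs k) * mi_fact \<alpha> * mi_fact k * (C * exp (c * norm v))))"
          by (intro sum_mono mult_left_mono b) auto
        finally show ?thesis
          by (simp add: sum_distrib_left mult_ac)
      qed
      then show "\<exists>C. \<forall>\<alpha> k s. cmod (mi_power s \<alpha> * (\<Sum>v\<in>S. a v * gatom k v s))
          \<le> h ^ (mi_abs \<alpha> + mi_abs k) * mi_fact \<alpha> * mi_fact k * C"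
        by blast
    qed
  qed
  then show "(\<lambda>s. \<Sum>v\<in>S. a v * gatom (\<lambda>_. 0) v s) \<in> Sigma1"
    using assms by blast
  assume u: "u \<in> Sigma1_dual"
  show "u (\<lambda>s. \<Sum>v\<in>S. a v * gatom (\<lambda>_. 0) v s) = (\<Sum>v\<in>S. a v * u (gabor gauss v))"
    using assms
  proof (induction S rule: finite_induct)
    case empty
    have "u (\<lambda>x. 0 * gauss x) = 0 * u gauss"
      by (rule Sigma1_dualD(2)[OF u gauss_Sigma1])
    then show ?case by simp
  next
    case (insert v S)
    have 1: "u (\<lambda>s. a v * gabor gauss v s) = a v * u (gabor gauss v)"
      by (rule Sigma1_dualD(2)[OF u gabor_gauss_Sigma1])
    have "(\<lambda>s. a v * gabor gauss v s) \<in> Sigma1"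
      using mem[of "{v}"] by (simp add: gabor_gauss_eq_gatom)
    from Sigma1_dualD(1)[OF u this mem[OF insert(1)]] insert 1 show ?case
      by (simp add: gabor_gauss_eq_gatom)
  qed
qed

text \<open>
  The functional commutes with the superposition: approximate the identity by simple functions
  \<open>r\<close>, so that the superposition along \<open>r\<close> is a finite sum, and use the Lipschitz dependence
  of the atoms on their centres.
\<close>

theorem synthesis:
  fixes W :: "'c::euclidean_space \<Rightarrow> complex" and T :: "'c \<Rightarrow> 'a::euclidean_space \<times> 'a"
  assumes W: "rapid W" and [measurable]: "W \<in> borel_measurable borel" "T \<in> borel_measurable borel"
    and T: "\<And>Y. norm (T Y) \<le> norm Y"
  shows "(\<lambda>s. \<integral>Y. W Y * gabor gauss (T Y) s \<partial>lborel) \<in> Sigma1"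
    and "u \<in> Sigma1_dual \<Longrightarrow> integrable lborel (\<lambda>Y. W Y * u (gabor gauss (T Y)))"
    and "u \<in> Sigma1_dual \<Longrightarrow> u (\<lambda>s. \<integral>Y. W Y * gabor gauss (T Y) s \<partial>lborel) = (\<integral>Y. W Y * u (gabor gauss (T Y)) \<partial>lborel)"
proof -
  note Wm = W \<open>W \<in> borel_measurable borel\<close>
  have T2: "norm (T Y) \<le> 2 * norm Y" for Y
    using T[of Y] norm_ge_zero[of Y] by linarith
  let ?T = "\<lambda>(r :: 'c \<Rightarrow> 'a \<times> 'a) k s. \<integral>Y. W Y * gatom k (r Y) s \<partial>lborel"
  have mem: "?T r (\<lambda>_. 0) \<in> Sigma1" if [measurable]: "r \<in> borel_measurable borel" and r: "\<And>Y. norm (r Y) \<le> 2 * norm Y"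
    for r :: "'c \<Rightarrow> 'a \<times> 'a"
  proof (rule tower_Sigma1[OF tower_synthesis[OF Wm that]])
    fix h :: real assume "0 < h"
    obtain C c where C: "0 \<le> C" "0 \<le> c" and b: "\<And>Y \<alpha> k s. cmod (mi_power s \<alpha> * gatom k (Y::'a \<times> 'a) s)
        \<le> h ^ (mi_abs \<alpha> + mi_abs k) * mi_fact \<alpha> * mi_fact k * (C * exp (c * norm Y))"
      using gatom_bounds[OF \<open>0 < h\<close>, where 'a='a] by metis
    have "cmod (mi_power s \<alpha> * ?T r k s) \<le> h ^ (mi_abs \<alpha> + mi_abs k) * mi_fact \<alpha> * mi_fact k
        * (\<integral>Y. C * (cmod (W Y) * exp (2 * c * norm Y)) \<partial>lborel)" for \<alpha> k s
    proof -
      let ?w = "h ^ (mi_abs \<alpha> + mi_abs k) * mi_fact \<alpha> * mi_fact k"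
      have w: "0 \<le> ?w"
        using \<open>0 < h\<close> mi_fact_pos[of \<alpha>] mi_fact_pos[of k] by simp
      have "mi_power s \<alpha> * ?T r k s = (\<integral>Y. W Y * (mi_power s \<alpha> * gatom k (r Y) s) \<partial>lborel)"
        by (subst integral_mult_right_zero[symmetric]) (simp add: mult_ac)
      moreover have "cmod (\<integral>Y. W Y * (mi_power s \<alpha> * gatom k (r Y) s) \<partial>lborel) \<le> (\<integral>Y. ?w * (C * (cmod (W Y) * exp (2 * c * norm Y))) \<partial>lborel)"
      proof (rule Bochner_Integration.integral_norm_bound_integral)
        have "integrable lborel (\<lambda>Y. mi_power s \<alpha> * (W Y * gatom k (r Y) s))"
          by (rule integrable_mult_right[OF synthesis_integrable[OF Wm that]])
        then show "integrable lborel (\<lambda>Y. W Y * (mi_power s \<alpha> * gatom k (r Y) s))"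
          by (simp add: mult_ac)
        show "integrable lborel (\<lambda>Y. ?w * (C * (cmod (W Y) * exp (2 * c * norm Y))))"
          using integrable_mult_right[OF integrable_mult_right[OF rapid_integrable_exp[OF W]]] by simp
        fix Y
        have "c * norm (r Y) \<le> 2 * c * norm Y"
          using mult_left_mono[OF r[of Y] C(2)] by simp
        then have "?w * (C * exp (c * norm (r Y))) \<le> ?w * (C * exp (2 * c * norm Y))"
          using C w by (intro mult_left_mono) auto
        then have "cmod (mi_power s \<alpha> * gatom k (r Y) s) \<le> ?w * (C * exp (2 * c * norm Y))"
          using b[of s \<alpha> k "r Y"] by linarith
        then have "cmod (W Y) * cmod (mi_power s \<alpha> * gatom k (r Y) s) \<le> cmod (W Y) * (?w * (C * exp (2 * c * norm Y)))"
          by (intro mult_left_mono) auto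
        then show "cmod (W Y * (mi_power s \<alpha> * gatom k (r Y) s)) \<le> ?w * (C * (cmod (W Y) * exp (2 * c * norm Y)))"
          by (simp add: norm_mult mult_ac)
      qed
      ultimately show ?thesis
        by (simp del: of_real_mult)
    qed
    then show "\<exists>C. \<forall>\<alpha> k s. cmod (mi_power s \<alpha> * ?T r k s) \<le> h ^ (mi_abs \<alpha> + mi_abs k) * mi_fact \<alpha> * mi_fact k * C"
      by blast
  qed
  have S: "?T T (\<lambda>_. 0) \<in> Sigma1"
    by (rule mem) (use T2 in auto)
  then show "(\<lambda>s. \<integral>Y. W Y * gabor gauss (T Y) s \<partial>lborel) \<in> Sigma1"
    by (simp add: gabor_gauss_eq_gatom)
  assume u: "u \<in> Sigma1_dual"
  define v where "v Y = u (gabor gauss Y)" for Y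
  have vc: "continuous_on UNIV v"
    unfolding v_def by (rule dual_gabor_gauss(2)[OF u])
  then have [measurable]: "v \<in> borel_measurable borel"
    by (rule borel_measurable_continuous_onI)
  obtain A a where A: "0 \<le> A" "0 \<le> a" and va: "\<And>Y. cmod (v Y) \<le> A * exp (a * norm Y)"
    using dual_gabor_gauss(1)[OF u] unfolding v_def by metis
  have "cmod (v (T Y)) \<le> A * exp (a * norm Y)" for Y
  proof -
    have "A * exp (a * norm (T Y)) \<le> A * exp (a * norm Y)"
      using A T by (intro mult_left_mono) (auto intro: mult_left_mono)
    then show ?thesis using va[of "T Y"] by linarith
  qed
  then have vI: "integrable lborel (\<lambda>Y. W Y * v (T Y))"
    by (rule rapid_integrable_mult[OF W, rotated 2]) auto
  then show "integrable lborel (\<lambda>Y. W Y * u (gabor gauss (T Y)))"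
    by (simp add: v_def)
  \<comment> \<open>The simple functions stay within twice the norm of \<open>T Y\<close>, which
    gives one integrable majorant for all \<open>i\<close>.\<close>
  obtain r where r: "\<And>i. simple_function lborel (r i)" "\<And>Y. (\<lambda>i. r i Y) \<longlonglongrightarrow> T Y"
    "\<And>i Y. dist (r i Y) 0 \<le> 2 * dist (T Y) (0::'a \<times> 'a)"
    using borel_measurable_implies_sequence_metric[of T lborel 0] by auto
  have [measurable]: "r i \<in> borel_measurable borel" for i
    using borel_measurable_simple_function[OF r(1)] by simp
  have rn: "norm (r i Y) \<le> 2 * norm Y" for i Y
    using r(3)[of i Y] T[of Y] by simp
  have fin: "finite (range (r i))" for i
    using r(1)[of i] by (auto simp: simple_function_def)
  have WI: "integrable lborel W"
    by (rule rapid_integrable[OF W]) simp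
  \<comment> \<open>The integral of \<open>W\<close> over the level set of \<open>r i\<close> with
    value \<open>y\<close>: the superposition along \<open>r i\<close> is the finite sum with these
    coefficients.\<close>
  define al where "al i y = (\<integral>Y. W Y * indicator (r i -` {y}) Y \<partial>lborel)" for i y
  have split_sum: "(\<integral>Y. W Y * F (r i Y) \<partial>lborel) = (\<Sum>y\<in>range (r i). al i y * F y)" for i and F :: "'a \<times> 'a \<Rightarrow> complex"
  proof -
    have "(\<integral>Y. W Y * F (r i Y) \<partial>lborel) = (\<integral>Y. (\<Sum>y\<in>range (r i). (W Y * indicator (r i -` {y}) Y) * F y) \<partial>lborel)"
    proof (intro Bochner_Integration.integral_cong refl)
      fix Y
      have "(\<Sum>y\<in>range (r i). (W Y * indicator (r i -` {y}) Y) * F y) = (\<Sum>y\<in>range (r i). if y = r i Y then W Y * F y else 0)"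
        by (intro sum.cong) (auto simp: indicator_def)
      then show "W Y * F (r i Y) = (\<Sum>y\<in>range (r i). (W Y * indicator (r i -` {y}) Y) * F y)"
        using fin by simp
    qed
    also have "\<dots> = (\<Sum>y\<in>range (r i). al i y * F y)"
    proof (subst Bochner_Integration.integral_sum)
      have m: "r i -` {y} \<in> sets borel" for y
        using measurable_sets[of "r i" borel borel "{y}"] by simp
      show "integrable lborel (\<lambda>Y. W Y * indicator (r i -` {y}) Y * F y)" for y
        by (intro integrable_mult_left Bochner_Integration.integrable_bound[OF WI])
          (use m in \<open>auto simp: norm_mult split: split_indicator\<close>)
    qed (simp add: al_def)
    finally show ?thesis .
  qed
  have step: "u (?T (r i) (\<lambda>_. 0)) = (\<integral>Y. W Y * v (r i Y) \<partial>lborel)" for i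
  proof -
    have "?T (r i) (\<lambda>_. 0) = (\<lambda>s. \<Sum>y\<in>range (r i). al i y * gatom (\<lambda>_. 0) y s)"
    proof
      fix s
      show "?T (r i) (\<lambda>_. 0) s = (\<Sum>y\<in>range (r i). al i y * gatom (\<lambda>_. 0) y s)"
        using split_sum[of "\<lambda>y. gatom (\<lambda>_. 0) y s" i] by simp
    qed
    then show ?thesis
      using finite_synthesis(2)[OF fin[of i] u, of "al i"] split_sum[of v i] by (simp add: v_def)
  qed
  have lim1: "(\<lambda>i. \<integral>Y. W Y * v (r i Y) \<partial>lborel) \<longlonglongrightarrow> (\<integral>Y. W Y * v (T Y) \<partial>lborel)"
  proof (rule integral_dominated_convergence[where w="\<lambda>Y. A * (cmod (W Y) * exp (2 * a * norm Y))"])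
    show "integrable lborel (\<lambda>Y. A * (cmod (W Y) * exp (2 * a * norm Y)))"
      by (rule integrable_mult_right[OF rapid_integrable_exp[OF W]]) simp
    show "AE Y in lborel. (\<lambda>i. W Y * v (r i Y)) \<longlonglongrightarrow> W Y * v (T Y)"
    proof (rule AE_I2)
      fix Y
      have "isCont v (T Y)"
        using vc continuous_on_eq_continuous_at[OF open_UNIV] by blast
      then have "(\<lambda>i. v (r i Y)) \<longlonglongrightarrow> v (T Y)"
        by (rule isCont_tendsto_compose[OF _ r(2)])
      then show "(\<lambda>i. W Y * v (r i Y)) \<longlonglongrightarrow> W Y * v (T Y)"
        by (intro tendsto_intros)
    qed
    show "AE Y in lborel. norm (W Y * v (r i Y)) \<le> A * (cmod (W Y) * exp (2 * a * norm Y))" for i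
    proof (rule AE_I2)
      fix Y
      have "a * norm (r i Y) \<le> 2 * a * norm Y"
        using mult_left_mono[OF rn[of i Y] A(2)] by simp
      then have "A * exp (a * norm (r i Y)) \<le> A * exp (2 * a * norm Y)"
        using A by (intro mult_left_mono) auto
      then have "cmod (W Y) * cmod (v (r i Y)) \<le> cmod (W Y) * (A * exp (2 * a * norm Y))"
        using va[of "r i Y"] by (intro mult_left_mono) auto
      then show "norm (W Y * v (r i Y)) \<le> A * (cmod (W Y) * exp (2 * a * norm Y))"
        by (simp add: norm_mult mult_ac)
    qed
  qed auto
  obtain h D where h: "0 < h" "0 \<le> D" and D: "\<And>f. f \<in> Sigma1 \<Longrightarrow> cmod (u f) \<le> D * sem h f"
    using Sigma1_dualD(3)[OF u] by blast
  obtain C c where C: "0 \<le> C" "0 \<le> c"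
    and b2: "\<And>Y Y' \<alpha> k s. cmod (mi_power s \<alpha> * (gatom k Y s - gatom k (Y'::'a \<times> 'a) s))
        \<le> h ^ (mi_abs \<alpha> + mi_abs k) * mi_fact \<alpha> * mi_fact k * (C * norm (Y - Y') * exp (c * (norm Y + norm Y')))"
    using gatom_bounds[OF h(1), where 'a='a] by metis
  define dom where "dom Y = 3 * C * (cmod (W Y) * exp ((3 * c + 1) * norm Y))" for Y
  have domI: "integrable lborel dom"
    unfolding dom_def by (rule integrable_mult_right[OF rapid_integrable_exp[OF W]]) simp
  \<comment> \<open>The pointwise error, measured in the single seminorm \<open>h\<close> that
    controls \<open>u\<close>; it tends to 0 as \<open>r i Y\<close> approaches \<open>T Y\<close>
    and stays below \<open>dom\<close>.\<close>
  define e where "e i Y = cmod (W Y) * (C * norm (T Y - r i Y) * exp (c * (norm (T Y) + norm (r i Y))))" for i Y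
  have e0: "0 \<le> e i Y" for i Y
    using C by (simp add: e_def)
  have [measurable]: "e i \<in> borel_measurable borel" for i
    unfolding e_def by measurable
  have e_dom: "e i Y \<le> dom Y" for i Y
  proof -
    have "norm (T Y - r i Y) * exp (c * (norm (T Y) + norm (r i Y))) \<le> (3 * exp (norm Y)) * exp (3 * c * norm Y)"
    proof (rule mult_mono)
      have "norm (T Y - r i Y) \<le> 3 * norm Y"
        using norm_triangle_ineq4[of "T Y" "r i Y"] rn[of i Y] T[of Y] by linarith
      also have "\<dots> \<le> 3 * exp (norm Y)"
        using exp_ge_add_one_self[of "norm Y"] by linarith
      finally show "norm (T Y - r i Y) \<le> 3 * exp (norm Y)" .
      have "c * (norm (T Y) + norm (r i Y)) \<le> c * (3 * norm Y)"
        using C(2) rn[of i Y] T[of Y] by (intro mult_left_mono) auto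
      then show "exp (c * (norm (T Y) + norm (r i Y))) \<le> exp (3 * c * norm Y)"
        by (simp add: mult_ac)
    qed auto
    also have "\<dots> = 3 * exp ((3 * c + 1) * norm Y)"
      by (simp add: exp_add[symmetric] algebra_simps)
    finally have "(cmod (W Y) * C) * (norm (T Y - r i Y) * exp (c * (norm (T Y) + norm (r i Y)))) \<le> (cmod (W Y) * C) * (3 * exp ((3 * c + 1) * norm Y))"
      using C by (intro mult_left_mono) auto
    then show ?thesis
      unfolding e_def dom_def by (simp add: mult_ac)
  qed
  have eI: "integrable lborel (e i)" for i
  proof (rule Bochner_Integration.integrable_bound[OF domI])
    show "AE Y in lborel. norm (e i Y) \<le> norm (dom Y)"
      unfolding real_norm_def
      by (intro AE_I2) (metis e0 e_dom abs_of_nonneg order_trans)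
  qed simp
  have elim: "(\<lambda>i. \<integral>Y. e i Y \<partial>lborel) \<longlonglongrightarrow> (\<integral>Y. 0 \<partial>(lborel::'c measure))"
  proof (rule integral_dominated_convergence[where w=dom])
    show "AE Y in lborel. (\<lambda>i. e i Y) \<longlonglongrightarrow> 0"
    proof (rule AE_I2)
      fix Y
      have "(\<lambda>i. e i Y) \<longlonglongrightarrow> cmod (W Y) * (C * norm (T Y - T Y) * exp (c * (norm (T Y) + norm (T Y))))"
        unfolding e_def by (intro tendsto_intros r(2))
      then show "(\<lambda>i. e i Y) \<longlonglongrightarrow> 0" by simp
    qed
    show "AE Y in lborel. norm (e i Y) \<le> dom Y" for i
      unfolding real_norm_def
      by (intro AE_I2) (metis e0 e_dom abs_of_nonneg)
  qed (use domI in auto)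
  have diff: "cmod (u (?T T (\<lambda>_. 0)) - u (?T (r i) (\<lambda>_. 0))) \<le> D * (\<integral>Y. e i Y \<partial>lborel)" for i
  proof -
    let ?G = "\<lambda>k s. ?T T k s - ?T (r i) k s"
    note id = \<open>T \<in> borel_measurable borel\<close> T2
    have tw: "tower ?G"
      by (intro tower_diff tower_synthesis[OF Wm] id rn) auto
    have Sr: "?T (r i) (\<lambda>_. 0) \<in> Sigma1"
      by (rule mem) (use rn in auto)
    have G_eq: "?G k s = (\<integral>Y. W Y * (gatom k (T Y) s - gatom k (r i Y) s) \<partial>lborel)" for k s
      unfolding right_diff_distrib
      by (subst Bochner_Integration.integral_diff) (auto intro!: synthesis_integrable[OF Wm] rn T2)
    have Gb: "cmod (mi_power s \<alpha> * ?G k s) \<le> h ^ (mi_abs \<alpha> + mi_abs k) * mi_fact \<alpha> * mi_fact k * (\<integral>Y. e i Y \<partial>lborel)" for \<alpha> k s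
    proof -
      let ?w = "h ^ (mi_abs \<alpha> + mi_abs k) * mi_fact \<alpha> * mi_fact k"
      have "mi_power s \<alpha> * ?G k s = (\<integral>Y. W Y * (mi_power s \<alpha> * (gatom k (T Y) s - gatom k (r i Y) s)) \<partial>lborel)"
        unfolding G_eq by (subst integral_mult_right_zero[symmetric]) (simp add: mult_ac)
      moreover have "cmod (\<integral>Y. W Y * (mi_power s \<alpha> * (gatom k (T Y) s - gatom k (r i Y) s)) \<partial>lborel) \<le> (\<integral>Y. ?w * e i Y \<partial>lborel)"
      proof (rule Bochner_Integration.integral_norm_bound_integral)
        have "integrable lborel (\<lambda>Y. mi_power s \<alpha> * (W Y * gatom k (T Y) s - W Y * gatom k (r i Y) s))"
          using rn T2 by (intro integrable_mult_right Bochner_Integration.integrable_diff synthesis_integrable[OF Wm]) auto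
        then show "integrable lborel (\<lambda>Y. W Y * (mi_power s \<alpha> * (gatom k (T Y) s - gatom k (r i Y) s)))"
          by (simp add: algebra_simps)
        show "integrable lborel (\<lambda>Y. ?w * e i Y)"
          by (rule integrable_mult_right[OF eI])
        show "cmod (W Y * (mi_power s \<alpha> * (gatom k (T Y) s - gatom k (r i Y) s))) \<le> ?w * e i Y" for Y
          using mult_left_mono[OF b2[of s \<alpha> k "T Y" "r i Y"], of "cmod (W Y)"]
          unfolding e_def by (simp add: norm_mult mult_ac)
      qed
      ultimately show ?thesis by simp
    qed
    \<comment> \<open>Linearity of \<open>u\<close> is available only on \<open>Sigma1\<close>, so
      the difference itself has to be a member. That takes finiteness in every seminorm, for which
      the sum of the two seminorms serves; smallness matters only for the fixed
      \<open>h\<close>.\<close>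
    have "?G (\<lambda>_. 0) \<in> Sigma1"
    proof (rule tower_Sigma1[OF tw])
      fix h' :: real assume h': "0 < h'"
      have single: "cmod (mi_power s \<alpha> * ?T q k s) \<le> h' ^ (mi_abs \<alpha> + mi_abs k) * mi_fact \<alpha> * mi_fact k * sem h' (?T q (\<lambda>_. 0))"
        if q: "q \<in> borel_measurable borel" "\<And>Y. norm (q Y) \<le> 2 * norm Y" for q :: "'c \<Rightarrow> 'a \<times> 'a" and \<alpha> k s
      proof -
        let ?k = "\<lambda>b. if b \<in> Basis then k b else 0"
        have gk: "gatom ?k Y s = gatom k Y s" for Y
          unfolding gatom_def by (intro prod.cong) auto
        have "partial k (?T q (\<lambda>_. 0)) = ?T q ?k"
          by (rule tower_partial[OF tower_synthesis[OF Wm q], of k])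
        then have "partial k (?T q (\<lambda>_. 0)) s = ?T q k s"
          by (simp only: gk)
        then show ?thesis
          using sem_bound[OF mem[OF q] h', of s \<alpha> k] by (simp only: mult_ac)
      qed
      have "cmod (mi_power s \<alpha> * ?G k s) \<le> h' ^ (mi_abs \<alpha> + mi_abs k) * mi_fact \<alpha> * mi_fact k
          * (sem h' (?T T (\<lambda>_. 0)) + sem h' (?T (r i) (\<lambda>_. 0)))" for \<alpha> k s
      proof -
        have "cmod (mi_power s \<alpha> * ?G k s) \<le> cmod (mi_power s \<alpha> * ?T T k s) + cmod (mi_power s \<alpha> * ?T (r i) k s)"
          unfolding right_diff_distrib by (rule norm_triangle_ineq4)
        also have "\<dots> \<le> h' ^ (mi_abs \<alpha> + mi_abs k) * mi_fact \<alpha> * mi_fact k * sem h' (?T T (\<lambda>_. 0))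
            + h' ^ (mi_abs \<alpha> + mi_abs k) * mi_fact \<alpha> * mi_fact k * sem h' (?T (r i) (\<lambda>_. 0))"
          by (intro add_mono single id rn) auto
        finally show ?thesis
          by (simp only: distrib_left)
      qed
      then show "\<exists>C. \<forall>\<alpha> k s. cmod (mi_power s \<alpha> * ?G k s) \<le> h' ^ (mi_abs \<alpha> + mi_abs k) * mi_fact \<alpha> * mi_fact k * C"
        by blast
    qed
    then have GS: "(\<lambda>s. ?T T (\<lambda>_. 0) s - ?T (r i) (\<lambda>_. 0) s) \<in> Sigma1" .
    have "sem h (?G (\<lambda>_. 0)) \<le> (\<integral>Y. e i Y \<partial>lborel)"
      using enn2real_mono[OF tower_Sigma1_seminorm[OF tw h(1) Gb]] e0
      by (simp add: Bochner_Integration.integral_nonneg)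
    then have "D * sem h (?G (\<lambda>_. 0)) \<le> D * (\<integral>Y. e i Y \<partial>lborel)"
      using h by (intro mult_left_mono)
    then show ?thesis
      using D[OF GS] unfolding Sigma1_dual_diff[OF u S GS Sr] by linarith
  qed
  have "(\<lambda>i. u (?T T (\<lambda>_. 0)) - (\<integral>Y. W Y * v (r i Y) \<partial>lborel)) \<longlonglongrightarrow> 0"
  proof (rule Lim_null_comparison)
    show "\<forall>\<^sub>F i in sequentially. cmod (u (?T T (\<lambda>_. 0)) - (\<integral>Y. W Y * v (r i Y) \<partial>lborel)) \<le> D * (\<integral>Y. e i Y \<partial>lborel)"
      using diff unfolding step by simp
    show "(\<lambda>i. D * (\<integral>Y. e i Y \<partial>lborel)) \<longlonglongrightarrow> 0"
      using tendsto_mult_right_zero[of "\<lambda>i. \<integral>Y. e i Y \<partial>lborel" sequentially D] elim by simp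
  qed
  moreover have "(\<lambda>i. u (?T T (\<lambda>_. 0)) - (\<integral>Y. W Y * v (r i Y) \<partial>lborel)) \<longlonglongrightarrow> u (?T T (\<lambda>_. 0)) - (\<integral>Y. W Y * v (T Y) \<partial>lborel)"
    by (intro tendsto_intros lim1)
  ultimately have "u (?T T (\<lambda>_. 0)) - (\<integral>Y. W Y * v (T Y) \<partial>lborel) = 0"
    using LIMSEQ_unique by blast
  then show "u (\<lambda>s. \<integral>Y. W Y * gabor gauss (T Y) s \<partial>lborel) = (\<integral>Y. W Y * u (gabor gauss (T Y)) \<partial>lborel)"
    by (simp add: gabor_gauss_eq_gatom v_def)
qed

subsection \<open>Changing the window\<close>

text \<open>The constant of \<open>coef_inversion\<close>: a power of \<open>2 * pi\<close> times
  the squared \<open>L^2\<close> norm of the window.\<close>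

definition cnst :: "('a::euclidean_space \<Rightarrow> complex) \<Rightarrow> complex" where
  "cnst \<phi> = of_real ((2 * pi) ^ DIM('a)) * (\<integral>v. \<phi> v * cnj (\<phi> v) \<partial>lborel)"

text \<open>A vanishing norm makes the open set where \<open>\<phi>\<close> is nonzero a null set,
  hence empty.\<close>

lemma cnst_nonzero:
  fixes \<phi> :: "'a::euclidean_space \<Rightarrow> complex"
  assumes \<phi>: "\<phi> \<in> Sigma1" "\<phi> \<noteq> (\<lambda>_. 0)"
  shows "cnst \<phi> \<noteq> 0"
proof
  assume "cnst \<phi> = 0"
  then have 0: "(\<integral>v. \<phi> v * cnj (\<phi> v) \<partial>lborel) = 0"
    by (simp add: cnst_def)
  have [measurable]: "\<phi> \<in> borel_measurable borel"
    by (rule Sigma1_measurable[OF \<phi>(1)])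
  obtain B where B: "0 \<le> B" "\<And>x. cmod (\<phi> x) \<le> B"
    using rapid_bounded[OF Sigma1_rapid[OF \<phi>(1)]] by blast
  have I: "integrable lborel (\<lambda>v. \<phi> v * cnj (\<phi> v))"
    by (rule rapid_integrable_mult[OF Sigma1_rapid[OF \<phi>(1)], where A=B and c=0]) (use B in auto)
  have eq: "\<phi> v * cnj (\<phi> v) = of_real ((cmod (\<phi> v))\<^sup>2)" for v
    by (simp add: complex_norm_square[symmetric])
  have I': "integrable lborel (\<lambda>v. (cmod (\<phi> v))\<^sup>2)"
    using integrable_norm[OF I] unfolding eq by (simp add: norm_power)
  have "(\<integral>v. (cmod (\<phi> v))\<^sup>2 \<partial>lborel) = 0"
    using 0 unfolding eq by (simp only: integral_complex_of_real of_real_eq_0_iff)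
  then have "AE v in lborel. (cmod (\<phi> v))\<^sup>2 = 0"
    using integral_nonneg_eq_0_iff_AE[OF I'] by simp
  then have "AE v in lborel. \<not> \<phi> v \<noteq> 0"
    by simp
  then have "{v. \<phi> v \<noteq> 0} \<in> null_sets lborel"
    using AE_iff_null[of lborel "\<lambda>v. \<not> \<phi> v \<noteq> 0"] by simp
  then have "negligible {v. \<phi> v \<noteq> 0}"
    unfolding negligible_iff_null_sets by (rule null_sets_completionI)
  moreover have "open {v. \<phi> v \<noteq> 0}"
    using Sigma1_continuous[OF \<phi>(1)] by (intro open_Collect_neq continuous_on_const)
  ultimately have "{v. \<phi> v \<noteq> 0} = {}"
    using open_not_negligible by blast
  then show False
    using \<phi>(2) by auto
qed

lemma gauss_nonzero: "gauss \<noteq> (\<lambda>_. 0)"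
proof
  assume "gauss = (\<lambda>_::'a. 0)"
  then have "gauss (0::'a) = 0" by metis
  then show False by (simp add: gauss_def)
qed

lemma rapid_translate:
  fixes g :: "'a::real_normed_vector \<Rightarrow> complex"
  assumes "rapid g"
  shows "rapid (\<lambda>x. g (x - a))"
proof (rule rapidI)
  fix N :: real assume "0 < N"
  obtain C where C: "0 \<le> C" "\<And>x. cmod (g x) \<le> C * exp (- (N * norm x))"
    using rapidE[OF assms] by blast
  have "cmod (g (x - a)) \<le> C * exp (N * norm a) * exp (- (N * norm x))" for x
  proof -
    have "N * norm x \<le> N * (norm (x - a) + norm a)"
      using \<open>0 < N\<close> norm_triangle_ineq[of "x - a" a] by (intro mult_left_mono) auto
    then have "C * exp (- (N * norm (x - a))) \<le> C * exp (N * norm a - N * norm x)"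
      using C(1) by (intro mult_left_mono) (auto simp: algebra_simps)
    then show ?thesis
      using C(2)[of "x - a"] by (simp add: exp_diff exp_minus divide_inverse mult.assoc)
  qed
  then show "\<exists>C. \<forall>x. cmod (g (x - a)) \<le> C * exp (- (N * norm x))"
    by blast
qed

lemma rapid_cong_norm:
  assumes "rapid g" "\<And>x. cmod (f x) = cmod (g x)"
  shows "rapid f"
  using assms unfolding rapid_def by simp

lemma rapid_cmult: "rapid g \<Longrightarrow> rapid (\<lambda>x. c * g x)"
  unfolding rapid_def
proof
  fix N
  assume "\<forall>N. \<exists>C\<ge>0. \<forall>x. cmod (g x) \<le> C * exp (- (N * norm x))"
  then obtain C where "0 \<le> C" "\<And>x. cmod (g x) \<le> C * exp (- (N * norm x))" by blast
  then show "\<exists>C\<ge>0. \<forall>x. cmod (c * g x) \<le> C * exp (- (N * norm x))"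
    by (intro exI[of _ "cmod c * C"]) (auto simp: norm_mult mult.assoc intro!: mult_left_mono)
qed

text \<open>Covariance under time-frequency shifts, by translating the integration variable. Up to a
  phase the coefficients depend only on \<open>Y - X\<close>, which turns the comparison of windows
  into a convolution.\<close>

lemma coef_gabor:
  fixes \<phi> \<psi> :: "'a::euclidean_space \<Rightarrow> complex"
  assumes [measurable]: "\<phi> \<in> borel_measurable borel" "\<psi> \<in> borel_measurable borel"
  shows "coef \<psi> (gabor \<phi> X) Y = cis (fst X \<bullet> (snd Y - snd X)) * coef \<psi> (\<lambda>t. cnj (\<phi> t)) (Y - X)"
proof -
  let ?F = "\<lambda>t. cnj (\<phi> (t - fst X)) * cis (- (t \<bullet> snd X)) * \<psi> (t - fst Y) * cis (t \<bullet> snd Y)"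
  have "coef \<psi> (gabor \<phi> X) Y = (\<integral>t. ?F t \<partial>lborel)"
    by (simp add: coef_def gabor_def)
  also have "\<dots> = (\<integral>t. ?F (t + fst X) \<partial>lborel)"
    by (rule lborel_integral_translate(1)[symmetric]) measurable
  also have "\<dots> = (\<integral>t. cis (fst X \<bullet> (snd Y - snd X)) * (cnj (\<phi> t) * \<psi> (t - fst (Y - X)) * cis (t \<bullet> snd (Y - X))) \<partial>lborel)"
  proof (intro Bochner_Integration.integral_cong refl)
    fix t
    have "cis (- ((t + fst X) \<bullet> snd X)) * cis ((t + fst X) \<bullet> snd Y) = cis (fst X \<bullet> (snd Y - snd X)) * cis (t \<bullet> snd (Y - X))"
      by (simp add: cis_mult inner_add_left inner_diff_right algebra_simps)
    then show "?F (t + fst X) = cis (fst X \<bullet> (snd Y - snd X)) * (cnj (\<phi> t) * \<psi> (t - fst (Y - X)) * cis (t \<bullet> snd (Y - X)))"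
      by (simp add: algebra_simps)
  qed
  also have "\<dots> = cis (fst X \<bullet> (snd Y - snd X)) * coef \<psi> (\<lambda>t. cnj (\<phi> t)) (Y - X)"
    unfolding coef_def by (rule integral_mult_right_zero)
  finally show ?thesis .
qed

text \<open>Up to \<open>cnst gauss\<close>, such a function is the superposition of Gaussian atoms
  with its own coefficients; \<open>synthesis\<close> puts the superposition into
  \<open>Sigma1\<close> and lets functionals pass through. This spares any estimate of derivatives
  for conjugates and time-frequency shifts.\<close>

lemma Sigma1_rapid_criterion:
  fixes g :: "'a::euclidean_space \<Rightarrow> complex"
  assumes g: "continuous_on UNIV g" "rapid g" "rapid (coef gauss g)"
  shows "g \<in> Sigma1"
    and "u \<in> Sigma1_dual \<Longrightarrow> cnst (gauss :: 'a \<Rightarrow> complex) * u g = (\<integral>Y. coef gauss g Y * u (gabor gauss Y) \<partial>lborel)"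
proof -
  let ?k = "cnst (gauss :: 'a \<Rightarrow> complex)"
  have k: "?k \<noteq> 0"
    by (rule cnst_nonzero[OF gauss_Sigma1 gauss_nonzero])
  have [measurable]: "g \<in> borel_measurable borel"
    by (rule borel_measurable_continuous_onI[OF g(1)])
  have m: "coef gauss g \<in> borel_measurable borel"
    by measurable
  have eq: "(\<integral>Y. coef gauss g Y * gabor gauss Y s \<partial>lborel) = ?k * g s" for s
    using coef_inversion[OF g(1,2) continuous_on_gauss rapid_gauss g(3)] by (simp add: cnst_def)
  have "(\<integral>Y. (1 / ?k * coef gauss g Y) * gabor gauss Y s \<partial>lborel) = g s" for s
  proof -
    have "(\<integral>Y. (1 / ?k * coef gauss g Y) * gabor gauss Y s \<partial>lborel)
      = (\<integral>Y. 1 / ?k * (coef gauss g Y * gabor gauss Y s) \<partial>lborel)"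
      by (simp only: mult.assoc)
    also have "\<dots> = 1 / ?k * (?k * g s)"
      by (subst integral_mult_right_zero) (simp only: eq)
    finally show ?thesis using k by simp
  qed
  then show S: "g \<in> Sigma1"
    using synthesis(1)[where T="\<lambda>Y. Y", OF rapid_cmult[OF g(3)], of "1 / ?k"] by simp
  assume u: "u \<in> Sigma1_dual"
  have "u (\<lambda>s. \<integral>Y. coef gauss g Y * gabor gauss Y s \<partial>lborel) = (\<integral>Y. coef gauss g Y * u (gabor gauss Y) \<partial>lborel)"
    by (rule synthesis(3)[where T="\<lambda>Y. Y", OF g(3) m _ _ u]) simp_all
  then show "?k * u g = (\<integral>Y. coef gauss g Y * u (gabor gauss Y) \<partial>lborel)"
    by (simp add: eq Sigma1_dualD(2)[OF u S])
qed

lemmas Sigma1_dual_expansion =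
  Sigma1_rapid_criterion(2)[OF Sigma1_continuous Sigma1_rapid rapid_coef[OF _ gauss_Sigma1]]

text \<open>The Gaussian is real, so conjugating the function conjugates its coefficients and
  reverses the frequency variable, which leaves norms unchanged.\<close>

lemma Sigma1_cnj:
  fixes \<phi> :: "'a::euclidean_space \<Rightarrow> complex"
  assumes \<phi>: "\<phi> \<in> Sigma1"
  shows "(\<lambda>t. cnj (\<phi> t)) \<in> Sigma1"
proof (rule Sigma1_rapid_criterion(1))
  show "continuous_on UNIV (\<lambda>t. cnj (\<phi> t))"
    by (intro continuous_intros Sigma1_continuous[OF \<phi>])
  show "rapid (\<lambda>t. cnj (\<phi> t))"
    by (rule rapid_cong_norm[OF Sigma1_rapid[OF \<phi>]]) simp
  have [measurable]: "\<phi> \<in> borel_measurable borel"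
    by (rule Sigma1_measurable[OF \<phi>])
  have "coef gauss (\<lambda>t. cnj (\<phi> t)) X = cnj (coef gauss \<phi> (fst X, - snd X))" for X
  proof -
    have "coef gauss (\<lambda>t. cnj (\<phi> t)) X = (\<integral>t. cnj (\<phi> t * gauss (t - fst X) * cis (t \<bullet> - snd X)) \<partial>lborel)"
      unfolding coef_def by (simp add: cis_cnj)
    also have "\<dots> = cnj (\<integral>t. \<phi> t * gauss (t - fst X) * cis (t \<bullet> - snd X) \<partial>lborel)"
      by (rule Bochner_Integration.integral_cnj)
    finally show ?thesis
      unfolding coef_def by simp
  qed
  moreover have "norm (fst X, - snd X) = norm X" for X :: "'a \<times> 'a"
    by (cases X) (simp add: norm_Pair)
  ultimately show "rapid (coef gauss (\<lambda>t. cnj (\<phi> t)))"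
    using rapid_coef[OF \<phi> gauss_Sigma1] unfolding rapid_def
    by (metis complex_mod_cnj)
qed

lemma cmod_coef_gabor:
  fixes \<phi> \<psi> :: "'a::euclidean_space \<Rightarrow> complex"
  assumes "\<phi> \<in> Sigma1" "\<psi> \<in> Sigma1"
  shows "cmod (coef \<psi> (gabor \<phi> X) Y) = cmod (coef \<psi> (\<lambda>t. cnj (\<phi> t)) (Y - X))"
  unfolding coef_gabor[OF Sigma1_measurable[OF assms(1)] Sigma1_measurable[OF assms(2)]]
  by (simp add: norm_mult)

lemma gabor_Sigma1:
  fixes \<phi> :: "'a::euclidean_space \<Rightarrow> complex"
  assumes \<phi>: "\<phi> \<in> Sigma1"
  shows "gabor \<phi> X \<in> Sigma1"
proof (rule Sigma1_rapid_criterion(1))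
  show "continuous_on UNIV (gabor \<phi> X)"
    by (rule continuous_on_gabor[OF Sigma1_continuous[OF \<phi>]])
  show "rapid (gabor \<phi> X)"
    by (rule rapid_cong_norm[OF rapid_translate[OF Sigma1_rapid[OF \<phi>]]]) (rule cmod_gabor)
  show "rapid (coef gauss (gabor \<phi> X))"
    by (rule rapid_cong_norm[OF rapid_translate[OF rapid_coef[OF Sigma1_cnj[OF \<phi>] gauss_Sigma1]]])
      (rule cmod_coef_gabor[OF \<phi> gauss_Sigma1])
qed

lemma borel_measurable_coef_gabor:
  fixes \<phi> \<psi> :: "'a::euclidean_space \<Rightarrow> complex"
  assumes [measurable]: "\<phi> \<in> borel_measurable borel" "\<psi> \<in> borel_measurable borel"
  shows "(\<lambda>(X, Y). coef \<psi> (gabor \<phi> X) Y) \<in> borel_measurable (borel \<Otimes>\<^sub>M borel)"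
proof -
  have [measurable]: "fst \<in> borel_measurable (borel :: ('a \<times> 'a) measure)"
    "snd \<in> borel_measurable (borel :: ('a \<times> 'a) measure)"
    by (intro borel_measurable_continuous_onI continuous_intros)+
  have [measurable]: "coef \<psi> (\<lambda>t. cnj (\<phi> t)) \<in> borel_measurable borel"
    by measurable
  show ?thesis
    unfolding coef_gabor[OF assms] by measurable
qed

text \<open>Expansion of the shifted window in Gaussian atoms: up to phases, the values for
  \<open>\<phi>\<close> are those for the Gaussian convolved with a rapid kernel, and both
  measurability and exponential growth survive.\<close>

lemma dual_gabor:
  fixes \<phi> :: "'a::euclidean_space \<Rightarrow> complex"
  assumes \<phi>: "\<phi> \<in> Sigma1" and u: "u \<in> Sigma1_dual"
  shows "(\<lambda>X. u (gabor \<phi> X)) \<in> borel_measurable borel"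
    and "\<exists>C\<ge>0. \<exists>c\<ge>0. \<forall>X. cmod (u (gabor \<phi> X)) \<le> C * exp (c * norm X)"
proof -
  let ?k = "cnst (gauss :: 'a \<Rightarrow> complex)"
  have k: "?k \<noteq> 0"
    by (rule cnst_nonzero[OF gauss_Sigma1 gauss_nonzero])
  have exp: "?k * u (gabor \<phi> X) = (\<integral>Y. coef gauss (gabor \<phi> X) Y * u (gabor gauss Y) \<partial>lborel)" for X
    by (rule Sigma1_dual_expansion[OF gabor_Sigma1[OF \<phi>] gabor_Sigma1[OF \<phi>] gabor_Sigma1[OF \<phi>] u])
  have [measurable]: "\<phi> \<in> borel_measurable borel"
    by (rule Sigma1_measurable[OF \<phi>])
  have [measurable]: "(\<lambda>Y. u (gabor gauss Y)) \<in> borel_measurable borel"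
    by (rule borel_measurable_continuous_onI[OF dual_gabor_gauss(2)[OF u]])
  have m: "(\<lambda>(X, Y). coef gauss (gabor \<phi> X) Y) \<in> borel_measurable (borel \<Otimes>\<^sub>M borel)"
    by (rule borel_measurable_coef_gabor) measurable
  have "(\<lambda>(X, Y). coef gauss (gabor \<phi> X) Y * u (gabor gauss Y)) \<in> borel_measurable (borel \<Otimes>\<^sub>M lborel)"
    using borel_measurable_times[OF m measurable_compose[OF measurable_snd \<open>(\<lambda>Y. u (gabor gauss Y)) \<in> borel_measurable borel\<close>]]
    by (simp add: split_beta' cong: measurable_cong_sets)
  then have "(\<lambda>X. \<integral>Y. coef gauss (gabor \<phi> X) Y * u (gabor gauss Y) \<partial>lborel) \<in> borel_measurable borel"
    by (rule lborel.borel_measurable_lebesgue_integral)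
  then have "(\<lambda>X. 1 / ?k * (?k * u (gabor \<phi> X))) \<in> borel_measurable borel"
    unfolding exp by measurable
  then show "(\<lambda>X. u (gabor \<phi> X)) \<in> borel_measurable borel"
    using k by simp
  obtain A a where A: "0 \<le> A" "0 \<le> a" and va: "\<And>Y. cmod (u (gabor gauss Y)) \<le> A * exp (a * norm Y)"
    using dual_gabor_gauss(1)[OF u] by metis
  let ?w = "coef gauss (\<lambda>t. cnj (\<phi> t))"
  have w: "rapid ?w"
    by (rule rapid_coef[OF Sigma1_cnj[OF \<phi>] gauss_Sigma1])
  have [measurable]: "?w \<in> borel_measurable borel"
    by measurable
  define J where "J = (\<integral>Y. cmod (?w Y) * exp (a * norm Y) \<partial>lborel)"
  have JI: "integrable lborel (\<lambda>Y. cmod (?w Y) * exp (a * norm Y))"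
    by (rule rapid_integrable_exp[OF w]) measurable
  have J0: "0 \<le> J"
    unfolding J_def by (rule Bochner_Integration.integral_nonneg) simp
  have "cmod ?k * cmod (u (gabor \<phi> X)) \<le> A * exp (a * norm X) * J" for X
  proof -
    have "cmod ?k * cmod (u (gabor \<phi> X)) \<le> (\<integral>Y. cmod (coef gauss (gabor \<phi> X) Y * u (gabor gauss Y)) \<partial>lborel)"
      unfolding norm_mult[symmetric] exp by (rule Bochner_Integration.integral_norm_bound)
    also have "\<dots> = (\<integral>Y. cmod (?w (Y - X)) * cmod (u (gabor gauss Y)) \<partial>lborel)"
      unfolding norm_mult cmod_coef_gabor[OF \<phi> gauss_Sigma1] ..
    also have "\<dots> \<le> (\<integral>Y. A * exp (a * norm X) * (cmod (?w (Y - X)) * exp (a * norm (Y - X))) \<partial>lborel)"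
    proof (rule integral_mono')
      have "integrable lborel (\<lambda>Y. complex_of_real (cmod (?w (Y - X)) * exp (a * norm (Y - X))))"
        using lborel_integral_affine_euclidean(1)[of 1 "\<lambda>Y. complex_of_real (cmod (?w Y) * exp (a * norm Y))" "- X"] integrable_of_real[OF JI]
        by (simp add: minus_diff_eq)
      from integrable_norm[OF this]
      have "integrable lborel (\<lambda>Y. cmod (?w (Y - X)) * exp (a * norm (Y - X)))"
        by (simp add: norm_mult)
      then show "integrable lborel (\<lambda>Y. A * exp (a * norm X) * (cmod (?w (Y - X)) * exp (a * norm (Y - X))))"
        by simp
      fix Y
      have "a * norm Y \<le> a * (norm X + norm (Y - X))"
        using A(2) norm_triangle_ineq[of X "Y - X"] by (intro mult_left_mono) auto
      then have "A * exp (a * norm Y) \<le> A * exp (a * norm X) * exp (a * norm (Y - X))"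
        using A(1) by (simp add: mult.assoc exp_add[symmetric] distrib_left mult_left_mono)
      then have "cmod (u (gabor gauss Y)) \<le> A * exp (a * norm X) * exp (a * norm (Y - X))"
        using va[of Y] by linarith
      from mult_left_mono[OF this, of "cmod (?w (Y - X))"]
      show "cmod (?w (Y - X)) * cmod (u (gabor gauss Y)) \<le> A * exp (a * norm X) * (cmod (?w (Y - X)) * exp (a * norm (Y - X)))"
        by (simp add: mult_ac)
      show "0 \<le> A * exp (a * norm X) * (cmod (?w (Y - X)) * exp (a * norm (Y - X)))"
        using A by simp
    qed
    also have "\<dots> = A * exp (a * norm X) * J"
    proof -
      have "(\<integral>Y. complex_of_real (cmod (?w (Y - X)) * exp (a * norm (Y - X))) \<partial>lborel) = (\<integral>Y. complex_of_real (cmod (?w Y) * exp (a * norm Y)) \<partial>lborel)"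
        by (rule lborel_integral_translate(2)[where f="\<lambda>Y. complex_of_real (cmod (?w Y) * exp (a * norm Y))"]) measurable
      then show ?thesis
        unfolding J_def by (simp only: integral_complex_of_real of_real_eq_iff integral_mult_right_zero)
    qed
    finally show ?thesis .
  qed
  then have "cmod (u (gabor \<phi> X)) \<le> A * J / cmod ?k * exp (a * norm X)" for X
    using k by (simp add: field_simps)
  then show "\<exists>C\<ge>0. \<exists>c\<ge>0. \<forall>X. cmod (u (gabor \<phi> X)) \<le> C * exp (c * norm X)"
    using A J0 by (intro exI[of _ "A * J / cmod ?k"] conjI exI[of _ a]) auto
qed

text \<open>
  The superposition principle for an arbitrary window reduces, by Fubini, to the one for the
  Gaussian window.
\<close>

lemma dual_inversion:
  fixes g \<phi> :: "'a::euclidean_space \<Rightarrow> complex"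
  assumes g: "g \<in> Sigma1" and \<phi>: "\<phi> \<in> Sigma1" and u: "u \<in> Sigma1_dual"
  shows "cnst \<phi> * u g = (\<integral>Y. coef \<phi> g Y * u (gabor \<phi> Y) \<partial>lborel)"
proof -
  let ?k = "cnst (gauss :: 'a \<Rightarrow> complex)"
  let ?w = "coef gauss (\<lambda>t. cnj (\<phi> t))" and ?v = "\<lambda>Y. u (gabor gauss Y)"
  have k: "?k \<noteq> 0"
    by (rule cnst_nonzero[OF gauss_Sigma1 gauss_nonzero])
  have [measurable]: "\<phi> \<in> borel_measurable borel" "g \<in> borel_measurable borel"
    using g \<phi> by (auto intro: Sigma1_measurable)
  have [measurable]: "?v \<in> borel_measurable borel"
    by (rule borel_measurable_continuous_onI[OF dual_gabor_gauss(2)[OF u]])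
  have m: "(\<lambda>(X, Y). coef gauss (gabor \<phi> X) Y) \<in> borel_measurable (borel \<Otimes>\<^sub>M borel)"
    by (rule borel_measurable_coef_gabor) measurable
  have cm [measurable]: "coef \<phi> g \<in> borel_measurable borel"
    by measurable
  obtain A a where A: "0 \<le> A" "0 \<le> a" and va: "\<And>Y. cmod (?v Y) \<le> A * exp (a * norm Y)"
    using dual_gabor_gauss(1)[OF u] by metis
  \<comment> \<open>With the rates \<open>a + 1\<close> and \<open>a + 2\<close> the triangle
    inequality leaves one unit of decay in each of \<open>Y\<close> and \<open>Y'\<close> after the
    growth rate \<open>a\<close> of the functional is paid, as the interchange of integrals
    requires.\<close>
  obtain C1 where C1: "0 \<le> C1" "\<And>Y. cmod (?w Y) \<le> C1 * exp (- ((a + 1) * norm Y))"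
    using rapidE[OF rapid_coef[OF Sigma1_cnj[OF \<phi>] gauss_Sigma1]] by blast
  obtain C2 where C2: "0 \<le> C2" "\<And>Y. cmod (coef \<phi> g Y) \<le> C2 * exp (- ((a + 2) * norm Y))"
    using rapidE[OF rapid_coef[OF g \<phi>]] by blast
  let ?f = "\<lambda>Y::'a \<times> 'a. complex_of_real (exp (- (1 * norm Y)))"
  have fI: "integrable lborel (\<lambda>Y. of_real (A * C1 * C2) * ?f Y)"
    by (intro integrable_mult_right integrable_of_real integrable_exp_neg_norm) simp
  have fI': "integrable lborel ?f"
    by (intro integrable_of_real integrable_exp_neg_norm) simp
  have m2: "(\<lambda>(Y, Y'). coef \<phi> g Y * (coef gauss (gabor \<phi> Y) Y' * ?v Y')) \<in> borel_measurable (borel \<Otimes>\<^sub>M borel)"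
    using borel_measurable_times[OF measurable_compose[OF measurable_fst cm]
        borel_measurable_times[OF m measurable_compose[OF measurable_snd \<open>?v \<in> borel_measurable borel\<close>]]]
    by (simp add: split_beta')
  have le2: "cmod (coef \<phi> g Y * (coef gauss (gabor \<phi> Y) Y' * ?v Y')) \<le> cmod (of_real (A * C1 * C2) * ?f Y) * cmod (?f Y')" for Y Y'
  proof -
    have "cmod (coef \<phi> g Y * (coef gauss (gabor \<phi> Y) Y' * ?v Y'))
      \<le> (C2 * exp (- ((a + 2) * norm Y))) * ((C1 * exp (- ((a + 1) * norm (Y' - Y)))) * (A * exp (a * norm Y')))"
      unfolding norm_mult cmod_coef_gabor[OF \<phi> gauss_Sigma1]
      using C1 C2 A by (intro mult_mono va) auto
    also have "\<dots> = A * C1 * C2 * exp (- ((a + 2) * norm Y) - (a + 1) * norm (Y' - Y) + a * norm Y')"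
      by (simp add: exp_add exp_diff exp_minus divide_inverse mult_ac)
    also have "\<dots> \<le> A * C1 * C2 * exp (- norm Y - norm Y')"
    proof -
      have "(a + 1) * norm Y' \<le> (a + 1) * (norm (Y' - Y) + norm Y)"
        using A(2) norm_triangle_ineq[of "Y' - Y" Y] by (intro mult_left_mono) auto
      then show ?thesis
        using A C1 C2 by (intro mult_left_mono) (auto simp: algebra_simps)
    qed
    also have "\<dots> = cmod (of_real (A * C1 * C2) * ?f Y) * cmod (?f Y')"
      unfolding norm_mult norm_of_real using A C1 C2
      by (simp add: exp_diff exp_minus divide_inverse abs_mult)
    finally show ?thesis .
  qed
  \<comment> \<open>The Gaussian coefficients of both sides of the inversion formula for
    \<open>g\<close>, computed under the integral.\<close>
  have inner: "(\<integral>Y. coef \<phi> g Y * coef gauss (gabor \<phi> Y) Y' \<partial>lborel) = cnst \<phi> * coef gauss g Y'" for Y'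
  proof -
    obtain B where B: "0 \<le> B" "\<And>x. cmod (\<phi> x) \<le> B"
      using rapid_bounded[OF Sigma1_rapid[OF \<phi>]] by blast
    have I1: "integrable lborel (\<lambda>Y. of_real B * coef \<phi> g Y)"
      by (intro integrable_mult_right rapid_integrable[OF rapid_coef[OF g \<phi>] cm])
    have "integrable lborel (gabor gauss (fst Y', 0::'a))"
      using rapid_integrable[OF Sigma1_rapid Sigma1_measurable] gabor_Sigma1[OF gauss_Sigma1] by blast
    then have I2: "integrable lborel (\<lambda>t. gauss (t - fst Y'))"
      by (simp add: gabor_def)
    have [measurable]: "fst \<in> borel_measurable (borel :: ('a \<times> 'a) measure)"
      "snd \<in> borel_measurable (borel :: ('a \<times> 'a) measure)"
      by (intro borel_measurable_continuous_onI continuous_intros)+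
    have m3: "(\<lambda>(Y, t). coef \<phi> g Y * (gabor \<phi> Y t * gauss (t - fst Y') * cis (t \<bullet> snd Y'))) \<in> borel_measurable (borel \<Otimes>\<^sub>M borel)"
      unfolding gabor_def by measurable
    have "(\<integral>Y. coef \<phi> g Y * coef gauss (gabor \<phi> Y) Y' \<partial>lborel)
      = (\<integral>Y. (\<integral>t. coef \<phi> g Y * (gabor \<phi> Y t * gauss (t - fst Y') * cis (t \<bullet> snd Y')) \<partial>lborel) \<partial>lborel)"
      unfolding coef_def[of gauss] by (simp only: integral_mult_right_zero)
    also have "\<dots> = (\<integral>t. (\<integral>Y. coef \<phi> g Y * (gabor \<phi> Y t * gauss (t - fst Y') * cis (t \<bullet> snd Y')) \<partial>lborel) \<partial>lborel)"
    proof (rule lborel_Fubini[OF I1 I2 m3])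
      fix Y t
      have "cmod (coef \<phi> g Y) * (cmod (\<phi> (t - fst Y)) * cmod (gauss (t - fst Y'))) \<le> cmod (coef \<phi> g Y) * (B * cmod (gauss (t - fst Y')))"
        by (intro mult_left_mono mult_right_mono B) auto
      then show "cmod (coef \<phi> g Y * (gabor \<phi> Y t * gauss (t - fst Y') * cis (t \<bullet> snd Y')))
        \<le> cmod (of_real B * coef \<phi> g Y) * cmod (gauss (t - fst Y'))"
        using B(1) by (simp add: norm_mult cmod_gabor mult_ac)
    qed
    also have "\<dots> = (\<integral>t. cnst \<phi> * (g t * gauss (t - fst Y') * cis (t \<bullet> snd Y')) \<partial>lborel)"
    proof (intro Bochner_Integration.integral_cong refl)
      fix t
      have "(\<integral>Y. coef \<phi> g Y * (gabor \<phi> Y t * gauss (t - fst Y') * cis (t \<bullet> snd Y')) \<partial>lborel)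
        = (\<integral>Y. (coef \<phi> g Y * gabor \<phi> Y t) * (gauss (t - fst Y') * cis (t \<bullet> snd Y')) \<partial>lborel)"
        by (simp only: mult.assoc)
      also have "\<dots> = (cnst \<phi> * g t) * (gauss (t - fst Y') * cis (t \<bullet> snd Y'))"
        by (subst integral_mult_left_zero, subst coef_inversion)
          (auto simp: cnst_def intro: Sigma1_continuous Sigma1_rapid rapid_coef g \<phi>)
      finally show "(\<integral>Y. coef \<phi> g Y * (gabor \<phi> Y t * gauss (t - fst Y') * cis (t \<bullet> snd Y')) \<partial>lborel)
        = cnst \<phi> * (g t * gauss (t - fst Y') * cis (t \<bullet> snd Y'))"
        by (simp only: mult.assoc)
    qed
    also have "\<dots> = cnst \<phi> * coef gauss g Y'"
      unfolding coef_def by (rule integral_mult_right_zero)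
    finally show ?thesis .
  qed
  have "?k * (\<integral>Y. coef \<phi> g Y * u (gabor \<phi> Y) \<partial>lborel) = (\<integral>Y. coef \<phi> g Y * (?k * u (gabor \<phi> Y)) \<partial>lborel)"
    by (subst integral_mult_right_zero[symmetric]) (simp only: mult_ac)
  also have "\<dots> = (\<integral>Y. (\<integral>Y'. coef \<phi> g Y * (coef gauss (gabor \<phi> Y) Y' * ?v Y') \<partial>lborel) \<partial>lborel)"
    unfolding Sigma1_dual_expansion[OF gabor_Sigma1[OF \<phi>] gabor_Sigma1[OF \<phi>] gabor_Sigma1[OF \<phi>] u]
    by (simp only: integral_mult_right_zero)
  also have "\<dots> = (\<integral>Y'. (\<integral>Y. coef \<phi> g Y * (coef gauss (gabor \<phi> Y) Y' * ?v Y') \<partial>lborel) \<partial>lborel)"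
    by (rule lborel_Fubini[OF fI fI' m2 le2])
  also have "\<dots> = (\<integral>Y'. cnst \<phi> * (coef gauss g Y' * ?v Y') \<partial>lborel)"
  proof (intro Bochner_Integration.integral_cong refl)
    fix Y'
    have "(\<integral>Y. coef \<phi> g Y * (coef gauss (gabor \<phi> Y) Y' * ?v Y') \<partial>lborel)
      = (\<integral>Y. (coef \<phi> g Y * coef gauss (gabor \<phi> Y) Y') * ?v Y' \<partial>lborel)"
      by (simp only: mult.assoc)
    also have "\<dots> = (cnst \<phi> * coef gauss g Y') * ?v Y'"
      by (subst integral_mult_left_zero) (simp only: inner)
    finally show "(\<integral>Y. coef \<phi> g Y * (coef gauss (gabor \<phi> Y) Y' * ?v Y') \<partial>lborel) = cnst \<phi> * (coef gauss g Y' * ?v Y')"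
      by (simp only: mult.assoc)
  qed
  also have "\<dots> = cnst \<phi> * (?k * u g)"
    unfolding Sigma1_dual_expansion[OF g g g u] by (rule integral_mult_right_zero)
  finally show ?thesis
    using k by (simp add: mult_ac)
qed

text \<open>\<open>dual_inversion\<close> is applied to the shifted window
  \<open>gabor \<psi> X\<close>, whose coefficients are, by covariance, a rapid function of
  \<open>Y - X\<close> in modulus. The constant depends on the two windows and \<open>N\<close>,
  never on the functional.\<close>

theorem change_window:
  fixes \<phi> \<psi> :: "'a::euclidean_space \<Rightarrow> complex"
  assumes \<phi>: "\<phi> \<in> Sigma1" "\<phi> \<noteq> (\<lambda>_. 0)" and \<psi>: "\<psi> \<in> Sigma1"
  shows "\<exists>C\<ge>0. \<forall>u\<in>Sigma1_dual. \<forall>X. ennreal (cmod (u (gabor \<psi> X)))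
    \<le> ennreal C * (\<integral>\<^sup>+Y. ennreal (exp (- (N * norm (X - Y))) * cmod (u (gabor \<phi> Y))) \<partial>lborel)"
proof -
  let ?w = "coef \<phi> (\<lambda>t. cnj (\<psi> t))"
  have k: "cnst \<phi> \<noteq> 0"
    by (rule cnst_nonzero[OF \<phi>])
  obtain C where C: "0 \<le> C" "\<And>Y. cmod (?w Y) \<le> C * exp (- (N * norm Y))"
    using rapidE[OF rapid_coef[OF Sigma1_cnj[OF \<psi>] \<phi>(1)]] by blast
  have "ennreal (cmod (u (gabor \<psi> X)))
    \<le> ennreal (C / cmod (cnst \<phi>)) * (\<integral>\<^sup>+Y. ennreal (exp (- (N * norm (X - Y))) * cmod (u (gabor \<phi> Y))) \<partial>lborel)"
    if u: "u \<in> Sigma1_dual" for u X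
  proof -
    have [measurable]: "(\<lambda>Y. u (gabor \<phi> Y)) \<in> borel_measurable borel"
      by (rule dual_gabor(1)[OF \<phi>(1) u])
    have eq: "u (gabor \<psi> X) = (\<integral>Y. coef \<phi> (gabor \<psi> X) Y * u (gabor \<phi> Y) \<partial>lborel) / cnst \<phi>"
      using dual_inversion[OF gabor_Sigma1[OF \<psi>] \<phi>(1) u, of X] k by (simp add: field_simps)
    \<comment> \<open>A Bochner integral without integrability is 0, so the bound holds in either
      case.\<close>
    have "ennreal (cmod (\<integral>Y. coef \<phi> (gabor \<psi> X) Y * u (gabor \<phi> Y) \<partial>lborel))
      \<le> (\<integral>\<^sup>+Y. ennreal (cmod (coef \<phi> (gabor \<psi> X) Y * u (gabor \<phi> Y))) \<partial>lborel)"
      by (cases "integrable lborel (\<lambda>Y. coef \<phi> (gabor \<psi> X) Y * u (gabor \<phi> Y))")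
        (auto simp: integral_norm_bound_ennreal not_integrable_integral_eq)
    also have "\<dots> \<le> (\<integral>\<^sup>+Y. ennreal C * ennreal (exp (- (N * norm (X - Y))) * cmod (u (gabor \<phi> Y))) \<partial>lborel)"
    proof (rule nn_integral_mono)
      fix Y
      have "cmod (coef \<phi> (gabor \<psi> X) Y * u (gabor \<phi> Y)) \<le> C * exp (- (N * norm (Y - X))) * cmod (u (gabor \<phi> Y))"
        unfolding norm_mult cmod_coef_gabor[OF \<psi> \<phi>(1)] by (intro mult_right_mono C) simp
      then show "ennreal (cmod (coef \<phi> (gabor \<psi> X) Y * u (gabor \<phi> Y)))
          \<le> ennreal C * ennreal (exp (- (N * norm (X - Y))) * cmod (u (gabor \<phi> Y)))"
        unfolding ennreal_mult'[OF C(1), symmetric] by (intro ennreal_leI) (simp add: norm_minus_commute mult.assoc)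
    qed
    also have "\<dots> = ennreal C * (\<integral>\<^sup>+Y. ennreal (exp (- (N * norm (X - Y))) * cmod (u (gabor \<phi> Y))) \<partial>lborel)"
      by (rule nn_integral_cmult) measurable
    finally have "ennreal (1 / cmod (cnst \<phi>)) * ennreal (cmod (\<integral>Y. coef \<phi> (gabor \<psi> X) Y * u (gabor \<phi> Y) \<partial>lborel))
      \<le> ennreal (1 / cmod (cnst \<phi>)) * (ennreal C * (\<integral>\<^sup>+Y. ennreal (exp (- (N * norm (X - Y))) * cmod (u (gabor \<phi> Y))) \<partial>lborel))"
      by (intro mult_left_mono) auto
    then show ?thesis
      unfolding eq mult.assoc[symmetric] using C(1)
      by (simp add: ennreal_mult'[symmetric] ennreal_mult[symmetric] norm_divide)
  qed
  then show ?thesis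
    using C(1) by (intro exI[of _ "C / cmod (cnst \<phi>)"]) auto
qed

subsection \<open>Local reproducing inequalities and powers\<close>

lemma nn_integral_exp_neg_norm:
  assumes a: "0 < a"
  obtains L where "0 < L" "\<And>X :: 'b::euclidean_space. (\<integral>\<^sup>+Y. ennreal (exp (- (a * norm (X - Y)))) \<partial>lborel) = ennreal L"
    "\<And>X :: 'b. (\<integral>\<^sup>+Y. ennreal (exp (- (a * norm (Y - X)))) \<partial>lborel) = ennreal L"
proof -
  let ?e = "\<lambda>Y::'b. exp (- (a * norm Y))"
  define L where "L = (\<integral>Y. ?e Y \<partial>lborel)"
  have I: "integrable lborel ?e"
    by (rule integrable_exp_neg_norm[OF a])
  have 0: "(\<integral>\<^sup>+Y. ennreal (?e Y) \<partial>lborel) = ennreal L"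
    unfolding L_def by (rule nn_integral_eq_integral[OF I]) simp
  have "L \<noteq> 0"
  proof
    assume "L = 0"
    then have "AE Y in lborel. ?e Y = 0"
      using integral_nonneg_eq_0_iff_AE[OF I] unfolding L_def by simp
    then have "AE Y in (lborel :: 'b measure). False"
      by simp
    then have "emeasure lborel (UNIV :: 'b set) = 0"
      using AE_iff_measurable[of UNIV "lborel :: 'b measure" "\<lambda>_. False"] by simp
    then show False
      by simp
  qed
  moreover have "0 \<le> L"
    unfolding L_def by (rule Bochner_Integration.integral_nonneg) simp
  ultimately have "0 < L" by simp
  moreover have "(\<integral>\<^sup>+Y. ennreal (exp (- (a * norm (X - Y)))) \<partial>lborel) = ennreal L" for X :: 'b
    unfolding 0[symmetric] by (rule nn_integral_lborel_translate(3)[where f="\<lambda>Y. ennreal (?e Y)"]) measurable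
  moreover have "(\<integral>\<^sup>+Y. ennreal (exp (- (a * norm (Y - X)))) \<partial>lborel) = ennreal L" for X :: 'b
    unfolding 0[symmetric] by (rule nn_integral_lborel_translate(2)[where f="\<lambda>Y. ennreal (?e Y)"]) measurable
  ultimately show ?thesis
    using that by blast
qed

lemma le_ennreal_mult_infinity: "0 < c \<Longrightarrow> x \<le> ennreal c * \<infinity>"
  by (simp add: ennreal_mult_top)

lemma mult_exp_powr: "0 \<le> (M::real) \<Longrightarrow> (M * exp a) powr q = M powr q * exp (q * a)"
  by (simp add: powr_mult exp_powr_real mult.commute)

text \<open>
  For \<open>p \<le> 1\<close> one cannot use convexity.  Instead split off the \<open>p\<close>-th power of \<open>F\<close> and bound the
  remaining factor by the maximal function \<open>M(X) = sup F(Z) exp(-N |X - Z|)\<close>; this gives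
  \<open>M \<le> K M powr (1 - p) I\<close>.  That \<open>M\<close> is finite follows from the growth bound when \<open>N\<close> is large,
  and the result for large \<open>N\<close> yields finiteness for small \<open>N\<close>.  The growth bound does not enter
  the final constant.
\<close>

lemma peetre_step:
  fixes F :: "'b::euclidean_space \<Rightarrow> real"
  assumes [measurable]: "F \<in> borel_measurable borel" and F0: "\<And>Y. 0 \<le> F Y"
    and p: "0 < p" "p \<le> 1" and N: "0 \<le> N" and K: "0 < K"
    and rep: "\<And>X. ennreal (F X) \<le> ennreal K * (\<integral>\<^sup>+Y. ennreal (exp (- (N * norm (X - Y))) * F Y) \<partial>lborel)"
    and bd: "\<And>Z. F Z * exp (- (N * norm (X - Z))) \<le> B"
  shows "ennreal (F Z powr p) \<le> ennreal (K * exp (N * p * norm (X - Z)))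
    * (\<integral>\<^sup>+Y. ennreal (exp (- (N * p * norm (X - Y))) * F Y powr p) \<partial>lborel)" (is "_ \<le> _ * ?I")
proof (cases "?I = \<infinity>")
  case True
  then show ?thesis
    using K by (simp add: ennreal_mult_top)
next
  case False
  then obtain i where i: "?I = ennreal i" "0 \<le> i"
    by (cases ?I) auto
  define M where "M = (SUP Z. F Z * exp (- (N * norm (X - Z))))"
  have bdd: "bdd_above (range (\<lambda>Z. F Z * exp (- (N * norm (X - Z)))))"
    using bd by (intro bdd_aboveI[of _ B]) auto
  have le_M: "F Z * exp (- (N * norm (X - Z))) \<le> M" for Z
    unfolding M_def by (rule cSUP_upper[OF _ bdd]) simp
  have M0: "0 \<le> M"
    using le_M[of X] F0[of X] by simp
  have FM: "F Z \<le> M * exp (N * norm (X - Z))" for Z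
    using mult_right_mono[OF le_M[of Z], of "exp (N * norm (X - Z))"]
    by (simp add: mult.assoc exp_add[symmetric])
  have main: "M powr p \<le> K * i"
  proof (cases "M = 0")
    case True
    then show ?thesis using K i by simp
  next
    case False
    then have M: "0 < M" using M0 by simp
    have "F Z * exp (- (N * norm (X - Z))) \<le> K * (M powr (1 - p) * i)" for Z
    proof -
      \<comment> \<open>The factor \<open>F Y powr (1 - p)\<close> is replaced by the maximal
        function at \<open>X\<close>; its growth rate \<open>N * (1 - p)\<close> lowers the rate of
        the kernel from \<open>N\<close> to \<open>N * p\<close>.\<close>
      have pt: "exp (- (N * norm (X - Z))) * (exp (- (N * norm (Z - Y))) * F Y)
          \<le> M powr (1 - p) * (exp (- (N * p * norm (X - Y))) * F Y powr p)" for Y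
      proof -
        have "N * norm (X - Y) \<le> N * (norm (X - Z) + norm (Z - Y))"
          using N norm_triangle_ineq[of "X - Z" "Z - Y"] by (intro mult_left_mono) auto
        then have 1: "exp (- (N * norm (X - Z))) * exp (- (N * norm (Z - Y))) \<le> exp (- (N * norm (X - Y)))"
          by (simp add: exp_add[symmetric] algebra_simps)
        have "F Y = F Y powr p * F Y powr (1 - p)"
          using F0[of Y] by (cases "F Y = 0") (auto simp: powr_add[symmetric])
        also have "\<dots> \<le> F Y powr p * (M * exp (N * norm (X - Y))) powr (1 - p)"
          using F0 FM p by (intro mult_left_mono powr_mono2) auto
        also have "(M * exp (N * norm (X - Y))) powr (1 - p) = M powr (1 - p) * exp (N * (1 - p) * norm (X - Y))"
          using mult_exp_powr[of M "N * norm (X - Y)" "1 - p"] M by (simp add: mult_ac)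
        finally have 2: "F Y \<le> F Y powr p * (M powr (1 - p) * exp (N * (1 - p) * norm (X - Y)))" .
        have "exp (- (N * norm (X - Z))) * (exp (- (N * norm (Z - Y))) * F Y) \<le> exp (- (N * norm (X - Y))) * F Y"
          using mult_right_mono[OF 1 F0[of Y]] by (simp add: mult.assoc)
        also have "\<dots> \<le> exp (- (N * norm (X - Y))) * (F Y powr p * (M powr (1 - p) * exp (N * (1 - p) * norm (X - Y))))"
          by (intro mult_left_mono 2) auto
        also have "\<dots> = M powr (1 - p) * ((exp (- (N * norm (X - Y))) * exp (N * (1 - p) * norm (X - Y))) * F Y powr p)"
          by (simp only: mult_ac)
        also have "exp (- (N * norm (X - Y))) * exp (N * (1 - p) * norm (X - Y)) = exp (- (N * p * norm (X - Y)))"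
          by (simp add: exp_add[symmetric] algebra_simps)
        finally show ?thesis .
      qed
      have "ennreal (exp (- (N * norm (X - Z)))) * ennreal (F Z)
        \<le> ennreal (exp (- (N * norm (X - Z)))) * (ennreal K * (\<integral>\<^sup>+Y. ennreal (exp (- (N * norm (Z - Y))) * F Y) \<partial>lborel))"
        by (intro mult_left_mono rep) auto
      also have "\<dots> = ennreal K * (\<integral>\<^sup>+Y. ennreal (exp (- (N * norm (X - Z)))) * ennreal (exp (- (N * norm (Z - Y))) * F Y) \<partial>lborel)"
        by (subst nn_integral_cmult) (auto simp: mult_ac)
      also have "\<dots> \<le> ennreal K * (\<integral>\<^sup>+Y. ennreal (M powr (1 - p)) * ennreal (exp (- (N * p * norm (X - Y))) * F Y powr p) \<partial>lborel)"
        using pt by (intro mult_left_mono nn_integral_mono) (auto simp: ennreal_mult'[symmetric] intro!: ennreal_leI)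
      also have "\<dots> = ennreal K * (ennreal (M powr (1 - p)) * ennreal i)"
        unfolding i(1)[symmetric] by (subst nn_integral_cmult) auto
      also have "\<dots> = ennreal (K * (M powr (1 - p) * i))"
        using K i by (simp add: ennreal_mult)
      also have "ennreal (exp (- (N * norm (X - Z)))) * ennreal (F Z) = ennreal (exp (- (N * norm (X - Z))) * F Z)"
        by (rule ennreal_mult'[symmetric]) simp
      finally have "ennreal (F Z * exp (- (N * norm (X - Z)))) \<le> ennreal (K * (M powr (1 - p) * i))"
        by (simp only: mult.commute[of "F Z"])
      then show ?thesis
        using K i by (subst (asm) ennreal_le_iff) auto
    qed
    then have "M \<le> K * (M powr (1 - p) * i)"
      unfolding M_def by (intro cSUP_least) auto
    \<comment> \<open>Here \<open>M\<close> may be divided out: it is finite by \<open>bd\<close>,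
      and the value 0 has been set aside.\<close>
    then have "M / M powr (1 - p) \<le> K * i"
      using M by (simp add: field_simps)
    moreover have "M / M powr (1 - p) = M powr p"
      using M by (simp add: powr_diff)
    ultimately show ?thesis by simp
  qed
  have "F Z powr p \<le> (M * exp (N * norm (X - Z))) powr p"
    using F0 FM p by (intro powr_mono2) auto
  also have "\<dots> = M powr p * exp (N * p * norm (X - Z))"
    using mult_exp_powr[OF M0, of "N * norm (X - Z)" p] by (simp add: mult_ac)
  also have "\<dots> \<le> (K * i) * exp (N * p * norm (X - Z))"
    by (intro mult_right_mono main) auto
  finally have "F Z powr p \<le> K * exp (N * p * norm (X - Z)) * i"
    by (simp add: mult_ac)
  then have "ennreal (F Z powr p) \<le> ennreal (K * exp (N * p * norm (X - Z))) * ennreal i"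
    using K i by (simp add: ennreal_mult'[symmetric] ennreal_leI)
  then show ?thesis
    by (simp only: i(1))
qed

text \<open>The order of the quantifiers is the point: \<open>K\<close> is a parameter shared by a
  whole family of functions, whereas the growth constants \<open>A\<close> and \<open>c\<close> sit
  in an existential and may vary with \<open>F\<close>. Bounds expressed through \<open>K\<close>
  are therefore uniform over functionals.\<close>

definition reproducing :: "(real \<Rightarrow> real) \<Rightarrow> ('b::euclidean_space \<Rightarrow> real) \<Rightarrow> bool" where
  "reproducing K F \<longleftrightarrow> F \<in> borel_measurable borel \<and> (\<forall>Y. 0 \<le> F Y)
    \<and> (\<exists>A c. 0 \<le> A \<and> 0 \<le> c \<and> (\<forall>Y. F Y \<le> A * exp (c * norm Y)))
    \<and> (\<forall>N. 0 < K N) \<and> (\<forall>N X. ennreal (F X) \<le> ennreal (K N) * (\<integral>\<^sup>+Y. ennreal (exp (- (N * norm (X - Y))) * F Y) \<partial>lborel))"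

lemma peetre:
  fixes F :: "'b::euclidean_space \<Rightarrow> real"
  assumes rep: "reproducing K F" and p: "0 < p" "p \<le> 1" and N: "0 \<le> N"
  shows "ennreal (F Z powr p) \<le> ennreal (K N * exp (N * p * norm (X - Z)))
    * (\<integral>\<^sup>+Y. ennreal (exp (- (N * p * norm (X - Y))) * F Y powr p) \<partial>lborel)"
proof -
  have [measurable]: "F \<in> borel_measurable borel" and F0: "\<And>Y. 0 \<le> F Y"
    and K: "\<And>N. 0 < K N"
    and r: "\<And>N X. ennreal (F X) \<le> ennreal (K N) * (\<integral>\<^sup>+Y. ennreal (exp (- (N * norm (X - Y))) * F Y) \<partial>lborel)"
    using rep unfolding reproducing_def by auto
  obtain A c where A: "0 \<le> A" "0 \<le> c" and Ac: "\<And>Y. F Y \<le> A * exp (c * norm Y)"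
    using rep unfolding reproducing_def by auto
  have large: "ennreal (F Z powr p) \<le> ennreal (K N * exp (N * p * norm (X - Z)))
    * (\<integral>\<^sup>+Y. ennreal (exp (- (N * p * norm (X - Y))) * F Y powr p) \<partial>lborel)" if "c \<le> N" for N X Z
  proof (rule peetre_step[OF _ F0 p _ K r])
    show "0 \<le> N" using that A by simp
    fix Z
    have "c * norm Z \<le> c * (norm X + norm (X - Z))"
      using A(2) norm_triangle_ineq4[of X "X - Z"] by (intro mult_left_mono) auto
    also have "\<dots> \<le> c * norm X + N * norm (X - Z)"
      using that by (simp add: distrib_left mult_right_mono)
    finally have "exp (c * norm Z) * exp (- (N * norm (X - Z))) \<le> exp (c * norm X)"
      by (simp add: exp_add[symmetric])
    then have *: "A * exp (c * norm Z) * exp (- (N * norm (X - Z))) \<le> A * exp (c * norm X)"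
      unfolding mult.assoc by (intro mult_left_mono A)
    have "F Z * exp (- (N * norm (X - Z))) \<le> A * exp (c * norm Z) * exp (- (N * norm (X - Z)))"
      by (intro mult_right_mono Ac) auto
    from order_trans[OF this *] show "F Z * exp (- (N * norm (X - Z))) \<le> A * exp (c * norm X)" .
  qed measurable
  let ?I = "\<lambda>N X. \<integral>\<^sup>+Y. ennreal (exp (- (N * p * norm (X - Y))) * F Y powr p) \<partial>lborel"
  show ?thesis
  proof (cases "?I N X = \<infinity>")
    case True
    then show ?thesis
      using K[of N] by (simp add: ennreal_mult_top)
  next
    case False
    then obtain i where i: "?I N X = ennreal i" "0 \<le> i"
      by (cases "?I N X") auto
    \<comment> \<open>At rate \<open>c'\<close> the estimate is already known. Centred at
      \<open>Z\<close> and compared with the finite integral at rate \<open>N\<close> around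
      \<open>X\<close>, it bounds \<open>F Z * exp (- (N * norm (X - Z)))\<close> in
      \<open>Z\<close>, which is what \<open>peetre_step\<close> asks for at rate
      \<open>N\<close>.\<close>
    define c' where "c' = max c N"
    have c': "c \<le> c'" "N \<le> c'" by (auto simp: c'_def)
    show ?thesis
    proof (rule peetre_step[OF _ F0 p N K r])
      fix Z
      have "?I c' Z \<le> (\<integral>\<^sup>+Y. ennreal (exp (N * p * norm (X - Z))) * ennreal (exp (- (N * p * norm (X - Y))) * F Y powr p) \<partial>lborel)"
      proof (rule nn_integral_mono)
        fix Y
        have "N * p * norm (X - Y) \<le> N * p * (norm (X - Z) + norm (Z - Y))"
          using N p norm_triangle_ineq[of "X - Z" "Z - Y"] by (intro mult_left_mono) auto
        also have "\<dots> \<le> N * p * norm (X - Z) + c' * p * norm (Z - Y)"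
          using c' p by (simp add: distrib_left mult_right_mono)
        finally have "exp (- (c' * p * norm (Z - Y))) \<le> exp (N * p * norm (X - Z)) * exp (- (N * p * norm (X - Y)))"
          by (simp add: exp_add[symmetric])
        then have "exp (- (c' * p * norm (Z - Y))) * F Y powr p \<le> exp (N * p * norm (X - Z)) * (exp (- (N * p * norm (X - Y))) * F Y powr p)"
          using mult_right_mono[of _ _ "F Y powr p"] by (fastforce simp: mult.assoc)
        then show "ennreal (exp (- (c' * p * norm (Z - Y))) * F Y powr p)
          \<le> ennreal (exp (N * p * norm (X - Z))) * ennreal (exp (- (N * p * norm (X - Y))) * F Y powr p)"
          by (simp add: ennreal_mult'[symmetric] ennreal_leI)
      qed
      also have "\<dots> = ennreal (exp (N * p * norm (X - Z))) * ennreal i"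
        unfolding i(1)[symmetric] by (subst nn_integral_cmult) auto
      finally have "ennreal (K c' * exp (c' * p * norm (Z - Z))) * ?I c' Z \<le> ennreal (K c') * (ennreal (exp (N * p * norm (X - Z))) * ennreal i)"
        by (simp add: mult_left_mono)
      with large[OF c'(1), of Z Z] have "ennreal (F Z powr p) \<le> ennreal (K c') * (ennreal (exp (N * p * norm (X - Z))) * ennreal i)"
        by (rule order_trans)
      then have "ennreal (F Z powr p) \<le> ennreal (K c' * (exp (N * p * norm (X - Z)) * i))"
        using K[of c'] i by (simp add: ennreal_mult)
      then have "F Z powr p \<le> K c' * (exp (N * p * norm (X - Z)) * i)"
        using K[of c'] i by (subst (asm) ennreal_le_iff) auto
      then have "F Z powr p * exp (- (N * p * norm (X - Z))) \<le> K c' * (exp (N * p * norm (X - Z)) * i) * exp (- (N * p * norm (X - Z)))"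
        by (intro mult_right_mono) auto
      then have "(F Z * exp (- (N * norm (X - Z)))) powr p \<le> K c' * i"
        using mult_exp_powr[OF F0[of Z], of "- (N * norm (X - Z))" p]
        by (simp add: mult_ac exp_minus)
      then have "((F Z * exp (- (N * norm (X - Z)))) powr p) powr (1 / p) \<le> (K c' * i) powr (1 / p)"
        using p by (intro powr_mono2) auto
      then show "F Z * exp (- (N * norm (X - Z))) \<le> (K c' * i) powr (1 / p)"
        using p F0[of Z] by (simp add: powr_powr)
    qed measurable
  qed
qed

text \<open>Integrate \<open>F \<le> l + l powr (1 - p) F powr p\<close> and optimize over \<open>l\<close>.\<close>

lemma crude_jensen:
  fixes F w :: "'x \<Rightarrow> real"
  assumes [measurable]: "F \<in> borel_measurable M" "w \<in> borel_measurable M"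
    and nn: "\<And>x. 0 \<le> F x" "\<And>x. 0 \<le> w x"
    and p: "1 \<le> p" and L: "(\<integral>\<^sup>+x. ennreal (w x) \<partial>M) \<le> ennreal L" "0 \<le> L"
    and g: "0 \<le> g" "ennreal g \<le> (\<integral>\<^sup>+x. ennreal (w x * F x) \<partial>M)"
  shows "ennreal (g powr p) \<le> ennreal ((1 + L) powr p) * (\<integral>\<^sup>+x. ennreal (w x * F x powr p) \<partial>M)" (is "_ \<le> _ * ?J")
proof (cases "?J = \<infinity>")
  case True
  then show ?thesis using L by (simp add: ennreal_mult_top)
next
  case False
  then obtain j where j: "?J = ennreal j" "0 \<le> j"
    by (cases ?J) auto
  have lam: "g \<le> l powr (1 - p) * j + l * L" if l: "0 < l" for l
  proof -
    have pt: "w x * F x \<le> l powr (1 - p) * (w x * F x powr p) + l * w x" for x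
    proof -
      have "F x \<le> l powr (1 - p) * F x powr p + l"
      proof (cases "F x \<le> l")
        case True
        then show ?thesis by (simp add: add_increasing)
      next
        case False
        then have "F x = F x powr p * F x powr (1 - p)"
          using l by (simp add: powr_add[symmetric])
        also have "\<dots> \<le> F x powr p * l powr (1 - p)"
          using False l p by (intro mult_left_mono powr_mono2') auto
        finally show ?thesis using l by (simp add: mult.commute)
      qed
      from mult_left_mono[OF this nn(2)[of x]] show ?thesis
        by (simp add: algebra_simps)
    qed
    have "ennreal g \<le> (\<integral>\<^sup>+x. ennreal (l powr (1 - p)) * ennreal (w x * F x powr p) + ennreal l * ennreal (w x) \<partial>M)"
      using pt nn l by (intro order_trans[OF g(2)] nn_integral_mono)
        (auto simp: ennreal_mult'[symmetric] ennreal_plus[symmetric] simp del: ennreal_plus intro!: ennreal_leI)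
    also have "\<dots> = ennreal (l powr (1 - p)) * ennreal j + ennreal l * (\<integral>\<^sup>+x. ennreal (w x) \<partial>M)"
      unfolding j(1)[symmetric] by (subst nn_integral_add, measurable) (simp add: nn_integral_cmult)
    also have "\<dots> \<le> ennreal (l powr (1 - p)) * ennreal j + ennreal l * ennreal L"
      by (intro add_left_mono mult_left_mono L) auto
    also have "\<dots> = ennreal (l powr (1 - p) * j + l * L)"
      using j L l by (simp add: ennreal_mult)
    finally show ?thesis
      using j L l by (subst (asm) ennreal_le_iff) auto
  qed
  \<comment> \<open>The choice \<open>l = j powr (1 / p)\<close> balances the two terms; for
    \<open>j = 0\<close> arbitrarily small \<open>l\<close> are used instead.\<close>
  have "g \<le> (1 + L) * j powr (1 / p)"
  proof (cases "j = 0")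
    case True
    have "g \<le> 0"
    proof (rule field_le_epsilon)
      fix e :: real assume e: "0 < e"
      then have "g \<le> e / (1 + L) * L"
        using lam[of "e / (1 + L)"] True L(2) by simp
      also have "\<dots> \<le> e"
        using e L(2) by (simp add: field_simps)
      finally show "g \<le> 0 + e" by simp
    qed
    then show ?thesis using True by simp
  next
    case False
    then have j0: "0 < j" using j by simp
    have "g \<le> (j powr (1 / p)) powr (1 - p) * j + j powr (1 / p) * L"
      using j0 by (intro lam) simp
    also have "(j powr (1 / p)) powr (1 - p) * j = j powr (1 / p)"
    proof -
      have "(j powr (1 / p)) powr (1 - p) * j = j powr (1 / p * (1 - p)) * j powr 1"
        using j0 by (simp add: powr_powr)
      also have "\<dots> = j powr (1 / p * (1 - p) + 1)"
        by (rule powr_add[symmetric])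
      also have "1 / p * (1 - p) + 1 = 1 / p"
        using p by (simp add: field_simps)
      finally show ?thesis .
    qed
    finally show ?thesis by (simp add: algebra_simps)
  qed
  then have "g powr p \<le> ((1 + L) * j powr (1 / p)) powr p"
    using g p by (intro powr_mono2) auto
  also have "\<dots> = (1 + L) powr p * j"
    using L j p by (simp add: powr_mult powr_powr)
  finally have "ennreal (g powr p) \<le> ennreal ((1 + L) powr p) * ennreal j"
    by (simp add: ennreal_mult'[symmetric] ennreal_leI)
  then show ?thesis
    by (simp only: j(1))
qed

text \<open>The number \<open>g\<close> stands for the value at \<open>X\<close> of another window,
  or of another functional, that \<open>F\<close> dominates at every rate. \<open>D\<close> is fixed
  before \<open>F\<close>, \<open>g\<close> and \<open>X\<close>, which gives constants independent
  of the functional.\<close>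

lemma power_bound:
  fixes K K' :: "real \<Rightarrow> real"
  assumes p: "0 < p" and K': "\<And>N. 0 \<le> K' N"
  shows "\<exists>D\<ge>0. \<forall>(F :: 'b::euclidean_space \<Rightarrow> real) g X. reproducing K F \<longrightarrow> 0 \<le> g \<longrightarrow>
     (\<forall>N. ennreal g \<le> ennreal (K' N) * (\<integral>\<^sup>+Y. ennreal (exp (- (N * norm (X - Y))) * F Y) \<partial>lborel)) \<longrightarrow>
     ennreal (g powr p) \<le> ennreal D * (\<integral>\<^sup>+Y. ennreal (exp (- norm (X - Y)) * F Y powr p) \<partial>lborel)"
proof -
  obtain L where L: "0 < L" "\<And>X :: 'b. (\<integral>\<^sup>+Y. ennreal (exp (- (1 * norm (X - Y)))) \<partial>lborel) = ennreal L"
    by (rule nn_integral_exp_neg_norm[of 1, where 'b='b]) auto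
  show ?thesis
  proof (cases "1 \<le> p")
    case True
    have "ennreal (g powr p) \<le> ennreal ((1 + K' 1 * L) powr p * K' 1) * (\<integral>\<^sup>+Y. ennreal (exp (- norm (X - Y)) * F Y powr p) \<partial>lborel)"
      if rep: "reproducing K F" and g: "0 \<le> g"
        "\<And>N. ennreal g \<le> ennreal (K' N) * (\<integral>\<^sup>+Y. ennreal (exp (- (N * norm (X - Y))) * F Y) \<partial>lborel)" for F g and X :: 'b
    proof -
      have [measurable]: "F \<in> borel_measurable borel" and F0: "\<And>Y. 0 \<le> F Y"
        using rep unfolding reproducing_def by auto
      let ?w = "\<lambda>Y. K' 1 * exp (- norm (X - Y))"
      have "(\<integral>\<^sup>+Y. ennreal (?w Y) \<partial>lborel) = ennreal (K' 1) * (\<integral>\<^sup>+Y. ennreal (exp (- (1 * norm (X - Y)))) \<partial>lborel)"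
        using K'[of 1] by (subst nn_integral_cmult[symmetric]) (auto simp: ennreal_mult')
      then have w: "(\<integral>\<^sup>+Y. ennreal (?w Y) \<partial>lborel) \<le> ennreal (K' 1 * L)"
        unfolding L(2) using K'[of 1] by (simp add: ennreal_mult')
      have "(\<integral>\<^sup>+Y. ennreal (?w Y * F Y) \<partial>lborel) = ennreal (K' 1) * (\<integral>\<^sup>+Y. ennreal (exp (- (1 * norm (X - Y))) * F Y) \<partial>lborel)"
        using K'[of 1] by (subst nn_integral_cmult[symmetric]) (auto simp: ennreal_mult' mult.assoc)
      then have "ennreal g \<le> (\<integral>\<^sup>+Y. ennreal (?w Y * F Y) \<partial>lborel)"
        using g(2)[of 1] by simp
      then have "ennreal (g powr p) \<le> ennreal ((1 + K' 1 * L) powr p) * (\<integral>\<^sup>+Y. ennreal (?w Y * F Y powr p) \<partial>lborel)"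
        using K'[of 1] L(1) F0 True g(1) by (intro crude_jensen[OF _ _ _ _ _ w]) auto
      also have "(\<integral>\<^sup>+Y. ennreal (?w Y * F Y powr p) \<partial>lborel)
         = ennreal (K' 1) * (\<integral>\<^sup>+Y. ennreal (exp (- norm (X - Y)) * F Y powr p) \<partial>lborel)"
        using K'[of 1] by (subst nn_integral_cmult[symmetric]) (auto simp: ennreal_mult' mult.assoc)
      finally show ?thesis
        by (simp add: ennreal_mult' mult.assoc)
    qed
    then show ?thesis
      using K'[of 1] by (intro exI[of _ "(1 + K' 1 * L) powr p * K' 1"]) auto
  next
    case False
    then have p1: "p \<le> 1" by simp
    \<comment> \<open>This rate makes the kernel of \<open>peetre\<close> decay with rate
      \<open>?N * p = 1\<close>. The resulting growth bound for \<open>F\<close>, of rate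
      \<open>?N\<close>, is inserted into the hypothesis at rate \<open>?N + 1\<close> and leaves an
      integrable exponential. The maximum with 0 is taken because positivity of \<open>K\<close> is
      part of \<open>reproducing\<close> and is not known before \<open>F\<close> is given.\<close>
    let ?N = "1 / p"
    let ?D = "(K' (?N + 1) * L) powr p * K ?N"
    have "ennreal (g powr p) \<le> ennreal (max 0 ?D) * (\<integral>\<^sup>+Y. ennreal (exp (- norm (X - Y)) * F Y powr p) \<partial>lborel)" (is "_ \<le> _ * ?I")
      if rep: "reproducing K F" and g: "0 \<le> g"
        "\<And>N. ennreal g \<le> ennreal (K' N) * (\<integral>\<^sup>+Y. ennreal (exp (- (N * norm (X - Y))) * F Y) \<partial>lborel)" for F g and X :: 'b
    proof -
      have [measurable]: "F \<in> borel_measurable borel" and F0: "\<And>Y. 0 \<le> F Y" and K: "0 < K ?N"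
        using rep unfolding reproducing_def by auto
      show ?thesis
      proof (cases "?I = \<infinity>")
        case True
        \<comment> \<open>In extended reals \<open>0 * \<infinity> = 0\<close>, so a vanishing
          constant is treated apart; it forces \<open>g = 0\<close>.\<close>
        show ?thesis
        proof (cases "K' (?N + 1) = 0")
          case True
          then have "g = 0"
            using g(1) g(2)[of "?N + 1"] by (simp add: ennreal_eq_0_iff)
          then show ?thesis by simp
        next
          case False
          then have "0 < ?D"
            using K'[of "?N + 1"] L(1) K by (simp add: less_le)
          then have "0 < max 0 ?D"
            by (rule order.strict_trans2[OF _ max.cobounded2])
          then show ?thesis
            unfolding \<open>?I = \<infinity>\<close> by (rule le_ennreal_mult_infinity)
        qed
      next
        case False
        then obtain i where i: "?I = ennreal i" "0 \<le> i"
          by (cases ?I) auto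
        have FZ: "F Z \<le> (K ?N * i) powr ?N * exp (?N * norm (X - Z))" for Z
        proof -
          have "ennreal (F Z powr p) \<le> ennreal (K ?N * exp (?N * p * norm (X - Z)))
            * (\<integral>\<^sup>+Y. ennreal (exp (- (?N * p * norm (X - Y))) * F Y powr p) \<partial>lborel)"
            using p by (intro peetre[OF rep p p1]) auto
          then have "ennreal (F Z powr p) \<le> ennreal (K ?N * exp (norm (X - Z))) * ennreal i"
            using p unfolding i(1)[symmetric] by simp
          then have "ennreal (F Z powr p) \<le> ennreal (K ?N * exp (norm (X - Z)) * i)"
            using i K by (simp add: ennreal_mult)
          then have "F Z powr p \<le> K ?N * exp (norm (X - Z)) * i"
            using K i by (subst (asm) ennreal_le_iff) auto
          then have "(F Z powr p) powr ?N \<le> ((K ?N * i) * exp (norm (X - Z))) powr ?N"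
            using p by (intro powr_mono2) (auto simp: mult_ac)
          then show ?thesis
            using p F0[of Z] K i mult_exp_powr[of "K ?N * i" "norm (X - Z)" ?N] by (simp add: powr_powr)
        qed
        have "ennreal g \<le> ennreal (K' (?N + 1)) * (\<integral>\<^sup>+Y. ennreal ((K ?N * i) powr ?N) * ennreal (exp (- (1 * norm (X - Y)))) \<partial>lborel)"
        proof (rule order_trans[OF g(2)[of "?N + 1"]], rule mult_left_mono, rule nn_integral_mono)
          fix Y
          have "exp (- ((?N + 1) * norm (X - Y))) * F Y
            \<le> exp (- ((?N + 1) * norm (X - Y))) * ((K ?N * i) powr ?N * exp (?N * norm (X - Y)))"
            by (intro mult_left_mono FZ) auto
          also have "\<dots> = (K ?N * i) powr ?N * (exp (- ((?N + 1) * norm (X - Y))) * exp (?N * norm (X - Y)))"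
            by (simp only: mult_ac)
          also have "exp (- ((?N + 1) * norm (X - Y))) * exp (?N * norm (X - Y)) = exp (- (1 * norm (X - Y)))"
            by (simp add: exp_add[symmetric] algebra_simps)
          finally show "ennreal (exp (- ((?N + 1) * norm (X - Y))) * F Y) \<le> ennreal ((K ?N * i) powr ?N) * ennreal (exp (- (1 * norm (X - Y))))"
            by (simp add: ennreal_mult'[symmetric] ennreal_leI)
        qed simp
        also have "\<dots> = ennreal (K' (?N + 1)) * (ennreal ((K ?N * i) powr ?N) * ennreal L)"
          unfolding L(2)[of X, symmetric] by (subst nn_integral_cmult) auto
        also have "\<dots> = ennreal (K' (?N + 1) * ((K ?N * i) powr ?N * L))"
          by (simp only: ennreal_mult'[OF K'] ennreal_mult'[OF powr_ge_zero])
        also have "K' (?N + 1) * ((K ?N * i) powr ?N * L) = K' (?N + 1) * L * (K ?N * i) powr ?N"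
          by (simp only: mult_ac)
        finally have "g \<le> K' (?N + 1) * L * (K ?N * i) powr ?N"
          using K'[of "?N + 1"] L(1) by (subst (asm) ennreal_le_iff) auto
        then have "g powr p \<le> (K' (?N + 1) * L * (K ?N * i) powr ?N) powr p"
          using g p by (intro powr_mono2) auto
        also have "\<dots> = ?D * i"
          using K'[of "?N + 1"] L(1) K i p by (simp add: powr_mult powr_powr)
        finally have "ennreal (g powr p) \<le> ennreal ?D * ennreal i"
          using i(2) K by (simp add: ennreal_mult'[symmetric] ennreal_mult''[symmetric] ennreal_leI)
        also have "\<dots> \<le> ennreal (max 0 ?D) * ennreal i"
          by (intro mult_right_mono ennreal_leI) auto
        finally show ?thesis
          by (simp only: i(1))
      qed
    qed
    then show ?thesis
      by (intro exI[of _ "max 0 ?D"]) auto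
  qed
qed

subsection \<open>Quasi-norms\<close>

lemma Lp_qnorm_finite_mono:
  assumes p: "0 < p" "p \<noteq> \<infinity>" and K: "0 < K"
    and le: "(\<integral>\<^sup>+z. ennreal (cmod (G z) powr enn2real p) \<partial>M) \<le> ennreal K * (\<integral>\<^sup>+z. ennreal (cmod (F z) powr enn2real p) \<partial>M')"
  shows "Lp_qnorm p M G \<le> ennreal (K powr (1 / enn2real p)) * Lp_qnorm p M' F"
proof -
  let ?r = "enn2real p"
  have r: "0 < ?r"
    using p by (simp add: enn2real_positive_iff less_top)
  let ?I = "\<integral>\<^sup>+z. ennreal (cmod (G z) powr ?r) \<partial>M" and ?J = "\<integral>\<^sup>+z. ennreal (cmod (F z) powr ?r) \<partial>M'"
  show ?thesis
  proof (cases "?J = \<infinity>")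
    case True
    then show ?thesis
      using p K by (simp add: Lp_qnorm_def Let_def ennreal_mult_top)
  next
    case False
    then obtain j where j: "?J = ennreal j" "0 \<le> j"
      by (cases ?J) auto
    have I: "?I \<le> ennreal (K * j)"
      using le K j by (simp add: ennreal_mult'[symmetric])
    then obtain i where i: "?I = ennreal i" "0 \<le> i"
      by (cases ?I) (auto simp: top_unique)
    have "i \<le> K * j"
      using I K j unfolding i(1) by (subst (asm) ennreal_le_iff) auto
    then have "i powr (1 / ?r) \<le> (K * j) powr (1 / ?r)"
      using i r by (intro powr_mono2) auto
    then have "ennreal (i powr (1 / ?r)) \<le> ennreal (K powr (1 / ?r)) * ennreal (j powr (1 / ?r))"
      using K j by (simp add: powr_mult ennreal_mult'[symmetric] ennreal_leI)
    then show ?thesis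
      using p i j by (simp add: Lp_qnorm_def Let_def)
  qed
qed

lemma Lp_qnorm_infty: "Lp_qnorm \<infinity> M F = esssup M (\<lambda>z. ennreal (cmod (F z)))"
  by (simp add: Lp_qnorm_def)

lemma Lp_qnorm_mono:
  assumes p: "0 < p" and a: "0 < a" and [measurable]: "G \<in> borel_measurable M" "F \<in> borel_measurable M"
    and le: "\<And>z. cmod (G z) \<le> a * cmod (F z)"
  shows "Lp_qnorm p M G \<le> ennreal a * Lp_qnorm p M F"
proof (cases "p = \<infinity>")
  case True
  have "AE z in M. ennreal (cmod (G z)) \<le> ennreal a * esssup M (\<lambda>z. ennreal (cmod (F z)))"
    using esssup_AE[of "\<lambda>z. ennreal (cmod (F z))" M]
  proof eventually_elim
    case (elim z)
    have "ennreal (cmod (G z)) \<le> ennreal a * ennreal (cmod (F z))"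
      using le[of z] a by (simp add: ennreal_mult'[symmetric] ennreal_leI)
    also have "\<dots> \<le> ennreal a * esssup M (\<lambda>z. ennreal (cmod (F z)))"
      by (intro mult_left_mono elim) auto
    finally show ?case .
  qed
  then show ?thesis
    unfolding True Lp_qnorm_infty by (intro esssup_I) auto
next
  case False
  let ?r = "enn2real p"
  have r: "0 < ?r"
    using p False by (simp add: enn2real_positive_iff less_top)
  have "(\<integral>\<^sup>+z. ennreal (cmod (G z) powr ?r) \<partial>M) \<le> (\<integral>\<^sup>+z. ennreal (a powr ?r) * ennreal (cmod (F z) powr ?r) \<partial>M)"
  proof (rule nn_integral_mono)
    fix z
    have "cmod (G z) powr ?r \<le> (a * cmod (F z)) powr ?r"
      using r le by (intro powr_mono2) auto
    then show "ennreal (cmod (G z) powr ?r) \<le> ennreal (a powr ?r) * ennreal (cmod (F z) powr ?r)"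
      using a by (simp add: powr_mult ennreal_mult'[symmetric] ennreal_leI)
  qed
  also have "\<dots> = ennreal (a powr ?r) * (\<integral>\<^sup>+z. ennreal (cmod (F z) powr ?r) \<partial>M)"
    by (rule nn_integral_cmult) measurable
  finally have "Lp_qnorm p M G \<le> ennreal ((a powr ?r) powr (1 / ?r)) * Lp_qnorm p M F"
    using a by (intro Lp_qnorm_finite_mono[OF p False]) auto
  then show ?thesis
    using a r by (simp add: powr_powr)
qed

text \<open>The special case of \<open>change_window\<close> in which both windows agree, with 1
  added to the constant to make it positive.\<close>

lemma reproducing_gabor:
  fixes \<phi> :: "'a::euclidean_space \<Rightarrow> complex"
  assumes \<phi>: "\<phi> \<in> Sigma1" "\<phi> \<noteq> (\<lambda>_. 0)"
  obtains K where "\<And>u. u \<in> Sigma1_dual \<Longrightarrow> reproducing K (\<lambda>X. cmod (u (gabor \<phi> X)))"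
proof -
  have "\<exists>C>0. \<forall>u\<in>Sigma1_dual. \<forall>X. ennreal (cmod (u (gabor \<phi> X)))
    \<le> ennreal C * (\<integral>\<^sup>+Y. ennreal (exp (- (N * norm (X - Y))) * cmod (u (gabor \<phi> Y))) \<partial>lborel)" for N
  proof -
    obtain C where C: "0 \<le> C" "\<And>u X. u \<in> Sigma1_dual \<Longrightarrow> ennreal (cmod (u (gabor \<phi> X)))
      \<le> ennreal C * (\<integral>\<^sup>+Y. ennreal (exp (- (N * norm (X - Y))) * cmod (u (gabor \<phi> Y))) \<partial>lborel)"
      using change_window[OF \<phi> \<phi>(1), of N] by blast
    have "ennreal C \<le> ennreal (C + 1)"
      by (intro ennreal_leI) simp
    then have *: "ennreal C * x \<le> ennreal (C + 1) * x" for x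
      by (intro mult_right_mono) auto
    show ?thesis
    proof (intro exI[of _ "C + 1"] conjI ballI allI)
      show "0 < C + 1" using C(1) by simp
      show "ennreal (cmod (u (gabor \<phi> X)))
        \<le> ennreal (C + 1) * (\<integral>\<^sup>+Y. ennreal (exp (- (N * norm (X - Y))) * cmod (u (gabor \<phi> Y))) \<partial>lborel)"
        if "u \<in> Sigma1_dual" for u X
        by (rule order_trans[OF C(2)[OF that] *])
    qed
  qed
  then have "\<forall>N. \<exists>C. C > 0 \<and> (\<forall>u\<in>Sigma1_dual. \<forall>X. ennreal (cmod (u (gabor \<phi> X)))
    \<le> ennreal C * (\<integral>\<^sup>+Y. ennreal (exp (- (N * norm (X - Y))) * cmod (u (gabor \<phi> Y))) \<partial>lborel))"
    by (intro allI)
  from choice[OF this] obtain K where "\<forall>N. K N > 0 \<and> (\<forall>u\<in>Sigma1_dual. \<forall>X. ennreal (cmod (u (gabor \<phi> X)))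
    \<le> ennreal (K N) * (\<integral>\<^sup>+Y. ennreal (exp (- (N * norm (X - Y))) * cmod (u (gabor \<phi> Y))) \<partial>lborel))"
    by (rule exE)
  then have "reproducing K (\<lambda>X. cmod (u (gabor \<phi> X)))" if "u \<in> Sigma1_dual" for u
    using dual_gabor[OF \<phi>(1) that] that unfolding reproducing_def by auto
  then show ?thesis using that by blast
qed

text \<open>The hypothesis concerns \<open>p\<close>-th powers already. So for finite
  \<open>p\<close> the argument is Tonelli followed by the bound on the integral of the kernel over
  \<open>X\<close>, and for \<open>p = \<infinity>\<close> it is the bound on the integral over
  \<open>Y\<close>. The added 1 keeps the constant positive.\<close>

lemma Lp_qnorm_schur:
  fixes F :: "'c \<Rightarrow> complex" and G :: "'b \<Rightarrow> complex"
  assumes p: "0 < p" and [measurable]: "G \<in> borel_measurable M" "F \<in> borel_measurable M'"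
    and "sigma_finite_measure M" "sigma_finite_measure M'"
    and k [measurable]: "case_prod k \<in> borel_measurable (M \<Otimes>\<^sub>M M')"
    and D: "0 \<le> D" "0 \<le> D'" and k1: "\<And>Y. Y \<in> space M' \<Longrightarrow> (\<integral>\<^sup>+X. k X Y \<partial>M) \<le> ennreal D"
    and k2: "\<And>X. X \<in> space M \<Longrightarrow> (\<integral>\<^sup>+Y. k X Y \<partial>M') \<le> ennreal D'"
    and fin: "p \<noteq> \<infinity> \<Longrightarrow> (\<And>X. X \<in> space M \<Longrightarrow> ennreal (cmod (G X) powr enn2real p) \<le> (\<integral>\<^sup>+Y. k X Y * ennreal (cmod (F Y) powr enn2real p) \<partial>M'))"
    and inf: "p = \<infinity> \<Longrightarrow> (\<And>X. X \<in> space M \<Longrightarrow> ennreal (cmod (G X)) \<le> (\<integral>\<^sup>+Y. k X Y * ennreal (cmod (F Y)) \<partial>M'))"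
  shows "Lp_qnorm p M G \<le> ennreal (if p = \<infinity> then D' + 1 else (D + 1) powr (1 / enn2real p)) * Lp_qnorm p M' F"
proof (cases "p = \<infinity>")
  case True
  let ?S = "esssup M' (\<lambda>z. ennreal (cmod (F z)))"
  have "ennreal (cmod (G X)) \<le> ennreal (D' + 1) * ?S" if X: "X \<in> space M" for X
  proof -
    have [measurable]: "k X \<in> borel_measurable M'"
      using measurable_Pair2[OF k X] by simp
    have "ennreal (cmod (G X)) \<le> (\<integral>\<^sup>+Y. k X Y * ?S \<partial>M')"
    proof (rule order_trans[OF inf[OF True X]], rule nn_integral_mono_AE)
      show "AE Y in M'. k X Y * ennreal (cmod (F Y)) \<le> k X Y * ?S"
        using esssup_AE[of "\<lambda>z. ennreal (cmod (F z))" M'] by eventually_elim (simp add: mult_left_mono)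
    qed
    also have "\<dots> = (\<integral>\<^sup>+Y. k X Y \<partial>M') * ?S"
      by (rule nn_integral_multc) measurable
    also have "\<dots> \<le> ennreal (D' + 1) * ?S"
      using D by (intro mult_right_mono order_trans[OF k2[OF X]] ennreal_leI) auto
    finally show ?thesis .
  qed
  then show ?thesis
    unfolding True Lp_qnorm_infty by (auto intro!: esssup_I AE_I2)
next
  case False
  interpret pair_sigma_finite M M'
    using assms(4,5) by (simp add: pair_sigma_finite_def)
  let ?f = "\<lambda>Y. ennreal (cmod (F Y) powr enn2real p)"
  have "(\<integral>\<^sup>+X. ennreal (cmod (G X) powr enn2real p) \<partial>M) \<le> (\<integral>\<^sup>+X. (\<integral>\<^sup>+Y. k X Y * ?f Y \<partial>M') \<partial>M)"
    by (intro nn_integral_mono fin[OF False])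
  also have "\<dots> = (\<integral>\<^sup>+Y. (\<integral>\<^sup>+X. k X Y * ?f Y \<partial>M) \<partial>M')"
    by (rule Fubini'[symmetric]) measurable
  also have "\<dots> = (\<integral>\<^sup>+Y. (\<integral>\<^sup>+X. k X Y \<partial>M) * ?f Y \<partial>M')"
    by (intro nn_integral_cong nn_integral_multc) measurable
  also have "\<dots> \<le> (\<integral>\<^sup>+Y. ennreal (D + 1) * ?f Y \<partial>M')"
    using D by (intro nn_integral_mono mult_right_mono order_trans[OF k1] ennreal_leI) auto
  also have "\<dots> = ennreal (D + 1) * (\<integral>\<^sup>+Y. ?f Y \<partial>M')"
    by (rule nn_integral_cmult) measurable
  finally show ?thesis
    using Lp_qnorm_finite_mono[where K="D + 1" and G=G and M=M and F=F and M'=M', OF p False] D False by simp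
qed

subsection \<open>Lattices\<close>

text \<open>Biorthogonality together with the resulting coordinate expansion. In this form every
  lattice lemma can be applied both to the basis and to its dual.\<close>

definition dual_pair :: "('n::finite \<Rightarrow> real ^ 'n) \<Rightarrow> ('n \<Rightarrow> real ^ 'n) \<Rightarrow> bool" where
  "dual_pair A B \<longleftrightarrow> (\<forall>j k. A j \<bullet> B k = (if j = k then 2 * pi else 0))
    \<and> (\<forall>x. x = (\<Sum>j\<in>UNIV. (x \<bullet> B j / (2 * pi)) *\<^sub>R A j))"

lemma dual_pair_dual_basis:
  fixes E :: "'n::finite \<Rightarrow> real ^ 'n"
  assumes E: "is_basis E"
  shows "dual_pair E (dual_basis E)" "dual_pair (dual_basis E) E"
proof -
  let ?B = "dual_basis E"
  note d = inner_dual_basis[OF E]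
  have rep: "x = (\<Sum>j\<in>UNIV. (x \<bullet> ?B j / (2 * pi)) *\<^sub>R E j)" for x
  proof -
    have "x \<in> span (range E)"
      using E by (simp add: is_basis_def)
    then obtain c where c: "x = (\<Sum>v\<in>range E. c v *\<^sub>R v)"
      by (auto simp: span_finite)
    have "(\<Sum>v\<in>range E. c v *\<^sub>R v) = (\<Sum>j\<in>UNIV. c (E j) *\<^sub>R E j)"
      using E by (subst sum.reindex) (auto simp: is_basis_def)
    then have x: "x = (\<Sum>j\<in>UNIV. c (E j) *\<^sub>R E j)"
      using c by simp
    have "x \<bullet> ?B k = (\<Sum>j\<in>UNIV. c (E j) * (if j = k then 2 * pi else 0))" for k
      by (subst x) (simp add: inner_sum_left d)
    then have "x \<bullet> ?B k = c (E k) * (2 * pi)" for k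
      by (simp add: if_distrib cong: if_cong)
    then have "c (E k) = x \<bullet> ?B k / (2 * pi)" for k
      by simp
    with x show ?thesis by simp
  qed
  show "dual_pair E ?B"
    unfolding dual_pair_def using d rep by auto
  have "y = (\<Sum>j\<in>UNIV. (y \<bullet> E j / (2 * pi)) *\<^sub>R ?B j)" for y
  proof -
    \<comment> \<open>This vector is orthogonal to every \<open>E k\<close>; expanding it along
      \<open>E\<close> shows that it is orthogonal to itself.\<close>
    let ?z = "y - (\<Sum>j\<in>UNIV. (y \<bullet> E j / (2 * pi)) *\<^sub>R ?B j)"
    have "E k \<bullet> ?z = 0" for k
    proof -
      have "E k \<bullet> (\<Sum>j\<in>UNIV. (y \<bullet> E j / (2 * pi)) *\<^sub>R ?B j) = (\<Sum>j\<in>UNIV. y \<bullet> E j / (2 * pi) * (if k = j then 2 * pi else 0))"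
        by (simp add: inner_sum_right d)
      also have "\<dots> = y \<bullet> E k"
        by (simp add: if_distrib cong: if_cong)
      finally show ?thesis
        by (simp add: inner_diff_right inner_commute)
    qed
    then have "?z \<bullet> ?z = 0"
      by (subst rep[of ?z]) (simp add: inner_sum_left)
    then show ?thesis by simp
  qed
  then show "dual_pair ?B E"
    unfolding dual_pair_def using d by (simp add: inner_commute)
qed

lemma lattice_ofE:
  assumes "x \<in> lattice_of A"
  obtains k :: "'n::finite \<Rightarrow> int" where "x = (\<Sum>j\<in>UNIV. of_int (k j) *\<^sub>R A j)"
  using assms unfolding lattice_of_def by blast

lemma lattice_of_add: "x \<in> lattice_of A \<Longrightarrow> y \<in> lattice_of A \<Longrightarrow> x + y \<in> lattice_of A"
proof -
  assume "x \<in> lattice_of A" "y \<in> lattice_of A"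
  then obtain k l where "x = (\<Sum>j\<in>UNIV. of_int (k j) *\<^sub>R A j)" "y = (\<Sum>j\<in>UNIV. of_int (l j) *\<^sub>R A j)"
    by (metis lattice_ofE)
  then have "x + y = (\<Sum>j\<in>UNIV. of_int (k j + l j) *\<^sub>R A j)"
    by (simp add: scaleR_add_left sum.distrib)
  then show ?thesis
    unfolding lattice_of_def by (intro CollectI exI[of _ "\<lambda>j. k j + l j"]) simp
qed

lemma lattice_of_minus: "x \<in> lattice_of A \<Longrightarrow> - x \<in> lattice_of A"
proof -
  assume "x \<in> lattice_of A"
  then obtain k where "x = (\<Sum>j\<in>UNIV. of_int (k j) *\<^sub>R A j)"
    by (rule lattice_ofE)
  then have "- x = (\<Sum>j\<in>UNIV. of_int (- k j) *\<^sub>R A j)"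
    by (simp add: sum_negf)
  then show ?thesis
    unfolding lattice_of_def by (intro CollectI exI[of _ "\<lambda>j. - k j"]) simp
qed

lemma lattice_of_diff: "x \<in> lattice_of A \<Longrightarrow> y \<in> lattice_of A \<Longrightarrow> x - y \<in> lattice_of A"
  using lattice_of_add[of x A "- y"] lattice_of_minus[of y A] by simp

lemma lattice_of_zero: "0 \<in> lattice_of A"
  unfolding lattice_of_def by (intro CollectI exI[of _ "\<lambda>_. 0"]) simp

lemma countable_lattice_of: "countable (lattice_of (A :: 'n::finite \<Rightarrow> real ^ 'n))"
proof -
  have "lattice_of A = range (\<lambda>k :: 'n \<Rightarrow> int. \<Sum>j\<in>UNIV. of_int (k j) *\<^sub>R A j)"
    unfolding lattice_of_def by auto
  moreover have "countable (UNIV :: ('n \<Rightarrow> int) set)"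
  proof -
    have "countable (PiE (UNIV :: 'n set) (\<lambda>_. UNIV :: int set))"
      by (intro countable_PiE) auto
    then show ?thesis by simp
  qed
  ultimately show ?thesis by simp
qed

lemma lattice_inner:
  assumes "dual_pair A B" "x = (\<Sum>j\<in>UNIV. of_int (k j) *\<^sub>R A j)"
  shows "x \<bullet> B m = 2 * pi * of_int (k m)"
proof -
  have "x \<bullet> B m = (\<Sum>j\<in>UNIV. of_int (k j) * (if j = m then 2 * pi else 0))"
    using assms unfolding dual_pair_def by (simp add: inner_sum_left)
  then show ?thesis
    by (simp add: if_distrib cong: if_cong)
qed

lemma lattice_inner_int:
  assumes "dual_pair A B" "x \<in> lattice_of A" "y \<in> lattice_of B"
  obtains i :: int where "x \<bullet> y = 2 * pi * of_int i"
proof -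
  obtain k where k: "x = (\<Sum>j\<in>UNIV. of_int (k j) *\<^sub>R A j)"
    using assms(2) by (rule lattice_ofE)
  obtain l where l: "y = (\<Sum>j\<in>UNIV. of_int (l j) *\<^sub>R B j)"
    using assms(3) by (rule lattice_ofE)
  have "x \<bullet> y = (\<Sum>j\<in>UNIV. of_int (l j) * (2 * pi * of_int (k j)))"
    by (subst l) (simp add: inner_sum_right lattice_inner[OF assms(1) k])
  also have "\<dots> = 2 * pi * of_int (\<Sum>j\<in>UNIV. l j * k j)"
    by (simp add: sum_distrib_left mult_ac)
  finally show ?thesis using that by blast
qed

lemma cis_lattice:
  assumes "dual_pair A B" "x \<in> lattice_of A" "y \<in> lattice_of B"
  shows "cis (x \<bullet> y) = 1"
proof -
  obtain i :: int where i: "x \<bullet> y = 2 * pi * of_int i"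
    using lattice_inner_int[OF assms] by blast
  show ?thesis
    unfolding i by (simp add: cis_multiple_2pi)
qed

text \<open>Some coordinate of a nonzero lattice vector is a nonzero integer. Pairing with the
  corresponding \<open>B m\<close> reads it off, and Cauchy-Schwarz turns this into a lower bound
  for the norm.\<close>

lemma lattice_separated:
  assumes "dual_pair A B"
  obtains d where "0 < d" "\<And>x y. x \<in> lattice_of A \<Longrightarrow> y \<in> lattice_of A \<Longrightarrow> x \<noteq> y \<Longrightarrow> d \<le> norm (x - y)"
proof -
  define S where "S = (\<Sum>m\<in>UNIV. norm (B m)) + 1"
  have S: "0 < S" "\<And>m. norm (B m) \<le> S"
  proof -
    show "0 < S"
      unfolding S_def by (simp add: sum_nonneg add_nonneg_pos)
    show "norm (B m) \<le> S" for m
      using member_le_sum[of m UNIV "\<lambda>m. norm (B m)"] unfolding S_def by simp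
  qed
  have "2 * pi / S \<le> norm (x - y)" if xy: "x \<in> lattice_of A" "y \<in> lattice_of A" "x \<noteq> y" for x y
  proof -
    obtain k where k: "x - y = (\<Sum>j\<in>UNIV. of_int (k j) *\<^sub>R A j)"
      using lattice_of_diff[OF xy(1,2)] by (rule lattice_ofE)
    have "\<exists>m. k m \<noteq> 0"
    proof (rule ccontr)
      assume "\<nexists>m. k m \<noteq> 0"
      then have "x - y = 0" by (subst k) simp
      then show False using xy(3) by simp
    qed
    then obtain m where m: "k m \<noteq> 0" by blast
    have "2 * pi \<le> 2 * pi * \<bar>of_int (k m)\<bar>"
      using m by (simp flip: of_int_abs)
    also have "\<dots> = \<bar>(x - y) \<bullet> B m\<bar>"
      unfolding lattice_inner[OF assms k] by (simp add: abs_mult)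
    also have "\<dots> \<le> norm (x - y) * norm (B m)"
      by (rule Cauchy_Schwarz_ineq2)
    also have "\<dots> \<le> norm (x - y) * S"
      by (intro mult_left_mono S) auto
    finally show ?thesis
      using S(1) by (simp add: field_simps)
  qed
  then show ?thesis
    using that[of "2 * pi / S"] S(1) by simp
qed

text \<open>Compare the sum with an integral over small disjoint balls around the lattice points.\<close>

lemma lattice_sum_exp:
  fixes A B :: "'n::finite \<Rightarrow> real ^ 'n"
  assumes AB: "dual_pair A B" and a: "0 < a"
  obtains C where "0 < C"
    "\<And>y. (\<integral>\<^sup>+j. ennreal (exp (- (a * norm (y - j)))) \<partial>count_space (lattice_of A)) \<le> ennreal C"
proof -
  let ?L = "lattice_of A"
  obtain d where d: "0 < d" "\<And>x y. x \<in> ?L \<Longrightarrow> y \<in> ?L \<Longrightarrow> x \<noteq> y \<Longrightarrow> d \<le> norm (x - y)"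
    using lattice_separated[OF AB] by blast
  \<comment> \<open>Half of the minimal distance, so that a point lies in at most one of the
    balls.\<close>
  define r where "r = d / 2"
  have r: "0 < r" using d by (simp add: r_def)
  obtain L where L: "0 < L" "\<And>X :: real ^ 'n. (\<integral>\<^sup>+Y. ennreal (exp (- (a * norm (X - Y)))) \<partial>lborel) = ennreal L"
    "\<And>X :: real ^ 'n. (\<integral>\<^sup>+Y. ennreal (exp (- (a * norm (Y - X)))) \<partial>lborel) = ennreal L"
    by (rule nn_integral_exp_neg_norm[OF a, where 'b="real ^ 'n"]) blast
  define V where "V = measure lborel (ball (0 :: real ^ 'n) r)"
  have emV: "emeasure lborel (ball j r) = ennreal V" for j :: "real ^ 'n"
  proof -
    have "emeasure lborel (ball j r) = emeasure lborel (ball (0 :: real ^ 'n) r)"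
      using r by (simp add: emeasure_ball)
    also have "\<dots> = ennreal V"
      unfolding V_def by (rule emeasure_eq_ennreal_measure)
        (use emeasure_lborel_ball_finite[of "0 :: real ^ 'n" r] in simp)
    finally show ?thesis .
  qed
  have "0 < V"
  proof -
    have "emeasure lborel (ball (0 :: real ^ 'n) r) \<noteq> 0"
    proof
      assume "emeasure lborel (ball (0 :: real ^ 'n) r) = 0"
      then have "ball (0 :: real ^ 'n) r \<in> null_sets lborel"
        by (simp add: null_sets_def)
      then have "negligible (ball (0 :: real ^ 'n) r)"
        unfolding negligible_iff_null_sets by (rule null_sets_completionI)
      then show False
        using r open_not_negligible[of "ball (0 :: real ^ 'n) r"] by simp
    qed
    then show ?thesis
      unfolding emV by (simp add: ennreal_eq_0_iff not_le)
  qed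
  have one: "(\<integral>\<^sup>+j. indicator (ball j r) t \<partial>count_space ?L) \<le> (1 :: ennreal)" for t :: "real ^ 'n"
  proof -
    let ?S = "{j \<in> ?L. t \<in> ball j r}"
    have sub: "\<exists>z. ?S \<subseteq> {z}"
    proof (cases "?S = {}")
      case False
      then obtain z where z: "z \<in> ?S" by blast
      have "j = z" if "j \<in> ?S" for j
      proof (rule ccontr)
        assume "j \<noteq> z"
        then have "d \<le> norm (j - z)"
          using d(2) that z by blast
        moreover have "dist j z < r + r"
          using that z dist_triangle_less_add[of j t r z r] by (auto simp: dist_commute)
        ultimately show False
          by (simp add: dist_norm r_def)
      qed
      then show ?thesis by blast
    qed auto
    then obtain z where z: "?S \<subseteq> {z}" by blast
    have "(\<integral>\<^sup>+j. indicator (ball j r) t \<partial>count_space ?L) = (\<integral>\<^sup>+j. indicator ?S j \<partial>count_space ?L)"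
      by (intro nn_integral_cong) (auto simp: indicator_def)
    also have "\<dots> = emeasure (count_space ?L) ?S"
      by (rule nn_integral_indicator) simp
    also have "\<dots> = of_nat (card ?S)"
      using z finite_subset[OF z] by (subst emeasure_count_space_finite) auto
    also have "\<dots> \<le> 1"
      using card_mono[OF _ z] by simp
    finally show ?thesis .
  qed
  \<comment> \<open>Over the ball around \<open>j\<close> the exponential changes at most by the
    factor \<open>exp (a * r)\<close>, and the mean over the ball is normalised by its volume
    \<open>V\<close>.\<close>
  define c where "c = exp (a * r) / V"
  have c: "0 < c" using \<open>0 < V\<close> by (simp add: c_def)
  have "(\<integral>\<^sup>+j. ennreal (exp (- (a * norm (y - j)))) \<partial>count_space ?L) \<le> ennreal (c * L)" for y
  proof -
    have pt: "ennreal (exp (- (a * norm (y - j))))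
        \<le> (\<integral>\<^sup>+t. indicator (ball j r) t * ennreal (c * exp (- (a * norm (y - t)))) \<partial>lborel)" for j
    proof -
      have "ennreal (exp (- (a * norm (y - j)))) = ennreal (exp (- (a * norm (y - j))) / V) * ennreal V"
        using \<open>0 < V\<close> by (simp add: ennreal_mult''[symmetric])
      also have "\<dots> = (\<integral>\<^sup>+t. ennreal (exp (- (a * norm (y - j))) / V) * indicator (ball j r) t \<partial>lborel)"
        unfolding emV[of j, symmetric] by (subst nn_integral_cmult_indicator) auto
      also have "\<dots> \<le> (\<integral>\<^sup>+t. indicator (ball j r) t * ennreal (c * exp (- (a * norm (y - t)))) \<partial>lborel)"
      proof (rule nn_integral_mono)
        fix t
        show "ennreal (exp (- (a * norm (y - j))) / V) * indicator (ball j r) t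
          \<le> indicator (ball j r) t * ennreal (c * exp (- (a * norm (y - t))))"
        proof (cases "t \<in> ball j r")
          case True
          then have "norm (j - t) \<le> r"
            by (simp add: dist_norm)
          then have "a * norm (y - t) \<le> a * (norm (y - j) + r)"
            using a norm_triangle_ineq[of "y - j" "j - t"] by (intro mult_left_mono) auto
          then have "exp (- (a * norm (y - j))) \<le> exp (a * r) * exp (- (a * norm (y - t)))"
            by (simp add: exp_add[symmetric] algebra_simps)
          then have "exp (- (a * norm (y - j))) / V \<le> c * exp (- (a * norm (y - t)))"
            using \<open>0 < V\<close> by (simp add: c_def divide_right_mono)
          then show ?thesis
            using True by (simp add: ennreal_leI)
        qed simp
      qed
      finally show ?thesis .
    qed
    have "(\<integral>\<^sup>+j. ennreal (exp (- (a * norm (y - j)))) \<partial>count_space ?L)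
      \<le> (\<integral>\<^sup>+j. (\<integral>\<^sup>+t. indicator (ball j r) t * ennreal (c * exp (- (a * norm (y - t)))) \<partial>lborel) \<partial>count_space ?L)"
      by (intro nn_integral_mono pt)
    also have "\<dots> = (\<integral>\<^sup>+t. (\<integral>\<^sup>+j. indicator (ball j r) t * ennreal (c * exp (- (a * norm (y - t)))) \<partial>count_space ?L) \<partial>lborel)"
    proof (rule nn_integral_count_space_nn_integral[OF countable_lattice_of, symmetric])
      fix j :: "real ^ 'n"
      have [measurable]: "ball j r \<in> sets borel"
        by simp
      show "(\<lambda>t. indicator (ball j r) t * ennreal (c * exp (- (a * norm (y - t))))) \<in> borel_measurable lborel"
        by measurable
    qed
    also have "\<dots> \<le> (\<integral>\<^sup>+t. 1 * ennreal (c * exp (- (a * norm (y - t)))) \<partial>lborel)"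
    proof (rule nn_integral_mono)
      fix t
      show "(\<integral>\<^sup>+j. indicator (ball j r) t * ennreal (c * exp (- (a * norm (y - t)))) \<partial>count_space ?L)
        \<le> 1 * ennreal (c * exp (- (a * norm (y - t))))"
        by (subst nn_integral_multc) (simp, intro mult_right_mono one, simp)
    qed
    also have "\<dots> = ennreal c * ennreal L"
      unfolding L(2)[of y, symmetric] using c
      by (subst nn_integral_cmult[symmetric]) (auto simp: ennreal_mult')
    also have "\<dots> = ennreal (c * L)"
      using c by (simp add: ennreal_mult')
    finally show ?thesis .
  qed
  then show ?thesis
    using that[of "c * L"] c L(1) by simp
qed

lemma parallelepiped_eq:
  assumes "dual_pair A B"
  shows "parallelepiped A = {x. \<forall>j. 0 \<le> x \<bullet> B j / (2 * pi) \<and> x \<bullet> B j / (2 * pi) \<le> 1}"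
proof (intro equalityI subsetI)
  fix x assume "x \<in> parallelepiped A"
  then obtain t where t: "x = (\<Sum>j\<in>UNIV. t j *\<^sub>R A j)" "\<And>j. 0 \<le> t j \<and> t j \<le> 1"
    unfolding parallelepiped_def by blast
  have "x \<bullet> B m = (\<Sum>j\<in>UNIV. t j * (if j = m then 2 * pi else 0))" for m
    using assms unfolding dual_pair_def t(1) by (simp add: inner_sum_left)
  then have "x \<bullet> B m / (2 * pi) = t m" for m
    by (simp add: if_distrib cong: if_cong)
  then show "x \<in> {x. \<forall>j. 0 \<le> x \<bullet> B j / (2 * pi) \<and> x \<bullet> B j / (2 * pi) \<le> 1}"
    using t(2) by (intro CollectI allI) (simp only:)
next
  fix x assume "x \<in> {x. \<forall>j. 0 \<le> x \<bullet> B j / (2 * pi) \<and> x \<bullet> B j / (2 * pi) \<le> 1}"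
  moreover have "x = (\<Sum>j\<in>UNIV. (x \<bullet> B j / (2 * pi)) *\<^sub>R A j)"
    using assms unfolding dual_pair_def by blast
  ultimately show "x \<in> parallelepiped A"
    unfolding parallelepiped_def
    by (intro CollectI exI[of _ "\<lambda>j. x \<bullet> B j / (2 * pi)"]) simp
qed

lemma closed_parallelepiped:
  assumes "dual_pair A B"
  shows "closed (parallelepiped A)"
  unfolding parallelepiped_eq[OF assms]
  by (intro closed_Collect_all closed_Collect_conj closed_Collect_le continuous_intros) auto

lemma parallelepiped_bounded:
  assumes "x \<in> parallelepiped A"
  shows "norm x \<le> (\<Sum>j\<in>UNIV. norm (A j))"
proof -
  obtain t where t: "x = (\<Sum>j\<in>UNIV. t j *\<^sub>R A j)" "\<And>j. 0 \<le> t j \<and> t j \<le> 1"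
    using assms unfolding parallelepiped_def by blast
  show ?thesis
    unfolding t(1) by (intro sum_norm_le) (use t(2) in \<open>auto intro: mult_left_le_one_le\<close>)
qed

lemma parallelepiped_cover:
  assumes "dual_pair A B"
  obtains k where "k \<in> lattice_of A" "x - k \<in> parallelepiped A"
proof -
  define t where "t j = x \<bullet> B j / (2 * pi)" for j
  let ?k = "\<Sum>j\<in>UNIV. of_int \<lfloor>t j\<rfloor> *\<^sub>R A j"
  have "x = (\<Sum>j\<in>UNIV. t j *\<^sub>R A j)"
    using assms unfolding dual_pair_def t_def by blast
  then have "x - ?k = (\<Sum>j\<in>UNIV. (t j - of_int \<lfloor>t j\<rfloor>) *\<^sub>R A j)"
    by (simp add: scaleR_diff_left sum_subtractf)
  moreover have "0 \<le> t j - of_int \<lfloor>t j\<rfloor> \<and> t j - of_int \<lfloor>t j\<rfloor> \<le> 1" for j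
    by linarith
  ultimately have "x - ?k \<in> parallelepiped A"
    unfolding parallelepiped_def by (intro CollectI exI[of _ "\<lambda>j. t j - of_int \<lfloor>t j\<rfloor>"]) simp
  moreover have "?k \<in> lattice_of A"
    unfolding lattice_of_def by (intro CollectI exI[of _ "\<lambda>j. \<lfloor>t j\<rfloor>"]) simp
  ultimately show ?thesis using that by blast
qed

subsection \<open>The Zak transform as an ultradistribution\<close>

text \<open>In the summable case with finite right-hand side the bound passes from finite partial
  sums to the limit. For a family that is not summable \<open>infsum\<close> is 0, so the estimate
  can be stated for all families.\<close>

lemma norm_infsum_le_nn_integral:
  fixes f :: "'x \<Rightarrow> complex"
  shows "ennreal (cmod (infsum f A)) \<le> (\<integral>\<^sup>+x. ennreal (cmod (f x)) \<partial>count_space A)" (is "_ \<le> ?I")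
proof (cases "f summable_on A \<and> ?I \<noteq> \<infinity>")
  case True
  then obtain B where B: "?I = ennreal B" "0 \<le> B"
    by (cases ?I) auto
  have "(sum f \<longlongrightarrow> infsum f A) (finite_subsets_at_top A)"
    using has_sum_infsum True unfolding has_sum_def by blast
  then have lim: "((\<lambda>S. cmod (sum f S)) \<longlongrightarrow> cmod (infsum f A)) (finite_subsets_at_top A)"
    by (rule tendsto_norm)
  have "cmod (infsum f A) \<le> B"
  proof (rule tendsto_upperbound[OF lim])
    show "\<forall>\<^sub>F S in finite_subsets_at_top A. cmod (sum f S) \<le> B"
    proof (rule eventually_finite_subsets_at_top_weakI)
      fix S assume S: "finite S" "S \<subseteq> A"
      have "ennreal (cmod (sum f S)) \<le> ennreal (\<Sum>x\<in>S. cmod (f x))"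
        by (intro ennreal_leI norm_sum)
      also have "\<dots> = (\<integral>\<^sup>+x. ennreal (cmod (f x)) \<partial>count_space S)"
        using S by (simp add: nn_integral_count_space_finite)
      also have "\<dots> = (\<integral>\<^sup>+x. ennreal (cmod (f x)) * indicator S x \<partial>count_space A)"
        using S by (subst nn_integral_restrict_space[symmetric]) (auto simp: restrict_count_space Int_absorb2)
      also have "\<dots> \<le> ?I"
        by (intro nn_integral_mono) (auto simp: indicator_def)
      finally show "cmod (sum f S) \<le> B"
        using B by (simp add: ennreal_le_iff)
    qed
  qed simp
  then show ?thesis
    unfolding B(1) by (rule ennreal_leI)
next
  case False
  then show ?thesis
    by (cases "f summable_on A") (auto simp: infsum_not_exists)
qed

lemma summable_on_nn_integral:
  fixes f :: "'x \<Rightarrow> complex"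
  assumes "(\<integral>\<^sup>+x. ennreal (cmod (f x)) \<partial>count_space A) \<le> ennreal B" "0 \<le> B"
  shows "f summable_on A"
proof (rule abs_summable_summable, rule nonneg_bdd_above_summable_on)
  show "bdd_above (sum (\<lambda>x. cmod (f x)) ` {F. F \<subseteq> A \<and> finite F})"
  proof (rule bdd_aboveI[of _ B], clarify)
    fix S assume S: "S \<subseteq> A" "finite S"
    have "ennreal (\<Sum>x\<in>S. cmod (f x)) = (\<integral>\<^sup>+x. ennreal (cmod (f x)) \<partial>count_space S)"
      using S by (simp add: nn_integral_count_space_finite)
    also have "\<dots> = (\<integral>\<^sup>+x. ennreal (cmod (f x)) * indicator S x \<partial>count_space A)"
      using S by (subst nn_integral_restrict_space[symmetric]) (auto simp: restrict_count_space Int_absorb2)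
    also have "\<dots> \<le> (\<integral>\<^sup>+x. ennreal (cmod (f x)) \<partial>count_space A)"
      by (intro nn_integral_mono) (auto simp: indicator_def)
    also have "\<dots> \<le> ennreal B"
      by (rule assms)
    finally show "(\<Sum>x\<in>S. cmod (f x)) \<le> B"
      using assms(2) by (simp add: ennreal_le_iff)
  qed
qed simp

text \<open>The test function that \<open>zak_term\<close> hands to \<open>f\<close>: the Zak
  transform is the sum over \<open>j\<close> of \<open>f\<close> composed with these linear
  maps.\<close>

definition zak_fibre :: "'a::euclidean_space \<Rightarrow> ('a \<times> 'a \<Rightarrow> complex) \<Rightarrow> 'a \<Rightarrow> complex" where
  "zak_fibre j \<Psi> = (\<lambda>s. \<integral>t. \<Psi> (s + j, t) * cis (j \<bullet> t) \<partial>lborel)"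

lemma zak_term_eq: "zak_term j f \<Psi> = f (zak_fibre j \<Psi>)"
  unfolding zak_term_def zak_fibre_def by (simp add: cis_conv_exp)

text \<open>For \<open>X = ((x, \<xi>), (\<eta>, y))\<close> this is the scalar that the
  \<open>j\<close>-th fibre map produces from the Gaussian atom at \<open>X\<close>: two phases
  times the Gaussian Fourier transform at \<open>j - y\<close>. It confines the \<open>j\<close>-th
  term to \<open>y\<close> near \<open>j\<close>.\<close>

definition zcoef :: "'a::euclidean_space \<Rightarrow> ('a \<times> 'a) \<times> ('a \<times> 'a) \<Rightarrow> complex" where
  "zcoef j X = cis (- (j \<bullet> fst (snd X))) * cis (snd (fst X) \<bullet> (j - snd (snd X)))
     * (of_real (sqrt (2 * pi)) ^ DIM('a) * gauss (j - snd (snd X)))"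

lemma gauss_Pair: "gauss (a, b) = gauss a * gauss b"
  unfolding gauss_def norm_Pair by (simp add: exp_add[symmetric] add_divide_distrib flip: of_real_mult)

text \<open>A Gaussian on the product space splits; the regrouped centres are
  \<open>(x, \<eta>)\<close> for the first variable and \<open>(\<xi>, y)\<close> for the
  second.\<close>

lemma gabor_gauss_Pair:
  fixes x y :: "'a::euclidean_space"
  shows "gabor gauss X (s, t) = gabor gauss (fst (fst X), fst (snd X)) s * gabor gauss (snd (fst X), snd (snd X)) t"
  by (cases X) (auto simp: gabor_def gauss_Pair cis_mult inner_add_left add.commute)

lemma gabor_gauss_fourier:
  fixes X :: "'a::euclidean_space \<times> 'a"
  shows "(\<integral>t. gabor gauss X t * cis (j \<bullet> t) \<partial>lborel)
    = cis (fst X \<bullet> (j - snd X)) * (of_real (sqrt (2 * pi)) ^ DIM('a) * gauss (j - snd X))"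
proof -
  let ?F = "\<lambda>t. gabor gauss X t * cis (j \<bullet> t)"
  have "(\<integral>t. ?F t \<partial>lborel) = (\<integral>t. ?F (t + fst X) \<partial>lborel)"
    by (rule lborel_integral_translate(1)[symmetric]) measurable
  also have "\<dots> = (\<integral>t. cis (fst X \<bullet> (j - snd X)) * (gauss t * cis (t \<bullet> (j - snd X))) \<partial>lborel)"
  proof (intro Bochner_Integration.integral_cong refl)
    fix t
    have "cis (- ((t + fst X) \<bullet> snd X)) * cis (j \<bullet> (t + fst X)) = cis (fst X \<bullet> (j - snd X)) * cis (t \<bullet> (j - snd X))"
      by (simp add: cis_mult inner_add_left inner_add_right inner_diff_right inner_commute[of j] algebra_simps)
    then show "?F (t + fst X) = cis (fst X \<bullet> (j - snd X)) * (gauss t * cis (t \<bullet> (j - snd X)))"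
      by (simp add: gabor_def algebra_simps)
  qed
  also have "\<dots> = cis (fst X \<bullet> (j - snd X)) * (of_real (sqrt (2 * pi)) ^ DIM('a) * gauss (j - snd X))"
    by (subst integral_mult_right_zero) (simp only: gauss_fourier)
  finally show ?thesis .
qed

lemma gabor_gauss_shift: "gabor gauss (x, \<eta>) (s + j) = cis (- (j \<bullet> \<eta>)) * gabor gauss (x - j, \<eta>) s"
  by (simp add: gabor_def inner_add_left cis_mult algebra_simps)

text \<open>The first variable is only translated by \<open>j\<close>, which moves the centre
  \<open>x\<close> to \<open>x - j\<close>, while the second one is integrated out by the Gaussian
  Fourier transform.\<close>

lemma zak_fibre_gabor_gauss:
  "zak_fibre j (gabor gauss X) s = zcoef j X * gabor gauss (fst (fst X) - j, fst (snd X)) s"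
proof -
  have "zak_fibre j (gabor gauss X) s
    = (\<integral>t. gabor gauss (fst (fst X), fst (snd X)) (s + j) * (gabor gauss (snd (fst X), snd (snd X)) t * cis (j \<bullet> t)) \<partial>lborel)"
    unfolding zak_fibre_def gabor_gauss_Pair by (simp only: mult.assoc)
  also have "\<dots> = zcoef j X * gabor gauss (fst (fst X) - j, fst (snd X)) s"
    unfolding integral_mult_right_zero gabor_gauss_fourier gabor_gauss_shift zcoef_def by (simp add: mult_ac)
  finally show ?thesis .
qed

lemma cmod_zcoef: "cmod (zcoef j X) = sqrt (2 * pi) ^ DIM('a::euclidean_space) * cmod (gauss (j - snd (snd X) :: 'a))"
  by (simp add: zcoef_def norm_mult norm_power)

lemma zcoef_measurable [measurable]:
  "zcoef (j :: 'a::euclidean_space) \<in> borel_measurable borel"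
proof -
  have "continuous_on UNIV (zcoef j)"
    unfolding zcoef_def cis_conv_exp
    by (intro continuous_intros continuous_on_compose2[OF continuous_on_gauss]) auto
  then show ?thesis
    by (rule borel_measurable_continuous_onI)
qed

lemma norm_coordinates:
  fixes X :: "('a::euclidean_space \<times> 'a) \<times> ('a \<times> 'a)"
  shows "norm (fst (fst X)) \<le> norm X" "norm (snd (fst X)) \<le> norm X"
    "norm (fst (snd X)) \<le> norm X" "norm (snd (snd X)) \<le> norm X" "norm (fst (fst X), fst (snd X)) \<le> norm X"
proof -
  obtain x \<xi> \<eta> y where X: "X = ((x, \<xi>), (\<eta>, y))"
    by (metis prod.collapse)
  show "norm (fst (fst X)) \<le> norm X" "norm (snd (fst X)) \<le> norm X"
    "norm (fst (snd X)) \<le> norm X" "norm (snd (snd X)) \<le> norm X" "norm (fst (fst X), fst (snd X)) \<le> norm X"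
    unfolding X by (auto simp: norm_Pair real_le_rsqrt)
qed

text \<open>\<open>\<Psi>\<close> is expanded in Gaussian atoms of the product space. The fibre map
  sends each of them to a multiple of an atom on the single space, so the image is again a
  superposition, but indexed by a larger space than that of the centres; the map of centres in
  \<open>synthesis\<close> exists for this purpose.\<close>

lemma zak_fibre_expansion:
  fixes \<Psi> :: "'a::euclidean_space \<times> 'a \<Rightarrow> complex"
  assumes \<Psi>: "\<Psi> \<in> Sigma1"
  shows "zak_fibre j \<Psi> \<in> Sigma1"
    and "f \<in> Sigma1_dual \<Longrightarrow> cnst (gauss :: 'a \<times> 'a \<Rightarrow> complex) * zak_term j f \<Psi>
      = (\<integral>X. coef gauss \<Psi> X * zak_term j f (gabor gauss X) \<partial>lborel)"
    and "f \<in> Sigma1_dual \<Longrightarrow> integrable lborel (\<lambda>X. coef gauss \<Psi> X * zak_term j f (gabor gauss X))"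
proof -
  let ?k = "cnst (gauss :: 'a \<times> 'a \<Rightarrow> complex)"
  let ?W = "coef gauss \<Psi>"
  \<comment> \<open>Translation by \<open>?J\<close> turns the centre \<open>x - j\<close> into
    \<open>x\<close>, so that the map of centres does not increase norms, as
    \<open>synthesis\<close> requires.\<close>
  let ?J = "((j, 0), (0, 0)) :: ('a \<times> 'a) \<times> ('a \<times> 'a)"
  let ?T = "\<lambda>X :: ('a \<times> 'a) \<times> ('a \<times> 'a). (fst (fst X), fst (snd X))"
  have k: "?k \<noteq> 0"
    by (rule cnst_nonzero[OF gauss_Sigma1 gauss_nonzero])
  have [measurable]: "\<Psi> \<in> borel_measurable borel"
    by (rule Sigma1_measurable[OF \<Psi>])
  have W: "rapid ?W"
    by (rule rapid_coef[OF \<Psi> gauss_Sigma1])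
  have Wm [measurable]: "?W \<in> borel_measurable borel"
    by measurable
  have Tm [measurable]: "?T \<in> borel_measurable borel"
    by (intro borel_measurable_continuous_onI continuous_intros)
  obtain G where G: "0 \<le> G" "\<And>t :: 'a. cmod (gauss t) \<le> G * exp (- (1 * norm t))"
    using rapidE[OF rapid_gauss, of 1] by blast
  define V where "V X = ?W X * zcoef j X" for X
  have V: "rapid V"
  proof (rule rapidI)
    fix N :: real
    obtain C where C: "0 \<le> C" "\<And>X. cmod (?W X) \<le> C * exp (- (N * norm X))"
      using rapidE[OF W] by blast
    have "cmod (zcoef j X) \<le> sqrt (2 * pi) ^ DIM('a) * 1" for X
      unfolding cmod_zcoef by (intro mult_left_mono) (auto simp: gauss_def)
    then have "cmod (V X) \<le> (C * exp (- (N * norm X))) * (sqrt (2 * pi) ^ DIM('a) * 1)" for X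
      unfolding V_def norm_mult using C by (intro mult_mono) auto
    then show "\<exists>C. \<forall>X. cmod (V X) \<le> C * exp (- (N * norm X))"
      by (intro exI[of _ "C * sqrt (2 * pi) ^ DIM('a)"]) (simp add: mult_ac)
  qed
  have Vm [measurable]: "V \<in> borel_measurable borel"
    unfolding V_def by measurable
  have "rapid (\<lambda>X. V (X + ?J))"
    using rapid_translate[OF V, of "- ?J"] by (simp only: diff_minus_eq_add)
  then have "rapid (\<lambda>X. 1 / ?k * V (X + ?J))"
    by (rule rapid_cmult)
  moreover have "(\<lambda>X. 1 / ?k * V (X + ?J)) \<in> borel_measurable borel"
    by measurable
  ultimately have V': "rapid (\<lambda>X. 1 / ?k * V (X + ?J))" "(\<lambda>X. 1 / ?k * V (X + ?J)) \<in> borel_measurable borel"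
    by (simp_all only:)
  have fibre: "zak_fibre j \<Psi> s = (\<integral>X. (1 / ?k * V (X + ?J)) * gabor gauss (?T X) s \<partial>lborel)" for s
  proof -
    have inv: "?k * \<Psi> z = (\<integral>X. ?W X * gabor gauss X z \<partial>lborel)" for z
      by (subst coef_inversion[OF Sigma1_continuous[OF \<Psi>] Sigma1_rapid[OF \<Psi>] continuous_on_gauss rapid_gauss W])
        (simp add: cnst_def)
    have gm [measurable]: "(\<lambda>(X, t :: 'a). gabor gauss X (s + j, t)) \<in> borel_measurable (borel \<Otimes>\<^sub>M borel)"
    proof -
      have "continuous_on UNIV (\<lambda>p :: (('a \<times> 'a) \<times> ('a \<times> 'a)) \<times> 'a. gabor gauss (fst p) (s + j, snd p))"
        unfolding gabor_def cis_conv_exp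
        by (intro continuous_intros continuous_on_compose2[OF continuous_on_gauss]) auto
      then show ?thesis
        unfolding borel_prod by (intro borel_measurable_continuous_onI) (simp add: split_beta')
    qed
    have m: "(\<lambda>(X, t). ?W X * gabor gauss X (s + j, t) * cis (j \<bullet> t)) \<in> borel_measurable (borel \<Otimes>\<^sub>M borel)"
      by (simp only: split_beta') measurable
    have I1: "integrable lborel (\<lambda>X. of_real (G * (cmod (?W X) * exp (1 * norm X))))"
      by (intro integrable_of_real integrable_mult_right rapid_integrable_exp[OF W]) auto
    have I2: "integrable lborel (\<lambda>t. complex_of_real (exp (- (1 * norm (t :: 'a)))))"
      by (intro integrable_of_real integrable_exp_neg_norm) simp
    have le: "cmod (?W X * gabor gauss X (s + j, t) * cis (j \<bullet> t))
      \<le> cmod (complex_of_real (G * (cmod (?W X) * exp (1 * norm X)))) * cmod (complex_of_real (exp (- (1 * norm t))))" for X t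
    proof -
      have "norm t \<le> norm (t - snd (fst X)) + norm X"
        using norm_triangle_ineq[of "t - snd (fst X)" "snd (fst X)"] norm_coordinates(2)[of X] by simp
      then have "exp (- (1 * norm (t - snd (fst X)))) \<le> exp (1 * norm X) * exp (- (1 * norm t))"
        by (simp add: exp_add[symmetric])
      then have "G * exp (- (1 * norm (t - snd (fst X)))) \<le> G * (exp (1 * norm X) * exp (- (1 * norm t)))"
        by (intro mult_left_mono G)
      with G(2)[of "t - snd (fst X)"] have 1: "cmod (gauss (t - snd (fst X))) \<le> G * (exp (1 * norm X) * exp (- (1 * norm t)))"
        by linarith
      have "cmod (gabor gauss X (s + j, t)) = cmod (gauss (s + j - fst (fst X))) * cmod (gauss (t - snd (fst X)))"
        unfolding gabor_gauss_Pair norm_mult cmod_gabor by simp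
      also have "\<dots> \<le> 1 * (G * (exp (1 * norm X) * exp (- (1 * norm t))))"
        by (intro mult_mono 1) (auto simp: gauss_def)
      finally have "cmod (?W X) * cmod (gabor gauss X (s + j, t)) \<le> cmod (?W X) * (G * (exp (1 * norm X) * exp (- (1 * norm t))))"
        by (intro mult_left_mono) auto
      then show ?thesis
        using G(1) by (simp add: norm_mult abs_mult mult_ac)
    qed
    have "?k * zak_fibre j \<Psi> s = (\<integral>t. (?k * \<Psi> (s + j, t)) * cis (j \<bullet> t) \<partial>lborel)"
      unfolding zak_fibre_def by (subst integral_mult_right_zero[symmetric]) (simp only: mult.assoc)
    also have "\<dots> = (\<integral>t. (\<integral>X. ?W X * gabor gauss X (s + j, t) * cis (j \<bullet> t) \<partial>lborel) \<partial>lborel)"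
      unfolding inv by simp
    also have "\<dots> = (\<integral>X. (\<integral>t. ?W X * gabor gauss X (s + j, t) * cis (j \<bullet> t) \<partial>lborel) \<partial>lborel)"
      by (rule lborel_Fubini[OF I1 I2 m le, symmetric])
    also have "\<dots> = (\<integral>X. ?W X * zak_fibre j (gabor gauss X) s \<partial>lborel)"
      unfolding zak_fibre_def by (simp only: mult.assoc integral_mult_right_zero)
    also have "\<dots> = (\<integral>X. V X * gabor gauss (fst (fst X) - j, fst (snd X)) s \<partial>lborel)"
      unfolding zak_fibre_gabor_gauss V_def by (simp only: mult.assoc)
    also have "\<dots> = (\<integral>X. V (X + ?J) * gabor gauss (?T X) s \<partial>lborel)"
    proof -
      have "(\<lambda>X. V X * gabor gauss (fst (fst X) - j, fst (snd X)) s) \<in> borel_measurable borel"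
      proof -
        have "(\<lambda>X. gabor gauss (fst (fst X) - j, fst (snd X)) s) \<in> borel_measurable (borel :: (('a \<times> 'a) \<times> ('a \<times> 'a)) measure)"
          unfolding gabor_def cis_conv_exp
          by (intro borel_measurable_continuous_onI continuous_intros continuous_on_compose2[OF continuous_on_gauss]) auto
        then show ?thesis by measurable
      qed
      from lborel_integral_translate(1)[OF this, of ?J] show ?thesis
        by simp
    qed
    finally have "zak_fibre j \<Psi> s = 1 / ?k * (\<integral>X. V (X + ?J) * gabor gauss (?T X) s \<partial>lborel)"
      using k by (simp add: field_simps)
    also have "\<dots> = (\<integral>X. (1 / ?k * V (X + ?J)) * gabor gauss (?T X) s \<partial>lborel)"
      by (subst integral_mult_right_zero[symmetric]) (simp only: mult.assoc)
    finally show ?thesis .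
  qed
  have T: "norm (?T X) \<le> norm X" for X
    by (rule norm_coordinates(5))
  show "zak_fibre j \<Psi> \<in> Sigma1"
    using synthesis(1)[OF V' Tm T] unfolding fibre[symmetric] .
  assume f: "f \<in> Sigma1_dual"
  let ?v = "\<lambda>Y. f (gabor gauss Y)"
  have vm [measurable]: "?v \<in> borel_measurable borel"
    by (rule dual_gabor(1)[OF gauss_Sigma1 f])
  have zt: "zak_term j f (gabor gauss X) = zcoef j X * ?v (fst (fst X) - j, fst (snd X))" for X
  proof -
    have "zak_fibre j (gabor gauss X) = (\<lambda>s. zcoef j X * gabor gauss (fst (fst X) - j, fst (snd X)) s)"
      by (rule ext) (rule zak_fibre_gabor_gauss)
    then show ?thesis
      unfolding zak_term_eq using Sigma1_dualD(2)[OF f gabor_gauss_Sigma1] by simp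
  qed
  have vm': "(\<lambda>X. ?v (fst (fst X) - j, fst (snd X))) \<in> borel_measurable (borel :: (('a \<times> 'a) \<times> ('a \<times> 'a)) measure)"
    by (rule measurable_compose[OF _ vm]) (intro borel_measurable_continuous_onI continuous_intros)
  have "?k * f (zak_fibre j \<Psi>) = ?k * (\<integral>X. (1 / ?k * V (X + ?J)) * ?v (?T X) \<partial>lborel)"
    using synthesis(3)[OF V' Tm T f] unfolding fibre[symmetric] by simp
  also have "\<dots> = (\<integral>X. V (X + ?J) * ?v (?T X) \<partial>lborel)"
    using k by (subst integral_mult_right_zero[symmetric]) simp
  also have "\<dots> = (\<integral>X. V X * ?v (fst (fst X) - j, fst (snd X)) \<partial>lborel)"
    using lborel_integral_translate(1)[of "\<lambda>X. V X * ?v (fst (fst X) - j, fst (snd X))" ?J] vm' by simp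
  also have "\<dots> = (\<integral>X. ?W X * zak_term j f (gabor gauss X) \<partial>lborel)"
    unfolding zt V_def by (simp only: mult.assoc)
  finally show "?k * zak_term j f \<Psi> = (\<integral>X. ?W X * zak_term j f (gabor gauss X) \<partial>lborel)"
    by (simp only: zak_term_eq)
  have "integrable lborel (\<lambda>X. ?k * ((1 / ?k * V (X + ?J)) * ?v (?T X)))"
    by (rule integrable_mult_right[OF synthesis(2)[OF V' Tm T f]])
  then have "integrable lborel (\<lambda>X. V (X + ?J) * ?v (?T X))"
    using k by simp
  then have "integrable lborel (\<lambda>X. V X * ?v (fst (fst X) - j, fst (snd X)))"
    using lborel_integral_affine_euclidean(1)[of 1 "\<lambda>X. V X * ?v (fst (fst X) - j, fst (snd X))" ?J] vm'
    by (simp add: add.commute)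
  then show "integrable lborel (\<lambda>X. ?W X * zak_term j f (gabor gauss X))"
    unfolding zt V_def by (simp only: mult.assoc)
qed

lemma zak_term_gabor_gauss:
  assumes "f \<in> Sigma1_dual"
  shows "zak_term j f (gabor gauss X) = zcoef j X * f (gabor gauss (fst (fst X) - j, fst (snd X)))"
proof -
  have "zak_fibre j (gabor gauss X) = (\<lambda>s. zcoef j X * gabor gauss (fst (fst X) - j, fst (snd X)) s)"
    by (rule ext) (rule zak_fibre_gabor_gauss)
  then show ?thesis
    unfolding zak_term_eq using Sigma1_dualD(2)[OF assms gabor_gauss_Sigma1] by simp
qed

text \<open>The Gaussian factor in \<open>j - y\<close> outweighs the exponential growth of
  \<open>f\<close> at the far centre \<open>(x - j, \<eta>)\<close>, and what remains is summable
  over the lattice.\<close>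

lemma zak_term_gabor_gauss_bound:
  fixes f :: "('a::euclidean_space \<Rightarrow> complex) \<Rightarrow> complex"
  assumes f: "f \<in> Sigma1_dual"
  obtains A a where "0 \<le> A" "0 \<le> a"
    "\<And>j X. cmod (zak_term j f (gabor gauss X)) \<le> A * exp (a * norm X) * exp (- norm (snd (snd X) - j))"
proof -
  obtain A a where A: "0 \<le> A" "0 \<le> a" and va: "\<And>Y. cmod (f (gabor gauss Y)) \<le> A * exp (a * norm Y)"
    using dual_gabor_gauss(1)[OF f] by metis
  obtain G where G: "0 \<le> G" "\<And>t :: 'a. cmod (gauss t) \<le> G * exp (- ((a + 1) * norm t))"
    using rapidE[OF rapid_gauss, of "a + 1"] by blast
  let ?B = "sqrt (2 * pi) ^ DIM('a)"
  have "cmod (zak_term j f (gabor gauss X)) \<le> (?B * G * A) * exp (3 * a * norm X) * exp (- norm (snd (snd X) - j))" for j X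
  proof -
    let ?y = "snd (snd X)"
    \<comment> \<open>The centre is reached through \<open>x\<close>, \<open>y\<close> and
      \<open>\<eta>\<close>, each at most \<open>norm X\<close>, and the difference
      \<open>j - y\<close>; this gives the rate \<open>3 * a\<close>.\<close>
    have 1: "norm (fst (fst X) - j, fst (snd X)) \<le> 3 * norm X + norm (j - ?y)"
    proof -
      have "norm (fst (fst X) - j, fst (snd X)) \<le> norm (fst (fst X) - j) + norm (fst (snd X))"
        by (rule norm_Pair_le)
      moreover have "norm (fst (fst X) - j) \<le> norm (fst (fst X)) + norm j"
        by (rule norm_triangle_ineq4)
      moreover have "norm j \<le> norm (j - ?y) + norm ?y"
        using norm_triangle_ineq[of "j - ?y" ?y] by simp
      ultimately show ?thesis
        using norm_coordinates[of X] by linarith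
    qed
    have "cmod (zak_term j f (gabor gauss X)) = ?B * cmod (gauss (j - ?y)) * cmod (f (gabor gauss (fst (fst X) - j, fst (snd X))))"
      unfolding zak_term_gabor_gauss[OF f] norm_mult cmod_zcoef ..
    also have "\<dots> \<le> ?B * (G * exp (- ((a + 1) * norm (j - ?y)))) * (A * exp (a * (3 * norm X + norm (j - ?y))))"
    proof (intro mult_mono order_refl G)
      have "A * exp (a * norm (fst (fst X) - j, fst (snd X))) \<le> A * exp (a * (3 * norm X + norm (j - ?y)))"
        using A 1 by (intro mult_left_mono) (auto intro: mult_left_mono)
      then show "cmod (f (gabor gauss (fst (fst X) - j, fst (snd X)))) \<le> A * exp (a * (3 * norm X + norm (j - ?y)))"
        using va order_trans by blast
    qed (use G in auto)
    also have "\<dots> = (?B * G * A) * (exp (- ((a + 1) * norm (j - ?y))) * exp (a * (3 * norm X + norm (j - ?y))))"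
      by (simp only: mult_ac)
    also have "exp (- ((a + 1) * norm (j - ?y))) * exp (a * (3 * norm X + norm (j - ?y))) = exp (3 * a * norm X) * exp (- norm (?y - j))"
      by (simp add: exp_add[symmetric] norm_minus_commute[of j] algebra_simps)
    finally show ?thesis
      by (simp only: mult.assoc)
  qed
  then show ?thesis
    using that[of "?B * G * A" "3 * a"] A G by simp
qed

text \<open>Coordinates are in the order \<open>((x, \<xi>), (\<eta>, y))\<close>: the first pair is
  position, the second frequency, with \<open>\<eta>\<close> dual to \<open>x\<close> and
  \<open>y\<close> dual to \<open>\<xi>\<close>.\<close>

type_synonym 'n phase = "((real ^ 'n) \<times> (real ^ 'n)) \<times> ((real ^ 'n) \<times> (real ^ 'n))"

text \<open>One estimate gives both the absolute convergence of the series and its continuity on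
  \<open>Sigma1\<close>. Each term is expanded in Gaussian atoms, and Tonelli moves the lattice sum
  onto the atoms, where it is bounded uniformly in \<open>y\<close>.\<close>

lemma zak_terms_bound:
  fixes f :: "(real ^ 'n::finite \<Rightarrow> complex) \<Rightarrow> complex"
  assumes EB: "dual_pair E B" and f: "f \<in> Sigma1_dual"
  obtains h D where "0 < h" "0 \<le> D"
    "\<And>\<Psi>. \<Psi> \<in> Sigma1 \<Longrightarrow> (\<integral>\<^sup>+j. ennreal (cmod (zak_term j f \<Psi>)) \<partial>count_space (lattice_of E)) \<le> ennreal (D * sem h \<Psi>)"
proof -
  let ?k = "cnst (gauss :: (real ^ 'n) \<times> (real ^ 'n) \<Rightarrow> complex)"
  let ?d = "real DIM((real ^ 'n) \<times> (real ^ 'n))"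
  have k: "?k \<noteq> 0"
    by (rule cnst_nonzero[OF gauss_Sigma1 gauss_nonzero])
  obtain A a where A: "0 \<le> A" "0 \<le> a" and zb: "\<And>j X. cmod (zak_term j f (gabor gauss X))
      \<le> A * exp (a * norm X) * exp (- norm (snd (snd X) - j))"
    using zak_term_gabor_gauss_bound[OF f] by blast
  obtain C where C: "0 < C" "\<And>y. (\<integral>\<^sup>+j. ennreal (exp (- (1 * norm (y - j)))) \<partial>count_space (lattice_of E)) \<le> ennreal C"
    by (rule lattice_sum_exp[OF EB, of 1]) auto
  obtain L where L: "0 < L" "\<And>X :: ((real ^ 'n) \<times> (real ^ 'n)) \<times> ((real ^ 'n) \<times> (real ^ 'n)). (\<integral>\<^sup>+Y. ennreal (exp (- (1 * norm (X - Y)))) \<partial>lborel) = ennreal L"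
    "\<And>X :: ((real ^ 'n) \<times> (real ^ 'n)) \<times> ((real ^ 'n) \<times> (real ^ 'n)). (\<integral>\<^sup>+Y. ennreal (exp (- (1 * norm (Y - X)))) \<partial>lborel) = ennreal L"
    by (rule nn_integral_exp_neg_norm[of 1]) auto
  \<comment> \<open>Chosen so that \<open>coef_decay\<close> has rate \<open>a + 1\<close>, one unit
    above the growth rate of the terms in \<open>X\<close>.\<close>
  define h where "h = 1 / (4 * (a + 1) * ?d)"
  have h: "0 < h" using A by (simp add: h_def add_nonneg_pos)
  have hN: "1 / (4 * h * ?d) = a + 1"
    using A by (simp add: h_def)
  obtain K where K1: "0 \<le> K" "\<forall>g\<in>Sigma1. \<forall>\<psi>\<in>Sigma1. \<forall>X :: ((real ^ 'n) \<times> (real ^ 'n)) \<times> ((real ^ 'n) \<times> (real ^ 'n)).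
      cmod (coef \<psi> g X) \<le> K * sem h g * sem h \<psi> * exp (- ((a + 1) * norm X))"
    using coef_decay[OF h, where 'a="(real ^ 'n) \<times> (real ^ 'n)"] unfolding hN by (elim exE conjE)
  have K2: "cmod (coef gauss \<Psi> X) \<le> K * sem h \<Psi> * sem h (gauss :: (real ^ 'n) \<times> (real ^ 'n) \<Rightarrow> complex)
      * exp (- ((a + 1) * norm X))" if "\<Psi> \<in> Sigma1" for \<Psi> :: "(real ^ 'n) \<times> (real ^ 'n) \<Rightarrow> complex" and X
    by (rule K1(2)[rule_format, OF that gauss_Sigma1])
  note K = K1(1) K2
  let ?g = "sem h (gauss :: (real ^ 'n) \<times> (real ^ 'n) \<Rightarrow> complex)"
  define D where "D = 1 / cmod ?k * (K * ?g * A) * C * L"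
  have D: "0 \<le> D"
    using K A C L by (simp add: D_def)
  have "(\<integral>\<^sup>+j. ennreal (cmod (zak_term j f \<Psi>)) \<partial>count_space (lattice_of E)) \<le> ennreal (D * sem h \<Psi>)"
    if \<Psi>: "\<Psi> \<in> Sigma1" for \<Psi>
  proof -
    let ?c = "1 / cmod ?k * (K * sem h \<Psi> * ?g * A)"
    have c0: "0 \<le> ?c" using K A by simp
    have 1: "ennreal (cmod (zak_term j f \<Psi>))
      \<le> (\<integral>\<^sup>+X. ennreal ?c * ennreal (exp (- (1 * norm (X :: 'n phase)))) * ennreal (exp (- (1 * norm (snd (snd X) - j)))) \<partial>lborel)" for j
    proof -
      have eq: "zak_term j f \<Psi> = 1 / ?k * (\<integral>X. coef gauss \<Psi> X * zak_term j f (gabor gauss X) \<partial>lborel)"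
        using zak_fibre_expansion(2)[OF \<Psi> f, of j] k by (simp add: field_simps)
      have "ennreal (cmod (zak_term j f \<Psi>)) = ennreal (cmod (\<integral>X. 1 / ?k * (coef gauss \<Psi> X * zak_term j f (gabor gauss X)) \<partial>lborel))"
        unfolding eq by (subst integral_mult_right_zero) simp
      also have "\<dots> \<le> (\<integral>\<^sup>+X. ennreal (cmod (1 / ?k * (coef gauss \<Psi> X * zak_term j f (gabor gauss X)))) \<partial>lborel)"
        by (rule integral_norm_bound_ennreal[OF integrable_mult_right[OF zak_fibre_expansion(3)[OF \<Psi> f]]])
      also have "\<dots> \<le> (\<integral>\<^sup>+X. ennreal ?c * ennreal (exp (- (1 * norm (X :: 'n phase)))) * ennreal (exp (- (1 * norm (snd (snd X) - j)))) \<partial>lborel)"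
      proof (rule nn_integral_mono)
        fix X
        have "cmod (coef gauss \<Psi> X) * cmod (zak_term j f (gabor gauss X))
          \<le> (K * sem h \<Psi> * ?g * exp (- ((a + 1) * norm X))) * (A * exp (a * norm X) * exp (- norm (snd (snd X) - j)))"
          using K by (intro mult_mono zb K(2)[OF \<Psi>]) auto
        also have "\<dots> = (K * sem h \<Psi> * ?g * A) * (exp (- ((a + 1) * norm X)) * exp (a * norm X)) * exp (- norm (snd (snd X) - j))"
          by (simp only: mult_ac)
        also have "exp (- ((a + 1) * norm X)) * exp (a * norm X) = exp (- (1 * norm X))"
          by (simp add: exp_add[symmetric] algebra_simps)
        finally have "1 / cmod ?k * (cmod (coef gauss \<Psi> X) * cmod (zak_term j f (gabor gauss X)))
          \<le> 1 / cmod ?k * ((K * sem h \<Psi> * ?g * A) * exp (- (1 * norm X)) * exp (- norm (snd (snd X) - j)))"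
          by (intro mult_left_mono) auto
        then have "cmod (1 / ?k * (coef gauss \<Psi> X * zak_term j f (gabor gauss X)))
          \<le> ?c * exp (- (1 * norm X)) * exp (- (1 * norm (snd (snd X) - j)))"
          by (simp add: norm_mult norm_divide mult.assoc)
        then show "ennreal (cmod (1 / ?k * (coef gauss \<Psi> X * zak_term j f (gabor gauss X))))
          \<le> ennreal ?c * ennreal (exp (- (1 * norm (X :: 'n phase)))) * ennreal (exp (- (1 * norm (snd (snd X) - j))))"
          unfolding ennreal_mult'[OF c0, symmetric] ennreal_mult''[OF exp_ge_zero, symmetric]
          by (rule ennreal_leI)
      qed
      finally show ?thesis .
    qed
    have "(\<integral>\<^sup>+j. ennreal (cmod (zak_term j f \<Psi>)) \<partial>count_space (lattice_of E))
      \<le> (\<integral>\<^sup>+j. (\<integral>\<^sup>+X. ennreal ?c * ennreal (exp (- (1 * norm (X :: 'n phase)))) * ennreal (exp (- (1 * norm (snd (snd X) - j)))) \<partial>lborel) \<partial>count_space (lattice_of E))"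
      by (intro nn_integral_mono 1)
    also have "\<dots> = (\<integral>\<^sup>+X. (\<integral>\<^sup>+j. ennreal ?c * ennreal (exp (- (1 * norm (X :: 'n phase)))) * ennreal (exp (- (1 * norm (snd (snd X) - j)))) \<partial>count_space (lattice_of E)) \<partial>lborel)"
    proof (rule nn_integral_count_space_nn_integral[OF countable_lattice_of, symmetric])
      have [measurable]: "(\<lambda>X. snd (snd X)) \<in> borel_measurable (borel :: ('n phase) measure)"
        by (intro borel_measurable_continuous_onI continuous_intros)
      show "(\<lambda>X :: 'n phase. ennreal ?c * ennreal (exp (- (1 * norm (X :: 'n phase)))) * ennreal (exp (- (1 * norm (snd (snd X) - j)))))
          \<in> borel_measurable lborel" for j
        by measurable
    qed
    also have "\<dots> = (\<integral>\<^sup>+X. ennreal ?c * ennreal (exp (- (1 * norm (X :: 'n phase)))) * (\<integral>\<^sup>+j. ennreal (exp (- (1 * norm (snd (snd X) - j)))) \<partial>count_space (lattice_of E)) \<partial>lborel)"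
      by (intro nn_integral_cong nn_integral_cmult) simp
    also have "\<dots> \<le> (\<integral>\<^sup>+X. ennreal ?c * ennreal (exp (- (1 * norm (X - (0 :: 'n phase))))) * ennreal C \<partial>lborel)"
      unfolding diff_zero by (intro nn_integral_mono mult_left_mono C(2)) simp
    also have "\<dots> = ennreal ?c * ennreal L * ennreal C"
      unfolding L(3)[of 0, symmetric] by (subst nn_integral_multc, measurable, subst nn_integral_cmult) auto
    also have "\<dots> = ennreal (?c * L * C)"
      using c0 L C by (simp only: ennreal_mult'[symmetric] mult_nonneg_nonneg less_imp_le)
    also have "?c * L * C = D * sem h \<Psi>"
      by (simp add: D_def)
    finally show ?thesis .
  qed
  then show ?thesis
    using that[of h D] h D by blast
qed

text \<open>The fibre maps are linear, hence so is each term; adding two series uses the summability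
  that the uniform bound provides, and the same bound is the continuity estimate.\<close>

theorem zak_Sigma1_dual:
  fixes f :: "(real ^ 'n::finite \<Rightarrow> complex) \<Rightarrow> complex"
  assumes EB: "dual_pair E B" and f: "f \<in> Sigma1_dual"
  shows "zak E f \<in> Sigma1_dual"
proof -
  let ?L = "lattice_of E"
  obtain h D where h: "0 < h" and D: "0 \<le> D" and hD: "\<And>\<Psi>. \<Psi> \<in> Sigma1 \<Longrightarrow>
      (\<integral>\<^sup>+j. ennreal (cmod (zak_term j f \<Psi>)) \<partial>count_space ?L) \<le> ennreal (D * sem h \<Psi>)"
    using zak_terms_bound[OF EB f] by blast
  have summ: "(\<lambda>j. zak_term j f \<Psi>) summable_on ?L" if "\<Psi> \<in> Sigma1" for \<Psi>
    by (rule summable_on_nn_integral[OF hD[OF that]]) (use D in simp)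
  have slice: "integrable lborel (\<lambda>t. \<Psi> (s, t) * cis (j \<bullet> t))" if \<Psi>: "\<Psi> \<in> Sigma1" for \<Psi> and s j :: "real ^ 'n"
  proof -
    obtain C where C: "0 \<le> C" "\<And>z. cmod (\<Psi> z) \<le> C * exp (- (1 * norm z))"
      using rapidE[OF Sigma1_rapid[OF \<Psi>]] by blast
    have c: "continuous_on UNIV (\<lambda>t. \<Psi> (s, t) * cis (j \<bullet> t))"
      unfolding cis_conv_exp by (intro continuous_intros continuous_on_compose2[OF Sigma1_continuous[OF \<Psi>]]) auto
    have "integrable lborel (\<lambda>t :: real ^ 'n. C * exp (- (1 * norm t)))"
      by (rule integrable_mult_right[OF integrable_exp_neg_norm]) simp
    then show ?thesis
    proof (rule Bochner_Integration.integrable_bound)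
      show "(\<lambda>t. \<Psi> (s, t) * cis (j \<bullet> t)) \<in> borel_measurable lborel"
        using borel_measurable_continuous_onI[OF c] by simp
      show "AE t in lborel. cmod (\<Psi> (s, t) * cis (j \<bullet> t)) \<le> norm (C * exp (- (1 * norm t)))"
      proof (rule AE_I2)
        fix t :: "real ^ 'n"
        have "C * exp (- (1 * norm (s, t))) \<le> C * exp (- (1 * norm t))"
          using C(1) norm_snd_le[of t s] by (intro mult_left_mono) auto
        then show "cmod (\<Psi> (s, t) * cis (j \<bullet> t)) \<le> norm (C * exp (- (1 * norm t)))"
          using C(2)[of "(s, t)"] C(1) by (simp add: norm_mult)
      qed
    qed
  qed
  have add: "zak_term j f (\<lambda>x. \<Psi> x + \<Psi>' x) = zak_term j f \<Psi> + zak_term j f \<Psi>'" if "\<Psi> \<in> Sigma1" "\<Psi>' \<in> Sigma1" for \<Psi> \<Psi>' j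
  proof -
    have "zak_fibre j (\<lambda>x. \<Psi> x + \<Psi>' x) = (\<lambda>s. zak_fibre j \<Psi> s + zak_fibre j \<Psi>' s)"
      unfolding zak_fibre_def distrib_right
      by (rule ext) (rule Bochner_Integration.integral_add[OF slice[OF that(1)] slice[OF that(2)]])
    then show ?thesis
      unfolding zak_term_eq
      using Sigma1_dualD(1)[OF f zak_fibre_expansion(1)[OF that(1)] zak_fibre_expansion(1)[OF that(2)]] by simp
  qed
  have mult: "zak_term j f (\<lambda>x. c * \<Psi> x) = c * zak_term j f \<Psi>" if "\<Psi> \<in> Sigma1" for c \<Psi> j
  proof -
    have "zak_fibre j (\<lambda>x. c * \<Psi> x) = (\<lambda>s. c * zak_fibre j \<Psi> s)"
      unfolding zak_fibre_def mult.assoc by (rule ext) (rule integral_mult_right_zero)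
    then show ?thesis
      unfolding zak_term_eq using Sigma1_dualD(2)[OF f] zak_fibre_expansion(1)[OF that] by simp
  qed
  have "zak E f (\<lambda>x. \<Psi> x + \<Psi>' x) = zak E f \<Psi> + zak E f \<Psi>'" if "\<Psi> \<in> Sigma1" "\<Psi>' \<in> Sigma1" for \<Psi> \<Psi>'
    unfolding zak_def add[OF that] by (rule infsum_add[OF summ[OF that(1)] summ[OF that(2)]])
  moreover have "zak E f (\<lambda>x. c * \<Psi> x) = c * zak E f \<Psi>" if "\<Psi> \<in> Sigma1" for c \<Psi>
    unfolding zak_def mult[OF that] by (rule infsum_cmult_right')
  moreover have "ennreal (cmod (zak E f \<Psi>)) \<le> ennreal D * Sigma1_seminorm h \<Psi>" if "\<Psi> \<in> Sigma1" for \<Psi>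
  proof -
    have "ennreal (cmod (zak E f \<Psi>)) \<le> ennreal (D * sem h \<Psi>)"
      unfolding zak_def by (rule order_trans[OF norm_infsum_le_nn_integral hD[OF that]])
    then show ?thesis
      by (simp only: ennreal_mult'[OF D] Sigma1_seminorm_eq_sem[OF that h, symmetric])
  qed
  ultimately show ?thesis
    unfolding Sigma1_dual_def using h D by blast
qed

subsection \<open>Quasi-periodicity\<close>

text \<open>Reindexing the series by \<open>k\<close> shows that translating the first variable by
  \<open>k\<close> amounts to multiplying by a character of the second, which moves the frequency
  \<open>y\<close> by \<open>k\<close>. Translation of the second variable by \<open>l\<close> is
  invisible because \<open>cis (j \<bullet> l) = 1\<close>. All other changes are phases and
  disappear in the modulus.\<close>

lemma zak_quasi_periodic:
  fixes f :: "(real ^ 'n::finite \<Rightarrow> complex) \<Rightarrow> complex"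
  assumes EB: "dual_pair E B" and f: "f \<in> Sigma1_dual" and \<Phi>: "\<Phi> \<in> Sigma1"
    and k: "k \<in> lattice_of E" and l: "l \<in> lattice_of B"
  shows "cmod (zak E f (gabor \<Phi> ((x + k, \<xi> + l), (\<eta>, y + k)))) = cmod (zak E f (gabor \<Phi> ((x, \<xi>), (\<eta>, y))))"
proof -
  let ?Z = "zak E f"
  have Z: "?Z \<in> Sigma1_dual"
    by (rule zak_Sigma1_dual[OF EB f])
  have shift1: "?Z (\<lambda>z. \<Psi> (fst z + k, snd z) * cis (k \<bullet> snd z)) = ?Z \<Psi>" for \<Psi>
  proof -
    have "zak_term j f (\<lambda>z. \<Psi> (fst z + k, snd z) * cis (k \<bullet> snd z)) = zak_term (j + k) f \<Psi>" for j
      unfolding zak_term_eq zak_fibre_def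
      by (simp add: cis_mult inner_add_left mult.assoc add.assoc add.commute[of "k \<bullet> _"])
    moreover have "bij_betw (\<lambda>j. j + k) (lattice_of E) (lattice_of E)"
      by (rule bij_betwI[where g="\<lambda>j. j - k"]) (auto intro: lattice_of_add lattice_of_diff k)
    ultimately show ?thesis
      using infsum_reindex_bij_betw[of "\<lambda>j. j + k" "lattice_of E" "lattice_of E" "\<lambda>j. zak_term j f \<Psi>"]
      unfolding zak_def by simp
  qed
  have shift2: "?Z (\<lambda>z. \<Psi> (fst z, snd z + l)) = ?Z \<Psi>" if \<Psi>: "\<Psi> \<in> Sigma1" for \<Psi>
  proof -
    have "zak_term j f (\<lambda>z. \<Psi> (fst z, snd z + l)) = zak_term j f \<Psi>" if j: "j \<in> lattice_of E" for j
    proof -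
      have "zak_fibre j (\<lambda>z. \<Psi> (fst z, snd z + l)) s = zak_fibre j \<Psi> s" for s
      proof -
        have "continuous_on UNIV (\<lambda>t. \<Psi> (s + j, t) * cis (j \<bullet> t))"
          unfolding cis_conv_exp by (intro continuous_intros continuous_on_compose2[OF Sigma1_continuous[OF \<Psi>]]) auto
        from lborel_integral_translate(1)[OF borel_measurable_continuous_onI[OF this], of l]
        have "(\<integral>t. \<Psi> (s + j, t + l) * cis (j \<bullet> (t + l)) \<partial>lborel) = zak_fibre j \<Psi> s"
          unfolding zak_fibre_def .
        moreover have "cis (j \<bullet> (t + l)) = cis (j \<bullet> t)" for t
          using cis_lattice[OF EB j l] by (simp add: inner_add_right cis_mult[symmetric])
        ultimately show ?thesis
          by (simp add: zak_fibre_def)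
      qed
      then show ?thesis
        unfolding zak_term_eq by presburger
    qed
    then show ?thesis
      unfolding zak_def by (rule infsum_cong)
  qed
  let ?X = "((x, \<xi>), (\<eta>, y))"
  have "(\<lambda>z. gabor \<Phi> ((x + k, \<xi> + l), (\<eta>, y + k)) (fst z + k, snd z) * cis (k \<bullet> snd z))
      = (\<lambda>z. cis (- (k \<bullet> \<eta>)) * gabor \<Phi> ((x, \<xi> + l), (\<eta>, y)) z)"
    by (rule ext) (auto simp: gabor_def cis_mult inner_add_left inner_add_right inner_commute[of _ k] algebra_simps)
  then have "?Z (gabor \<Phi> ((x + k, \<xi> + l), (\<eta>, y + k))) = cis (- (k \<bullet> \<eta>)) * ?Z (gabor \<Phi> ((x, \<xi> + l), (\<eta>, y)))"
    using shift1[of "gabor \<Phi> ((x + k, \<xi> + l), (\<eta>, y + k))"] Sigma1_dualD(2)[OF Z gabor_Sigma1[OF \<Phi>]] by simp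
  moreover have "(\<lambda>z. gabor \<Phi> ((x, \<xi> + l), (\<eta>, y)) (fst z, snd z + l)) = (\<lambda>z. cis (- (l \<bullet> y)) * gabor \<Phi> ?X z)"
  proof
    fix z :: "(real ^ 'n) \<times> (real ^ 'n)"
    have "- ((fst z, snd z + l) \<bullet> (\<eta>, y)) = - (l \<bullet> y) + - (z \<bullet> (\<eta>, y))"
      by (cases z) (simp add: inner_add_left)
    then have "cis (- ((fst z, snd z + l) \<bullet> (\<eta>, y))) = cis (- (l \<bullet> y)) * cis (- (z \<bullet> (\<eta>, y)))"
      by (simp only: cis_mult)
    moreover have "(fst z, snd z + l) - (x, \<xi> + l) = z - (x, \<xi>)"
      by (cases z) simp
    ultimately show "gabor \<Phi> ((x, \<xi> + l), (\<eta>, y)) (fst z, snd z + l) = cis (- (l \<bullet> y)) * gabor \<Phi> ?X z"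
      by (simp only: gabor_def fst_conv snd_conv mult_ac)
  qed
  then have "?Z (gabor \<Phi> ((x, \<xi> + l), (\<eta>, y))) = cis (- (l \<bullet> y)) * ?Z (gabor \<Phi> ?X)"
    using shift2[OF gabor_Sigma1[OF \<Phi>], of "((x, \<xi> + l), (\<eta>, y))"] Sigma1_dualD(2)[OF Z gabor_Sigma1[OF \<Phi>]] by simp
  ultimately show ?thesis
    by (simp add: norm_mult)
qed

subsection \<open>Recovering the short-time Fourier transform from the Zak transform\<close>

lemma integral_cis_unit_interval:
  fixes i :: int
  shows "integrable lborel (\<lambda>s. indicator {0..1::real} s *\<^sub>R cis (s * c))"
    and "(\<integral>s. indicator {0..1::real} s *\<^sub>R cis (s * (2 * pi * of_int i)) \<partial>lborel) = (if i = 0 then 1 else 0)"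
proof -
  have cont: "continuous_on {0..1} (\<lambda>s. cis (s * c))" for c
    unfolding cis_conv_exp by (intro continuous_intros)
  show "integrable lborel (\<lambda>s. indicator {0..1::real} s *\<^sub>R cis (s * c))"
    using borel_integrable_compact[OF compact_Icc cont] by simp
  show "(\<integral>s. indicator {0..1::real} s *\<^sub>R cis (s * (2 * pi * of_int i)) \<partial>lborel) = (if i = 0 then 1 else 0)"
  proof (cases "i = 0")
    case True
    then show ?thesis by simp
  next
    case False
    define c where "c = 2 * pi * of_int i"
    have c: "c \<noteq> 0" using False by (simp add: c_def)
    have "(\<integral>s. indicator {0..1::real} s *\<^sub>R cis (s * c) \<partial>lborel) = cis (1 * c) / (\<i> * c) - cis (0 * c) / (\<i> * c)"
    proof (rule integral_FTC_Icc)
      fix s :: real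
      have "((\<lambda>z. exp (\<i> * z * of_real c) / (\<i> * of_real c)) has_field_derivative exp (\<i> * of_real s * of_real c)) (at (of_real s))"
        using c by (auto intro!: derivative_eq_intros)
      from has_vector_derivative_real_field[OF this]
      have "((\<lambda>s. cis (s * c) / (\<i> * of_real c)) has_vector_derivative cis (s * c)) (at s)"
        by (simp add: cis_conv_exp mult.assoc)
      then show "((\<lambda>s. cis (s * c) / (\<i> * of_real c)) has_vector_derivative cis (s * c)) (at s within {0..1})"
        by (rule has_vector_derivative_at_within)
    qed (auto simp: cont)
    also have "cis (1 * c) = 1"
      by (simp add: c_def cis_multiple_2pi)
    finally show ?thesis
      using False by (simp add: c_def)
  qed
qed

text \<open>Parametrises the dual cell by the unit cube, so that averaging over a period is an
  integral over a set of volume 1 and no determinant appears.\<close>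

definition torus_map :: "('n::finite \<Rightarrow> real ^ 'n) \<Rightarrow> real ^ 'n \<Rightarrow> real ^ 'n" where
  "torus_map B \<tau> = (\<Sum>m\<in>UNIV. (\<tau> $ m) *\<^sub>R B m)"

lemma indicator_cbox_One:
  "indicator (cbox 0 One) (\<tau> :: 'a::euclidean_space) = (\<Prod>b\<in>Basis. indicator {0..1::real} (\<tau> \<bullet> b) :: real)"
proof (cases "\<tau> \<in> cbox 0 One")
  case True
  then show ?thesis by (simp add: mem_box)
next
  case False
  then obtain b where "b \<in> Basis" "\<tau> \<bullet> b \<notin> {0..1}"
    by (auto simp: mem_box)
  then have "\<exists>b\<in>Basis. (indicator {0..1::real} (\<tau> \<bullet> b) :: real) = 0"
    by (intro bexI[of _ b]) (simp_all add: indicator_eq_0_iff del: atLeastAtMost_iff)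
  then have "(\<Prod>b\<in>Basis. indicator {0..1::real} (\<tau> \<bullet> b) :: real) = 0"
    by (rule prod_zero[OF finite_Basis])
  then show ?thesis using False by simp
qed

text \<open>In the coordinates of the cube the character splits into one-dimensional characters with
  integer frequencies, each of which has mean 0 unless its frequency vanishes.\<close>

lemma integral_cis_torus:
  fixes B :: "'n::finite \<Rightarrow> real ^ 'n"
  assumes AB: "dual_pair A B" and j: "j \<in> lattice_of A"
  shows "integrable lborel (\<lambda>\<tau>. indicator (cbox 0 One) \<tau> *\<^sub>R cis (torus_map B \<tau> \<bullet> j))"
    and "(\<integral>\<tau>. indicator (cbox 0 One) \<tau> *\<^sub>R cis (torus_map B \<tau> \<bullet> j) \<partial>lborel) = (if j = 0 then 1 else 0)"
proof -
  obtain k where k: "j = (\<Sum>m\<in>UNIV. of_int (k m) *\<^sub>R A m)"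
    using j by (rule lattice_ofE)
  have inner: "torus_map B \<tau> \<bullet> j = (\<Sum>m\<in>UNIV. \<tau> $ m * (2 * pi * of_int (k m)))" for \<tau>
    unfolding torus_map_def inner_commute[of _ j] by (simp add: inner_sum_right lattice_inner[OF AB k])
  \<comment> \<open>The integer coordinates, transferred from the index type to the basis vectors
    over which \<open>lborel_integral_prod_Basis\<close> takes its product.\<close>
  define K where "K b = k (SOME m. b = axis m 1)" for b :: "real ^ 'n"
  have K: "K (axis m 1) = k m" for m
  proof -
    have "(SOME m'. (axis m 1 :: real ^ 'n) = axis m' 1) = m"
      by (rule some_equality) (auto simp: axis_eq_axis)
    then show ?thesis by (simp add: K_def)
  qed
  have basis: "(Basis :: (real ^ 'n) set) = range (\<lambda>m. axis m 1)" and inj: "inj (\<lambda>m. axis m 1 :: real ^ 'n)"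
    by (auto simp: Basis_vec_def inj_on_def axis_eq_axis)
  have inner': "torus_map B \<tau> \<bullet> j = (\<Sum>b\<in>Basis. (\<tau> \<bullet> b) * (2 * pi * of_int (K b)))" for \<tau>
    unfolding inner basis by (subst sum.reindex[OF inj]) (simp add: K inner_axis)
  have prod: "indicator (cbox 0 One) \<tau> *\<^sub>R cis (torus_map B \<tau> \<bullet> j)
     = (\<Prod>b\<in>Basis. indicator {0..1} (\<tau> \<bullet> b) *\<^sub>R cis ((\<tau> \<bullet> b) * (2 * pi * of_int (K b))))" for \<tau>
    unfolding inner' indicator_cbox_One
    by (simp add: cis_conv_exp exp_sum sum_distrib_left scaleR_conv_of_real prod.distrib)
  have I: "integrable lborel (\<lambda>s. indicator {0..1::real} s *\<^sub>R cis (s * (2 * pi * of_int (K b))))" for b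
    by (rule integral_cis_unit_interval(1))
  show "integrable lborel (\<lambda>\<tau>. indicator (cbox 0 One) \<tau> *\<^sub>R cis (torus_map B \<tau> \<bullet> j))"
    unfolding prod by (rule lborel_integral_prod_Basis(1)[where f="\<lambda>b s. indicator {0..1::real} s *\<^sub>R cis (s * (2 * pi * of_int (K b)))", OF I])
  have "(\<integral>\<tau>. indicator (cbox 0 One) \<tau> *\<^sub>R cis (torus_map B \<tau> \<bullet> j) \<partial>lborel)
     = (\<Prod>b\<in>(Basis :: (real ^ 'n) set). if K b = 0 then 1 else 0)"
    unfolding prod
    by (subst lborel_integral_prod_Basis(2)[where f="\<lambda>b s. indicator {0..1::real} s *\<^sub>R cis (s * (2 * pi * of_int (K b)))", OF I])
      (simp only: integral_cis_unit_interval(2))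
  also have "\<dots> = (if j = 0 then 1 else 0)"
  proof (cases "j = 0")
    case True
    then have "k m = 0" for m
      using lattice_inner[OF AB k, of m] by simp
    then have "K b = 0" if "b \<in> Basis" for b
      using that unfolding basis by (auto simp: K)
    then show ?thesis using True by simp
  next
    case False
    then obtain m where "k m \<noteq> 0"
      using k by (metis (no_types, lifting) of_int_0 scaleR_zero_left sum.neutral)
    then have "K (axis m 1) \<noteq> 0" "axis m 1 \<in> (Basis :: (real ^ 'n) set)"
      by (auto simp: K basis)
    then have "(\<Prod>b\<in>(Basis :: (real ^ 'n) set). if K b = 0 then 1 else 0 :: complex) = 0"
      by (intro prod_zero) auto
    then show ?thesis using False by simp
  qed
  finally show "(\<integral>\<tau>. indicator (cbox 0 One) \<tau> *\<^sub>R cis (torus_map B \<tau> \<bullet> j) \<partial>lborel) = (if j = 0 then 1 else 0)" .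
qed

lemma continuous_torus_map: "continuous_on UNIV (torus_map B)"
  unfolding torus_map_def by (intro continuous_intros)

lemma torus_map_bound:
  assumes "\<tau> \<in> cbox 0 One"
  shows "norm (torus_map B \<tau>) \<le> (\<Sum>m\<in>UNIV. norm (B m))"
proof -
  have "0 \<le> \<tau> $ m \<and> \<tau> $ m \<le> 1" for m
    using assms unfolding mem_box_cart by (simp add: mem_box_cart[symmetric]) (use assms in \<open>auto simp: mem_box inner_axis[symmetric] cart_eq_inner_axis\<close>)
  then show ?thesis
    unfolding torus_map_def by (intro sum_norm_le) (auto intro: mult_left_le_one_le)
qed

text \<open>Up to phase factors, the Gabor coefficients of \<open>f\<close> are the Fourier coefficients in \<open>\<xi>\<close> of the
  short-time Fourier transform of its Zak transform.\<close>

lemma zak_extraction: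
  fixes f :: "(real ^ 'n::finite \<Rightarrow> complex) \<Rightarrow> complex"
  assumes EB: "dual_pair E B" and f: "f \<in> Sigma1_dual"
  shows "ennreal (sqrt (2 * pi) ^ DIM(real ^ 'n) * cmod (f (gabor gauss (x, \<eta>))))
    \<le> (\<integral>\<^sup>+\<tau>. indicator (cbox 0 One) \<tau> * ennreal (cmod (zak E f (gabor gauss ((x, torus_map B \<tau>), (\<eta>, 0))))) \<partial>lborel)"
    (is "_ \<le> ?R")
proof -
  let ?L = "lattice_of E"
  \<comment> \<open>The centre is placed at \<open>y = 0\<close>, where the Gaussian factor of the
    term \<open>j = 0\<close> equals 1; the terms then depend on \<open>\<xi>\<close> only through
    the character \<open>cis (\<xi> \<bullet> j)\<close>.\<close>
  define a where "a j = cis (- (j \<bullet> \<eta>)) * (of_real (sqrt (2 * pi)) ^ DIM(real ^ 'n) * gauss j) * f (gabor gauss (x - j, \<eta>))" for j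
  have term_eq: "zak_term j f (gabor gauss ((x, \<xi>), (\<eta>, 0))) = a j * cis (\<xi> \<bullet> j)" for j \<xi>
    unfolding zak_term_gabor_gauss[OF f] zcoef_def a_def by simp
  obtain h D where "0 < h" "0 \<le> D" and hD: "\<And>\<Psi>. \<Psi> \<in> Sigma1 \<Longrightarrow>
      (\<integral>\<^sup>+j. ennreal (cmod (zak_term j f \<Psi>)) \<partial>count_space ?L) \<le> ennreal (D * sem h \<Psi>)"
    using zak_terms_bound[OF EB f] by blast
  have abs: "(\<lambda>j. cmod (a j)) summable_on ?L"
  proof -
    have "(\<lambda>j. complex_of_real (cmod (a j))) summable_on ?L"
    proof (rule summable_on_nn_integral)
      show "(\<integral>\<^sup>+j. ennreal (cmod (complex_of_real (cmod (a j)))) \<partial>count_space ?L) \<le> ennreal (D * sem h (gabor gauss ((x, 0), (\<eta>, 0 :: real ^ 'n))))"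
        using hD[OF gabor_gauss_Sigma1[of "((x, 0), (\<eta>, 0 :: real ^ 'n))"]] by (simp add: term_eq norm_mult)
    qed (use \<open>0 \<le> D\<close> in simp)
    from summable_on_bounded_linear[OF bounded_linear_Re this] show ?thesis
      by simp
  qed
  have summ: "(\<lambda>j. a j * c j) summable_on S" if "\<And>j. cmod (c j) = 1" "S \<subseteq> ?L" for c S
  proof (rule abs_summable_summable)
    have "(\<lambda>j. cmod (a j)) summable_on S"
      by (rule summable_on_subset_banach[OF abs that(2)])
    then show "(\<lambda>j. cmod (a j * c j)) summable_on S"
      by (simp add: norm_mult that(1))
  qed
  \<comment> \<open>Only a finite partial sum is integrated term by term. It differs from the full
    series by at most \<open>e\<close>, uniformly over the cube of volume 1, so the integral changes
    by at most \<open>e\<close>.\<close>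
  have eps: "ennreal (cmod (a 0)) \<le> ?R + ennreal e" if e: "0 < e" for e
  proof -
    obtain S where S: "finite S" "S \<subseteq> ?L" "0 \<in> S" and tail: "infsum (\<lambda>j. cmod (a j)) (?L - S) \<le> e"
    proof -
      have "(sum (\<lambda>j. cmod (a j)) \<longlongrightarrow> infsum (\<lambda>j. cmod (a j)) ?L) (finite_subsets_at_top ?L)"
        using has_sum_infsum[OF abs] unfolding has_sum_def .
      from tendstoD[OF this e] obtain S0 where S0: "finite S0" "S0 \<subseteq> ?L"
        "\<forall>S. finite S \<and> S0 \<subseteq> S \<and> S \<subseteq> ?L \<longrightarrow> dist (sum (\<lambda>j. cmod (a j)) S) (infsum (\<lambda>j. cmod (a j)) ?L) < e"
        unfolding eventually_finite_subsets_at_top by (elim exE conjE)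
      let ?S = "insert 0 S0"
      have sub: "?S \<subseteq> ?L" using S0(2) lattice_of_zero by blast
      have "dist (sum (\<lambda>j. cmod (a j)) ?S) (infsum (\<lambda>j. cmod (a j)) ?L) < e"
        using S0(1) sub by (intro S0(3)[rule_format]) auto
      moreover have "infsum (\<lambda>j. cmod (a j)) (?L - ?S) = infsum (\<lambda>j. cmod (a j)) ?L - infsum (\<lambda>j. cmod (a j)) ?S"
        by (rule infsum_Diff[OF abs _ sub]) (rule summable_on_finite, use S0 in simp)
      moreover have "infsum (\<lambda>j. cmod (a j)) ?S = sum (\<lambda>j. cmod (a j)) ?S"
        using S0 by (intro infsum_finite) simp
      ultimately show ?thesis
        using that[of ?S] S0 sub by (simp add: dist_real_def)
    qed
    define P where "P \<tau> = (\<Sum>j\<in>S. a j * cis (torus_map B \<tau> \<bullet> j))" for \<tau>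
    have P: "cmod (P \<tau>) \<le> cmod (zak E f (gabor gauss ((x, torus_map B \<tau>), (\<eta>, 0)))) + e" for \<tau>
    proof -
      let ?F = "\<lambda>j. a j * cis (torus_map B \<tau> \<bullet> j)"
      have "infsum ?F (?L - S) = infsum ?F ?L - infsum ?F S"
        by (rule infsum_Diff[OF summ summ S(2)]) (use S in auto)
      then have "P \<tau> = infsum ?F ?L - infsum ?F (?L - S)"
        using S(1) by (simp add: P_def)
      moreover have "cmod (infsum ?F (?L - S)) \<le> infsum (\<lambda>j. cmod (?F j)) (?L - S)"
        by (rule norm_infsum_bound) (simp add: norm_mult summable_on_subset_banach[OF abs])
      then have "cmod (infsum ?F (?L - S)) \<le> e"
        using tail by (simp add: norm_mult)
      moreover have "zak E f (gabor gauss ((x, torus_map B \<tau>), (\<eta>, 0))) = infsum ?F ?L"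
        unfolding zak_def term_eq ..
      ultimately show ?thesis
        using norm_triangle_ineq4[of "infsum ?F ?L" "infsum ?F (?L - S)"] by simp
    qed
    have "(\<integral>\<tau>. indicator (cbox 0 One) \<tau> *\<^sub>R P \<tau> \<partial>lborel)
       = (\<Sum>j\<in>S. a j * (\<integral>\<tau>. indicator (cbox 0 One) \<tau> *\<^sub>R cis (torus_map B \<tau> \<bullet> j) \<partial>lborel))"
    proof -
      have "indicator (cbox 0 One) \<tau> *\<^sub>R P \<tau> = (\<Sum>j\<in>S. a j * (indicator (cbox 0 One) \<tau> *\<^sub>R cis (torus_map B \<tau> \<bullet> j)))" for \<tau>
        unfolding P_def by (simp add: scaleR_sum_right)
      then have "(\<integral>\<tau>. indicator (cbox 0 One) \<tau> *\<^sub>R P \<tau> \<partial>lborel)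
         = (\<integral>\<tau>. (\<Sum>j\<in>S. a j * (indicator (cbox 0 One) \<tau> *\<^sub>R cis (torus_map B \<tau> \<bullet> j))) \<partial>lborel)"
        by (simp only:)
      also have "\<dots> = (\<Sum>j\<in>S. (\<integral>\<tau>. a j * (indicator (cbox 0 One) \<tau> *\<^sub>R cis (torus_map B \<tau> \<bullet> j)) \<partial>lborel))"
        using S(2) by (intro Bochner_Integration.integral_sum integrable_mult_right integral_cis_torus(1)[OF EB]) auto
      finally show ?thesis
        by (simp only: integral_mult_right_zero)
    qed
    also have "\<dots> = (\<Sum>j\<in>S. a j * (if j = 0 then 1 else 0))"
      using S(2) by (intro sum.cong) (auto simp: integral_cis_torus(2)[OF EB])
    also have "\<dots> = a 0"
      using S by (simp add: if_distrib cong: if_cong)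
    finally have a0: "(\<integral>\<tau>. indicator (cbox 0 One) \<tau> *\<^sub>R P \<tau> \<partial>lborel) = a 0" .
    have PI: "integrable lborel (\<lambda>\<tau>. indicator (cbox 0 One) \<tau> *\<^sub>R P \<tau>)"
    proof -
      have "continuous_on UNIV P"
        unfolding P_def cis_conv_exp by (intro continuous_intros continuous_torus_map)
      then show ?thesis
        by (intro borel_integrable_compact compact_cbox) (auto intro: continuous_on_subset)
    qed
    have [measurable]: "(\<lambda>\<tau>. zak E f (gabor gauss ((x, torus_map B \<tau>), (\<eta>, 0)))) \<in> borel_measurable borel"
      by (rule measurable_compose[OF _ dual_gabor(1)[OF gauss_Sigma1 zak_Sigma1_dual[OF EB f]]])
        (intro borel_measurable_continuous_onI continuous_intros continuous_torus_map)
    have "ennreal (cmod (a 0)) \<le> (\<integral>\<^sup>+\<tau>. ennreal (cmod (indicator (cbox 0 One) \<tau> *\<^sub>R P \<tau>)) \<partial>lborel)"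
      unfolding a0[symmetric] by (rule integral_norm_bound_ennreal[OF PI])
    also have "\<dots> \<le> (\<integral>\<^sup>+\<tau>. indicator (cbox 0 One) \<tau> * ennreal (cmod (zak E f (gabor gauss ((x, torus_map B \<tau>), (\<eta>, 0)))))
        + ennreal e * indicator (cbox 0 One) \<tau> \<partial>lborel)"
      using P e by (intro nn_integral_mono) (auto split: split_indicator simp: ennreal_plus[symmetric] simp del: ennreal_plus intro!: ennreal_leI)
    also have "\<dots> = ?R + ennreal e * emeasure lborel (cbox 0 (One :: real ^ 'n))"
      by (subst nn_integral_add) (auto simp: nn_integral_cmult_indicator)
    also have "emeasure lborel (cbox 0 (One :: real ^ 'n)) = 1"
      by (subst emeasure_lborel_cbox) auto
    finally show ?thesis by simp
  qed
  have "ennreal (cmod (a 0)) \<le> ?R"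
    by (rule ennreal_le_epsilon) (use eps in auto)
  moreover have "cmod (a 0) = sqrt (2 * pi) ^ DIM(real ^ 'n) * cmod (f (gabor gauss (x, \<eta>)))"
    by (simp add: a_def norm_mult norm_power gauss_def)
  ultimately show ?thesis
    by simp
qed

subsection \<open>Comparison of quasi-norms\<close>

text \<open>\<open>change_window\<close> dominates the new window by the old one at every rate,
  \<open>reproducing_gabor\<close> lets the old one dominate itself, and \<open>power_bound\<close>
  combines the two with a constant independent of the functional.\<close>

lemma gabor_power:
  fixes \<phi> \<psi> :: "'a::euclidean_space \<Rightarrow> complex"
  assumes \<phi>: "\<phi> \<in> Sigma1" "\<phi> \<noteq> (\<lambda>_. 0)" and \<psi>: "\<psi> \<in> Sigma1" and r: "0 < r"
  obtains D where "0 \<le> D" "\<And>u X. u \<in> Sigma1_dual \<Longrightarrow> ennreal (cmod (u (gabor \<psi> X)) powr r)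
    \<le> ennreal D * (\<integral>\<^sup>+Y. ennreal (exp (- norm (X - Y)) * cmod (u (gabor \<phi> Y)) powr r) \<partial>lborel)"
proof -
  obtain K where K: "\<And>u. u \<in> Sigma1_dual \<Longrightarrow> reproducing K (\<lambda>X. cmod (u (gabor \<phi> X)))"
    using reproducing_gabor[OF \<phi>] by blast
  have "\<forall>N. \<exists>C. 0 \<le> C \<and> (\<forall>u\<in>Sigma1_dual. \<forall>X. ennreal (cmod (u (gabor \<psi> X)))
    \<le> ennreal C * (\<integral>\<^sup>+Y. ennreal (exp (- (N * norm (X - Y))) * cmod (u (gabor \<phi> Y))) \<partial>lborel))"
    using change_window[OF \<phi> \<psi>] by (intro allI) blast
  from choice[OF this] obtain K' where K': "\<And>N. 0 \<le> K' N" "\<forall>N. \<forall>u\<in>Sigma1_dual. \<forall>X. ennreal (cmod (u (gabor \<psi> X)))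
    \<le> ennreal (K' N) * (\<integral>\<^sup>+Y. ennreal (exp (- (N * norm (X - Y))) * cmod (u (gabor \<phi> Y))) \<partial>lborel)"
    by blast
  obtain D where D: "0 \<le> D" "\<forall>(F :: 'a \<times> 'a \<Rightarrow> real) g X. reproducing K F \<longrightarrow> 0 \<le> g \<longrightarrow>
     (\<forall>N. ennreal g \<le> ennreal (K' N) * (\<integral>\<^sup>+Y. ennreal (exp (- (N * norm (X - Y))) * F Y) \<partial>lborel)) \<longrightarrow>
     ennreal (g powr r) \<le> ennreal D * (\<integral>\<^sup>+Y. ennreal (exp (- norm (X - Y)) * F Y powr r) \<partial>lborel)"
    using power_bound[of r K', OF r K'(1), of K, where 'b="'a \<times> 'a"] by (elim exE conjE)
  show ?thesis
  proof (rule that[OF D(1)])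
    fix u :: "('a \<Rightarrow> complex) \<Rightarrow> complex" and X assume u: "u \<in> Sigma1_dual"
    show "ennreal (cmod (u (gabor \<psi> X)) powr r)
      \<le> ennreal D * (\<integral>\<^sup>+Y. ennreal (exp (- norm (X - Y)) * cmod (u (gabor \<phi> Y)) powr r) \<partial>lborel)"
      using K'(2) u by (intro D(2)[rule_format, OF K[OF u]] norm_ge_zero) blast
  qed
qed

text \<open>For the essential supremum the pointwise inequality is used without a power; the value 1
  lets finite and infinite \<open>p\<close> share one argument.\<close>

definition expo :: "ennreal \<Rightarrow> real" where
  "expo p = (if p = \<infinity> then 1 else enn2real p)"

lemma expo_pos: "0 < p \<Longrightarrow> 0 < expo p"
  by (simp add: expo_def enn2real_positive_iff less_top)

text \<open>Change of window for the modulation quasi-norm. The kernel is a multiple of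
  \<open>exp (- norm (X - Y))\<close>, so both integrals in Schur's test have the same
  value.\<close>

lemma gabor_qnorm:
  fixes \<phi> \<psi> :: "'a::euclidean_space \<Rightarrow> complex"
  assumes \<phi>: "\<phi> \<in> Sigma1" "\<phi> \<noteq> (\<lambda>_. 0)" and \<psi>: "\<psi> \<in> Sigma1" and p: "0 < p"
  obtains C where "0 < C" "\<And>u. u \<in> Sigma1_dual \<Longrightarrow>
    Lp_qnorm p lborel (\<lambda>X. u (gabor \<psi> X)) \<le> ennreal C * Lp_qnorm p lborel (\<lambda>X. u (gabor \<phi> X))"
proof -
  obtain D where D: "0 \<le> D" and DD: "\<And>u X. u \<in> Sigma1_dual \<Longrightarrow> ennreal (cmod (u (gabor \<psi> X)) powr expo p)
    \<le> ennreal D * (\<integral>\<^sup>+Y. ennreal (exp (- norm (X - Y)) * cmod (u (gabor \<phi> Y)) powr expo p) \<partial>lborel)"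
    using gabor_power[OF \<phi> \<psi> expo_pos[OF p]] by blast
  obtain L where L: "0 < L" "\<And>X :: 'a \<times> 'a. (\<integral>\<^sup>+Y. ennreal (exp (- (1 * norm (X - Y)))) \<partial>lborel) = ennreal L"
    "\<And>X :: 'a \<times> 'a. (\<integral>\<^sup>+Y. ennreal (exp (- (1 * norm (Y - X)))) \<partial>lborel) = ennreal L"
    by (rule nn_integral_exp_neg_norm[of 1]) auto
  let ?k = "\<lambda>(X :: 'a \<times> 'a) Y. ennreal D * ennreal (exp (- norm (X - Y)))"
  let ?C = "if p = \<infinity> then D * L + 1 else (D * L + 1) powr (1 / enn2real p)"
  have DL: "0 \<le> D * L" using D L by simp
  have "0 < ?C"
    using DL by (auto intro: add_nonneg_pos)
  moreover have "Lp_qnorm p lborel (\<lambda>X. u (gabor \<psi> X)) \<le> ennreal ?C * Lp_qnorm p lborel (\<lambda>X. u (gabor \<phi> X))"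
    if u: "u \<in> Sigma1_dual" for u
  proof (rule Lp_qnorm_schur[OF p _ _ _ _ _ DL DL, where k="?k"])
    have [measurable]: "(\<lambda>X. u (gabor \<phi> X)) \<in> borel_measurable borel" "(\<lambda>X. u (gabor \<psi> X)) \<in> borel_measurable borel"
      using dual_gabor(1)[OF _ u] \<phi>(1) \<psi> by auto
    show "(\<lambda>X. u (gabor \<psi> X)) \<in> borel_measurable lborel" "(\<lambda>X. u (gabor \<phi> X)) \<in> borel_measurable lborel"
      by measurable
    show "sigma_finite_measure (lborel :: ('a \<times> 'a) measure)" "sigma_finite_measure (lborel :: ('a \<times> 'a) measure)"
      by (rule sigma_finite_lborel)+
    show "case_prod ?k \<in> borel_measurable (lborel \<Otimes>\<^sub>M lborel)"
      by measurable
    show "(\<integral>\<^sup>+X. ?k X Y \<partial>lborel) \<le> ennreal (D * L)" for Y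
      using L(3)[of Y] D by (subst nn_integral_cmult) (auto simp: ennreal_mult')
    show "(\<integral>\<^sup>+Y. ?k X Y \<partial>lborel) \<le> ennreal (D * L)" for X
      using L(2)[of X] D by (subst nn_integral_cmult) (auto simp: ennreal_mult')
    have eq: "ennreal D * (\<integral>\<^sup>+Y. ennreal (exp (- norm (X - Y)) * cmod (u (gabor \<phi> Y)) powr q) \<partial>lborel)
        = (\<integral>\<^sup>+Y. ?k X Y * ennreal (cmod (u (gabor \<phi> Y)) powr q) \<partial>lborel)" for X q
      by (subst nn_integral_cmult[symmetric]) (auto simp: ennreal_mult' mult.assoc)
    show "ennreal (cmod (u (gabor \<psi> X)) powr enn2real p) \<le> (\<integral>\<^sup>+Y. ?k X Y * ennreal (cmod (u (gabor \<phi> Y)) powr enn2real p) \<partial>lborel)"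
      if "p \<noteq> \<infinity>" for X
      using DD[OF u, of X] that unfolding eq by (simp add: expo_def)
    show "ennreal (cmod (u (gabor \<psi> X))) \<le> (\<integral>\<^sup>+Y. ?k X Y * ennreal (cmod (u (gabor \<phi> Y))) \<partial>lborel)"
      if "p = \<infinity>" for X
      using DD[OF u, of X] that unfolding eq by (simp add: expo_def)
  qed
  ultimately show ?thesis
    using that by blast
qed

text \<open>With \<open>S\<close> the total sum, every term satisfies
  \<open>a j <= S powr (1 - r) * a j powr r\<close>; summation and division give subadditivity of
  the power \<open>r\<close>. The separate \<open>g\<close> stands for the modulus of a
  series.\<close>

lemma sum_powr_le:
  fixes a :: "'x \<Rightarrow> real"
  assumes r: "0 < r" "r \<le> 1" and a: "\<And>j. 0 \<le> a j" and g: "0 \<le> g" "ennreal g \<le> (\<integral>\<^sup>+j. ennreal (a j) \<partial>count_space A)"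
    and fin: "(\<integral>\<^sup>+j. ennreal (a j) \<partial>count_space A) \<noteq> \<infinity>"
  shows "ennreal (g powr r) \<le> (\<integral>\<^sup>+j. ennreal (a j powr r) \<partial>count_space A)" (is "_ \<le> ?J")
proof -
  obtain S where S: "(\<integral>\<^sup>+j. ennreal (a j) \<partial>count_space A) = ennreal S" "0 \<le> S"
    using fin by (cases "\<integral>\<^sup>+j. ennreal (a j) \<partial>count_space A") auto
  have gS: "g \<le> S"
    using g S by (simp add: ennreal_le_iff)
  show ?thesis
  proof (cases "?J = \<infinity> \<or> S = 0")
    case True
    then show ?thesis using gS g r by auto
  next
    case False
    then obtain i where i: "?J = ennreal i" "0 \<le> i"
      by (cases ?J) auto
    have S0: "0 < S" using False S by simp
    have aS: "a j \<le> S" if "j \<in> A" for j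
    proof -
      have "ennreal (a j) = (\<integral>\<^sup>+i. ennreal (a i) * indicator {j} i \<partial>count_space A)"
        using that by simp
      also have "\<dots> \<le> (\<integral>\<^sup>+i. ennreal (a i) \<partial>count_space A)"
        by (intro nn_integral_mono) (auto simp: indicator_def)
      finally show ?thesis
        unfolding S(1) using S(2) by (simp add: ennreal_le_iff)
    qed
    have pt: "a j \<le> S powr (1 - r) * a j powr r" if "j \<in> A" for j
    proof -
      have "a j = a j powr r * a j powr (1 - r)"
        using a[of j] by (cases "a j = 0") (auto simp: powr_add[symmetric])
      also have "\<dots> \<le> a j powr r * S powr (1 - r)"
        using a aS[OF that] r by (intro mult_left_mono powr_mono2) auto
      finally show ?thesis by (simp add: mult.commute)
    qed
    have "ennreal S \<le> (\<integral>\<^sup>+j. ennreal (S powr (1 - r)) * ennreal (a j powr r) \<partial>count_space A)"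
      unfolding S(1)[symmetric] using pt
      by (intro nn_integral_mono) (auto simp: ennreal_mult'[symmetric] intro!: ennreal_leI)
    also have "\<dots> = ennreal (S powr (1 - r) * i)"
      using i(2) by (subst nn_integral_cmult) (auto simp: i(1) ennreal_mult')
    finally have "S \<le> S powr (1 - r) * i"
      using i by (subst (asm) ennreal_le_iff) auto
    then have "S / S powr (1 - r) \<le> i"
      using S0 by (simp add: field_simps)
    then have "S powr r \<le> i"
      using S0 by (simp add: powr_diff)
    moreover have "g powr r \<le> S powr r"
      using gS g r by (intro powr_mono2) auto
    ultimately show ?thesis
      unfolding i(1) by (intro ennreal_leI) linarith
  qed
qed

text \<open>The modulus of the series is estimated termwise with a weight decaying in
  \<open>j - y\<close>. For \<open>r >= 1\<close> the power is taken by \<open>crude_jensen\<close>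
  with counting measure on the lattice, for \<open>r < 1\<close> by subadditivity.\<close>

lemma zak_power:
  fixes E :: "'n::finite \<Rightarrow> real ^ 'n"
  assumes EB: "dual_pair E B" and r: "0 < r"
  obtains D where "0 \<le> D" "\<And>f X. f \<in> Sigma1_dual \<Longrightarrow> ennreal (cmod (zak E f (gabor gauss X)) powr r)
    \<le> ennreal D * (\<integral>\<^sup>+j. ennreal (exp (- norm (snd (snd X) - j)) * cmod (f (gabor gauss (fst (fst X) - j, fst (snd X)))) powr r) \<partial>count_space (lattice_of E))"
proof -
  let ?L = "lattice_of E"
  let ?b = "sqrt (2 * pi) ^ DIM(real ^ 'n)"
  \<comment> \<open>This rate satisfies both \<open>q >= 1\<close> and \<open>r * q >= 1\<close>, so
    the weight decays at least with rate 1 also after being raised to the power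
    \<open>r\<close>.\<close>
  define q where "q = max 1 (1 / r)"
  obtain G where G: "0 \<le> G" "\<And>t :: real ^ 'n. cmod (gauss t) \<le> G * exp (- (q * norm t))"
    using rapidE[OF rapid_gauss, of q] by blast
  obtain C where C: "0 < C" "\<And>y. (\<integral>\<^sup>+j. ennreal (exp (- (1 * norm (y - j)))) \<partial>count_space ?L) \<le> ennreal C"
    by (rule lattice_sum_exp[OF EB, of 1]) auto
  let ?c = "?b * G"
  have c: "0 \<le> ?c" using G by simp
  define D where "D = (if 1 \<le> r then (1 + ?c * C) powr r * ?c else ?c powr r)"
  have "ennreal (cmod (zak E f (gabor gauss X)) powr r)
    \<le> ennreal D * (\<integral>\<^sup>+j. ennreal (exp (- norm (snd (snd X) - j)) * cmod (f (gabor gauss (fst (fst X) - j, fst (snd X)))) powr r) \<partial>count_space ?L)"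
    if f: "f \<in> Sigma1_dual" for f X
  proof -
    let ?y = "snd (snd X)"
    define v where "v j = cmod (f (gabor gauss (fst (fst X) - j, fst (snd X))))" for j
    have v0: "0 \<le> v j" for j by (simp add: v_def)
    have t: "cmod (zak_term j f (gabor gauss X)) \<le> ?c * exp (- (q * norm (?y - j))) * v j" for j
    proof -
      have "?b * cmod (gauss (j - ?y)) * v j \<le> ?b * (G * exp (- (q * norm (j - ?y)))) * v j"
        by (intro mult_right_mono mult_left_mono G v0) auto
      then show ?thesis
        unfolding zak_term_gabor_gauss[OF f] norm_mult cmod_zcoef v_def by (simp add: norm_minus_commute mult.assoc)
    qed
    have z: "ennreal (cmod (zak E f (gabor gauss X))) \<le> (\<integral>\<^sup>+j. ennreal (cmod (zak_term j f (gabor gauss X))) \<partial>count_space ?L)"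
      unfolding zak_def by (rule norm_infsum_le_nn_integral)
    show ?thesis
    proof (cases "1 \<le> r")
      case True
      have q1: "1 \<le> q" by (simp add: q_def)
      have le: "exp (- (q * norm (?y - j))) \<le> exp (- (1 * norm (?y - j)))" for j
        using mult_right_mono[OF q1, of "norm (?y - j)"] by simp
      let ?w = "\<lambda>j. ?c * exp (- (1 * norm (?y - j)))"
      have "ennreal (cmod (zak E f (gabor gauss X))) \<le> (\<integral>\<^sup>+j. ennreal (?w j * v j) \<partial>count_space ?L)"
      proof (rule order_trans[OF z], rule nn_integral_mono, rule ennreal_leI)
        fix j
        have "?c * exp (- (q * norm (?y - j))) * v j \<le> ?w j * v j"
          by (intro mult_right_mono mult_left_mono le c v0)
        then show "cmod (zak_term j f (gabor gauss X)) \<le> ?w j * v j"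
          using t[of j] by linarith
      qed
      moreover have "(\<integral>\<^sup>+j. ennreal (?w j) \<partial>count_space ?L) \<le> ennreal (?c * C)"
      proof -
        have "(\<integral>\<^sup>+j. ennreal (?w j) \<partial>count_space ?L) = ennreal ?c * (\<integral>\<^sup>+j. ennreal (exp (- (1 * norm (?y - j)))) \<partial>count_space ?L)"
          unfolding ennreal_mult'[OF c] by (rule nn_integral_cmult) simp
        also have "\<dots> \<le> ennreal ?c * ennreal C"
          by (intro mult_left_mono C(2)) simp
        finally show ?thesis by (simp only: ennreal_mult'[OF c])
      qed
      ultimately have "ennreal (cmod (zak E f (gabor gauss X)) powr r)
          \<le> ennreal ((1 + ?c * C) powr r) * (\<integral>\<^sup>+j. ennreal (?w j * v j powr r) \<partial>count_space ?L)"
        using True c C(1) v0 by (intro crude_jensen) auto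
      also have "(\<integral>\<^sup>+j. ennreal (?w j * v j powr r) \<partial>count_space ?L)
          = ennreal ?c * (\<integral>\<^sup>+j. ennreal (exp (- norm (?y - j)) * v j powr r) \<partial>count_space ?L)"
        unfolding mult.assoc[of ?c] ennreal_mult'[OF c] by (simp add: nn_integral_cmult)
      finally show ?thesis
        using True c by (simp add: D_def v_def ennreal_mult' mult.assoc)
    next
      case False
      then have r1: "r \<le> 1" by simp
      have rq: "1 \<le> r * q"
        using r by (simp add: q_def max_def field_simps)
      obtain h D' where "0 < h" "0 \<le> D'" and hD: "\<And>\<Psi>. \<Psi> \<in> Sigma1 \<Longrightarrow>
          (\<integral>\<^sup>+j. ennreal (cmod (zak_term j f \<Psi>)) \<partial>count_space ?L) \<le> ennreal (D' * sem h \<Psi>)"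
        using zak_terms_bound[OF EB f] by blast
      have "(\<integral>\<^sup>+j. ennreal (cmod (zak_term j f (gabor gauss X))) \<partial>count_space ?L) \<noteq> \<infinity>"
        using hD[OF gabor_gauss_Sigma1[of X]] by (auto simp: top_unique)
      then have "ennreal (cmod (zak E f (gabor gauss X)) powr r)
        \<le> (\<integral>\<^sup>+j. ennreal (cmod (zak_term j f (gabor gauss X)) powr r) \<partial>count_space ?L)"
        by (intro sum_powr_le[OF r r1 _ _ z]) auto
      also have "\<dots> \<le> (\<integral>\<^sup>+j. ennreal (?c powr r) * ennreal (exp (- norm (?y - j)) * v j powr r) \<partial>count_space ?L)"
      proof (rule nn_integral_mono)
        fix j
        have "cmod (zak_term j f (gabor gauss X)) powr r \<le> (?c * exp (- (q * norm (?y - j))) * v j) powr r"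
          using t r by (intro powr_mono2) auto
        also have "\<dots> = ?c powr r * exp (- (r * q * norm (?y - j))) * v j powr r"
          unfolding powr_mult[of "?c * exp (- (q * norm (?y - j)))" "v j"] mult_exp_powr[OF c] by (simp only: mult_minus_right mult.assoc)
        also have "\<dots> \<le> ?c powr r * exp (- norm (?y - j)) * v j powr r"
        proof (intro mult_right_mono mult_left_mono)
          show "exp (- (r * q * norm (?y - j))) \<le> exp (- norm (?y - j))"
            using mult_right_mono[OF rq, of "norm (?y - j)"] by simp
        qed auto
        finally have "cmod (zak_term j f (gabor gauss X)) powr r \<le> ?c powr r * (exp (- norm (?y - j)) * v j powr r)"
          by (simp only: mult.assoc)
        then show "ennreal (cmod (zak_term j f (gabor gauss X)) powr r)
          \<le> ennreal (?c powr r) * ennreal (exp (- norm (?y - j)) * v j powr r)"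
          unfolding ennreal_mult'[OF powr_ge_zero, symmetric] by (rule ennreal_leI)
      qed
      also have "\<dots> = ennreal (?c powr r) * (\<integral>\<^sup>+j. ennreal (exp (- norm (?y - j)) * v j powr r) \<partial>count_space ?L)"
        by (rule nn_integral_cmult) simp
      finally show ?thesis
        using False by (simp add: D_def v_def)
    qed
  qed
  moreover have "0 \<le> D"
    using c by (simp add: D_def)
  ultimately show ?thesis
    using that by blast
qed

text \<open>\<open>zak_extraction\<close> recovers the value of \<open>f\<close> from one period in
  \<open>\<xi>\<close> at \<open>y = 0\<close>. Changing the window to \<open>\<Phi>\<close> under
  this average, and moving all points of the bounded period to \<open>\<xi> = 0\<close>, gives a
  domination at every rate, to which \<open>power_bound\<close> applies.\<close>

lemma gabor_power_from_zak:
  fixes E :: "'n::finite \<Rightarrow> real ^ 'n"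
  assumes EB: "dual_pair E B" and \<Phi>: "\<Phi> \<in> Sigma1" "\<Phi> \<noteq> (\<lambda>_. 0)" and r: "0 < r"
  obtains D where "0 \<le> D" "\<And>f x \<eta>. f \<in> Sigma1_dual \<Longrightarrow> ennreal (cmod (f (gabor gauss (x, \<eta>))) powr r)
    \<le> ennreal D * (\<integral>\<^sup>+Y. ennreal (exp (- norm (((x, 0), (\<eta>, 0)) - Y)) * cmod (zak E f (gabor \<Phi> Y)) powr r) \<partial>lborel)"
proof -
  obtain K where K: "\<And>u. u \<in> Sigma1_dual \<Longrightarrow> reproducing K (\<lambda>X. cmod (u (gabor \<Phi> X)))"
    using reproducing_gabor[OF \<Phi>] by blast
  have "\<forall>N. \<exists>C. 0 \<le> C \<and> (\<forall>u\<in>Sigma1_dual. \<forall>X. ennreal (cmod (u (gabor gauss X)))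
    \<le> ennreal C * (\<integral>\<^sup>+Y. ennreal (exp (- (N * norm (X - Y))) * cmod (u (gabor \<Phi> Y))) \<partial>lborel))"
    using change_window[OF \<Phi> gauss_Sigma1] by (intro allI) blast
  from choice[OF this] obtain C where C: "\<And>N. 0 \<le> C N" "\<forall>N. \<forall>u\<in>Sigma1_dual. \<forall>X. ennreal (cmod (u (gabor gauss X)))
    \<le> ennreal (C N) * (\<integral>\<^sup>+Y. ennreal (exp (- (N * norm (X - Y))) * cmod (u (gabor \<Phi> Y))) \<partial>lborel)"
    by blast
  let ?b = "sqrt (2 * pi) ^ DIM(real ^ 'n)"
  have b: "0 < ?b" by simp
  define R where "R = (\<Sum>m\<in>UNIV. norm (B m))"
  \<comment> \<open>\<open>R\<close> bounds the displacement along the period, which costs an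
    exponential in \<open>R\<close>. Since \<open>power_bound\<close> asks for every real rate,
    \<open>max N 0\<close> reduces negative rates to rate 0. The division by \<open>?b\<close>
    undoes the Gaussian constant of \<open>zak_extraction\<close>.\<close>
  define K' where "K' N = C (max N 0) * exp (max N 0 * R) / ?b" for N
  have K'0: "0 \<le> K' N" for N
    using C(1) b by (simp add: K'_def)
  have key: "ennreal (cmod (f (gabor gauss (x, \<eta>))))
    \<le> ennreal (K' N) * (\<integral>\<^sup>+Y. ennreal (exp (- (N * norm (((x, 0), (\<eta>, 0)) - Y))) * cmod (zak E f (gabor \<Phi> Y))) \<partial>lborel)"
    (is "_ \<le> _ * ?J") if f: "f \<in> Sigma1_dual" for f x \<eta> N
  proof -
    have Z: "zak E f \<in> Sigma1_dual"
      by (rule zak_Sigma1_dual[OF EB f])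
    have [measurable]: "(\<lambda>Y. zak E f (gabor \<Phi> Y)) \<in> borel_measurable borel"
      by (rule dual_gabor(1)[OF \<Phi>(1) Z])
    let ?M = "max N 0"
    let ?X = "\<lambda>\<xi>. ((x, \<xi>), (\<eta>, 0 :: real ^ 'n))"
    let ?c = "C ?M * exp (?M * R)"
    have c0: "0 \<le> ?c" using C(1) by simp
    have pt: "ennreal (cmod (zak E f (gabor gauss (?X (torus_map B \<tau>))))) \<le> ennreal ?c * ?J" if \<tau>: "\<tau> \<in> cbox 0 One" for \<tau>
    proof -
      let ?\<xi> = "torus_map B \<tau>"
      have "ennreal (cmod (zak E f (gabor gauss (?X ?\<xi>))))
        \<le> ennreal (C ?M) * (\<integral>\<^sup>+Y. ennreal (exp (- (?M * norm (?X ?\<xi> - Y))) * cmod (zak E f (gabor \<Phi> Y))) \<partial>lborel)"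
        using C(2) Z by blast
      also have "\<dots> \<le> ennreal (C ?M) * (\<integral>\<^sup>+Y. ennreal (exp (?M * R)) * ennreal (exp (- (N * norm (?X 0 - Y))) * cmod (zak E f (gabor \<Phi> Y))) \<partial>lborel)"
      proof (intro mult_left_mono nn_integral_mono)
        fix Y
        have "norm (?X 0 - Y) \<le> norm (?X 0 - ?X ?\<xi>) + norm (?X ?\<xi> - Y)"
          using dist_triangle[of "?X 0" Y "?X ?\<xi>"] unfolding dist_norm .
        moreover have "norm (?X 0 - ?X ?\<xi>) \<le> R"
          using torus_map_bound[OF \<tau>, of B] by (simp add: norm_Pair R_def)
        ultimately have "?M * norm (?X 0 - Y) \<le> ?M * (R + norm (?X ?\<xi> - Y))"
          by (intro mult_left_mono) auto
        moreover have "N * norm (?X 0 - Y) \<le> ?M * norm (?X 0 - Y)"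
          by (intro mult_right_mono) auto
        ultimately have "exp (- (?M * norm (?X ?\<xi> - Y))) \<le> exp (?M * R) * exp (- (N * norm (?X 0 - Y)))"
          unfolding exp_add[symmetric] exp_le_cancel_iff by (simp only: distrib_left)
        then have "exp (- (?M * norm (?X ?\<xi> - Y))) * cmod (zak E f (gabor \<Phi> Y))
          \<le> exp (?M * R) * exp (- (N * norm (?X 0 - Y))) * cmod (zak E f (gabor \<Phi> Y))"
          by (intro mult_right_mono) auto
        then show "ennreal (exp (- (?M * norm (?X ?\<xi> - Y))) * cmod (zak E f (gabor \<Phi> Y)))
          \<le> ennreal (exp (?M * R)) * ennreal (exp (- (N * norm (?X 0 - Y))) * cmod (zak E f (gabor \<Phi> Y)))"
          unfolding ennreal_mult'[OF exp_ge_zero, symmetric] by (intro ennreal_leI) (simp only: mult.assoc)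
      qed auto
      also have "\<dots> = ennreal (C ?M) * (ennreal (exp (?M * R)) * ?J)"
        by (subst nn_integral_cmult) auto
      also have "\<dots> = ennreal ?c * ?J"
        using C(1) by (simp add: ennreal_mult' mult.assoc)
      finally show ?thesis .
    qed
    have "ennreal (?b * cmod (f (gabor gauss (x, \<eta>))))
      \<le> (\<integral>\<^sup>+\<tau>. indicator (cbox 0 One) \<tau> * ennreal (cmod (zak E f (gabor gauss (?X (torus_map B \<tau>))))) \<partial>lborel)"
      by (rule zak_extraction[OF EB f])
    also have "\<dots> \<le> (\<integral>\<^sup>+\<tau>. (ennreal ?c * ?J) * indicator (cbox 0 (One :: real ^ 'n)) \<tau> \<partial>lborel)"
      using pt by (intro nn_integral_mono) (auto split: split_indicator)
    also have "\<dots> = ennreal ?c * ?J * emeasure lborel (cbox 0 (One :: real ^ 'n))"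
      by (rule nn_integral_cmult_indicator) simp
    also have "emeasure lborel (cbox 0 (One :: real ^ 'n)) = 1"
      by (subst emeasure_lborel_cbox) auto
    finally have "ennreal (1 / ?b) * ennreal (?b * cmod (f (gabor gauss (x, \<eta>)))) \<le> ennreal (1 / ?b) * (ennreal ?c * ?J * 1)"
      by (intro mult_left_mono) auto
    moreover have "ennreal (1 / ?b) * ennreal (?b * cmod (f (gabor gauss (x, \<eta>)))) = ennreal (cmod (f (gabor gauss (x, \<eta>))))"
      using b by (simp add: ennreal_mult'[symmetric])
    moreover have "ennreal (1 / ?b) * (ennreal ?c * ?J * 1) = ennreal (K' N) * ?J"
      using b c0 by (simp add: ennreal_mult''[symmetric] mult.assoc[symmetric] K'_def)
    ultimately show ?thesis
      by (simp only:)
  qed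
  obtain D where D: "0 \<le> D" "\<forall>(F :: 'n phase \<Rightarrow> real) g X. reproducing K F \<longrightarrow> 0 \<le> g \<longrightarrow>
     (\<forall>N. ennreal g \<le> ennreal (K' N) * (\<integral>\<^sup>+Y. ennreal (exp (- (N * norm (X - Y))) * F Y) \<partial>lborel)) \<longrightarrow>
     ennreal (g powr r) \<le> ennreal D * (\<integral>\<^sup>+Y. ennreal (exp (- norm (X - Y)) * F Y powr r) \<partial>lborel)"
    using power_bound[of r K', OF r K'0, of K, where 'b="'n phase"] by (elim exE conjE)
  show ?thesis
  proof (rule that[OF D(1)])
    fix f :: "(real ^ 'n \<Rightarrow> complex) \<Rightarrow> complex" and x \<eta> assume f: "f \<in> Sigma1_dual"
    show "ennreal (cmod (f (gabor gauss (x, \<eta>))) powr r)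
      \<le> ennreal D * (\<integral>\<^sup>+Y. ennreal (exp (- norm (((x, 0), (\<eta>, 0)) - Y)) * cmod (zak E f (gabor \<Phi> Y)) powr r) \<partial>lborel)"
      by (rule D(2)[rule_format, OF K[OF zak_Sigma1_dual[OF EB f]]]) (rule norm_ge_zero, rule key[OF f])
  qed
qed

section \<open>Tiling phase space by translates of the fundamental domain\<close>

lemma lattice_cover_count:
  assumes AB: "dual_pair A B" and Q: "parallelepiped A \<subseteq> Q"
  shows "1 \<le> (\<integral>\<^sup>+k. indicator Q (x - k) \<partial>count_space (lattice_of A) :: ennreal)"
proof -
  obtain k where k: "k \<in> lattice_of A" "x - k \<in> parallelepiped A"
    by (rule parallelepiped_cover[OF AB])
  have "(1 :: ennreal) = (\<integral>\<^sup>+i. indicator {k} i \<partial>count_space (lattice_of A))"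
    using k by simp
  also have "\<dots> \<le> (\<integral>\<^sup>+i. indicator Q (x - i) \<partial>count_space (lattice_of A))"
    using k Q by (intro nn_integral_mono) (auto simp: indicator_def)
  finally show ?thesis .
qed

lemma borel_measurable_nn_integral_count_space:
  fixes f :: "'i \<Rightarrow> 'x \<Rightarrow> ennreal"
  assumes A: "countable A" and f: "\<And>i. i \<in> A \<Longrightarrow> f i \<in> borel_measurable M"
  shows "(\<lambda>x. \<integral>\<^sup>+i. f i x \<partial>count_space A) \<in> borel_measurable M"
proof (cases "finite A")
  case True
  then show ?thesis
    using f by (simp add: nn_integral_count_space_finite)
next
  case False
  then have ne: "A \<noteq> {}" by auto
  note * = bij_betw_from_nat_into[OF A False]
  have [measurable]: "f (from_nat_into A n) \<in> borel_measurable M" for n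
    by (intro f from_nat_into ne)
  have "(\<integral>\<^sup>+i. f i x \<partial>count_space A) = (\<Sum>n. f (from_nat_into A n) x)" for x
    by (simp add: nn_integral_bij_count_space[symmetric, OF *] nn_integral_count_space_nat)
  then show ?thesis
    by simp
qed

lemma nn_integral_count_space2:
  fixes f :: "'i \<Rightarrow> 'j \<Rightarrow> 'x \<Rightarrow> ennreal"
  assumes A: "countable A" and B: "countable B" and f: "\<And>i j. f i j \<in> borel_measurable M"
  shows "(\<integral>\<^sup>+x. (\<integral>\<^sup>+i. (\<integral>\<^sup>+j. f i j x \<partial>count_space B) \<partial>count_space A) \<partial>M)
    = (\<integral>\<^sup>+i. (\<integral>\<^sup>+j. (\<integral>\<^sup>+x. f i j x \<partial>M) \<partial>count_space B) \<partial>count_space A)"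
proof -
  have "(\<integral>\<^sup>+x. (\<integral>\<^sup>+i. (\<integral>\<^sup>+j. f i j x \<partial>count_space B) \<partial>count_space A) \<partial>M)
    = (\<integral>\<^sup>+i. (\<integral>\<^sup>+x. (\<integral>\<^sup>+j. f i j x \<partial>count_space B) \<partial>M) \<partial>count_space A)"
    by (intro nn_integral_count_space_nn_integral A borel_measurable_nn_integral_count_space B f)
  also have "\<dots> = (\<integral>\<^sup>+i. (\<integral>\<^sup>+j. (\<integral>\<^sup>+x. f i j x \<partial>M) \<partial>count_space B) \<partial>count_space A)"
    by (intro nn_integral_cong nn_integral_count_space_nn_integral B f)
  finally show ?thesis .
qed

lemma norm_fst_snd_le:
  fixes Z :: "'c::real_normed_vector \<times> 'd::real_normed_vector"
  shows "norm (fst Z) \<le> norm Z" "norm (snd Z) \<le> norm Z"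
  by (metis norm_fst_le norm_snd_le prod.collapse)+

lemma norm_le_coordinates:
  fixes X :: "('a::euclidean_space \<times> 'a) \<times> ('a \<times> 'a)"
  shows "norm X \<le> norm (fst (fst X)) + norm (snd (fst X)) + norm (fst (snd X)) + norm (snd (snd X))"
proof -
  have le: "norm Z \<le> norm (fst Z) + norm (snd Z)" for Z :: "'c::real_normed_vector \<times> 'd::real_normed_vector"
    by (cases Z) (simp add: norm_Pair sqrt_sum_squares_le_sum)
  show ?thesis
    using le[of X] le[of "fst X"] le[of "snd X"] by linarith
qed

lemma lattice_sum_exp_both:
  assumes AB: "dual_pair A B" and a: "0 < a"
  obtains C where "0 < C"
    "\<And>y. (\<integral>\<^sup>+j. ennreal (exp (- (a * norm (y - j)))) \<partial>count_space (lattice_of A)) \<le> ennreal C"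
    "\<And>y. (\<integral>\<^sup>+j. ennreal (exp (- (a * norm (y + j)))) \<partial>count_space (lattice_of A)) \<le> ennreal C"
proof -
  obtain C where C: "0 < C" "\<And>y. (\<integral>\<^sup>+j. ennreal (exp (- (a * norm (y - j)))) \<partial>count_space (lattice_of A)) \<le> ennreal C"
    using lattice_sum_exp[OF AB a] by blast
  have "(\<integral>\<^sup>+j. ennreal (exp (- (a * norm (y + j)))) \<partial>count_space (lattice_of A)) \<le> ennreal C" for y
    using C(2)[of "- y"] by (simp add: norm_minus_commute add.commute)
  then show ?thesis
    using that C by blast
qed

lemma nn_integral_count_space_product_le:
  assumes c: "0 \<le> c" and a: "(\<integral>\<^sup>+i. ennreal (a i) \<partial>count_space A) \<le> ennreal C1" "0 \<le> C1" "\<And>i. 0 \<le> a i"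
    and b: "(\<integral>\<^sup>+j. ennreal (b j) \<partial>count_space B) \<le> ennreal C2" "\<And>j. 0 \<le> b j"
  shows "(\<integral>\<^sup>+i. (\<integral>\<^sup>+j. ennreal (c * a i * b j) \<partial>count_space B) \<partial>count_space A) \<le> ennreal (c * C1 * C2)"
proof -
  have "(\<integral>\<^sup>+i. (\<integral>\<^sup>+j. ennreal (c * a i * b j) \<partial>count_space B) \<partial>count_space A)
    = (\<integral>\<^sup>+i. ennreal c * ennreal (a i) * (\<integral>\<^sup>+j. ennreal (b j) \<partial>count_space B) \<partial>count_space A)"
    using c a(3) by (intro nn_integral_cong) (simp add: ennreal_mult' nn_integral_cmult)
  also have "\<dots> = ennreal c * (\<integral>\<^sup>+i. ennreal (a i) \<partial>count_space A) * (\<integral>\<^sup>+j. ennreal (b j) \<partial>count_space B)"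
    by (simp add: nn_integral_multc nn_integral_cmult)
  also have "\<dots> \<le> ennreal c * ennreal C1 * ennreal C2"
    by (intro mult_mono a b) auto
  finally show ?thesis
    using c a(2) by (simp add: ennreal_mult')
qed

lemma borel_measurable_kernel:
  fixes g :: "'a::euclidean_space \<Rightarrow> 'b::euclidean_space \<Rightarrow> real"
  assumes g: "continuous_on UNIV (\<lambda>z. g (fst z) (snd z))"
    and M: "(\<lambda>x. x) \<in> borel_measurable M" and N: "(\<lambda>x. x) \<in> borel_measurable N"
  shows "(\<lambda>z. ennreal (g (fst z) (snd z))) \<in> borel_measurable (M \<Otimes>\<^sub>M N)"
proof -
  have "(\<lambda>z. (fst z, snd z)) \<in> M \<Otimes>\<^sub>M N \<rightarrow>\<^sub>M borel \<Otimes>\<^sub>M borel"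
    using M N by measurable
  then have "(\<lambda>z. z) \<in> M \<Otimes>\<^sub>M N \<rightarrow>\<^sub>M borel"
    by (simp add: borel_prod)
  from measurable_compose[OF this borel_measurable_continuous_onI[OF g]] show ?thesis
    by simp
qed

text \<open>Bounded in \<open>x\<close> and \<open>\<xi>\<close> only. The whole frequency space is
  kept, in accordance with quasi-periodicity, which moves \<open>y\<close> together with
  \<open>x\<close>.\<close>

definition fundamental_domain :: "('n::finite \<Rightarrow> real ^ 'n) \<Rightarrow> ('n \<Rightarrow> real ^ 'n) \<Rightarrow> 'n phase set" where
  "fundamental_domain E B = (parallelepiped E \<times> parallelepiped B) \<times> UNIV"

abbreviation cell_measure :: "('n::finite \<Rightarrow> real ^ 'n) \<Rightarrow> ('n \<Rightarrow> real ^ 'n) \<Rightarrow> 'n phase measure" where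
  "cell_measure E B \<equiv> restrict_space lborel (fundamental_domain E B)"

lemma fundamental_domain_borel:
  assumes "dual_pair E B" "dual_pair B E"
  shows "fundamental_domain E B \<in> sets borel"
  unfolding fundamental_domain_def
  by (intro borel_closed closed_Times closed_parallelepiped[OF assms(1)] closed_parallelepiped[OF assms(2)] closed_UNIV)

lemma nn_integral_cell_measure:
  assumes "dual_pair E B" "dual_pair B E"
  shows "(\<integral>\<^sup>+Y. f Y \<partial>cell_measure E B) = (\<integral>\<^sup>+Y. f Y * indicator (fundamental_domain E B) Y \<partial>lborel)"
  using fundamental_domain_borel[OF assms] by (intro nn_integral_restrict_space) simp

lemma nn_integral_cell_measure_le:
  assumes EB: "dual_pair E B" "dual_pair B E"
    and le: "\<And>Y. Y \<in> fundamental_domain E B \<Longrightarrow> f Y \<le> g Y"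
  shows "(\<integral>\<^sup>+Y. f Y \<partial>cell_measure E B) \<le> (\<integral>\<^sup>+Y. g Y \<partial>lborel)"
  unfolding nn_integral_cell_measure[OF EB]
  using le by (intro nn_integral_mono) (auto split: split_indicator)

lemma norm_fundamental_domain:
  assumes "Y \<in> fundamental_domain E B"
  shows "norm (fst (fst Y)) \<le> (\<Sum>j\<in>UNIV. norm (E j))" "norm (snd (fst Y)) \<le> (\<Sum>j\<in>UNIV. norm (B j))"
  using assms parallelepiped_bounded unfolding fundamental_domain_def by auto

text \<open>Cover phase space by translates of the fundamental domain and move each of them back by quasi-periodicity.\<close>

lemma nn_integral_tiling:
  fixes E B :: "'n::finite \<Rightarrow> real ^ 'n" and H W :: "'n phase \<Rightarrow> ennreal"
  assumes EB: "dual_pair E B" and BE: "dual_pair B E"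
    and [measurable]: "W \<in> borel_measurable borel" "H \<in> borel_measurable borel"
    and Hp: "\<And>k l x \<xi> \<eta> y. k \<in> lattice_of E \<Longrightarrow> l \<in> lattice_of B \<Longrightarrow> H ((x + k, \<xi> + l), (\<eta>, y + k)) = H ((x, \<xi>), (\<eta>, y))"
  shows "(\<integral>\<^sup>+Y. W Y * H Y \<partial>lborel) \<le> (\<integral>\<^sup>+Y. (\<integral>\<^sup>+k. (\<integral>\<^sup>+l. W (Y + ((k, l), (0, k)))
      \<partial>count_space (lattice_of B)) \<partial>count_space (lattice_of E)) * H Y \<partial>cell_measure E B)"
proof -
  let ?L = "lattice_of E" and ?L' = "lattice_of B" and ?Q = "parallelepiped E" and ?Q' = "parallelepiped B"
  have cnt: "countable ?L" "countable ?L'"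
    by (rule countable_lattice_of)+
  \<comment> \<open>The translation under which the modulus on the Zak side is invariant;
    \<open>k\<close> enters twice because a shift of \<open>x\<close> also shifts
    \<open>y\<close>.\<close>
  define J :: "real ^ 'n \<Rightarrow> real ^ 'n \<Rightarrow> 'n phase" where "J k l = ((k, l), (0, k))" for k l
  define I where "I = (indicator (fundamental_domain E B) :: 'n phase \<Rightarrow> ennreal)"
  have [measurable]: "I \<in> borel_measurable borel"
    unfolding I_def by (intro borel_measurable_indicator fundamental_domain_borel EB BE)
  have I_eq: "I Y = indicator ?Q (fst (fst Y)) * indicator ?Q' (snd (fst Y))" for Y
    by (cases Y) (auto simp: I_def fundamental_domain_def indicator_def)
  have H': "H (Y + J k l) = H Y" if "k \<in> ?L" "l \<in> ?L'" for Y k l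
  proof -
    obtain x \<xi> \<eta> y where "Y = ((x, \<xi>), (\<eta>, y))" by (metis prod.collapse)
    then show ?thesis using Hp[OF that] by (simp add: J_def)
  qed
  \<comment> \<open>The cells are closed and overlap on their boundaries, so the number of covering
    translates is bounded from below by 1 instead of being equal to it; this yields an
    inequality.\<close>
  have cover: "(\<integral>\<^sup>+k. (\<integral>\<^sup>+l. I (Y - J k l) \<partial>count_space ?L') \<partial>count_space ?L) \<ge> 1" for Y
  proof -
    have "(\<integral>\<^sup>+k. (\<integral>\<^sup>+l. I (Y - J k l) \<partial>count_space ?L') \<partial>count_space ?L)
       = (\<integral>\<^sup>+k. indicator ?Q (fst (fst Y) - k) * (\<integral>\<^sup>+l. indicator ?Q' (snd (fst Y) - l) \<partial>count_space ?L') \<partial>count_space ?L)"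
      unfolding I_eq J_def by (simp add: nn_integral_cmult)
    also have "\<dots> = (\<integral>\<^sup>+k. indicator ?Q (fst (fst Y) - k) \<partial>count_space ?L) * (\<integral>\<^sup>+l. indicator ?Q' (snd (fst Y) - l) \<partial>count_space ?L')"
      by (rule nn_integral_multc) simp
    finally show ?thesis
      using mult_mono[OF lattice_cover_count[OF EB order_refl, of "fst (fst Y)"] lattice_cover_count[OF BE order_refl, of "snd (fst Y)"]]
      by simp
  qed
  have "(\<integral>\<^sup>+Y. W Y * H Y \<partial>lborel) \<le> (\<integral>\<^sup>+Y. (\<integral>\<^sup>+k. (\<integral>\<^sup>+l. I (Y - J k l) * (W Y * H Y) \<partial>count_space ?L') \<partial>count_space ?L) \<partial>lborel)"
  proof (rule nn_integral_mono)
    fix Y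
    have "1 * (W Y * H Y) \<le> (\<integral>\<^sup>+k. (\<integral>\<^sup>+l. I (Y - J k l) \<partial>count_space ?L') \<partial>count_space ?L) * (W Y * H Y)"
      by (intro mult_right_mono cover) simp
    then show "W Y * H Y \<le> (\<integral>\<^sup>+k. (\<integral>\<^sup>+l. I (Y - J k l) * (W Y * H Y) \<partial>count_space ?L') \<partial>count_space ?L)"
      by (simp add: nn_integral_multc)
  qed
  also have "\<dots> = (\<integral>\<^sup>+k. (\<integral>\<^sup>+l. (\<integral>\<^sup>+Y. I (Y - J k l) * (W Y * H Y) \<partial>lborel) \<partial>count_space ?L') \<partial>count_space ?L)"
    by (rule nn_integral_count_space2[OF cnt]) measurable
  also have "\<dots> = (\<integral>\<^sup>+k. (\<integral>\<^sup>+l. (\<integral>\<^sup>+Y. I Y * (W (Y + J k l) * H Y) \<partial>lborel) \<partial>count_space ?L') \<partial>count_space ?L)"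
  proof (rule nn_integral_cong, rule nn_integral_cong)
    fix k l assume "k \<in> space (count_space ?L)" "l \<in> space (count_space ?L')"
    then have kl: "k \<in> ?L" "l \<in> ?L'" by auto
    have "(\<integral>\<^sup>+Y. I (Y - J k l) * (W Y * H Y) \<partial>lborel) = (\<integral>\<^sup>+Y. I (Y + J k l - J k l) * (W (Y + J k l) * H (Y + J k l)) \<partial>lborel)"
      by (rule nn_integral_lborel_translate(1)[symmetric, where f="\<lambda>Y. I (Y - J k l) * (W Y * H Y)"]) measurable
    then show "(\<integral>\<^sup>+Y. I (Y - J k l) * (W Y * H Y) \<partial>lborel) = (\<integral>\<^sup>+Y. I Y * (W (Y + J k l) * H Y) \<partial>lborel)"
      by (simp add: H'[OF kl])
  qed
  also have "\<dots> = (\<integral>\<^sup>+Y. (\<integral>\<^sup>+k. (\<integral>\<^sup>+l. I Y * (W (Y + J k l) * H Y) \<partial>count_space ?L') \<partial>count_space ?L) \<partial>lborel)"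
    by (rule nn_integral_count_space2[OF cnt, symmetric]) measurable
  also have "\<dots> = (\<integral>\<^sup>+Y. (I Y * H Y) * (\<integral>\<^sup>+k. (\<integral>\<^sup>+l. W (Y + J k l) \<partial>count_space ?L') \<partial>count_space ?L) \<partial>lborel)"
  proof (rule nn_integral_cong)
    fix Y
    have "I Y * (W (Y + J k l) * H Y) = I Y * H Y * W (Y + J k l)" for k l
      by (simp add: mult_ac)
    then show "(\<integral>\<^sup>+k. (\<integral>\<^sup>+l. I Y * (W (Y + J k l) * H Y) \<partial>count_space ?L') \<partial>count_space ?L)
      = (I Y * H Y) * (\<integral>\<^sup>+k. (\<integral>\<^sup>+l. W (Y + J k l) \<partial>count_space ?L') \<partial>count_space ?L)"
      by (simp only: nn_integral_cmult borel_measurable_count_space)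
  qed
  also have "\<dots> = (\<integral>\<^sup>+Y. (\<integral>\<^sup>+k. (\<integral>\<^sup>+l. W (Y + J k l) \<partial>count_space ?L') \<partial>count_space ?L) * H Y \<partial>cell_measure E B)"
    unfolding nn_integral_cell_measure[OF EB BE] I_def by (intro nn_integral_cong) (simp only: mult_ac)
  finally show ?thesis
    unfolding J_def .
qed

lemma measurable_ident_cell_measure: "(\<lambda>x. x) \<in> borel_measurable (cell_measure E B)"
  by (rule measurable_restrict_space1) simp

text \<open>The inequality of \<open>gabor_power_from_zak\<close> integrates over all of phase space
  around \<open>((x, 0), (\<eta>, 0))\<close>. Tiling folds this integral into the fundamental
  domain, with a kernel summed over both lattices, and Schur's test applies to the folded
  kernel.\<close>

lemma zak_lower:
  fixes E B :: "'n::finite \<Rightarrow> real ^ 'n"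
  assumes EB: "dual_pair E B" and BE: "dual_pair B E" and \<Phi>: "\<Phi> \<in> Sigma1" "\<Phi> \<noteq> (\<lambda>_. 0)" and p: "0 < p"
  obtains C where "0 < C" "\<And>f. f \<in> Sigma1_dual \<Longrightarrow> Lp_qnorm p lborel (\<lambda>X. f (gabor gauss X))
    \<le> ennreal C * Lp_qnorm p (cell_measure E B) (\<lambda>X. zak E f (gabor \<Phi> X))"
proof -
  let ?L = "lattice_of E" and ?L' = "lattice_of B" and ?M = "cell_measure E B"
  let ?r = "expo p"
  obtain D where D: "0 \<le> D" and DD: "\<And>f x \<eta>. f \<in> Sigma1_dual \<Longrightarrow> ennreal (cmod (f (gabor gauss (x, \<eta>))) powr ?r)
    \<le> ennreal D * (\<integral>\<^sup>+Y. ennreal (exp (- norm (((x, 0), (\<eta>, 0)) - Y)) * cmod (zak E f (gabor \<Phi> Y)) powr ?r) \<partial>lborel)"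
    using gabor_power_from_zak[OF EB \<Phi> expo_pos[OF p]] by blast
  let ?e = "\<lambda>t :: real ^ 'n. exp (- (1 / 4 * norm t))"
  let ?T = "\<lambda>Y :: 'n phase. (fst (fst Y), fst (snd Y))"
  let ?J = "\<lambda>k l :: real ^ 'n. ((k, l), (0, k)) :: 'n phase"
  obtain C1 where C1: "0 < C1" "\<And>y. (\<integral>\<^sup>+j. ennreal (?e (y - j)) \<partial>count_space ?L) \<le> ennreal C1"
    "\<And>y. (\<integral>\<^sup>+j. ennreal (?e (y + j)) \<partial>count_space ?L) \<le> ennreal C1"
    by (rule lattice_sum_exp_both[OF EB, of "1/4"]) auto
  obtain C2 where C2: "0 < C2" "\<And>y. (\<integral>\<^sup>+j. ennreal (?e (y - j)) \<partial>count_space ?L') \<le> ennreal C2"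
    "\<And>y. (\<integral>\<^sup>+j. ennreal (?e (y + j)) \<partial>count_space ?L') \<le> ennreal C2"
    by (rule lattice_sum_exp_both[OF BE, of "1/4"]) auto
  obtain L where L: "0 < L" "\<And>X :: (real ^ 'n) \<times> (real ^ 'n). (\<integral>\<^sup>+Y. ennreal (exp (- (1 / 2 * norm (Y - X)))) \<partial>lborel) = ennreal L"
    by (rule nn_integral_exp_neg_norm[of "1/2", where 'b="(real ^ 'n) \<times> (real ^ 'n)"]) auto
  obtain L4 where L4: "0 < L4" "\<And>X :: 'n phase. (\<integral>\<^sup>+Y. ennreal (exp (- (1 / 4 * norm (Y - X)))) \<partial>lborel) = ennreal L4"
    by (rule nn_integral_exp_neg_norm[of "1/4", where 'b="'n phase"]) auto
  define R where "R = (\<Sum>j\<in>UNIV. norm (E j)) + (\<Sum>j\<in>UNIV. norm (B j))"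
  \<comment> \<open>The rate 1 of the original kernel is divided into 1/2 for
    \<open>(x, \<eta>)\<close> and 1/4 each for \<open>y\<close> and \<open>\<xi>\<close>, so that
    these groups of variables can be treated separately.\<close>
  define w where "w Y' Y = D * exp (- (1 / 2 * norm (Y' - ?T Y))) * ?e (snd (snd Y)) * ?e (snd (fst Y))"
    for Y' and Y :: "'n phase"
  have w0: "0 \<le> w Y' Y" for Y' Y
    using D by (simp add: w_def)
  have w_cont: "continuous_on UNIV (\<lambda>z. w (fst z) (snd z + c))" for c
    unfolding w_def by (intro continuous_intros)
  define k where "k Y' Y = (\<integral>\<^sup>+i. (\<integral>\<^sup>+l. ennreal (w Y' (Y + ?J i l)) \<partial>count_space ?L') \<partial>count_space ?L)" for Y' Y
  have wm: "(\<lambda>z. ennreal (w (fst z) (snd z + c))) \<in> borel_measurable (lborel \<Otimes>\<^sub>M ?M)" for c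
    by (rule borel_measurable_kernel[OF w_cont _ measurable_ident_cell_measure]) simp
  have km: "case_prod k \<in> borel_measurable (lborel \<Otimes>\<^sub>M ?M)"
    unfolding k_def case_prod_beta'
    by (intro borel_measurable_nn_integral_count_space countable_lattice_of wm)
  have wm1: "(\<lambda>Y'. ennreal (w Y' (Y + c))) \<in> borel_measurable borel" for Y c
    unfolding w_def by measurable
  have wm2: "(\<lambda>Y. ennreal (w Y' (Y + c))) \<in> borel_measurable lborel" for Y' c
  proof -
    have "continuous_on UNIV (\<lambda>Y. w Y' (Y + c))"
      unfolding w_def by (intro continuous_intros)
    from borel_measurable_continuous_onI[OF this] show ?thesis by measurable
  qed
  \<comment> \<open>Integration over \<open>Y'\<close> uses up the decay in
    \<open>(x, \<eta>)\<close>; the decay in \<open>y\<close> and \<open>\<xi>\<close> then makes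
    the two lattice sums converge, uniformly in \<open>Y\<close>.\<close>
  have k1: "(\<integral>\<^sup>+Y'. k Y' Y \<partial>lborel) \<le> ennreal (D * L * C1 * C2)" for Y
  proof -
    have "(\<integral>\<^sup>+Y'. k Y' Y \<partial>lborel) = (\<integral>\<^sup>+i. (\<integral>\<^sup>+l. (\<integral>\<^sup>+Y'. ennreal (w Y' (Y + ?J i l)) \<partial>lborel) \<partial>count_space ?L') \<partial>count_space ?L)"
      unfolding k_def by (rule nn_integral_count_space2) (use wm1 in \<open>auto intro: countable_lattice_of\<close>)
    also have "\<dots> = (\<integral>\<^sup>+i. (\<integral>\<^sup>+l. ennreal (D * L * ?e (snd (snd Y) + i) * ?e (snd (fst Y) + l)) \<partial>count_space ?L') \<partial>count_space ?L)"
    proof (intro arg_cong[where f="nn_integral (count_space ?L)"] arg_cong[where f="nn_integral (count_space ?L')"] ext)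
      fix i l
      have "(\<integral>\<^sup>+Y'. ennreal (w Y' (Y + ?J i l)) \<partial>lborel)
        = (\<integral>\<^sup>+Y'. ennreal (D * ?e (snd (snd Y) + i) * ?e (snd (fst Y) + l)) * ennreal (exp (- (1 / 2 * norm (Y' - ?T (Y + ?J i l))))) \<partial>lborel)"
        using D by (intro nn_integral_cong) (simp add: w_def ennreal_mult'[symmetric] mult_ac)
      also have "\<dots> = ennreal (D * ?e (snd (snd Y) + i) * ?e (snd (fst Y) + l)) * ennreal L"
        unfolding L(2)[symmetric, of "?T (Y + ?J i l)"] by (rule nn_integral_cmult) simp
      also have "\<dots> = ennreal (D * L * ?e (snd (snd Y) + i) * ?e (snd (fst Y) + l))"
        using D by (subst ennreal_mult'[symmetric]) (auto simp: mult_ac)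
      finally show "(\<integral>\<^sup>+Y'. ennreal (w Y' (Y + ?J i l)) \<partial>lborel) = ennreal (D * L * ?e (snd (snd Y) + i) * ?e (snd (fst Y) + l))" .
    qed
    also have "\<dots> \<le> ennreal (D * L * C1 * C2)"
      using D L(1) C1 C2 by (intro nn_integral_count_space_product_le) auto
    finally show ?thesis .
  qed
  let ?D = "D * exp R"
  \<comment> \<open>Now \<open>x\<close> and \<open>\<xi>\<close> stay in bounded cells, at the
    price \<open>exp R\<close>. The rate 1/2 is halved: one part makes the sum over \<open>i\<close>
    converge, the other, together with the decay in \<open>y + i\<close>, the integral over
    \<open>Y\<close>. The sum over \<open>l\<close> uses the decay in
    \<open>\<xi> + l\<close>.\<close>
  have k2: "(\<integral>\<^sup>+Y. k Y' Y \<partial>?M) \<le> ennreal (?D * L4 * C1 * C2)" for Y'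
  proof -
    let ?Y = "\<lambda>i. ((0, 0), (snd Y', - i)) :: 'n phase"
    have pt: "w Y' (Y + ?J i l) \<le> (?D * ?e (fst Y' - i) * ?e (0 - l)) * exp (- (1 / 4 * norm (Y - ?Y i)))"
      if Y: "Y \<in> fundamental_domain E B" for Y i l
    proof -
      let ?A = "Y' - ?T (Y + ?J i l)"
      have A: "norm (fst ?A) \<le> norm ?A" "norm (snd ?A) \<le> norm ?A"
        by (rule norm_fst_snd_le)+
      have "norm (fst Y' - i) \<le> norm (fst ?A) + norm (fst (fst Y))"
        using norm_triangle_ineq[of "fst ?A" "fst (fst Y)"] by (simp add: algebra_simps)
      moreover have "norm l \<le> norm (snd (fst Y) + l) + norm (snd (fst Y))"
        using norm_triangle_ineq4[of "snd (fst Y) + l" "snd (fst Y)"] by simp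
      moreover have "norm (Y - ?Y i) \<le> norm (fst (fst Y)) + norm (snd (fst Y)) + norm (snd ?A) + norm (snd (snd Y) + i)"
        using norm_le_coordinates[of "Y - ?Y i"] by (simp add: norm_minus_commute)
      ultimately have "1 / 4 * norm (Y - ?Y i) + 1 / 4 * norm (fst Y' - i) + 1 / 4 * norm (0 - l) - R
        \<le> 1 / 2 * norm ?A + 1 / 4 * norm (snd (snd Y) + i) + 1 / 4 * norm (snd (fst Y) + l)"
        using A norm_fundamental_domain[OF Y] norm_ge_zero[of "fst (fst Y)"] norm_ge_zero[of "snd (fst Y)"]
        unfolding R_def by (simp del: norm_ge_zero)
      then have "exp (- (1 / 2 * norm ?A)) * ?e (snd (snd Y) + i) * ?e (snd (fst Y) + l)
        \<le> exp R * ?e (fst Y' - i) * ?e (0 - l) * exp (- (1 / 4 * norm (Y - ?Y i)))"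
        unfolding exp_add[symmetric] exp_le_cancel_iff by linarith
      from mult_left_mono[OF this D] show ?thesis
        by (simp add: w_def mult.assoc)
    qed
    have "(\<integral>\<^sup>+Y. k Y' Y \<partial>?M) = (\<integral>\<^sup>+i. (\<integral>\<^sup>+l. (\<integral>\<^sup>+Y. ennreal (w Y' (Y + ?J i l)) \<partial>?M) \<partial>count_space ?L') \<partial>count_space ?L)"
      unfolding k_def
      by (intro nn_integral_count_space2 countable_lattice_of measurable_restrict_space1)
        (rule wm2)
    also have "\<dots> \<le> (\<integral>\<^sup>+i. (\<integral>\<^sup>+l. ennreal (?D * L4 * ?e (fst Y' - i) * ?e (0 - l)) \<partial>count_space ?L') \<partial>count_space ?L)"
    proof (rule nn_integral_mono, rule nn_integral_mono)
      fix i l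
      let ?c = "?D * ?e (fst Y' - i) * ?e (0 - l)"
      have c: "0 \<le> ?c" using D by simp
      have "(\<integral>\<^sup>+Y. ennreal (w Y' (Y + ?J i l)) \<partial>?M) \<le> (\<integral>\<^sup>+Y. ennreal ?c * ennreal (exp (- (1 / 4 * norm (Y - ?Y i)))) \<partial>lborel)"
        unfolding ennreal_mult'[OF c, symmetric] by (intro nn_integral_cell_measure_le EB BE ennreal_leI pt)
      also have "\<dots> = ennreal ?c * ennreal L4"
        unfolding L4(2)[symmetric, of "?Y i"] by (rule nn_integral_cmult) simp
      also have "\<dots> = ennreal (?D * L4 * ?e (fst Y' - i) * ?e (0 - l))"
        unfolding ennreal_mult'[OF c, symmetric] by (simp only: mult_ac)
      finally show "(\<integral>\<^sup>+Y. ennreal (w Y' (Y + ?J i l)) \<partial>?M) \<le> \<dots>" .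
    qed
    also have "\<dots> \<le> ennreal (?D * L4 * C1 * C2)"
      using D L4(1) C1 C2(1) C2(2)[of 0] by (intro nn_integral_count_space_product_le) auto
    finally show ?thesis .
  qed
  have key: "ennreal (cmod (f (gabor gauss Y')) powr ?r) \<le> (\<integral>\<^sup>+Y. k Y' Y * ennreal (cmod (zak E f (gabor \<Phi> Y)) powr ?r) \<partial>?M)"
    if f: "f \<in> Sigma1_dual" for f Y'
  proof -
    have [measurable]: "(\<lambda>Y. zak E f (gabor \<Phi> Y)) \<in> borel_measurable borel"
      by (rule dual_gabor(1)[OF \<Phi>(1) zak_Sigma1_dual[OF EB f]])
    let ?H = "\<lambda>Y. ennreal (cmod (zak E f (gabor \<Phi> Y)) powr ?r)"
    let ?X = "((fst Y', 0), (snd Y', 0)) :: 'n phase"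
    have le: "D * exp (- norm (?X - Y)) \<le> w Y' Y" for Y
    proof -
      have "1 / 2 * norm (Y' - ?T Y) + 1 / 4 * norm (snd (snd Y)) + 1 / 4 * norm (snd (fst Y)) \<le> norm (?X - Y)"
        using norm_coordinates(2,4,5)[of "?X - Y"] by (cases Y') (simp add: norm_minus_commute)
      then have "exp (- norm (?X - Y)) \<le> exp (- (1 / 2 * norm (Y' - ?T Y))) * ?e (snd (snd Y)) * ?e (snd (fst Y))"
        unfolding exp_add[symmetric] exp_le_cancel_iff by linarith
      from mult_left_mono[OF this D] show ?thesis
        by (simp add: w_def mult.assoc)
    qed
    have "ennreal (cmod (f (gabor gauss Y')) powr ?r)
      \<le> ennreal D * (\<integral>\<^sup>+Y. ennreal (exp (- norm (?X - Y)) * cmod (zak E f (gabor \<Phi> Y)) powr ?r) \<partial>lborel)"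
      using DD[OF f, of "fst Y'" "snd Y'"] by simp
    also have "\<dots> = (\<integral>\<^sup>+Y. ennreal (D * exp (- norm (?X - Y))) * ?H Y \<partial>lborel)"
      using D by (subst nn_integral_cmult[symmetric]) (auto simp: ennreal_mult' mult.assoc)
    also have "\<dots> \<le> (\<integral>\<^sup>+Y. ennreal (w Y' Y) * ?H Y \<partial>lborel)"
      by (intro nn_integral_mono mult_right_mono ennreal_leI le) simp
    also have "\<dots> \<le> (\<integral>\<^sup>+Y. k Y' Y * ?H Y \<partial>?M)"
      unfolding k_def
    proof (rule nn_integral_tiling[OF EB BE])
      show "(\<lambda>Y. ennreal (w Y' Y)) \<in> borel_measurable borel"
        using wm2[of Y' 0] by simp
    qed (measurable, simp add: zak_quasi_periodic[OF EB f \<Phi>(1)])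
    finally show ?thesis .
  qed
  have DL: "0 \<le> D * L * C1 * C2" "0 \<le> ?D * L4 * C1 * C2"
    using D L(1) L4(1) C1(1) C2(1) by auto
  let ?C = "if p = \<infinity> then ?D * L4 * C1 * C2 + 1 else (D * L * C1 * C2 + 1) powr (1 / enn2real p)"
  have "0 < ?C"
    using DL by (auto intro: add_nonneg_pos)
  moreover have "Lp_qnorm p lborel (\<lambda>X. f (gabor gauss X)) \<le> ennreal ?C * Lp_qnorm p ?M (\<lambda>X. zak E f (gabor \<Phi> X))"
    if f: "f \<in> Sigma1_dual" for f
  proof (rule Lp_qnorm_schur[OF p _ _ _ _ _ DL, where k=k])
    show "(\<integral>\<^sup>+Y'. k Y' Y \<partial>lborel) \<le> ennreal (D * L * C1 * C2)" for Y
      by (rule k1)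
    show "(\<integral>\<^sup>+Y. k Y' Y \<partial>?M) \<le> ennreal (?D * L4 * C1 * C2)" for Y'
      by (rule k2)
    show "(\<lambda>X. f (gabor gauss X)) \<in> borel_measurable lborel"
      using dual_gabor(1)[OF gauss_Sigma1 f] by simp
    show "(\<lambda>X. zak E f (gabor \<Phi> X)) \<in> borel_measurable ?M"
      using dual_gabor(1)[OF \<Phi>(1) zak_Sigma1_dual[OF EB f]] by (intro measurable_restrict_space1) simp
    show "case_prod k \<in> borel_measurable (lborel \<Otimes>\<^sub>M ?M)"
      by (rule km)
    show "sigma_finite_measure (lborel :: ((real ^ 'n) \<times> (real ^ 'n)) measure)"
      by (rule sigma_finite_lborel)
    show "sigma_finite_measure ?M"
      using fundamental_domain_borel[OF EB BE] by (intro sigma_finite_measure_restrict_space sigma_finite_lborel) simp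
    show "ennreal (cmod (f (gabor gauss X)) powr enn2real p) \<le> (\<integral>\<^sup>+Y. k X Y * ennreal (cmod (zak E f (gabor \<Phi> Y)) powr enn2real p) \<partial>?M)"
      if "p \<noteq> \<infinity>" for X
      using key[OF f, of X] that by (simp add: expo_def)
    show "ennreal (cmod (f (gabor gauss X))) \<le> (\<integral>\<^sup>+Y. k X Y * ennreal (cmod (zak E f (gabor \<Phi> Y))) \<partial>?M)"
      if "p = \<infinity>" for X
      using key[OF f, of X] that by (simp add: expo_def)
  qed
  ultimately show ?thesis
    using that by blast
qed


text \<open>Three pointwise inequalities are composed: \<open>D1\<close> passes from
  \<open>\<Phi>\<close> to the Gaussian window, \<open>D2\<close> sums the Zak series, and
  \<open>D3\<close> replaces the point values of the transform of \<open>f\<close> at lattice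
  translates by local averages. The last one produces a kernel in \<open>Y'\<close> suited to
  Schur's test.\<close>

lemma zak_upper:
  fixes E B :: "'n::finite \<Rightarrow> real ^ 'n"
  assumes EB: "dual_pair E B" and BE: "dual_pair B E" and \<Phi>: "\<Phi> \<in> Sigma1" and p: "0 < p"
  obtains C where "0 < C" "\<And>f. f \<in> Sigma1_dual \<Longrightarrow> Lp_qnorm p (cell_measure E B) (\<lambda>X. zak E f (gabor \<Phi> X))
    \<le> ennreal C * Lp_qnorm p lborel (\<lambda>X. f (gabor gauss X))"
proof -
  let ?L = "lattice_of E" and ?M = "cell_measure E B"
  let ?r = "expo p"
  let ?T = "\<lambda>Y :: 'n phase. (fst (fst Y), fst (snd Y))"
  obtain D1 where D1: "0 \<le> D1" "\<And>u X. u \<in> Sigma1_dual \<Longrightarrow> ennreal (cmod (u (gabor \<Phi> X)) powr ?r)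
    \<le> ennreal D1 * (\<integral>\<^sup>+Y. ennreal (exp (- norm (X - Y)) * cmod (u (gabor gauss Y)) powr ?r) \<partial>lborel)"
    using gabor_power[OF gauss_Sigma1 gauss_nonzero \<Phi> expo_pos[OF p]] by blast
  obtain D2 where D2: "0 \<le> D2" "\<And>f Y. f \<in> Sigma1_dual \<Longrightarrow> ennreal (cmod (zak E f (gabor gauss Y)) powr ?r)
    \<le> ennreal D2 * (\<integral>\<^sup>+j. ennreal (exp (- norm (snd (snd Y) - j)) * cmod (f (gabor gauss (fst (fst Y) - j, fst (snd Y)))) powr ?r) \<partial>count_space ?L)"
    using zak_power[OF EB expo_pos[OF p]] by blast
  obtain D3 where D3: "0 \<le> D3" "\<And>f X. f \<in> Sigma1_dual \<Longrightarrow> ennreal (cmod (f (gabor (gauss :: real ^ 'n \<Rightarrow> complex) X)) powr ?r)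
    \<le> ennreal D3 * (\<integral>\<^sup>+Y. ennreal (exp (- norm (X - Y)) * cmod (f (gabor gauss Y)) powr ?r) \<partial>lborel)"
    using gabor_power[OF gauss_Sigma1 gauss_nonzero gauss_Sigma1 expo_pos[OF p]] by blast
  obtain C4 where C4: "0 < C4" "\<And>y. (\<integral>\<^sup>+j. ennreal (exp (- (1 / 4 * norm (y - j)))) \<partial>count_space ?L) \<le> ennreal C4"
    by (rule lattice_sum_exp[OF EB, of "1/4"]) auto
  obtain C8 where C8: "0 < C8" "\<And>y. (\<integral>\<^sup>+j. ennreal (exp (- (1 / 8 * norm (y - j)))) \<partial>count_space ?L) \<le> ennreal C8"
    by (rule lattice_sum_exp[OF EB, of "1/8"]) auto
  obtain L2 where L2: "0 < L2" "\<And>X :: 'n phase. (\<integral>\<^sup>+Y. ennreal (exp (- (1 / 2 * norm (X - Y)))) \<partial>lborel) = ennreal L2"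
    by (rule nn_integral_exp_neg_norm[of "1/2", where 'b="'n phase"]) auto
  obtain L8 where L8: "0 < L8" "\<And>X :: 'n phase. (\<integral>\<^sup>+Y. ennreal (exp (- (1 / 8 * norm (Y - X)))) \<partial>lborel) = ennreal L8"
    by (rule nn_integral_exp_neg_norm[of "1/8", where 'b="'n phase"]) auto
  obtain L4 where L4: "0 < L4" "\<And>X :: (real ^ 'n) \<times> (real ^ 'n). (\<integral>\<^sup>+Y. ennreal (exp (- (1 / 4 * norm (X - Y)))) \<partial>lborel) = ennreal L4"
    by (rule nn_integral_exp_neg_norm[of "1/4", where 'b="(real ^ 'n) \<times> (real ^ 'n)"]) auto
  define D where "D = D1 * D2 * D3 * L2"
  have D: "0 \<le> D" using D1 D2 D3 L2 by (simp add: D_def)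
  define R where "R = (\<Sum>j\<in>UNIV. norm (E j)) + (\<Sum>j\<in>UNIV. norm (B j))"
  \<comment> \<open>The \<open>j\<close>-th part of the kernel: \<open>y\<close> is localised near
    \<open>j\<close>, and \<open>(x - j, \<eta>)\<close> near \<open>Y'\<close>.\<close>
  define w where "w j X Y' = exp (- (1 / 4 * norm (snd (snd X) - j))) * exp (- (1 / 4 * norm (?T X - (j, 0) - Y')))"
    for j and X :: "'n phase" and Y'
  have w0: "0 \<le> w j X Y'" for j X Y'
    by (simp add: w_def)
  define k where "k X Y' = (\<integral>\<^sup>+j. ennreal (D * w j X Y') \<partial>count_space ?L)" for X Y'
  have wm: "(\<lambda>z. ennreal (D * w j (fst z) (snd z))) \<in> borel_measurable (?M \<Otimes>\<^sub>M lborel)" for j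
  proof (rule borel_measurable_kernel)
    show "continuous_on UNIV (\<lambda>z. D * w j (fst z) (snd z))"
      unfolding w_def by (intro continuous_intros)
  qed (simp_all add: measurable_ident_cell_measure)
  have km: "case_prod k \<in> borel_measurable (?M \<Otimes>\<^sub>M lborel)"
    unfolding k_def case_prod_beta'
    by (intro borel_measurable_nn_integral_count_space countable_lattice_of wm)
  have wm1: "(\<lambda>Y'. ennreal (D * w j X Y')) \<in> borel_measurable borel" for j X
    unfolding w_def by measurable
  have wm2: "(\<lambda>X. ennreal (D * w j X Y')) \<in> borel_measurable ?M" for j Y'
  proof -
    have "continuous_on UNIV (\<lambda>X. D * w j X Y')"
      unfolding w_def by (intro continuous_intros)
    from borel_measurable_continuous_onI[OF this] have "(\<lambda>X. ennreal (D * w j X Y')) \<in> borel_measurable borel"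
      by (rule measurable_compose) simp
    then show ?thesis
      by (intro measurable_restrict_space1) simp
  qed
  have k2: "(\<integral>\<^sup>+Y'. k X Y' \<partial>lborel) \<le> ennreal (D * L4 * C4)" for X
  proof -
    have "(\<integral>\<^sup>+Y'. k X Y' \<partial>lborel) = (\<integral>\<^sup>+j. (\<integral>\<^sup>+Y'. ennreal (D * w j X Y') \<partial>lborel) \<partial>count_space ?L)"
      unfolding k_def by (intro nn_integral_count_space_nn_integral countable_lattice_of) (use wm1 in simp)
    also have "\<dots> = (\<integral>\<^sup>+j. ennreal (D * L4) * ennreal (exp (- (1 / 4 * norm (snd (snd X) - j)))) \<partial>count_space ?L)"
    proof (rule nn_integral_cong)
      fix j
      let ?c = "D * exp (- (1 / 4 * norm (snd (snd X) - j)))"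
      have c: "0 \<le> ?c" using D by simp
      have "(\<integral>\<^sup>+Y'. ennreal (D * w j X Y') \<partial>lborel) = (\<integral>\<^sup>+Y'. ennreal ?c * ennreal (exp (- (1 / 4 * norm (?T X - (j, 0) - Y')))) \<partial>lborel)"
        unfolding w_def ennreal_mult'[OF c, symmetric] by (simp only: mult.assoc)
      also have "\<dots> = ennreal ?c * ennreal L4"
        unfolding L4(2)[symmetric, of "?T X - (j, 0)"] by (rule nn_integral_cmult) simp
      also have "\<dots> = ennreal (D * L4) * ennreal (exp (- (1 / 4 * norm (snd (snd X) - j))))"
        using D L4(1) by (subst (1 2) ennreal_mult'[symmetric]) (auto simp: mult_ac)
      finally show "(\<integral>\<^sup>+Y'. ennreal (D * w j X Y') \<partial>lborel) = \<dots>" .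
    qed
    also have "\<dots> = ennreal (D * L4) * (\<integral>\<^sup>+j. ennreal (exp (- (1 / 4 * norm (snd (snd X) - j)))) \<partial>count_space ?L)"
      by (rule nn_integral_cmult) simp
    also have "\<dots> \<le> ennreal (D * L4) * ennreal C4"
      by (intro mult_left_mono C4(2)) simp
    finally show ?thesis
      using D L4(1) by (simp add: ennreal_mult')
  qed
  let ?D = "D * exp R"
  \<comment> \<open>The cell bounds \<open>x\<close> and \<open>\<xi>\<close>. Since
    \<open>x - j\<close> is localised near \<open>fst Y'\<close>, the point \<open>- fst Y'\<close>
    is localised near \<open>j\<close>, which makes the lattice sum converge; the decay in
    \<open>\<eta>\<close> and \<open>y\<close> takes care of the unbounded variables. The rate 1/4
    is split into two eighths for these two purposes.\<close>
  have k1: "(\<integral>\<^sup>+X. k X Y' \<partial>?M) \<le> ennreal (?D * L8 * C8)" for Y'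
  proof -
    let ?X = "\<lambda>j. ((0, 0), (snd Y', j)) :: 'n phase"
    let ?e = "\<lambda>j. exp (- (1 / 8 * norm (- fst Y' - j)))"
    have pt: "D * w j X Y' \<le> (?D * ?e j) * exp (- (1 / 8 * norm (X - ?X j)))"
      if X: "X \<in> fundamental_domain E B" for X j
    proof -
      let ?A = "?T X - (j, 0) - Y'"
      have A: "norm (fst ?A) \<le> norm ?A" "norm (snd ?A) \<le> norm ?A"
        by (rule norm_fst_snd_le)+
      have "norm (- fst Y' - j) \<le> norm (fst ?A) + norm (fst (fst X))"
        using norm_triangle_ineq4[of "fst ?A" "fst (fst X)"] by (simp add: algebra_simps minus_diff_commute)
      moreover have "norm (X - ?X j) \<le> norm (fst (fst X)) + norm (snd (fst X)) + norm (snd ?A) + norm (snd (snd X) - j)"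
        using norm_le_coordinates[of "X - ?X j"] by simp
      ultimately have "1 / 8 * norm (X - ?X j) + 1 / 8 * norm (- fst Y' - j) - R
        \<le> 1 / 4 * norm (snd (snd X) - j) + 1 / 4 * norm ?A"
        using A norm_fundamental_domain[OF X] norm_ge_zero[of "fst (fst X)"] norm_ge_zero[of "snd (fst X)"] norm_ge_zero[of "snd (snd X) - j"]
        unfolding R_def by (simp del: norm_ge_zero)
      then have "w j X Y' \<le> exp R * ?e j * exp (- (1 / 8 * norm (X - ?X j)))"
        unfolding w_def exp_add[symmetric] exp_le_cancel_iff by linarith
      from mult_left_mono[OF this D] show ?thesis
        by (simp only: mult.assoc)
    qed
    have "(\<integral>\<^sup>+X. k X Y' \<partial>?M) = (\<integral>\<^sup>+j. (\<integral>\<^sup>+X. ennreal (D * w j X Y') \<partial>?M) \<partial>count_space ?L)"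
      unfolding k_def by (intro nn_integral_count_space_nn_integral countable_lattice_of wm2)
    also have "\<dots> \<le> (\<integral>\<^sup>+j. ennreal (?D * L8) * ennreal (?e j) \<partial>count_space ?L)"
    proof (rule nn_integral_mono)
      fix j
      have c: "0 \<le> ?D * ?e j" using D by simp
      have "(\<integral>\<^sup>+X. ennreal (D * w j X Y') \<partial>?M) \<le> (\<integral>\<^sup>+X. ennreal (?D * ?e j) * ennreal (exp (- (1 / 8 * norm (X - ?X j)))) \<partial>lborel)"
        unfolding ennreal_mult'[OF c, symmetric] by (intro nn_integral_cell_measure_le EB BE ennreal_leI pt)
      also have "\<dots> = ennreal (?D * ?e j) * ennreal L8"
        unfolding L8(2)[symmetric, of "?X j"] by (rule nn_integral_cmult) simp
      also have "\<dots> = ennreal (?D * L8) * ennreal (?e j)"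
        using D L8(1) by (subst (1 2) ennreal_mult'[symmetric]) (auto simp: mult_ac)
      finally show "(\<integral>\<^sup>+X. ennreal (D * w j X Y') \<partial>?M) \<le> \<dots>" .
    qed
    also have "\<dots> = ennreal (?D * L8) * (\<integral>\<^sup>+j. ennreal (?e j) \<partial>count_space ?L)"
      by (rule nn_integral_cmult) simp
    also have "\<dots> \<le> ennreal (?D * L8) * ennreal C8"
      by (intro mult_left_mono C8(2)) simp
    finally show ?thesis
      using D L8(1) by (simp add: ennreal_mult')
  qed
  have key: "ennreal (cmod (zak E f (gabor \<Phi> X)) powr ?r) \<le> (\<integral>\<^sup>+Y'. k X Y' * ennreal (cmod (f (gabor gauss Y')) powr ?r) \<partial>lborel)"
    if f: "f \<in> Sigma1_dual" for f X
  proof -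
    have [measurable]: "(\<lambda>Y. f (gabor gauss Y)) \<in> borel_measurable borel"
      by (rule dual_gabor(1)[OF gauss_Sigma1 f])
    let ?v = "\<lambda>Y'. cmod (f (gabor gauss Y')) powr ?r"
    let ?S = "\<integral>\<^sup>+j. (\<integral>\<^sup>+Y'. ennreal (w j X Y' * ?v Y') \<partial>lborel) \<partial>count_space ?L"
    \<comment> \<open>Half of the rate in \<open>X - Y\<close> moves the two other factors from
      \<open>Y\<close> to \<open>X\<close>, a quarter for each; the remaining half is integrated
      over \<open>Y\<close> and becomes \<open>L2\<close>.\<close>
    have pt: "exp (- norm (X - Y)) * exp (- norm (snd (snd Y) - j)) * exp (- norm (?T Y - (j, 0) - Y'))
      \<le> exp (- (1 / 2 * norm (X - Y))) * w j X Y'" for Y j Y'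
    proof -
      have "norm (snd (snd X) - j) \<le> norm (snd (snd (X - Y))) + norm (snd (snd Y) - j)"
        using norm_triangle_ineq[of "snd (snd (X - Y))" "snd (snd Y) - j"] by simp
      moreover have "norm (?T X - (j, 0) - Y') \<le> norm (?T (X - Y)) + norm (?T Y - (j, 0) - Y')"
      proof -
        have "?T X - (j, 0) - Y' = ?T (X - Y) + (?T Y - (j, 0) - Y')"
          by (simp add: prod_eq_iff)
        then show ?thesis
          using norm_triangle_ineq[of "?T (X - Y)" "?T Y - (j, 0) - Y'"] by (simp only:)
      qed
      ultimately show ?thesis
        unfolding w_def exp_add[symmetric] exp_le_cancel_iff
        using norm_coordinates(4,5)[of "X - Y"] norm_ge_zero[of "snd (snd Y) - j"] norm_ge_zero[of "?T Y - (j, 0) - Y'"]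
        by linarith
    qed
    have U: "ennreal (exp (- norm (X - Y)) * cmod (zak E f (gabor gauss Y)) powr ?r)
      \<le> ennreal (D2 * D3) * (ennreal (exp (- (1 / 2 * norm (X - Y)))) * ?S)" for Y
    proof -
      have "ennreal (exp (- norm (X - Y)) * cmod (zak E f (gabor gauss Y)) powr ?r)
        \<le> ennreal (exp (- norm (X - Y))) * (ennreal D2 * (\<integral>\<^sup>+j. ennreal (exp (- norm (snd (snd Y) - j)) * ?v (fst (fst Y) - j, fst (snd Y))) \<partial>count_space ?L))"
        unfolding ennreal_mult'[OF exp_ge_zero] using D2(2)[OF f, of Y]
        by (intro mult_left_mono) (simp_all add: ennreal_mult')
      also have "\<dots> \<le> ennreal (exp (- norm (X - Y))) * (ennreal D2 * (\<integral>\<^sup>+j. ennreal (exp (- norm (snd (snd Y) - j)))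
          * (ennreal D3 * (\<integral>\<^sup>+Y'. ennreal (exp (- norm (?T Y - (j, 0) - Y')) * ?v Y') \<partial>lborel)) \<partial>count_space ?L))"
        unfolding ennreal_mult'[OF exp_ge_zero] using D3(2)[OF f]
        by (intro mult_left_mono nn_integral_mono) (simp_all add: ennreal_mult')
      also have "\<dots> = ennreal (D2 * D3) * (\<integral>\<^sup>+j. (\<integral>\<^sup>+Y'. ennreal (exp (- norm (X - Y)) * exp (- norm (snd (snd Y) - j)) * exp (- norm (?T Y - (j, 0) - Y')) * ?v Y') \<partial>lborel) \<partial>count_space ?L)"
        using D2(1) D3(1) by (simp add: ennreal_mult' nn_integral_cmult mult_ac)
      also have "\<dots> \<le> ennreal (D2 * D3) * (\<integral>\<^sup>+j. (\<integral>\<^sup>+Y'. ennreal (exp (- (1 / 2 * norm (X - Y)))) * ennreal (w j X Y' * ?v Y') \<partial>lborel) \<partial>count_space ?L)"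
      proof (intro mult_left_mono nn_integral_mono)
        fix j Y'
        show "ennreal (exp (- norm (X - Y)) * exp (- norm (snd (snd Y) - j)) * exp (- norm (?T Y - (j, 0) - Y')) * ?v Y')
          \<le> ennreal (exp (- (1 / 2 * norm (X - Y)))) * ennreal (w j X Y' * ?v Y')"
          using mult_right_mono[OF pt[of Y j Y'] powr_ge_zero]
          unfolding ennreal_mult'[OF exp_ge_zero, symmetric] by (intro ennreal_leI) (simp only: mult.assoc)
      qed simp
      also have "\<dots> = ennreal (D2 * D3) * (ennreal (exp (- (1 / 2 * norm (X - Y)))) * ?S)"
        unfolding w_def by (simp add: nn_integral_cmult)
      finally show ?thesis .
    qed
    have "ennreal (cmod (zak E f (gabor \<Phi> X)) powr ?r)
      \<le> ennreal D1 * (\<integral>\<^sup>+Y. ennreal (exp (- norm (X - Y)) * cmod (zak E f (gabor gauss Y)) powr ?r) \<partial>lborel)"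
      by (rule D1(2)[OF zak_Sigma1_dual[OF EB f]])
    also have "\<dots> \<le> ennreal D1 * (\<integral>\<^sup>+Y. ennreal (D2 * D3) * (ennreal (exp (- (1 / 2 * norm (X - Y)))) * ?S) \<partial>lborel)"
      by (intro mult_left_mono nn_integral_mono U) simp
    also have "\<dots> = ennreal D1 * (ennreal (D2 * D3) * (ennreal L2 * ?S))"
      unfolding L2(2)[symmetric, of X] by (simp add: nn_integral_cmult nn_integral_multc)
    also have "\<dots> = ennreal D * ?S"
      using D1(1) D2(1) D3(1) L2(1) by (simp add: D_def ennreal_mult' mult.assoc)
    also have "?S = (\<integral>\<^sup>+Y'. (\<integral>\<^sup>+j. ennreal (w j X Y' * ?v Y') \<partial>count_space ?L) \<partial>lborel)"
      unfolding w_def by (intro nn_integral_count_space_nn_integral[symmetric] countable_lattice_of) measurable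
    also have "ennreal D * \<dots> = (\<integral>\<^sup>+Y'. ennreal D * (\<integral>\<^sup>+j. ennreal (w j X Y' * ?v Y') \<partial>count_space ?L) \<partial>lborel)"
      unfolding w_def
      by (intro nn_integral_cmult[symmetric] borel_measurable_nn_integral_count_space countable_lattice_of) measurable
    also have "\<dots> = (\<integral>\<^sup>+Y'. k X Y' * ennreal (?v Y') \<partial>lborel)"
      unfolding k_def using D w0 by (simp add: nn_integral_cmult nn_integral_multc ennreal_mult' mult.assoc)
    finally show ?thesis .
  qed
  have DL: "0 \<le> ?D * L8 * C8" "0 \<le> D * L4 * C4"
    using D L4(1) L8(1) C4(1) C8(1) by auto
  let ?C = "if p = \<infinity> then D * L4 * C4 + 1 else (?D * L8 * C8 + 1) powr (1 / enn2real p)"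
  have "0 < ?C"
    using DL by (auto intro: add_nonneg_pos)
  moreover have "Lp_qnorm p ?M (\<lambda>X. zak E f (gabor \<Phi> X)) \<le> ennreal ?C * Lp_qnorm p lborel (\<lambda>X. f (gabor gauss X))"
    if f: "f \<in> Sigma1_dual" for f
  proof (rule Lp_qnorm_schur[OF p _ _ _ _ _ DL, where k=k])
    show "(\<integral>\<^sup>+X. k X Y' \<partial>?M) \<le> ennreal (?D * L8 * C8)" for Y'
      by (rule k1)
    show "(\<integral>\<^sup>+Y'. k X Y' \<partial>lborel) \<le> ennreal (D * L4 * C4)" for X
      by (rule k2)
    show "(\<lambda>X. f (gabor gauss X)) \<in> borel_measurable lborel"
      using dual_gabor(1)[OF gauss_Sigma1 f] by simp
    show "(\<lambda>X. zak E f (gabor \<Phi> X)) \<in> borel_measurable ?M"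
      using dual_gabor(1)[OF \<Phi> zak_Sigma1_dual[OF EB f]] by (intro measurable_restrict_space1) simp
    show "case_prod k \<in> borel_measurable (?M \<Otimes>\<^sub>M lborel)"
      by (rule km)
    show "sigma_finite_measure (lborel :: ((real ^ 'n) \<times> (real ^ 'n)) measure)"
      by (rule sigma_finite_lborel)
    show "sigma_finite_measure ?M"
      using fundamental_domain_borel[OF EB BE] by (intro sigma_finite_measure_restrict_space sigma_finite_lborel) simp
    show "ennreal (cmod (zak E f (gabor \<Phi> X)) powr enn2real p) \<le> (\<integral>\<^sup>+Y. k X Y * ennreal (cmod (f (gabor gauss Y)) powr enn2real p) \<partial>lborel)"
      if "p \<noteq> \<infinity>" for X
      using key[OF f, of X] that by (simp add: expo_def)
    show "ennreal (cmod (zak E f (gabor \<Phi> X))) \<le> (\<integral>\<^sup>+Y. k X Y * ennreal (cmod (f (gabor gauss Y))) \<partial>lborel)"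
      if "p = \<infinity>" for X
      using key[OF f, of X] that by (simp add: expo_def)
  qed
  ultimately show ?thesis
    using that by blast
qed

section \<open>Normalisation of the short-time Fourier transform and conclusion\<close>

lemma stft_eq_gabor:
  fixes \<phi> :: "'a::euclidean_space \<Rightarrow> complex"
  shows "stft \<phi> u X = of_real ((2 * pi) powr (- real DIM('a) / 2)) * u (gabor \<phi> X)"
  by (cases X) (simp add: stft_def gabor_def cis_conv_exp)

lemma Lp_qnorm_stft:
  fixes \<phi> :: "'a::euclidean_space \<Rightarrow> complex"
  assumes p: "0 < p" and [measurable]: "(\<lambda>X. u (gabor \<phi> X)) \<in> borel_measurable M"
  shows "Lp_qnorm p M (stft \<phi> u) \<le> ennreal ((2 * pi) powr (- real DIM('a) / 2)) * Lp_qnorm p M (\<lambda>X. u (gabor \<phi> X))"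
    and "Lp_qnorm p M (\<lambda>X. u (gabor \<phi> X)) \<le> ennreal ((2 * pi) powr (real DIM('a) / 2)) * Lp_qnorm p M (stft \<phi> u)"
proof -
  have [measurable]: "stft \<phi> u \<in> borel_measurable M"
    unfolding stft_eq_gabor[abs_def] by measurable
  have inv: "(2 * pi) powr (real DIM('a) / 2) * (2 * pi) powr (- real DIM('a) / 2) = 1"
    by (simp add: powr_add[symmetric])
  show "Lp_qnorm p M (stft \<phi> u) \<le> ennreal ((2 * pi) powr (- real DIM('a) / 2)) * Lp_qnorm p M (\<lambda>X. u (gabor \<phi> X))"
    by (rule Lp_qnorm_mono[OF p]) (auto simp: stft_eq_gabor norm_mult)
  show "Lp_qnorm p M (\<lambda>X. u (gabor \<phi> X)) \<le> ennreal ((2 * pi) powr (real DIM('a) / 2)) * Lp_qnorm p M (stft \<phi> u)"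
  proof (rule Lp_qnorm_mono[OF p])
    show "cmod (u (gabor \<phi> X)) \<le> (2 * pi) powr (real DIM('a) / 2) * cmod (stft \<phi> u X)" for X
      using inv by (simp add: stft_eq_gabor norm_mult mult.assoc[symmetric])
  qed auto
qed

lemma ennreal_le_trans_mult:
  assumes "x \<le> ennreal a * y" "y \<le> ennreal b * z" "0 \<le> a"
  shows "x \<le> ennreal (a * b) * z"
  using order_trans[OF assms(1) mult_left_mono[OF assms(2), of "ennreal a"]] assms(3)
  by (simp add: ennreal_mult' mult.assoc)

text \<open>The Gaussian window on the single space mediates: \<open>gabor_qnorm\<close> compares it
  with \<open>\<phi>\<close> in both directions, and \<open>zak_lower\<close> and
  \<open>zak_upper\<close> compare it with \<open>\<Phi>\<close> on the Zak side. Powers of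
  \<open>2 * pi\<close> pass between \<open>stft\<close> and \<open>gabor\<close>.\<close>

theorem corollary3p14:
  fixes E :: "'n::finite \<Rightarrow> real ^ 'n"
    and \<phi> :: "real ^ 'n \<Rightarrow> complex"
    and \<Phi> :: "(real ^ 'n) \<times> (real ^ 'n) \<Rightarrow> complex"
    and p :: ennreal
  assumes "is_basis E"
    and "\<phi> \<in> Sigma1" and "\<phi> \<noteq> (\<lambda>_. 0)"
    and "\<Phi> \<in> Sigma1" and "\<Phi> \<noteq> (\<lambda>_. 0)"
    and "0 < p"
  shows "\<exists>c C :: real. 0 < c \<and> 0 < C \<and>
    (\<forall>f \<in> Sigma1_dual.
       ennreal c * modulation_qnorm \<phi> p f
         \<le> Lp_qnorm p
             (restrict_space lborel ((parallelepiped E \<times> parallelepiped (dual_basis E)) \<times> UNIV))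
             (stft \<Phi> (zak E f)) \<and>
       Lp_qnorm p
             (restrict_space lborel ((parallelepiped E \<times> parallelepiped (dual_basis E)) \<times> UNIV))
             (stft \<Phi> (zak E f))
         \<le> ennreal C * modulation_qnorm \<phi> p f)"
proof -
  let ?B = "dual_basis E"
  let ?M = "cell_measure E ?B"
  have EB: "dual_pair E ?B" and BE: "dual_pair ?B E"
    by (rule dual_pair_dual_basis[OF assms(1)])+
  let ?a = "(2 * pi) powr (- real DIM(real ^ 'n) / 2)" and ?a' = "(2 * pi) powr (real DIM(real ^ 'n) / 2)"
  let ?b = "(2 * pi) powr (- real DIM((real ^ 'n) \<times> (real ^ 'n)) / 2)" and ?b' = "(2 * pi) powr (real DIM((real ^ 'n) \<times> (real ^ 'n)) / 2)"
  obtain C1 where C1: "0 < C1" "\<And>u. u \<in> Sigma1_dual \<Longrightarrow>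
    Lp_qnorm p lborel (\<lambda>X. u (gabor \<phi> X)) \<le> ennreal C1 * Lp_qnorm p lborel (\<lambda>X. u (gabor gauss X))"
    using gabor_qnorm[OF gauss_Sigma1 gauss_nonzero assms(2,6)] by blast
  obtain C2 where C2: "0 < C2" "\<And>u. u \<in> Sigma1_dual \<Longrightarrow>
    Lp_qnorm p lborel (\<lambda>X. u (gabor gauss X)) \<le> ennreal C2 * Lp_qnorm p lborel (\<lambda>X. u (gabor \<phi> X))"
    using gabor_qnorm[OF assms(2,3) gauss_Sigma1 assms(6)] by blast
  obtain C3 where C3: "0 < C3" "\<And>f. f \<in> Sigma1_dual \<Longrightarrow> Lp_qnorm p lborel (\<lambda>X. f (gabor gauss X))
    \<le> ennreal C3 * Lp_qnorm p ?M (\<lambda>X. zak E f (gabor \<Phi> X))"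
    using zak_lower[OF EB BE assms(4-6)] by blast
  obtain C4 where C4: "0 < C4" "\<And>f. f \<in> Sigma1_dual \<Longrightarrow> Lp_qnorm p ?M (\<lambda>X. zak E f (gabor \<Phi> X))
    \<le> ennreal C4 * Lp_qnorm p lborel (\<lambda>X. f (gabor gauss X))"
    using zak_upper[OF EB BE assms(4,6)] by blast
  \<comment> \<open>The chain through \<open>zak_lower\<close> bounds the modulation quasi-norm from
    above by the Zak side, so the lower constant is \<open>1 / K\<close>.\<close>
  define K where "K = ?a * (C1 * (C3 * ?b'))"
  have K: "0 < K"
    using C1(1) C3(1) by (simp add: K_def)
  have main: "modulation_qnorm \<phi> p f \<le> ennreal K * Lp_qnorm p ?M (stft \<Phi> (zak E f))"
      "Lp_qnorm p ?M (stft \<Phi> (zak E f)) \<le> ennreal (?b * (C4 * (C2 * ?a'))) * modulation_qnorm \<phi> p f"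
    if f: "f \<in> Sigma1_dual" for f
  proof -
    have m1: "(\<lambda>X. f (gabor \<phi> X)) \<in> borel_measurable lborel"
      using dual_gabor(1)[OF assms(2) f] by simp
    have m2: "(\<lambda>X. zak E f (gabor \<Phi> X)) \<in> borel_measurable ?M"
      using dual_gabor(1)[OF assms(4) zak_Sigma1_dual[OF EB f]] by (intro measurable_restrict_space1) simp
    show "modulation_qnorm \<phi> p f \<le> ennreal K * Lp_qnorm p ?M (stft \<Phi> (zak E f))"
      unfolding modulation_qnorm_def K_def using C1(1) C3(1)
      by (intro ennreal_le_trans_mult[OF Lp_qnorm_stft(1)[where u=f, OF assms(6) m1]] ennreal_le_trans_mult[OF C1(2)[OF f]]
          ennreal_le_trans_mult[OF C3(2)[OF f]] Lp_qnorm_stft(2)[where u="zak E f", OF assms(6) m2]) auto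
    show "Lp_qnorm p ?M (stft \<Phi> (zak E f)) \<le> ennreal (?b * (C4 * (C2 * ?a'))) * modulation_qnorm \<phi> p f"
      unfolding modulation_qnorm_def using C2(1) C4(1)
      by (intro ennreal_le_trans_mult[OF Lp_qnorm_stft(1)[where u="zak E f", OF assms(6) m2]] ennreal_le_trans_mult[OF C4(2)[OF f]]
          ennreal_le_trans_mult[OF C2(2)[OF f]] Lp_qnorm_stft(2)[where u=f, OF assms(6) m1]) auto
  qed
  show ?thesis
  proof (rule exI[of _ "1 / K"], rule exI[of _ "?b * (C4 * (C2 * ?a'))"], intro conjI ballI)
    show "0 < 1 / K" "0 < ?b * (C4 * (C2 * ?a'))"
      using K C2(1) C4(1) by auto
    fix f :: "(real ^ 'n \<Rightarrow> complex) \<Rightarrow> complex" assume f: "f \<in> Sigma1_dual"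
    have "ennreal (1 / K) * modulation_qnorm \<phi> p f \<le> ennreal (1 / K) * (ennreal K * Lp_qnorm p ?M (stft \<Phi> (zak E f)))"
      by (intro mult_left_mono main f) simp
    also have "\<dots> = Lp_qnorm p ?M (stft \<Phi> (zak E f))"
      using K by (simp add: mult.assoc[symmetric] ennreal_mult'[symmetric])
    finally show "ennreal (1 / K) * modulation_qnorm \<phi> p f \<le> Lp_qnorm p
        (restrict_space lborel ((parallelepiped E \<times> parallelepiped ?B) \<times> UNIV)) (stft \<Phi> (zak E f))"
      by (simp only: fundamental_domain_def)
    show "Lp_qnorm p (restrict_space lborel ((parallelepiped E \<times> parallelepiped ?B) \<times> UNIV)) (stft \<Phi> (zak E f))
      \<le> ennreal (?b * (C4 * (C2 * ?a'))) * modulation_qnorm \<phi> p f"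
      using main(2)[OF f] by (simp only: fundamental_domain_def)
  qed
qed

end
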